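(* Let $\mathcal{X}\to\mathbb{D}$ be a non-singular Kähler family over the unit disk $\mathbb{D}\subset\mathbb{C}$, with fibers $\mathcal{X}_t$, $t\in\mathbb{D}$. Assume that the canonical bundle $K_{\mathcal{X}_t}$ is nef for every $t\in\mathbb{D}$. Then the relative canonical bundle $K_{\mathcal{X}/\mathbb{D}}$ is nef.
   Context: A non-singular Kähler family over $\mathbb{D}$ is a proper surjective holomorphic submersion $p:\mathcal{X}\to\mathbb{D}$ from a complex manifold $\mathcal{X}$ admitting a Kähler metric; the fibers $\mathcal{X}_t=p^{-1}(t)$ are then compact Kähler manifolds. The relative canonical bundle is $K_{\mathcal{X}/\mathbb{D}}:=K_{\mathcal{X}}-p^\star K_{\mathbb{D}}$ (additive notation). Nefness is understood in the metric sense. Let $(M,\omega)$ be a complex manifold endowed with a hermitian metric and let $\{\rho\}$ be a real $(1,1)$-class on $M$, represented by a smooth closed real $(1,1)$-form $\rho$. The class $\{\rho\}$ is nef if for every $\varepsilon>0$ there exists a function $f_\varepsilon\in\mathcal{C}^\infty(M)$ such that $\rho+\sqrt{-1}\,\partial\overline{\partial} f_\varepsilon\geq-\varepsilon\,\omega$. A line bundle is nef if its first Chern class, represented by the curvature form of a smooth hermitian metric on the bundle, is nef. For $M=\mathcal{X}_t$ (compact) this does not depend on $\omega$; for $M=\mathcal{X}$, $\omega$ is a Kähler metric on $\mathcal{X}$. *)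

theory Defs
  imports "HOL-Analysis.Analysis"
begin

section \<open>Calculus on complex coordinate spaces\<close>

text \<open>
  To allow every dimension, including 0 (finite fibres), the model space of an n-dimensional manifold
  is the coordinate subspace \<open>coords I\<close> of \<open>complex^'m\<close>, where \<open>card I = n\<close>. A function on
  \<open>coords I\<close> is differentiated after composing it with the projection \<open>cproj I\<close>, so that only the
  coordinates in \<open>I\<close> matter.
\<close>

definition coords :: "'m::finite set \<Rightarrow> (complex^'m) set" where
  "coords I = {z. \<forall>i. i \<notin> I \<longrightarrow> z $ i = 0}"

definition cproj :: "'m::finite set \<Rightarrow> complex^'m \<Rightarrow> complex^'m" where
  "cproj I z = (\<chi> i. if i \<in> I then z $ i else 0)"

fun Ck_on :: "nat \<Rightarrow> 'a::real_normed_vector set \<Rightarrow> ('a \<Rightarrow> 'b::real_normed_vector) \<Rightarrow> bool" where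
  "Ck_on 0 S f \<longleftrightarrow> continuous_on S f"
| "Ck_on (Suc k) S f \<longleftrightarrow> (\<forall>x\<in>S. f differentiable (at x)) \<and>
     (\<forall>v. Ck_on k S (\<lambda>x. frechet_derivative f (at x) v))"

text \<open>Only used for open sets \<open>S\<close> of a finite-dimensional space.\<close>
definition smooth_on :: "'a::real_normed_vector set \<Rightarrow> ('a \<Rightarrow> 'b::real_normed_vector) \<Rightarrow> bool" where
  "smooth_on S f \<longleftrightarrow> (\<forall>k. Ck_on k S f)"

definition hol_on :: "(complex^'m::finite) set \<Rightarrow> (complex^'m \<Rightarrow> complex) \<Rightarrow> bool" where
  "hol_on S f \<longleftrightarrow>
     (\<forall>z\<in>S. \<exists>D. (f has_derivative D) (at z) \<and> (\<forall>a v. D (a *s v) = a * D v))"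

text \<open>The Wirtinger derivatives with respect to \<open>z\<^sub>j\<close> and to its conjugate.\<close>

definition dz :: "'m::finite \<Rightarrow> (complex^'m \<Rightarrow> complex) \<Rightarrow> complex^'m \<Rightarrow> complex" where
  "dz j f z = (frechet_derivative f (at z) (axis j 1) - \<i> * frechet_derivative f (at z) (axis j \<i>)) / 2"

definition dzbar :: "'m::finite \<Rightarrow> (complex^'m \<Rightarrow> complex) \<Rightarrow> complex^'m \<Rightarrow> complex" where
  "dzbar j f z = (frechet_derivative f (at z) (axis j 1) + \<i> * frechet_derivative f (at z) (axis j \<i>)) / 2"


section \<open>Complex manifolds\<close>

text \<open>A chart is a pair of its domain and its coordinate map (irrelevant outside the domain).\<close>

type_synonym ('a, 'm) chart = "'a set \<times> ('a \<Rightarrow> complex^'m)"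

record ('a, 'm::finite) cmanifold =
  mtop :: "'a topology"
  midx :: "'m set"
  atlas :: "('a, 'm) chart set"

definition coord_dom :: "('a, 'm::finite) cmanifold \<Rightarrow> ('a, 'm) chart \<Rightarrow> 'a set \<Rightarrow> (complex^'m) set" where
  "coord_dom M c V = {z. cproj (midx M) z \<in> snd c ` (fst c \<inter> V)}"

definition coord_fun :: "('a, 'm::finite) cmanifold \<Rightarrow> ('a, 'm) chart \<Rightarrow> ('a \<Rightarrow> 'b) \<Rightarrow> complex^'m \<Rightarrow> 'b" where
  "coord_fun M c f = (\<lambda>z. f (inv_into (fst c) (snd c) (cproj (midx M) z)))"

definition is_chart :: "('a, 'm::finite) cmanifold \<Rightarrow> ('a, 'm) chart \<Rightarrow> bool" where
  "is_chart M c \<longleftrightarrow> openin (mtop M) (fst c) \<and>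
     openin (top_of_set (coords (midx M))) (snd c ` fst c) \<and>
     homeomorphic_map (subtopology (mtop M) (fst c)) (top_of_set (snd c ` fst c)) (snd c)"

definition hol_transition :: "('a, 'm::finite) cmanifold \<Rightarrow> ('a, 'm) chart \<Rightarrow> ('a, 'm) chart \<Rightarrow> bool" where
  "hol_transition M c d \<longleftrightarrow>
     (\<forall>i\<in>midx M. hol_on (coord_dom M c (fst d)) (coord_fun M c (\<lambda>x. snd d x $ i)))"

definition complex_manifold :: "('a, 'm::finite) cmanifold \<Rightarrow> bool" where
  "complex_manifold M \<longleftrightarrow>
     Hausdorff_space (mtop M) \<and> second_countable (mtop M) \<and>
     (\<forall>c\<in>atlas M. is_chart M c) \<and> \<Union> (fst ` atlas M) = topspace (mtop M) \<and>
     (\<forall>c\<in>atlas M. \<forall>d\<in>atlas M. hol_transition M c d)"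

definition maximal_atlas :: "('a, 'm::finite) cmanifold \<Rightarrow> ('a, 'm) chart set" where
  "maximal_atlas M =
     {c. is_chart M c \<and> (\<forall>d\<in>atlas M. hol_transition M c d \<and> hol_transition M d c)}"

definition smooth_fun_on ::
    "('a, 'm::finite) cmanifold \<Rightarrow> 'a set \<Rightarrow> ('a \<Rightarrow> 'b::real_normed_vector) \<Rightarrow> bool" where
  "smooth_fun_on M V f \<longleftrightarrow> (\<forall>c\<in>atlas M. smooth_on (coord_dom M c V) (coord_fun M c f))"

definition hol_fun :: "('a, 'm::finite) cmanifold \<Rightarrow> ('a \<Rightarrow> complex) \<Rightarrow> bool" where
  "hol_fun M f \<longleftrightarrow> (\<forall>c\<in>atlas M. hol_on (coord_dom M c (topspace (mtop M))) (coord_fun M c f))"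

text \<open>
  The submanifold structure on a subset \<open>S\<close>, given by all slice charts, i.e. charts of the
  ambient maximal atlas that map \<open>S\<close> to the coordinate subspace \<open>coords J\<close>.
\<close>
definition submanifold :: "('a, 'm::finite) cmanifold \<Rightarrow> 'a set \<Rightarrow> 'm set \<Rightarrow> ('a, 'm) cmanifold" where
  "submanifold M S J =
     \<lparr>mtop = subtopology (mtop M) S, midx = J,
      atlas = {(U \<inter> S, \<phi>) | U \<phi>. (U, \<phi>) \<in> maximal_atlas M \<and> \<phi> ` (U \<inter> S) = \<phi> ` U \<inter> coords J}\<rparr>"

definition disk :: "(complex, 1) cmanifold" where
  "disk = \<lparr>mtop = top_of_set (ball 0 1), midx = UNIV, atlas = {(ball 0 1, \<lambda>t. vec t)}\<rparr>"

text \<open>\<open>jacobian M c d x $ i $ j\<close> is the derivative of the coordinate \<open>i\<close> of \<open>d\<close> with respect to the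
  coordinate \<open>j\<close> of \<open>c\<close>. It is padded by the identity outside \<open>midx M\<close>, so that its determinant is
  that of the block with indices in \<open>midx M\<close>.\<close>
definition jacobian ::
    "('a, 'm::finite) cmanifold \<Rightarrow> ('a, 'm) chart \<Rightarrow> ('a, 'm) chart \<Rightarrow> 'a \<Rightarrow> complex^'m^'m" where
  "jacobian M c d x = (\<chi> i j.
     if i \<in> midx M \<and> j \<in> midx M then dz j (coord_fun M c (\<lambda>y. snd d y $ i)) (snd c x)
     else if i = j then 1 else 0)"


section \<open>Real (1,1)-forms\<close>

text \<open>
  A (1,1)-form \<open>A\<close> is given by its coefficient matrices in the charts of the atlas: at \<open>x\<close> it is
  \<open>\<i> * (\<Sum>j k. A c x $ j $ k * dz\<^sub>j \<and> dzbar\<^sub>k)\<close> in the coordinates of \<open>c\<close>, the sum being over \<open>midx M\<close>.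
  It is real iff the matrices are hermitian.
\<close>

type_synonym ('a, 'm) form11 = "('a, 'm) chart \<Rightarrow> 'a \<Rightarrow> complex^'m^'m"

definition real_form11 :: "('a, 'm::finite) cmanifold \<Rightarrow> ('a, 'm) form11 \<Rightarrow> bool" where
  "real_form11 M A \<longleftrightarrow>
     (\<forall>c\<in>atlas M. \<forall>j\<in>midx M. \<forall>k\<in>midx M.
        smooth_on (coord_dom M c (fst c)) (coord_fun M c (\<lambda>x. A c x $ j $ k)) \<and>
        (\<forall>x\<in>fst c. A c x $ k $ j = cnj (A c x $ j $ k))) \<and>
     (\<forall>c\<in>atlas M. \<forall>d\<in>atlas M. \<forall>x\<in>fst c \<inter> fst d. \<forall>j\<in>midx M. \<forall>k\<in>midx M.
        A c x $ j $ k = (\<Sum>a\<in>midx M. \<Sum>b\<in>midx M.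
          A d x $ a $ b * jacobian M c d x $ a $ j * cnj (jacobian M c d x $ b $ k)))"

text \<open>The two identities express that the (2,1)-part and the (1,2)-part of the exterior derivative vanish.\<close>
definition closed_form11 :: "('a, 'm::finite) cmanifold \<Rightarrow> ('a, 'm) form11 \<Rightarrow> bool" where
  "closed_form11 M A \<longleftrightarrow>
     (\<forall>c\<in>atlas M. \<forall>x\<in>fst c. \<forall>j\<in>midx M. \<forall>k\<in>midx M. \<forall>l\<in>midx M.
        dz l (coord_fun M c (\<lambda>y. A c y $ j $ k)) (snd c x) =
        dz j (coord_fun M c (\<lambda>y. A c y $ l $ k)) (snd c x) \<and>
        dzbar l (coord_fun M c (\<lambda>y. A c y $ j $ k)) (snd c x) =
        dzbar k (coord_fun M c (\<lambda>y. A c y $ j $ l)) (snd c x))"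

definition herm :: "'m::finite set \<Rightarrow> complex^'m^'m \<Rightarrow> complex^'m \<Rightarrow> complex" where
  "herm I A v = (\<Sum>j\<in>I. \<Sum>k\<in>I. A $ j $ k * v $ j * cnj (v $ k))"

text \<open>For hermitian matrices \<open>herm\<close> is real-valued, so \<open>Re\<close> loses nothing.\<close>
definition form_ge :: "('a, 'm::finite) cmanifold \<Rightarrow> ('a, 'm) form11 \<Rightarrow> ('a, 'm) form11 \<Rightarrow> bool" where
  "form_ge M A B \<longleftrightarrow>
     (\<forall>c\<in>atlas M. \<forall>x\<in>fst c. \<forall>v. Re (herm (midx M) (A c x) v) \<ge> Re (herm (midx M) (B c x) v))"

definition hermitian_metric :: "('a, 'm::finite) cmanifold \<Rightarrow> ('a, 'm) form11 \<Rightarrow> bool" where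
  "hermitian_metric M \<omega> \<longleftrightarrow> real_form11 M \<omega> \<and>
     (\<forall>c\<in>atlas M. \<forall>x\<in>fst c. \<forall>v\<in>coords (midx M). v \<noteq> 0 \<longrightarrow> Re (herm (midx M) (\<omega> c x) v) > 0)"

definition kaehler_metric :: "('a, 'm::finite) cmanifold \<Rightarrow> ('a, 'm) form11 \<Rightarrow> bool" where
  "kaehler_metric M \<omega> \<longleftrightarrow> hermitian_metric M \<omega> \<and> closed_form11 M \<omega>"

text \<open>The coefficient of \<open>\<i> * dz\<^sub>j \<and> dzbar\<^sub>k\<close> is the mixed second derivative of \<open>u\<close>.\<close>
definition i_ddbar :: "('a, 'm::finite) cmanifold \<Rightarrow> ('a \<Rightarrow> real) \<Rightarrow> ('a, 'm) form11" where
  "i_ddbar M u = (\<lambda>c x. \<chi> j k. dz j (dzbar k (coord_fun M c (\<lambda>y. complex_of_real (u y)))) (snd c x))"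

definition nef_class :: "('a, 'm::finite) cmanifold \<Rightarrow> ('a, 'm) form11 \<Rightarrow> ('a, 'm) form11 \<Rightarrow> bool" where
  "nef_class M \<omega> \<rho> \<longleftrightarrow> real_form11 M \<rho> \<and> closed_form11 M \<rho> \<and>
     (\<forall>\<epsilon>>0. \<exists>f :: 'a \<Rightarrow> real. smooth_fun_on M (topspace (mtop M)) f \<and>
        form_ge M (\<lambda>c x. \<rho> c x + i_ddbar M f c x) (\<lambda>c x. - \<epsilon> *\<^sub>R \<omega> c x))"


section \<open>Line bundles\<close>

text \<open>
  A line bundle is given by an open trivializing cover \<open>ldom i\<close>, \<open>i \<in> lidx\<close>, and its cocycle: the
  local components of a section satisfy \<open>s\<^sub>i = cocycle i j * s\<^sub>j\<close>.
\<close>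

record ('a, 'i) line_bundle =
  lidx :: "'i set"
  ldom :: "'i \<Rightarrow> 'a set"
  cocycle :: "'i \<Rightarrow> 'i \<Rightarrow> 'a \<Rightarrow> complex"

text \<open>Over a chart \<open>c\<close> the canonical bundle is trivialized by the form \<open>dz\<^sub>1 \<and> \<dots> \<and> dz\<^sub>n\<close> of the coordinates of \<open>c\<close>.\<close>
definition canonical_bundle :: "('a, 'm::finite) cmanifold \<Rightarrow> ('a, ('a, 'm) chart) line_bundle" where
  "canonical_bundle M =
     \<lparr>lidx = atlas M, ldom = fst, cocycle = (\<lambda>c d x. det (jacobian M c d x))\<rparr>"

definition pullback_bundle ::
    "('a, 'm::finite) cmanifold \<Rightarrow> ('a \<Rightarrow> 'b) \<Rightarrow> ('b, 'i) line_bundle \<Rightarrow> ('a, 'i) line_bundle" where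
  "pullback_bundle M p L =
     \<lparr>lidx = lidx L, ldom = (\<lambda>i. {x \<in> topspace (mtop M). p x \<in> ldom L i}),
      cocycle = (\<lambda>i j x. cocycle L i j (p x))\<rparr>"

text \<open>The difference in additive notation, i.e. the tensor product of \<open>L\<close> with the dual of \<open>L'\<close>.\<close>
definition bundle_diff ::
    "('a, 'i) line_bundle \<Rightarrow> ('a, 'j) line_bundle \<Rightarrow> ('a, 'i \<times> 'j) line_bundle" where
  "bundle_diff L L' =
     \<lparr>lidx = lidx L \<times> lidx L', ldom = (\<lambda>(i, j). ldom L i \<inter> ldom L' j),
      cocycle = (\<lambda>(i, j) (k, l) x. cocycle L i k x / cocycle L' j l x)\<rparr>"

text \<open>The local weights of a smooth hermitian metric: a section has squared norm \<open>\<bar>s\<^sub>i\<bar>\<^sup>2 * h i\<close>.\<close>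
definition bundle_metric ::
    "('a, 'm::finite) cmanifold \<Rightarrow> ('a, 'i) line_bundle \<Rightarrow> ('i \<Rightarrow> 'a \<Rightarrow> real) \<Rightarrow> bool" where
  "bundle_metric M L h \<longleftrightarrow>
     (\<forall>i\<in>lidx L. smooth_fun_on M (ldom L i) (h i) \<and> (\<forall>x\<in>ldom L i. h i x > 0)) \<and>
     (\<forall>i\<in>lidx L. \<forall>j\<in>lidx L. \<forall>x\<in>ldom L i \<inter> ldom L j. h j x = (cmod (cocycle L i j x))\<^sup>2 * h i x)"

text \<open>\<open>\<rho>\<close> is \<open>\<i>/(2\<pi>)\<close> times the curvature of \<open>h\<close>, the form representing the first Chern class.\<close>
definition is_chern_form ::
    "('a, 'm::finite) cmanifold \<Rightarrow> ('a, 'i) line_bundle \<Rightarrow> ('i \<Rightarrow> 'a \<Rightarrow> real) \<Rightarrow> ('a, 'm) form11 \<Rightarrow> bool" where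
  "is_chern_form M L h \<rho> \<longleftrightarrow>
     (\<forall>c\<in>atlas M. \<forall>i\<in>lidx L. \<forall>x\<in>fst c \<inter> ldom L i. \<forall>j\<in>midx M. \<forall>k\<in>midx M.
        \<rho> c x $ j $ k = - (1 / (2 * pi)) * i_ddbar M (\<lambda>y. ln (h i y)) c x $ j $ k)"

text \<open>The class does not depend on the metric \<open>h\<close>.\<close>
definition nef_line_bundle ::
    "('a, 'm::finite) cmanifold \<Rightarrow> ('a, 'm) form11 \<Rightarrow> ('a, 'i) line_bundle \<Rightarrow> bool" where
  "nef_line_bundle M \<omega> L \<longleftrightarrow>
     (\<exists>h \<rho>. bundle_metric M L h \<and> is_chern_form M L h \<rho> \<and> nef_class M \<omega> \<rho>)"


section \<open>Families over the disk\<close>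

definition submersion :: "('a, 'm::finite) cmanifold \<Rightarrow> ('a \<Rightarrow> complex) \<Rightarrow> bool" where
  "submersion M p \<longleftrightarrow>
     (\<forall>c\<in>atlas M. \<forall>x\<in>fst c. surj (frechet_derivative (coord_fun M c p) (at (snd c x))))"

definition kaehler_family :: "('a, 'm::finite) cmanifold \<Rightarrow> ('a \<Rightarrow> complex) \<Rightarrow> bool" where
  "kaehler_family X p \<longleftrightarrow>
     complex_manifold X \<and> (\<exists>\<omega>. kaehler_metric X \<omega>) \<and>
     p ` topspace (mtop X) = ball 0 1 \<and> hol_fun X p \<and> submersion X p \<and>
     proper_map (mtop X) (top_of_set (ball 0 1)) p"

text \<open>\<open>b\<close> is any coordinate index of \<open>X\<close>: the fibre is modelled on the hyperplane where coordinate \<open>b\<close> is 0.\<close>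
definition fibre ::
    "('a, 'm::finite) cmanifold \<Rightarrow> ('a \<Rightarrow> complex) \<Rightarrow> 'm \<Rightarrow> complex \<Rightarrow> ('a, 'm) cmanifold" where
  "fibre X p b t = submanifold X {x \<in> topspace (mtop X). p x = t} (midx X - {b})"

definition relative_canonical_bundle ::
    "('a, 'm::finite) cmanifold \<Rightarrow> ('a \<Rightarrow> complex) \<Rightarrow>
     ('a, ('a, 'm) chart \<times> (complex, 1) chart) line_bundle" where
  "relative_canonical_bundle X p =
     bundle_diff (canonical_bundle X) (pullback_bundle X p (canonical_bundle disk))"

end

theory Submission
  imports Defs "HOL-Complex_Analysis.Complex_Analysis"
begin

text \<open>
  Nefness of a class is a statement about arbitrarily small losses of positivity, and such a loss leaves room for
  perturbation. If every fibre of a smooth proper family is nef, then for each \<open>\<epsilon>\<close> the form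
  \<open>\<rho> + \<epsilon> * \<omega>\<close> becomes strictly positive on each single fibre after adding the Levi form of a suitable function,
  where \<open>\<rho>\<close> is a curvature form of the relative canonical bundle. Strict positivity is an open condition, so it extends
  to neighbouring fibres, and potentials over small disks can be glued. No equation has to be solved. It is essential
  here that all fibres are nef, and not only a general one.

  The metric \<open>\<omega>\<close> itself induces a metric on the canonical bundle with weights \<open>1 / cmod (det \<omega>)\<close>. As the canonical
  bundle of the disk is trivial (\<open>disk_jacobian\<close>), its curvature \<open>canonical_form \<omega>\<close> represents the relative canonical
  bundle. By adjunction (\<open>slice_det\<close>), in charts that have \<open>p - t\<close> as a coordinate, the weights of this metric and
  those of the given metric on the canonical bundle of the fibre over \<open>t\<close> differ by a global function on the fibre.
  Together with the potential that nefness of the fibre provides, this gives a function on the fibre whose Levi form makes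
  \<open>canonical_form \<omega> + \<epsilon> * \<omega>\<close> positive on the fibre. It is extended to a neighbourhood by bump functions
  (\<open>fibre_potential\<close>). The way it is extended does not matter, because the Levi form on vertical vectors only depends on
  the restriction to the fibre (\<open>vertical_levi_cong\<close>). By openness and properness the extension is positive on vertical
  vectors over a small disk around \<open>t\<close> (\<open>tube_potential\<close>).

  Over the whole disk these local potentials are averaged with a locally finite system of weights that are functions of the
  base, hence constant on fibres; the average is still positive on vertical vectors (\<open>global_vertical_potential\<close>). Such a
  form becomes nonnegative on all vectors if a large multiple of the square of \<open>dp\<close> is added. The multiple is bounded over
  compact parts of the disk, so it is dominated by the Levi form of a rapidly growing subharmonic function of the base
  (\<open>global_potential\<close>).

  Two analytic facts are used throughout. Functions that are complex differentiable in several variables are smooth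
  (\<open>hol_on_smooth\<close>), which makes changes of charts smooth, and charts with \<open>p - t\<close> as a coordinate exist by the inverse
  function theorem (\<open>adapted_exists\<close>).
\<close>

text \<open>In what follows, \<open>$\<close> only denotes components of vectors; a second reading, as the coefficients of a power series, makes
  formulas with many components ambiguous.\<close>
no_notation fps_nth (infixl "$" 75)

section \<open>Functions of class C^k\<close>

lemma frechet_derivative_cong_open:
  assumes "open S" "x \<in> S" "\<And>y. y \<in> S \<Longrightarrow> f y = g y"
  shows "frechet_derivative f (at x) = frechet_derivative g (at x)"
proof -
  have "(f has_derivative D) (at x) \<longleftrightarrow> (g has_derivative D) (at x)" for D
    using has_derivative_transform_within_open[OF _ assms(1,2), of f D UNIV g]
      has_derivative_transform_within_open[OF _ assms(1,2), of g D UNIV f] assms(3) by auto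
  then show ?thesis
    by (simp add: frechet_derivative_def)
qed

lemma Ck_on_cong:
  assumes "open S" "\<And>x. x \<in> S \<Longrightarrow> f x = g x"
  shows "Ck_on k S f \<longleftrightarrow> Ck_on k S g"
  using assms(2)
proof (induction k arbitrary: f g)
  case 0
  then show ?case by (simp cong: continuous_on_cong)
next
  case (Suc k)
  have "frechet_derivative f (at x) = frechet_derivative g (at x)" if "x \<in> S" for x
    using frechet_derivative_cong_open[OF assms(1) that] Suc.prems by blast
  then have "Ck_on k S (\<lambda>x. frechet_derivative f (at x) v)
      \<longleftrightarrow> Ck_on k S (\<lambda>x. frechet_derivative g (at x) v)" for v
    by (intro Suc.IH) auto
  moreover have "f differentiable (at x) \<longleftrightarrow> g differentiable (at x)" if "x \<in> S" for x
    using has_derivative_transform_within_open[OF _ assms(1) that, of f _ UNIV g]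
      has_derivative_transform_within_open[OF _ assms(1) that, of g _ UNIV f] Suc.prems
    unfolding differentiable_def by fastforce
  ultimately show ?case by simp
qed

lemma Ck_on_subset: "Ck_on k S f \<Longrightarrow> T \<subseteq> S \<Longrightarrow> Ck_on k T f"
  by (induction k arbitrary: f) (auto intro: continuous_on_subset)

text \<open>The derivatives in \<open>Ck_on\<close> are taken in the ambient space, so being of class C^k is a condition on neighbourhoods
  of points; this allows functions on a manifold to be glued from charts.\<close>
lemma Ck_on_local:
  assumes "\<And>x. x \<in> S \<Longrightarrow> \<exists>T. open T \<and> x \<in> T \<and> Ck_on k T f"
  shows "Ck_on k S f"
  using assms
proof (induction k arbitrary: f)
  case 0
  then have "isCont f x" if "x \<in> S" for x
    using that by (fastforce simp: continuous_on_eq_continuous_at)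
  then show ?case
    by (simp add: continuous_at_imp_continuous_on)
next
  case (Suc k)
  show ?case
  proof (simp, intro conjI ballI allI)
    show "f differentiable at x" if "x \<in> S" for x
      using Suc.prems[OF that] by auto
    show "Ck_on k S (\<lambda>x. frechet_derivative f (at x) v)" for v
      by (rule Suc.IH) (use Suc.prems in fastforce)
  qed
qed

lemma Ck_on_SucD: "Ck_on (Suc k) S f \<Longrightarrow> Ck_on k S f"
proof (induction k arbitrary: f)
  case 0
  then show ?case
    by (simp add: continuous_at_imp_continuous_on differentiable_imp_continuous_within)
next
  case (Suc k)
  from Suc.prems have d: "\<forall>x\<in>S. f differentiable at x"
    and D: "\<And>v. Ck_on (Suc k) S (\<lambda>x. frechet_derivative f (at x) v)"
    unfolding Ck_on.simps(2)[of "Suc k"] by blast+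
  show ?case
    unfolding Ck_on.simps(2)[of k] using d Suc.IH[OF D] by blast
qed

lemma Ck_on_SucI:
  assumes "open S" "\<And>x. x \<in> S \<Longrightarrow> (f has_derivative f' x) (at x)"
    and "\<And>v. Ck_on k S (\<lambda>x. f' x v)"
  shows "Ck_on (Suc k) S f"
proof (simp, intro conjI ballI allI)
  show "f differentiable at x" if "x \<in> S" for x
    using assms(2)[OF that] by (auto simp: differentiable_def)
  have "frechet_derivative f (at x) = f' x" if "x \<in> S" for x
    using frechet_derivative_at[OF assms(2)[OF that]] by simp
  then show "Ck_on k S (\<lambda>x. frechet_derivative f (at x) v)" for v
    using Ck_on_cong[OF assms(1), of "\<lambda>x. frechet_derivative f (at x) v" "\<lambda>x. f' x v" k] assms(3)
    by simp
qed

lemma Ck_on_Suc_has_derivative: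
  "Ck_on (Suc k) S f \<Longrightarrow> x \<in> S \<Longrightarrow> (f has_derivative frechet_derivative f (at x)) (at x)"
  by (simp add: frechet_derivative_works)

lemma Ck_on_const: "open S \<Longrightarrow> Ck_on k S (\<lambda>_. c)"
proof (induction k arbitrary: c)
  case (Suc k)
  then show ?case by (intro Ck_on_SucI[where f' = "\<lambda>_ _. 0"]) auto
qed simp

lemma Ck_on_linear:
  assumes "open S" "bounded_linear L"
  shows "Ck_on k S L"
proof (cases k)
  case 0
  then show ?thesis using assms by (simp add: linear_continuous_on)
next
  case (Suc j)
  show ?thesis
    unfolding Suc using assms
    by (intro Ck_on_SucI[where f' = "\<lambda>_. L"])
       (auto intro: bounded_linear_imp_has_derivative Ck_on_const)
qed

lemma Ck_on_add:
  "open S \<Longrightarrow> Ck_on k S f \<Longrightarrow> Ck_on k S g \<Longrightarrow> Ck_on k S (\<lambda>x. f x + g x)"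
proof (induction k arbitrary: f g)
  case 0
  then show ?case by (auto intro: continuous_intros)
next
  case (Suc k)
  show ?case
  proof (rule Ck_on_SucI[OF Suc.prems(1) has_derivative_add[OF
        Ck_on_Suc_has_derivative[OF Suc.prems(2)] Ck_on_Suc_has_derivative[OF Suc.prems(3)]]])
    show "Ck_on k S (\<lambda>x. frechet_derivative f (at x) v + frechet_derivative g (at x) v)" for v
      by (intro Suc.IH Suc.prems(1)) (use Suc.prems in auto)
  qed
qed

lemma Ck_on_bilinear:
  assumes "bounded_bilinear pr"
  shows "open S \<Longrightarrow> Ck_on k S f \<Longrightarrow> Ck_on k S g \<Longrightarrow> Ck_on k S (\<lambda>x. pr (f x) (g x))"
proof (induction k arbitrary: f g)
  case 0
  then show ?case using bounded_bilinear.continuous_on[OF assms] by auto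
next
  case (Suc k)
  show ?case
  proof (rule Ck_on_SucI[OF Suc.prems(1) bounded_bilinear.FDERIV[OF assms
        Ck_on_Suc_has_derivative[OF Suc.prems(2)] Ck_on_Suc_has_derivative[OF Suc.prems(3)]]])
    show "Ck_on k S (\<lambda>x. pr (f x) (frechet_derivative g (at x) v) + pr (frechet_derivative f (at x) v) (g x))"
      for v
      by (intro Ck_on_add Suc.IH Suc.prems(1) Ck_on_SucD[OF Suc.prems(2)] Ck_on_SucD[OF Suc.prems(3)])
         (use Suc.prems in auto)
  qed
qed

lemma Ck_on_linear_compose:
  assumes "bounded_linear L"
  shows "open S \<Longrightarrow> Ck_on k S f \<Longrightarrow> Ck_on k S (\<lambda>x. L (f x))"
proof (induction k arbitrary: f)
  case 0
  then show ?case using bounded_linear.continuous_on[OF assms] by auto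
next
  case (Suc k)
  show ?case
  proof (rule Ck_on_SucI[OF Suc.prems(1) bounded_linear.has_derivative[OF assms
        Ck_on_Suc_has_derivative[OF Suc.prems(2)]]])
    show "Ck_on k S (\<lambda>x. L (frechet_derivative f (at x) v))" for v
      by (intro Suc.IH Suc.prems(1)) (use Suc.prems in auto)
  qed
qed

lemma Ck_on_sum:
  "open S \<Longrightarrow> (\<And>i. i \<in> A \<Longrightarrow> Ck_on k S (f i)) \<Longrightarrow> Ck_on k S (\<lambda>x. \<Sum>i\<in>A. f i x)"
  by (induction A rule: infinite_finite_induct) (auto intro: Ck_on_const Ck_on_add)

text \<open>Expanding the inner derivative in a basis writes the derivative of the composition as a finite sum of products
  of functions to which the induction hypothesis applies; this is why \<open>f\<close> takes values in a Euclidean space.\<close>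
lemma Ck_on_compose:
  fixes f :: "'a::real_normed_vector \<Rightarrow> 'b::euclidean_space"
  assumes "open S" "open T" "f ` S \<subseteq> T"
  shows "Ck_on k S f \<Longrightarrow> Ck_on k T g \<Longrightarrow> Ck_on k S (\<lambda>x. g (f x))"
proof (induction k arbitrary: g)
  case 0
  then show ?case
    using assms by (auto intro: continuous_on_compose2)
next
  case (Suc k)
  define D where "D x = frechet_derivative f (at x)" for x
  define G where "G y = frechet_derivative g (at y)" for y
  have linG: "linear (G y)" if "y \<in> T" for y
    using Ck_on_Suc_has_derivative[OF Suc.prems(2) that]
    by (auto simp: G_def dest: has_derivative_linear)
  have derf: "(f has_derivative D x) (at x)" if "x \<in> S" for x
    using Ck_on_Suc_has_derivative[OF Suc.prems(1) that] by (simp add: D_def)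
  have expand: "G (f x) (D x v) = (\<Sum>e\<in>Basis. (D x v \<bullet> e) *\<^sub>R G (f x) e)" if "x \<in> S" for x v
  proof -
    have "G (f x) (\<Sum>e\<in>Basis. (D x v \<bullet> e) *\<^sub>R e) = (\<Sum>e\<in>Basis. (D x v \<bullet> e) *\<^sub>R G (f x) e)"
      using linG assms(3) that by (auto simp: linear_sum linear_cmul image_subset_iff)
    then show ?thesis by (simp add: euclidean_representation)
  qed
  have "((\<lambda>x. g (f x)) has_derivative (\<lambda>v. \<Sum>e\<in>Basis. (D x v \<bullet> e) *\<^sub>R G (f x) e)) (at x)"
    if x: "x \<in> S" for x
  proof -
    have "(g has_derivative G (f x)) (at (f x))"
      using Ck_on_Suc_has_derivative[OF Suc.prems(2)] x assms(3) by (auto simp: G_def)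
    from has_derivative_compose[OF derf[OF x] this] show ?thesis
      by (simp add: expand[OF x])
  qed
  moreover have "Ck_on k S (\<lambda>x. \<Sum>e\<in>Basis. (D x v \<bullet> e) *\<^sub>R G (f x) e)" for v
  proof (intro Ck_on_sum Ck_on_bilinear[OF bounded_bilinear_scaleR] assms(1))
    show "Ck_on k S (\<lambda>x. D x v \<bullet> e)" for e
      using Suc.prems(1) by (intro Ck_on_linear_compose[OF bounded_linear_inner_left] assms(1))
        (simp add: D_def)
    show "Ck_on k S (\<lambda>x. G (f x) e)" for e
      by (rule Suc.IH[OF Ck_on_SucD[OF Suc.prems(1)]]) (use Suc.prems(2) in \<open>simp add: G_def\<close>)
  qed
  ultimately show ?case
    by (rule Ck_on_SucI[OF assms(1)])
qed

lemma smooth_on_cong: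
  "open S \<Longrightarrow> (\<And>x. x \<in> S \<Longrightarrow> f x = g x) \<Longrightarrow> smooth_on S f \<longleftrightarrow> smooth_on S g"
  unfolding smooth_on_def using Ck_on_cong by blast

lemma smooth_on_subset: "smooth_on S f \<Longrightarrow> T \<subseteq> S \<Longrightarrow> smooth_on T f"
  unfolding smooth_on_def using Ck_on_subset by blast

lemma smooth_on_local:
  assumes "\<And>x. x \<in> S \<Longrightarrow> \<exists>T. open T \<and> x \<in> T \<and> smooth_on T f"
  shows "smooth_on S f"
  unfolding smooth_on_def
proof
  fix k show "Ck_on k S f"
    by (rule Ck_on_local) (use assms in \<open>auto simp: smooth_on_def\<close>)
qed

lemma smooth_on_has_derivative:
  "smooth_on S f \<Longrightarrow> x \<in> S \<Longrightarrow> (f has_derivative frechet_derivative f (at x)) (at x)"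
  using Ck_on_Suc_has_derivative[of 0 S f x] unfolding smooth_on_def by blast

lemma smooth_on_differentiable:
  "smooth_on S f \<Longrightarrow> x \<in> S \<Longrightarrow> f differentiable (at x)"
  using smooth_on_has_derivative differentiable_def by blast

lemma smooth_on_frechet_derivative:
  "smooth_on S f \<Longrightarrow> smooth_on S (\<lambda>x. frechet_derivative f (at x) v)"
  unfolding smooth_on_def
proof
  fix k assume "\<forall>k. Ck_on k S f"
  then have "Ck_on (Suc k) S f" by blast
  then show "Ck_on k S (\<lambda>x. frechet_derivative f (at x) v)" by simp
qed

lemma smooth_on_continuous: "smooth_on S f \<Longrightarrow> continuous_on S f"
  using Ck_on.simps(1)[of S f] unfolding smooth_on_def by blast

lemma smooth_on_const: "open S \<Longrightarrow> smooth_on S (\<lambda>_. c)"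
  by (simp add: smooth_on_def Ck_on_const)

lemma smooth_on_linear: "open S \<Longrightarrow> bounded_linear L \<Longrightarrow> smooth_on S L"
  by (simp add: smooth_on_def Ck_on_linear)

lemma smooth_on_add:
  "open S \<Longrightarrow> smooth_on S f \<Longrightarrow> smooth_on S g \<Longrightarrow> smooth_on S (\<lambda>x. f x + g x)"
  by (simp add: smooth_on_def Ck_on_add)

lemma smooth_on_linear_compose:
  "bounded_linear L \<Longrightarrow> open S \<Longrightarrow> smooth_on S f \<Longrightarrow> smooth_on S (\<lambda>x. L (f x))"
  by (simp add: smooth_on_def Ck_on_linear_compose)

lemma smooth_on_mult:
  fixes f g :: "'a::real_normed_vector \<Rightarrow> 'b::real_normed_algebra"
  shows "open S \<Longrightarrow> smooth_on S f \<Longrightarrow> smooth_on S g \<Longrightarrow> smooth_on S (\<lambda>x. f x * g x)"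
  by (simp add: smooth_on_def Ck_on_bilinear[OF bounded_bilinear_mult])

lemma smooth_on_minus: "open S \<Longrightarrow> smooth_on S f \<Longrightarrow> smooth_on S (\<lambda>x. - f x)"
  using smooth_on_linear_compose[OF bounded_linear_minus[OF bounded_linear_ident]] by blast

lemma smooth_on_diff:
  "open S \<Longrightarrow> smooth_on S f \<Longrightarrow> smooth_on S g \<Longrightarrow> smooth_on S (\<lambda>x. f x - g x)"
  using smooth_on_add[of S f "\<lambda>x. - g x"] smooth_on_minus by auto

lemma smooth_on_sum:
  "open S \<Longrightarrow> (\<And>i. i \<in> A \<Longrightarrow> smooth_on S (f i)) \<Longrightarrow> smooth_on S (\<lambda>x. \<Sum>i\<in>A. f i x)"
  by (simp add: smooth_on_def Ck_on_sum)

lemma smooth_on_prod: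
  fixes f :: "'i \<Rightarrow> 'a::real_normed_vector \<Rightarrow> 'b::{real_normed_algebra,comm_ring_1}"
  shows "open S \<Longrightarrow> (\<And>i. i \<in> A \<Longrightarrow> smooth_on S (f i)) \<Longrightarrow> smooth_on S (\<lambda>x. \<Prod>i\<in>A. f i x)"
  by (induction A rule: infinite_finite_induct) (auto intro: smooth_on_const smooth_on_mult)

lemma smooth_on_compose:
  fixes f :: "'a::real_normed_vector \<Rightarrow> 'b::euclidean_space"
  assumes "open S" "open T" "f ` S \<subseteq> T" "smooth_on S f" "smooth_on T g"
  shows "smooth_on S (\<lambda>x. g (f x))"
  using Ck_on_compose[OF assms(1-3)] assms(4,5) unfolding smooth_on_def by blast

lemma smooth_on_inverse_real: "smooth_on {x. x \<noteq> 0} (inverse :: real \<Rightarrow> real)"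
  unfolding smooth_on_def
proof
  have o: "open {x::real. x \<noteq> 0}"
    by (simp add: open_Collect_neq)
  fix k show "Ck_on k {x. x \<noteq> 0} (inverse :: real \<Rightarrow> real)"
  proof (induction k)
    case 0
    then show ?case by (simp add: continuous_on_inverse)
  next
    case (Suc k)
    show ?case
    proof (rule Ck_on_SucI[OF o])
      show "(inverse has_derivative (\<lambda>h. - (inverse x * h * inverse x))) (at x)"
        if "x \<in> {x. x \<noteq> 0}" for x :: real
        using has_derivative_inverse'[of x UNIV] that by simp
      show "Ck_on k {x. x \<noteq> 0} (\<lambda>x::real. - (inverse x * v * inverse x))" for v
        by (intro Ck_on_linear_compose[OF bounded_linear_minus[OF bounded_linear_ident]] o
            Ck_on_bilinear[OF bounded_bilinear_mult] Suc Ck_on_const)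
    qed
  qed
qed

lemma smooth_on_exp_real: "smooth_on UNIV (exp :: real \<Rightarrow> real)"
  unfolding smooth_on_def
proof
  fix k show "Ck_on k UNIV (exp :: real \<Rightarrow> real)"
  proof (induction k)
    case 0
    then show ?case by (simp add: continuous_on_exp)
  next
    case (Suc k)
    show ?case
    proof (rule Ck_on_SucI)
      show "(exp has_derivative (\<lambda>h. exp x * h)) (at x)" for x :: real
        using DERIV_exp[of x] by (simp add: has_field_derivative_def)
      show "Ck_on k UNIV (\<lambda>x::real. exp x * v)" for v
        by (intro Ck_on_bilinear[OF bounded_bilinear_mult] Suc Ck_on_const) auto
    qed auto
  qed
qed

lemma smooth_on_ln_real: "smooth_on {0<..} (ln :: real \<Rightarrow> real)"
  unfolding smooth_on_def
proof
  fix k show "Ck_on k {0<..} (ln :: real \<Rightarrow> real)"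
  proof (cases k)
    case 0
    then show ?thesis by (auto intro: continuous_on_ln)
  next
    case (Suc j)
    show ?thesis
      unfolding Suc
    proof (rule Ck_on_SucI)
      show "(ln has_derivative (\<lambda>h. inverse x * h)) (at x)" if "x \<in> {0<..}" for x :: real
        using DERIV_ln[of x] that by (simp add: has_field_derivative_def)
      show "Ck_on j {0<..} (\<lambda>x::real. inverse x * v)" for v
      proof (intro Ck_on_bilinear[OF bounded_bilinear_mult] Ck_on_const open_greaterThan)
        show "Ck_on j {0<..} (inverse :: real \<Rightarrow> real)"
          by (rule Ck_on_subset[where S="{x. x \<noteq> 0}"])
            (use smooth_on_inverse_real in \<open>auto simp: smooth_on_def\<close>)
      qed
    qed auto
  qed
qed

lemma smooth_on_inverse:
  fixes f :: "'a::real_normed_vector \<Rightarrow> real"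
  assumes "open S" "smooth_on S f" "\<And>x. x \<in> S \<Longrightarrow> f x \<noteq> 0"
  shows "smooth_on S (\<lambda>x. inverse (f x))"
  by (rule smooth_on_compose[OF assms(1) _ _ assms(2) smooth_on_inverse_real])
     (use assms(3) in \<open>auto simp: open_Collect_neq\<close>)

lemma smooth_on_exp:
  fixes f :: "'a::real_normed_vector \<Rightarrow> real"
  assumes "open S" "smooth_on S f"
  shows "smooth_on S (\<lambda>x. exp (f x))"
  by (rule smooth_on_compose[OF assms(1) _ _ assms(2) smooth_on_exp_real]) auto

lemma smooth_on_ln:
  fixes f :: "'a::real_normed_vector \<Rightarrow> real"
  assumes "open S" "smooth_on S f" "\<And>x. x \<in> S \<Longrightarrow> f x > 0"
  shows "smooth_on S (\<lambda>x. ln (f x))"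
  by (rule smooth_on_compose[OF assms(1) _ _ assms(2) smooth_on_ln_real]) (use assms(3) in auto)

section \<open>Symmetry of second derivatives, and a flat function\<close>

text \<open>The mean value theorem, applied once in each direction, turns the symmetric second difference into a second
  derivative at an intermediate point. The left-hand side is symmetric in \<open>v\<close> and \<open>w\<close>.\<close>
lemma second_difference_mean_value:
  fixes f :: "'a::real_normed_vector \<Rightarrow> real"
  assumes f: "smooth_on S f" and B: "\<And>\<sigma> \<tau>. \<sigma> \<in> {0..s} \<Longrightarrow> \<tau> \<in> {0..s} \<Longrightarrow> x + \<sigma> *\<^sub>R v + \<tau> *\<^sub>R w \<in> S"
    and s: "s > 0"
  shows "\<exists>\<sigma> \<tau>. 0 < \<sigma> \<and> \<sigma> < s \<and> 0 < \<tau> \<and> \<tau> < s \<and>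
     f (x + s *\<^sub>R v + s *\<^sub>R w) - f (x + s *\<^sub>R v) - f (x + s *\<^sub>R w) + f x =
     s\<^sup>2 * frechet_derivative (\<lambda>y. frechet_derivative f (at y) v) (at (x + \<sigma> *\<^sub>R v + \<tau> *\<^sub>R w)) w"
proof -
  define g where "g y = frechet_derivative f (at y) v" for y
  have df: "(f has_derivative frechet_derivative f (at y)) (at y)" if "y \<in> S" for y
    using smooth_on_has_derivative[OF f that] .
  have dg: "(g has_derivative frechet_derivative g (at y)) (at y)" if "y \<in> S" for y
    unfolding g_def using smooth_on_has_derivative[OF smooth_on_frechet_derivative[OF f] that] .
  have 1: "((\<lambda>\<sigma>. f (x + \<sigma> *\<^sub>R v + s *\<^sub>R w) - f (x + \<sigma> *\<^sub>R v)) has_real_derivative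
        (g (x + \<sigma> *\<^sub>R v + s *\<^sub>R w) - g (x + \<sigma> *\<^sub>R v))) (at \<sigma>)"
    if "0 \<le> \<sigma>" "\<sigma> \<le> s" for \<sigma>
  proof -
    have a: "((\<lambda>\<sigma>. x + \<sigma> *\<^sub>R v + s *\<^sub>R w) has_derivative (\<lambda>h. h *\<^sub>R v)) (at \<sigma>)"
      "((\<lambda>\<sigma>. x + \<sigma> *\<^sub>R v) has_derivative (\<lambda>h. h *\<^sub>R v)) (at \<sigma>)"
      by (auto intro!: derivative_eq_intros)
    have m: "x + \<sigma> *\<^sub>R v + s *\<^sub>R w \<in> S" "x + \<sigma> *\<^sub>R v \<in> S"
      using B[of \<sigma> s] B[of \<sigma> 0] that s by auto
    have "linear (frechet_derivative f (at (x + \<sigma> *\<^sub>R v + s *\<^sub>R w)))"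
      "linear (frechet_derivative f (at (x + \<sigma> *\<^sub>R v)))"
      using df[OF m(1)] df[OF m(2)] has_derivative_linear by blast+
    then have "(\<lambda>h. frechet_derivative f (at (x + \<sigma> *\<^sub>R v + s *\<^sub>R w)) (h *\<^sub>R v)
          - frechet_derivative f (at (x + \<sigma> *\<^sub>R v)) (h *\<^sub>R v)) =
        (*) (g (x + \<sigma> *\<^sub>R v + s *\<^sub>R w) - g (x + \<sigma> *\<^sub>R v))"
      by (simp add: fun_eq_iff g_def linear_cmul left_diff_distrib)
    with has_derivative_diff[OF has_derivative_compose[OF a(1) df[OF m(1)]]
         has_derivative_compose[OF a(2) df[OF m(2)]]]
    show ?thesis
      by (simp add: has_field_derivative_def)
  qed
  obtain \<sigma> where \<sigma>: "0 < \<sigma>" "\<sigma> < s"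
    "(f (x + s *\<^sub>R v + s *\<^sub>R w) - f (x + s *\<^sub>R v)) - (f (x + 0 *\<^sub>R v + s *\<^sub>R w) - f (x + 0 *\<^sub>R v)) =
     (s - 0) * (g (x + \<sigma> *\<^sub>R v + s *\<^sub>R w) - g (x + \<sigma> *\<^sub>R v))"
    using MVT2[OF s, of "\<lambda>\<sigma>. f (x + \<sigma> *\<^sub>R v + s *\<^sub>R w) - f (x + \<sigma> *\<^sub>R v)"
       "\<lambda>\<sigma>. g (x + \<sigma> *\<^sub>R v + s *\<^sub>R w) - g (x + \<sigma> *\<^sub>R v)"] 1 by blast
  have 2: "((\<lambda>\<tau>. g (x + \<sigma> *\<^sub>R v + \<tau> *\<^sub>R w)) has_real_derivative
        frechet_derivative g (at (x + \<sigma> *\<^sub>R v + \<tau> *\<^sub>R w)) w) (at \<tau>)"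
    if "0 \<le> \<tau>" "\<tau> \<le> s" for \<tau>
  proof -
    have a: "((\<lambda>\<tau>. x + \<sigma> *\<^sub>R v + \<tau> *\<^sub>R w) has_derivative (\<lambda>h. h *\<^sub>R w)) (at \<tau>)"
      by (auto intro!: derivative_eq_intros)
    have m: "x + \<sigma> *\<^sub>R v + \<tau> *\<^sub>R w \<in> S"
      using B[of \<sigma> \<tau>] \<sigma> that by auto
    have "linear (frechet_derivative g (at (x + \<sigma> *\<^sub>R v + \<tau> *\<^sub>R w)))"
      using dg[OF m] has_derivative_linear by blast
    with has_derivative_compose[OF a dg[OF m]] show ?thesis
      by (simp add: has_field_derivative_def linear_cmul mult_commute_abs)
  qed
  obtain \<tau> where \<tau>: "0 < \<tau>" "\<tau> < s"
    "g (x + \<sigma> *\<^sub>R v + s *\<^sub>R w) - g (x + \<sigma> *\<^sub>R v + 0 *\<^sub>R w) =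
       (s - 0) * frechet_derivative g (at (x + \<sigma> *\<^sub>R v + \<tau> *\<^sub>R w)) w"
    using MVT2[OF s, of "\<lambda>\<tau>. g (x + \<sigma> *\<^sub>R v + \<tau> *\<^sub>R w)"
        "\<lambda>\<tau>. frechet_derivative g (at (x + \<sigma> *\<^sub>R v + \<tau> *\<^sub>R w)) w"] 2 by blast
  have "f (x + s *\<^sub>R v + s *\<^sub>R w) - f (x + s *\<^sub>R v) - f (x + s *\<^sub>R w) + f x =
      s * (g (x + \<sigma> *\<^sub>R v + s *\<^sub>R w) - g (x + \<sigma> *\<^sub>R v + 0 *\<^sub>R w))"
    using \<sigma>(3) by simp
  also have "\<dots> = s\<^sup>2 * frechet_derivative g (at (x + \<sigma> *\<^sub>R v + \<tau> *\<^sub>R w)) w"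
    using \<tau>(3) by (simp add: power2_eq_square)
  finally show ?thesis
    using \<sigma> \<tau> unfolding g_def by blast
qed

lemma second_derivatives_commute_real:
  fixes f :: "'a::real_normed_vector \<Rightarrow> real"
  assumes S: "open S" and f: "smooth_on S f" and x: "x \<in> S"
  shows "frechet_derivative (\<lambda>y. frechet_derivative f (at y) v) (at x) w =
         frechet_derivative (\<lambda>y. frechet_derivative f (at y) w) (at x) v"
proof (rule ccontr)
  define A where "A v w y = frechet_derivative (\<lambda>y. frechet_derivative f (at y) v) (at y) w" for v w y
  have contA: "isCont (A v w) x" for v w
    using smooth_on_continuous[OF smooth_on_frechet_derivative[OF smooth_on_frechet_derivative[OF f]]] S x
    unfolding A_def by (simp add: continuous_on_eq_continuous_at)
  assume "\<not> ?thesis"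
  then have e: "\<bar>A v w x - A w v x\<bar> / 2 > 0" (is "?e > 0")
    by (simp add: A_def)
  obtain d1 where d1: "d1 > 0" "\<And>y. dist y x < d1 \<Longrightarrow> dist (A v w y) (A v w x) < ?e"
    using contA[of v w] e unfolding continuous_at_eps_delta by blast
  obtain d2 where d2: "d2 > 0" "\<And>y. dist y x < d2 \<Longrightarrow> dist (A w v y) (A w v x) < ?e"
    using contA[of w v] e unfolding continuous_at_eps_delta by blast
  obtain d3 where d3: "d3 > 0" "ball x d3 \<subseteq> S"
    using S x open_contains_ball by blast
  define d where "d = min d1 (min d2 d3)"
  have d: "d > 0" using d1 d2 d3 by (simp add: d_def)
  define s where "s = d / (2 * (norm v + norm w + 1))"
  have s: "s > 0" using d by (simp add: s_def add_nonneg_pos)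
  have sd: "s * (norm v + norm w) < d"
  proof -
    have p: "norm v + norm w + 1 > 0" by (simp add: add_nonneg_pos)
    have "s * (norm v + norm w) \<le> s * (norm v + norm w + 1)" using s by simp
    also have "\<dots> = d / 2" using p by (simp only: s_def) (simp add: divide_simps)
    finally show ?thesis using d by simp
  qed
  have near: "dist (x + \<sigma> *\<^sub>R v + \<tau> *\<^sub>R w) x < d" if "0 \<le> \<sigma>" "\<sigma> \<le> s" "0 \<le> \<tau>" "\<tau> \<le> s" for \<sigma> \<tau>
  proof -
    have "dist (x + \<sigma> *\<^sub>R v + \<tau> *\<^sub>R w) x = norm (\<sigma> *\<^sub>R v + \<tau> *\<^sub>R w)"
      by (simp add: dist_norm)
    also have "\<dots> \<le> \<sigma> * norm v + \<tau> * norm w"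
      using norm_triangle_ineq[of "\<sigma> *\<^sub>R v" "\<tau> *\<^sub>R w"] that by simp
    also have "\<dots> \<le> s * norm v + s * norm w"
      using that by (intro add_mono mult_right_mono) auto
    finally show ?thesis using sd by (simp add: algebra_simps)
  qed
  have inS: "x + \<sigma> *\<^sub>R v + \<tau> *\<^sub>R w \<in> S" if "\<sigma> \<in> {0..s}" "\<tau> \<in> {0..s}" for \<sigma> \<tau>
    using near[of \<sigma> \<tau>] that d3 by (auto simp: d_def dist_commute)
  have inS': "x + \<sigma> *\<^sub>R w + \<tau> *\<^sub>R v \<in> S" if "\<sigma> \<in> {0..s}" "\<tau> \<in> {0..s}" for \<sigma> \<tau>
    using inS[OF that(2) that(1)] by (simp add: add_ac)
  obtain \<sigma> \<tau> where 1: "0 < \<sigma>" "\<sigma> < s" "0 < \<tau>" "\<tau> < s"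
    "f (x + s *\<^sub>R v + s *\<^sub>R w) - f (x + s *\<^sub>R v) - f (x + s *\<^sub>R w) + f x =
      s\<^sup>2 * A v w (x + \<sigma> *\<^sub>R v + \<tau> *\<^sub>R w)"
    using second_difference_mean_value[OF f inS s] unfolding A_def by blast
  obtain \<tau>' \<sigma>' where 2: "0 < \<sigma>'" "\<sigma>' < s" "0 < \<tau>'" "\<tau>' < s"
    "f (x + s *\<^sub>R w + s *\<^sub>R v) - f (x + s *\<^sub>R w) - f (x + s *\<^sub>R v) + f x =
      s\<^sup>2 * A w v (x + \<tau>' *\<^sub>R w + \<sigma>' *\<^sub>R v)"
    using second_difference_mean_value[OF f inS' s] unfolding A_def by blast
  have "f (x + s *\<^sub>R w + s *\<^sub>R v) = f (x + s *\<^sub>R v + s *\<^sub>R w)"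
    by (simp add: add_ac)
  then have "s\<^sup>2 * A v w (x + \<sigma> *\<^sub>R v + \<tau> *\<^sub>R w) = s\<^sup>2 * A w v (x + \<tau>' *\<^sub>R w + \<sigma>' *\<^sub>R v)"
    using 1(5) 2(5) by linarith
  then have eq: "A v w (x + \<sigma> *\<^sub>R v + \<tau> *\<^sub>R w) = A w v (x + \<sigma>' *\<^sub>R v + \<tau>' *\<^sub>R w)"
    using s by (simp add: add_ac)
  have "dist (A v w (x + \<sigma> *\<^sub>R v + \<tau> *\<^sub>R w)) (A v w x) < ?e"
    using near[of \<sigma> \<tau>] 1 by (intro d1) (auto simp: d_def)
  moreover have "dist (A w v (x + \<sigma>' *\<^sub>R v + \<tau>' *\<^sub>R w)) (A w v x) < ?e"
    using near[of \<sigma>' \<tau>'] 2 by (intro d2) (auto simp: d_def)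
  moreover have "\<bar>A v w x - A w v x\<bar> \<le> \<bar>u - A v w x\<bar> + \<bar>u - A w v x\<bar>" for u
    by linarith
  ultimately show False
    unfolding eq dist_real_def using field_sum_of_halves add_strict_mono by (metis not_le)
qed

lemma frechet_derivative_linear_compose:
  assumes "bounded_linear L" "f differentiable (at x)"
  shows "frechet_derivative (\<lambda>x. L (f x)) (at x) v = L (frechet_derivative f (at x) v)"
  using frechet_derivative_at[OF bounded_linear.has_derivative[OF assms(1)
      assms(2)[unfolded frechet_derivative_works]]] by (metis)

lemma second_derivatives_commute:
  fixes f :: "'a::real_normed_vector \<Rightarrow> complex"
  assumes S: "open S" and f: "smooth_on S f" and x: "x \<in> S"
  shows "frechet_derivative (\<lambda>y. frechet_derivative f (at y) v) (at x) w =
         frechet_derivative (\<lambda>y. frechet_derivative f (at y) w) (at x) v"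
proof -
  have *: "L (frechet_derivative (\<lambda>y. frechet_derivative f (at y) v) (at x) w) =
      frechet_derivative (\<lambda>y. frechet_derivative (\<lambda>z. L (f z)) (at y) v) (at x) w"
    if L: "bounded_linear L" for L :: "complex \<Rightarrow> real" and v w
  proof -
    have "frechet_derivative (\<lambda>y. frechet_derivative (\<lambda>z. L (f z)) (at y) v) (at x) =
        frechet_derivative (\<lambda>y. L (frechet_derivative f (at y) v)) (at x)"
      by (intro frechet_derivative_cong_open[OF S x] frechet_derivative_linear_compose[OF L]
           smooth_on_differentiable[OF f])
    then show ?thesis
      using frechet_derivative_linear_compose[OF L
          smooth_on_differentiable[OF smooth_on_frechet_derivative[OF f] x]] by simp
  qed
  note c = second_derivatives_commute_real[OF S smooth_on_linear_compose[OF _ S f] x]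
  show ?thesis
    by (rule complex_eqI)
      (use *[OF bounded_linear_Re] *[OF bounded_linear_Im] c[OF bounded_linear_Re] c[OF bounded_linear_Im]
        in simp_all)
qed

text \<open>The functions that occur as derivatives of \<open>exp (-1/x)\<close>, extended by 0 to nonpositive \<open>x\<close>.\<close>
definition flat_exp_power :: "nat \<Rightarrow> real \<Rightarrow> real" where
  "flat_exp_power k x = (if x > 0 then (1 / x) ^ k * exp (- (1 / x)) else 0)"

lemma flat_exp_power_tendsto_0: "(flat_exp_power k \<longlongrightarrow> 0) (at 0)"
proof -
  have "((\<lambda>y::real. y ^ k / exp y) \<longlongrightarrow> 0) at_top"
    by (rule tendsto_power_div_exp_0)
  then have "((\<lambda>x::real. (inverse x) ^ k / exp (inverse x)) \<longlongrightarrow> 0) (at_right 0)"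
    by (rule filterlim_compose[OF _ filterlim_inverse_at_top_right])
  then have r: "(flat_exp_power k \<longlongrightarrow> 0) (at_right 0)"
    by (rule Lim_transform_eventually)
       (auto simp: eventually_at_filter flat_exp_power_def exp_minus divide_simps)
  have l: "(flat_exp_power k \<longlongrightarrow> 0) (at_left 0)"
    by (rule Lim_transform_eventually[OF tendsto_const])
       (auto simp: eventually_at_filter flat_exp_power_def)
  show ?thesis
    using l r by (simp add: filterlim_at_split)
qed

text \<open>The functions \<open>x^(-k) exp (-1/x)\<close>, extended by 0 to the left, are closed under differentiation up to linear
  combinations. This gives smoothness at once, and it gives the second derivative whose sign is needed later.\<close>
lemma flat_exp_power_DERIV:
  "(flat_exp_power k has_real_derivative
     flat_exp_power (k + 2) x - k * flat_exp_power (k + 1) x) (at x)"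
proof -
  consider "x > 0" | "x < 0" | "x = 0" by linarith
  then show ?thesis
  proof cases
    case 1
    have "((\<lambda>x. (1 / x) ^ k * exp (- (1 / x))) has_real_derivative
        flat_exp_power (k + 2) x - k * flat_exp_power (k + 1) x) (at x)"
    proof -
      have inv: "((\<lambda>x. 1 / x) has_real_derivative - ((1 / x) * (1 / x))) (at x)"
        using 1 by (auto intro!: derivative_eq_intros)
      have "((\<lambda>x. (1 / x) ^ k * exp (- (1 / x))) has_real_derivative
          k * (- ((1 / x) * (1 / x)) * (1 / x) ^ (k - Suc 0)) * exp (- (1 / x)) +
          exp (- (1 / x)) * - (- ((1 / x) * (1 / x))) * (1 / x) ^ k) (at x)"
        by (intro DERIV_mult DERIV_power inv DERIV_fun_exp DERIV_minus)
      also have "k * (- ((1 / x) * (1 / x)) * (1 / x) ^ (k - Suc 0)) * exp (- (1 / x)) +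
          exp (- (1 / x)) * - (- ((1 / x) * (1 / x))) * (1 / x) ^ k =
          (1 / x) ^ (k + 2) * exp (- (1 / x)) - k * ((1 / x) ^ (k + 1) * exp (- (1 / x)))"
        using 1 by (cases k) (simp_all add: algebra_simps)
      finally show ?thesis using 1 by (simp add: flat_exp_power_def)
    qed
    then show ?thesis
      by (rule has_field_derivative_transform_within_open[of _ _ _ "{0<..}"])
        (use 1 in \<open>auto simp: flat_exp_power_def\<close>)
  next
    case 2
    have "((\<lambda>_. 0) has_real_derivative 0) (at x)" by simp
    then have "(flat_exp_power k has_real_derivative 0) (at x)"
      by (rule has_field_derivative_transform_within_open[of _ _ _ "{..<0}"])
        (use 2 in \<open>auto simp: flat_exp_power_def\<close>)
    then show ?thesis using 2 by (simp add: flat_exp_power_def)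
  next
    case 3
    have "((\<lambda>h. (flat_exp_power k (0 + h) - flat_exp_power k 0) / h) \<longlongrightarrow> 0) (at 0)"
      by (rule Lim_transform_eventually[OF flat_exp_power_tendsto_0[of "Suc k"]])
        (auto simp: eventually_at_filter flat_exp_power_def)
    then show ?thesis
      using 3 by (simp add: DERIV_def flat_exp_power_def)
  qed
qed

lemma smooth_on_flat_exp_power: "smooth_on UNIV (flat_exp_power k)"
  unfolding smooth_on_def
proof
  fix n show "Ck_on n UNIV (flat_exp_power k)"
  proof (induction n arbitrary: k)
    case 0
    show ?case
      using DERIV_isCont[OF flat_exp_power_DERIV] by (auto intro!: continuous_at_imp_continuous_on)
  next
    case (Suc n)
    show ?case
    proof (rule Ck_on_SucI)
      show "(flat_exp_power k has_derivative
          (\<lambda>h. (flat_exp_power (k + 2) x + (- k) * flat_exp_power (k + 1) x) * h)) (at x)" for x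
        using flat_exp_power_DERIV[of k x] by (simp add: has_field_derivative_def)
      show "Ck_on n UNIV (\<lambda>x. (flat_exp_power (k + 2) x + (- k) * flat_exp_power (k + 1) x) * v)" for v
        by (intro Ck_on_bilinear[OF bounded_bilinear_mult] Ck_on_add Ck_on_const Suc.IH open_UNIV)
    qed auto
  qed
qed

text \<open>So \<open>flat_exp_power 0\<close>, which serves for the bump functions, is also convex and increasing up to 1/2, which makes
  it a building block for subharmonic functions that vanish on a given disk.\<close>
lemma flat_exp_second_derivative_nonneg:
  "x \<le> 1 / 2 \<Longrightarrow> 0 \<le> flat_exp_power 4 x - 2 * flat_exp_power 3 x"
proof (cases "x > 0")
  case True
  assume "x \<le> 1 / 2"
  then have "2 \<le> 1 / x" using True by (simp add: field_simps)
  then have "(1 / x) ^ 3 * exp (- (1 / x)) * (1 / x - 2) \<ge> 0"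
    using True by simp
  then show ?thesis
    using True by (simp add: flat_exp_power_def power_numeral_reduce right_diff_distrib diff_divide_distrib mult_ac)
qed (simp add: flat_exp_power_def)

lemma flat_exp_power_nonneg: "flat_exp_power k x \<ge> 0"
  by (simp add: flat_exp_power_def)

lemma flat_exp_power_pos_iff: "flat_exp_power k x > 0 \<longleftrightarrow> x > 0"
  by (simp add: flat_exp_power_def)

section \<open>Holomorphic functions of several variables\<close>

lemma norm_cscale: "norm (c *s (v::complex^'m::finite)) = cmod c * norm v"
  by (simp add: norm_vec_def norm_mult L2_set_right_distrib)

lemma dist_add_le: "dist x (y + w) \<le> dist x y + norm (w :: 'a::real_normed_vector)"
  using dist_triangle[of x "y + w" y] by (simp add: dist_norm)

lemma bounded_linear_cscale: "bounded_linear (\<lambda>c. c *s (v::complex^'m::finite))"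
  by (rule bounded_linear_intro[where K = "norm v"])
     (auto simp: norm_cscale vec_eq_iff algebra_simps)

lemma axis_i: "axis j \<i> = \<i> *s axis j (1::complex)"
  by (simp add: vec_eq_iff axis_def)

lemma vec_real_expansion:
  "(v::complex^'m::finite) = (\<Sum>j\<in>UNIV. Re (v $ j) *\<^sub>R axis j 1 + Im (v $ j) *\<^sub>R axis j \<i>)"
proof -
  have "(\<Sum>j\<in>UNIV. (Re (v $ j) *\<^sub>R axis j 1 + Im (v $ j) *\<^sub>R axis j \<i>) $ k) = v $ k" for k
  proof -
    have "(\<Sum>j\<in>UNIV. (Re (v $ j) *\<^sub>R axis j 1 + Im (v $ j) *\<^sub>R axis j \<i>) $ k) =
        (\<Sum>j\<in>UNIV. if j = k then v $ k else 0)"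
      by (rule sum.cong) (auto simp: axis_def complex_eq_iff)
    then show ?thesis by simp
  qed
  then show ?thesis by (simp add: vec_eq_iff)
qed

lemma frechet_derivative_wirtinger:
  assumes "f differentiable (at z)"
  shows "frechet_derivative f (at z) v = (\<Sum>j\<in>UNIV. v $ j * dz j f z + cnj (v $ j) * dzbar j f z)"
proof -
  let ?D = "frechet_derivative f (at z)"
  have lin: "linear ?D"
    using assms by (rule linear_frechet_derivative)
  have "?D v = ?D (\<Sum>j\<in>UNIV. Re (v $ j) *\<^sub>R axis j 1 + Im (v $ j) *\<^sub>R axis j \<i>)"
    using vec_real_expansion[of v] by simp
  also have "\<dots> = (\<Sum>j\<in>UNIV. Re (v $ j) *\<^sub>R ?D (axis j 1) + Im (v $ j) *\<^sub>R ?D (axis j \<i>))"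
    using lin by (simp add: linear_sum linear_add linear_cmul)
  also have "\<dots> = (\<Sum>j\<in>UNIV. v $ j * dz j f z + cnj (v $ j) * dzbar j f z)"
    by (rule sum.cong) (simp_all add: dz_def dzbar_def complex_eq_iff field_simps)
  finally show ?thesis .
qed

text \<open>The Wirtinger derivatives are the coefficients of \<open>v\<close> and of its conjugate in the differential, and these are unique;
  all rules of calculus for them can be read off the real differential.\<close>
lemma wirtinger_eqI:
  assumes "(f has_derivative (\<lambda>v. \<Sum>j\<in>UNIV. v $ j * a j + cnj (v $ j) * b j)) (at z)"
  shows "dz k f z = a k" "dzbar k f z = b k"
proof -
  have D: "frechet_derivative f (at z) = (\<lambda>v. \<Sum>j\<in>UNIV. v $ j * a j + cnj (v $ j) * b j)"
    using frechet_derivative_at[OF assms] by simp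
  have 1: "(\<Sum>j\<in>UNIV. axis k c $ j * a j + cnj (axis k c $ j) * b j) = c * a k + cnj c * b k" for c
  proof -
    have "(\<Sum>j\<in>UNIV. axis k c $ j * a j + cnj (axis k c $ j) * b j) =
        (\<Sum>j\<in>UNIV. if j = k then c * a k + cnj c * b k else 0)"
      by (rule sum.cong) (auto simp: axis_def)
    then show ?thesis by simp
  qed
  show "dz k f z = a k" "dzbar k f z = b k"
    unfolding dz_def dzbar_def D 1 by (simp_all add: algebra_simps)
qed

lemma has_derivative_wirtinger:
  assumes "f differentiable (at z)"
  shows "(f has_derivative (\<lambda>v. \<Sum>j\<in>UNIV. v $ j * dz j f z + cnj (v $ j) * dzbar j f z)) (at z)"
proof -
  have "frechet_derivative f (at z) = (\<lambda>v. \<Sum>j\<in>UNIV. v $ j * dz j f z + cnj (v $ j) * dzbar j f z)"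
    using frechet_derivative_wirtinger[OF assms] by (rule ext)
  then show ?thesis
    using assms unfolding frechet_derivative_works by simp
qed

text \<open>The Cauchy-Riemann equations at a point; by \<open>hol_at_iff\<close> this is the condition in \<open>hol_on\<close>.\<close>
definition hol_at :: "(complex^'m::finite \<Rightarrow> complex) \<Rightarrow> complex^'m \<Rightarrow> bool" where
  "hol_at f z \<longleftrightarrow> f differentiable (at z) \<and> (\<forall>j. dzbar j f z = 0)"

lemma hol_at_has_derivative:
  "hol_at f z \<Longrightarrow> (f has_derivative (\<lambda>v. \<Sum>j\<in>UNIV. v $ j * dz j f z)) (at z)"
  using has_derivative_wirtinger[of f z] by (simp add: hol_at_def)

lemma hol_at_frechet:
  "hol_at f z \<Longrightarrow> frechet_derivative f (at z) v = (\<Sum>j\<in>UNIV. v $ j * dz j f z)"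
  using frechet_derivative_wirtinger[of f z v] by (simp add: hol_at_def)

lemma hol_at_iff:
  "hol_at f z \<longleftrightarrow> (\<exists>D. (f has_derivative D) (at z) \<and> (\<forall>a v. D (a *s v) = a * D v))"
proof
  assume "hol_at f z"
  then show "\<exists>D. (f has_derivative D) (at z) \<and> (\<forall>a v. D (a *s v) = a * D v)"
    by (intro exI[of _ "\<lambda>v. \<Sum>j\<in>UNIV. v $ j * dz j f z"])
       (auto intro: hol_at_has_derivative simp: sum_distrib_left mult_ac)
next
  assume "\<exists>D. (f has_derivative D) (at z) \<and> (\<forall>a v. D (a *s v) = a * D v)"
  then obtain D where D: "(f has_derivative D) (at z)" "\<And>a v. D (a *s v) = a * D v" by blast
  have "frechet_derivative f (at z) = D"
    using frechet_derivative_at[OF D(1)] by simp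
  then show "hol_at f z"
    using D by (auto simp: hol_at_def differentiable_def dzbar_def axis_i)
qed

lemma hol_on_iff: "hol_on S f \<longleftrightarrow> (\<forall>z\<in>S. hol_at f z)"
  by (simp add: hol_on_def hol_at_iff)

lemma hol_atI:
  "(f has_derivative D) (at z) \<Longrightarrow> (\<And>a v. D (a *s v) = a * D v) \<Longrightarrow> hol_at f z"
  using hol_at_iff by blast

lemma hol_at_frechet_cscale:
  "hol_at f z \<Longrightarrow> frechet_derivative f (at z) (a *s v) = a * frechet_derivative f (at z) v"
  by (simp add: hol_at_frechet sum_distrib_left mult_ac)

lemma hol_at_differentiable: "hol_at f z \<Longrightarrow> f differentiable (at z)"
  by (simp add: hol_at_def)

lemma dz_eq_frechet: "hol_at f z \<Longrightarrow> dz j f z = frechet_derivative f (at z) (axis j 1)"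
  by (simp add: dz_def axis_i hol_at_frechet_cscale flip: mult.assoc)

lemma hol_on_line_deriv:
  assumes "hol_at f (z + \<zeta> *s v)"
  shows "((\<lambda>\<zeta>. f (z + \<zeta> *s v)) has_field_derivative frechet_derivative f (at (z + \<zeta> *s v)) v) (at \<zeta>)"
proof -
  have "((\<lambda>\<zeta>. z + \<zeta> *s v) has_derivative (\<lambda>h. h *s v)) (at \<zeta>)"
    using has_derivative_add[OF has_derivative_const[of z] bounded_linear_imp_has_derivative[OF bounded_linear_cscale[of v]]]
    by simp
  from has_derivative_compose[OF this, of f "frechet_derivative f (at (z + \<zeta> *s v))"]
  have "((\<lambda>\<zeta>. f (z + \<zeta> *s v)) has_derivative (\<lambda>h. frechet_derivative f (at (z + \<zeta> *s v)) (h *s v))) (at \<zeta>)"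
    using hol_at_differentiable[OF assms] by (simp add: frechet_derivative_works)
  then show ?thesis
    using assms unfolding has_field_derivative_def
    by (rule_tac has_derivative_eq_rhs) (auto simp: fun_eq_iff hol_at_frechet_cscale)
qed

text \<open>The one-dimensional Cauchy inequality on the complex line through \<open>z\<close> in direction \<open>v\<close>. Holomorphy is only
  assumed in the sense of pointwise complex differentiability, so all regularity has to come from such lines.\<close>
lemma hol_on_Cauchy_estimate:
  assumes f: "hol_on S f" and \<rho>: "\<rho> > 0"
    and B: "\<And>\<zeta>. cmod \<zeta> \<le> \<rho> \<Longrightarrow> z + \<zeta> *s v \<in> S \<and> cmod (f (z + \<zeta> *s v)) \<le> B"
  shows "cmod (frechet_derivative f (at z) v) \<le> B / \<rho>"
proof -
  define F where "F \<zeta> = f (z + \<zeta> *s v)" for \<zeta>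
  have F: "(F has_field_derivative frechet_derivative f (at (z + \<zeta> *s v)) v) (at \<zeta>)" if "cmod \<zeta> \<le> \<rho>" for \<zeta>
    unfolding F_def using hol_on_line_deriv[of f z \<zeta> v] f B[OF that] by (auto simp: hol_on_iff)
  have hF: "F holomorphic_on cball 0 \<rho>"
    unfolding holomorphic_on_def field_differentiable_def
    using DERIV_subset[OF F] by fastforce
  have "norm ((deriv ^^ 1) F 0) \<le> fact 1 * B / \<rho> ^ 1"
  proof (rule Cauchy_inequality[OF holomorphic_on_subset[OF hF] holomorphic_on_imp_continuous_on[OF hF] \<rho>])
    show "norm (F x) \<le> B" if "norm (0 - x) = \<rho>" for x
      using B[of x] that by (simp add: F_def)
  qed auto
  moreover have "deriv F 0 = frechet_derivative f (at z) v"
    using DERIV_imp_deriv[OF F[of 0]] \<rho> by simp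
  ultimately show ?thesis by simp
qed

lemma hol_on_difference_quotient_bound:
  assumes f: "hol_on S f" and \<rho>: "\<rho> > 0"
    and B: "\<And>\<zeta>. cmod \<zeta> \<le> 2 * \<rho> \<Longrightarrow> z + \<zeta> *s v \<in> S \<and> cmod (f (z + \<zeta> *s v)) \<le> B"
    and h: "cmod \<zeta> \<le> \<rho>"
  shows "cmod (f (z + \<zeta> *s v) - f z - \<zeta> * frechet_derivative f (at z) v) \<le> (2 * B / \<rho>\<^sup>2) * (cmod \<zeta>)\<^sup>2"
proof -
  define F where "F \<zeta> = f (z + \<zeta> *s v)" for \<zeta>
  have F: "(F has_field_derivative frechet_derivative f (at (z + \<zeta> *s v)) v) (at \<zeta>)"
    if "cmod \<zeta> \<le> 2 * \<rho>" for \<zeta>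
    unfolding F_def using hol_on_line_deriv[of f z \<zeta> v] f B[OF that] by (auto simp: hol_on_iff)
  have hF: "F holomorphic_on cball 0 (2 * \<rho>)"
    unfolding holomorphic_on_def field_differentiable_def
    using DERIV_subset[OF F] by fastforce
  have hFb: "F holomorphic_on ball 0 (2 * \<rho>)"
    by (rule holomorphic_on_subset[OF hF]) auto
  have F'': "norm ((deriv ^^ 2) F \<xi>) \<le> fact 2 * B / \<rho> ^ 2" if "cmod \<xi> \<le> \<rho>" for \<xi>
  proof -
    have sub: "cball \<xi> \<rho> \<subseteq> cball 0 (2 * \<rho>)"
      using that by (auto simp: dist_norm) (metis add_mono diff_add_cancel mult_2 norm_minus_commute norm_triangle_le)
    show ?thesis
    proof (rule Cauchy_inequality[OF _ _ \<rho>])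
      show "F holomorphic_on ball \<xi> \<rho>"
        using holomorphic_on_subset[OF hF] sub ball_subset_cball by blast
      show "continuous_on (cball \<xi> \<rho>) F"
        using holomorphic_on_imp_continuous_on[OF holomorphic_on_subset[OF hF sub]] .
      show "norm (F x) \<le> B" if "norm (\<xi> - x) = \<rho>" for x
      proof -
        have "x \<in> cball \<xi> \<rho>" using that by (simp add: dist_norm)
        then show ?thesis using sub B[of x] unfolding F_def by auto
      qed
    qed
  qed
  have "cmod ((deriv ^^ 0) F \<zeta> - (\<Sum>i\<le>1. (deriv ^^ i) F 0 * (\<zeta> - 0) ^ i / fact i)) \<le>
      (fact 2 * B / \<rho> ^ 2) * cmod (\<zeta> - 0) ^ Suc 1 / fact 1"
  proof (rule complex_Taylor[of "cball 0 \<rho>"])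
    fix i x assume "x \<in> cball (0::complex) \<rho>"
    then have "x \<in> ball 0 (2 * \<rho>)" using \<rho> by auto
    moreover have "(deriv ^^ i) F holomorphic_on ball 0 (2 * \<rho>)"
      using hFb by (intro holomorphic_higher_deriv) auto
    ultimately have "((deriv ^^ i) F has_field_derivative deriv ((deriv ^^ i) F) x) (at x)"
      using holomorphic_derivI[of "(deriv ^^ i) F" "ball 0 (2 * \<rho>)" x UNIV] by auto
    then show "((deriv ^^ i) F has_field_derivative (deriv ^^ Suc i) F x) (at x within cball 0 \<rho>)"
      using has_field_derivative_at_within by auto
  qed (use F'' h \<rho> in \<open>auto simp: numeral_2_eq_2\<close>)
  moreover have "deriv F 0 = frechet_derivative f (at z) v"
    using DERIV_imp_deriv[OF F[of 0]] \<rho> by simp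
  ultimately show ?thesis
    by (simp add: F_def algebra_simps power2_eq_square)
qed

text \<open>The difference quotients of \<open>f\<close> in direction \<open>j\<close> are holomorphic and converge locally uniformly to \<open>dz j f\<close>
  (second-order Taylor estimate on lines); by the Cauchy estimate their derivatives are uniformly Cauchy, so the limit
  is differentiable, and its derivative is complex linear as a limit of complex linear maps.\<close>
lemma hol_on_dz:
  fixes f :: "complex^'m::finite \<Rightarrow> complex"
  assumes S: "open S" and f: "hol_on S f"
  shows "hol_on S (dz j f)"
  unfolding hol_on_iff
proof
  fix z0 assume z0: "z0 \<in> S"
  obtain r where r: "r > 0" "cball z0 r \<subseteq> S"
    using S z0 open_contains_cball by blast
  \<comment> \<open>Limits of derivatives are taken on the ball of radius \<open>2 * d\<close>; the Cauchy estimate for them uses circles of radius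
    \<open>d\<close>, and the difference quotients on these use circles of radius \<open>2 * d\<close>.\<close>
  define d where "d = r / 5"
  have d: "d > 0" "cball z0 (5 * d) \<subseteq> S" using r by (auto simp: d_def)
  have cont: "continuous_on S f"
    using f by (auto simp: hol_on_iff intro!: continuous_at_imp_continuous_on
        dest!: hol_at_differentiable differentiable_imp_continuous_within)
  obtain B where B: "B > 0" "\<And>z. z \<in> cball z0 (5 * d) \<Longrightarrow> cmod (f z) \<le> B"
    using compact_imp_bounded[OF compact_continuous_image[OF continuous_on_subset[OF cont d(2)] compact_cball]]
    unfolding bounded_pos by blast
  define e where "e = axis j (1::complex)"
  have ne: "norm e = 1" by (simp add: e_def)
  define N where "N = nat \<lceil>1 / d\<rceil> + 1"
  define \<epsilon> where "\<epsilon> n = 1 / real (n + N)" for n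
  have \<epsilon>: "0 < \<epsilon> n" "\<epsilon> n \<le> d" for n
  proof -
    show "0 < \<epsilon> n" by (simp add: \<epsilon>_def N_def)
    have "1 / d \<le> real (n + N)" unfolding N_def by linarith
    then have "1 \<le> real (n + N) * d" using d(1) by (simp add: pos_divide_le_eq)
    moreover have "real (n + N) > 0" by (simp add: N_def)
    ultimately show "\<epsilon> n \<le> d" unfolding \<epsilon>_def by (simp add: pos_divide_le_eq mult.commute)
  qed
  have \<epsilon>0: "\<epsilon> \<longlonglongrightarrow> 0"
    unfolding \<epsilon>_def by (rule LIMSEQ_ignore_initial_segment[OF lim_1_over_n])
  define g where "g n z = of_real (1 / \<epsilon> n) * (f (z + of_real (\<epsilon> n) *s e) - f z)" for n z
  define C where "C = 2 * B / d\<^sup>2"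
  have dzf: "hol_at f z" "dz j f z = frechet_derivative f (at z) e" if "z \<in> cball z0 (5 * d)" for z
    using f d(2) that dz_eq_frechet[of f z j] by (auto simp: hol_on_iff e_def)
  have gC: "cmod (g n z - dz j f z) \<le> C * \<epsilon> n" if z: "z \<in> cball z0 (3 * d)" for n z
  proof -
    have "cmod (f (z + of_real (\<epsilon> n) *s e) - f z - of_real (\<epsilon> n) * frechet_derivative f (at z) e)
        \<le> (2 * B / d\<^sup>2) * (cmod (of_real (\<epsilon> n)))\<^sup>2"
    proof (rule hol_on_difference_quotient_bound[OF f d(1)])
      fix \<zeta> :: complex assume "cmod \<zeta> \<le> 2 * d"
      then have "dist z0 (z + \<zeta> *s e) \<le> 5 * d"
        using z dist_add_le[of z0 z "\<zeta> *s e"] by (auto simp: norm_cscale ne)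
      then show "z + \<zeta> *s e \<in> S \<and> cmod (f (z + \<zeta> *s e)) \<le> B"
        using B(2) d(2) by auto
    qed (use \<epsilon>[of n] in auto)
    then have 1: "cmod (f (z + of_real (\<epsilon> n) *s e) - f z - of_real (\<epsilon> n) * dz j f z) \<le> C * (\<epsilon> n)\<^sup>2"
      using dzf(2)[of z] z d(1) by (simp add: C_def)
    have "g n z - dz j f z = of_real (1 / \<epsilon> n) * (f (z + of_real (\<epsilon> n) *s e) - f z - of_real (\<epsilon> n) * dz j f z)"
      using \<epsilon>(1)[of n] by (simp add: g_def field_simps)
    then have "cmod (g n z - dz j f z) =
        1 / \<epsilon> n * cmod (f (z + of_real (\<epsilon> n) *s e) - f z - of_real (\<epsilon> n) * dz j f z)"
      using \<epsilon>(1)[of n] by (simp add: norm_mult norm_divide)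
    also have "\<dots> \<le> 1 / \<epsilon> n * (C * (\<epsilon> n)\<^sup>2)"
      using 1 \<epsilon>(1)[of n] by (intro mult_left_mono) auto
    finally show ?thesis using \<epsilon>(1)[of n] by (simp add: power2_eq_square)
  qed
  have holg: "hol_at (g n) z" if z: "z \<in> cball z0 (3 * d)" for n z
  proof -
    have 1: "z + of_real (\<epsilon> n) *s e \<in> cball z0 (5 * d)" "z \<in> cball z0 (5 * d)"
      using z \<epsilon>[of n] d(1) dist_add_le[of z0 z "of_real (\<epsilon> n) *s e"] by (auto simp: norm_cscale ne)
    let ?w = "z + of_real (\<epsilon> n) *s e"
    have sh: "((\<lambda>z. z + of_real (\<epsilon> n) *s e) has_derivative (\<lambda>h. h)) (at z)"
      by (auto intro!: derivative_eq_intros)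
    have "(g n has_derivative (\<lambda>h. of_real (1 / \<epsilon> n) *
        (frechet_derivative f (at ?w) h - frechet_derivative f (at z) h))) (at z)"
      unfolding g_def
      using has_derivative_compose[OF sh, of f "frechet_derivative f (at ?w)"]
        hol_at_differentiable[OF dzf(1)[OF 1(1)]] hol_at_differentiable[OF dzf(1)[OF 1(2)]]
      by (intro has_derivative_mult_right has_derivative_diff) (auto simp: frechet_derivative_works)
    then show ?thesis
      by (rule hol_atI) (simp add: hol_at_frechet_cscale[OF dzf(1)[OF 1(1)]]
          hol_at_frechet_cscale[OF dzf(1)[OF 1(2)]] algebra_simps)
  qed
  define G where "G n z = frechet_derivative (g n) (at z)" for n z
  have Gder: "(g n has_derivative G n z) (at z)" if "z \<in> cball z0 (3 * d)" for n z
    using hol_at_differentiable[OF holg[OF that]] by (simp add: G_def frechet_derivative_works)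
  have Gdiff: "cmod (G n z h - G m z h) \<le> (C * (\<epsilon> n + \<epsilon> m) / d) * norm h" if z: "z \<in> cball z0 (2 * d)" for n m z h
  proof (cases "h = 0")
    case True
    have "linear (G n z)" "linear (G m z)"
      using Gder[of z] z d(1) has_derivative_linear by fastforce+
    then show ?thesis using True by (simp add: linear_0)
  next
    case False
    have z3: "z \<in> cball z0 (3 * d)" using z d(1) by auto
    have hd: "hol_on (cball z0 (3 * d)) (\<lambda>z. g n z - g m z)"
      unfolding hol_on_iff
    proof
      fix w assume w: "w \<in> cball z0 (3 * d)"
      show "hol_at (\<lambda>z. g n z - g m z) w"
        by (rule hol_atI[OF has_derivative_diff[OF Gder[OF w] Gder[OF w]]])
           (simp add: G_def hol_at_frechet_cscale[OF holg[OF w]] algebra_simps)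
    qed
    have "cmod (frechet_derivative (\<lambda>z. g n z - g m z) (at z) h) \<le> (C * (\<epsilon> n + \<epsilon> m)) / (d / norm h)"
    proof (rule hol_on_Cauchy_estimate[OF hd])
      show "d / norm h > 0" using d False by simp
      fix \<zeta> :: complex assume "cmod \<zeta> \<le> d / norm h"
      then have "norm (\<zeta> *s h) \<le> d" using False by (simp add: norm_cscale field_simps)
      then have w: "z + \<zeta> *s h \<in> cball z0 (3 * d)"
        using z dist_add_le[of z0 z "\<zeta> *s h"] by auto
      have "cmod (g n (z + \<zeta> *s h) - g m (z + \<zeta> *s h)) \<le>
          cmod (g n (z + \<zeta> *s h) - dz j f (z + \<zeta> *s h)) + cmod (g m (z + \<zeta> *s h) - dz j f (z + \<zeta> *s h))"
        using norm_triangle_ineq4[of "g n (z + \<zeta> *s h) - dz j f (z + \<zeta> *s h)" "g m (z + \<zeta> *s h) - dz j f (z + \<zeta> *s h)"]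
        by simp
      also have "\<dots> \<le> C * (\<epsilon> n + \<epsilon> m)"
        using gC[OF w, of n] gC[OF w, of m] by (simp add: algebra_simps)
      finally show "z + \<zeta> *s h \<in> cball z0 (3 * d) \<and> cmod (g n (z + \<zeta> *s h) - g m (z + \<zeta> *s h)) \<le> C * (\<epsilon> n + \<epsilon> m)"
        using w by blast
    qed
    moreover have "frechet_derivative (\<lambda>z. g n z - g m z) (at z) = (\<lambda>h. G n z h - G m z h)"
      using frechet_derivative_at[OF has_derivative_diff[OF Gder[OF z3] Gder[OF z3]]] by simp
    ultimately show ?thesis by simp
  qed
  have small: "\<forall>\<^sub>F n in sequentially. K * \<epsilon> n < \<eta>" if "\<eta> > 0" for K \<eta>
    using order_tendstoD(2)[OF tendsto_mult_right_zero[OF \<epsilon>0, of K], of \<eta>] that by simp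
  have conv: "convergent (\<lambda>n. G n z h)" if z: "z \<in> cball z0 (2 * d)" for z h
    unfolding Cauchy_convergent_iff[symmetric]
  proof (rule metric_CauchyI)
    fix \<eta> :: real assume \<eta>: "\<eta> > 0"
    define K where "K = C / d * norm h"
    obtain M where M: "\<And>n. n \<ge> M \<Longrightarrow> K * \<epsilon> n < \<eta> / 2"
      using small[of "\<eta> / 2" K] \<eta> unfolding eventually_sequentially by auto
    have "dist (G m z h) (G n z h) < \<eta>" if "m \<ge> M" "n \<ge> M" for m n
    proof -
      have "dist (G m z h) (G n z h) \<le> K * \<epsilon> m + K * \<epsilon> n"
        using Gdiff[OF z, of m h n] by (simp add: dist_norm K_def algebra_simps add_divide_distrib)
      then show ?thesis using M[OF that(1)] M[OF that(2)] by linarith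
    qed
    then show "\<exists>M. \<forall>m\<ge>M. \<forall>n\<ge>M. dist (G m z h) (G n z h) < \<eta>" by blast
  qed
  define L where "L z h = lim (\<lambda>n. G n z h)" for z h
  have GL: "(\<lambda>n. G n z h) \<longlonglongrightarrow> L z h" if "z \<in> cball z0 (2 * d)" for z h
    using conv[OF that] by (simp add: L_def convergent_LIMSEQ_iff)
  have GLbound: "cmod (G n z h - L z h) \<le> (C * \<epsilon> n / d) * norm h" if z: "z \<in> cball z0 (2 * d)" for n z h
  proof (rule LIMSEQ_le)
    show "(\<lambda>m. cmod (G n z h - G m z h)) \<longlonglongrightarrow> cmod (G n z h - L z h)"
      by (intro tendsto_intros GL z)
    have "(\<lambda>m. (C * (\<epsilon> n + \<epsilon> m) / d) * norm h) \<longlonglongrightarrow> (C * (\<epsilon> n + 0) / d) * norm h"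
      by (intro tendsto_intros \<epsilon>0) (use d in auto)
    then show "(\<lambda>m. (C * (\<epsilon> n + \<epsilon> m) / d) * norm h) \<longlonglongrightarrow> (C * \<epsilon> n / d) * norm h" by simp
    show "\<exists>N. \<forall>m\<ge>N. cmod (G n z h - G m z h) \<le> (C * (\<epsilon> n + \<epsilon> m) / d) * norm h"
      using Gdiff[OF z] by blast
  qed
  have lim: "(\<lambda>n. g n z) \<longlonglongrightarrow> dz j f z" if z: "z \<in> cball z0 (3 * d)" for z
  proof -
    have "(\<lambda>n. g n z - dz j f z) \<longlonglongrightarrow> 0"
      by (rule Lim_null_comparison[OF _ tendsto_mult_right_zero[OF \<epsilon>0, of C]])
         (use gC[OF z] in auto)
    then show ?thesis by (simp add: LIM_zero_iff)
  qed
  obtain H where H: "\<forall>z\<in>ball z0 d. (\<lambda>n. g n z) \<longlonglongrightarrow> H z \<and> (H has_derivative L z) (at z within ball z0 d)"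
  proof -
    have "\<exists>H. \<forall>z\<in>ball z0 d. (\<lambda>n. g n z) \<longlonglongrightarrow> H z \<and> (H has_derivative L z) (at z within ball z0 d)"
    proof (rule has_derivative_sequence[where ?x0.0 = z0 and f' = G])
      show "(g n has_derivative G n z) (at z within ball z0 d)" if "z \<in> ball z0 d" for n z
        using that d(1) by (intro has_derivative_at_withinI[OF Gder]) auto
      show "\<forall>\<^sub>F n in sequentially. \<forall>x\<in>ball z0 d. \<forall>h. norm (G n x h - L x h) \<le> \<eta> * norm h" if "\<eta> > 0" for \<eta>
        using small[OF that, of "C / d"]
      proof eventually_elim
        case (elim n)
        show ?case
        proof (intro ballI allI)
          fix x h assume "x \<in> ball z0 d"
          then have "norm (G n x h - L x h) \<le> (C * \<epsilon> n / d) * norm h"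
            using d(1) by (intro GLbound) auto
          also have "\<dots> \<le> \<eta> * norm h" using elim by (intro mult_right_mono) auto
          finally show "norm (G n x h - L x h) \<le> \<eta> * norm h" .
        qed
      qed
      show "(\<lambda>n. g n z0) \<longlonglongrightarrow> dz j f z0" using lim[of z0] d(1) by auto
    qed (use d(1) in auto)
    then show ?thesis using that by blast
  qed
  have HD: "H z = dz j f z" if "z \<in> ball z0 d" for z
  proof -
    have "z \<in> cball z0 (3 * d)" using that d(1) by simp
    then show ?thesis using lim[of z] H that LIMSEQ_unique by blast
  qed
  have "(H has_derivative L z0) (at z0)"
  proof -
    have "z0 \<in> ball z0 d" using d(1) by simp
    then have "(H has_derivative L z0) (at z0 within ball z0 d)" using H by blast
    then show ?thesis using at_within_open[OF \<open>z0 \<in> ball z0 d\<close> open_ball] by simp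
  qed
  then have der: "(dz j f has_derivative L z0) (at z0)"
    by (rule has_derivative_transform_within_open[of _ _ _ _ "ball z0 d"]) (use d(1) HD in auto)
  show "hol_at (dz j f) z0"
  proof (rule hol_atI[OF der])
    fix a h
    have z: "z0 \<in> cball z0 (2 * d)" "z0 \<in> cball z0 (3 * d)" using d(1) by auto
    have "(\<lambda>n. a * G n z0 h) \<longlonglongrightarrow> a * L z0 h"
      by (intro tendsto_intros GL z)
    moreover have "(\<lambda>n. a * G n z0 h) = (\<lambda>n. G n z0 (a *s h))"
      by (simp add: G_def hol_at_frechet_cscale[OF holg[OF z(2)]])
    ultimately show "L z0 (a *s h) = a * L z0 h"
      using GL[OF z(1), of "a *s h"] LIMSEQ_unique by auto
  qed
qed

lemma hol_on_smooth:
  assumes S: "open S" and f: "hol_on S f"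
  shows "smooth_on S f"
  unfolding smooth_on_def
proof
  fix k show "Ck_on k S f"
    using f
  proof (induction k arbitrary: f)
    case 0
    then show ?case
      by (auto simp: hol_on_iff intro!: continuous_at_imp_continuous_on
        dest!: hol_at_differentiable differentiable_imp_continuous_within)
  next
    case (Suc k)
    show ?case
    proof (rule Ck_on_SucI[OF S])
      show "(f has_derivative (\<lambda>v. \<Sum>j\<in>UNIV. v $ j * dz j f z)) (at z)" if "z \<in> S" for z
        using Suc.prems that by (auto simp: hol_on_iff intro: hol_at_has_derivative)
      show "Ck_on k S (\<lambda>z. \<Sum>j\<in>UNIV. v $ j * dz j f z)" for v
        by (intro Ck_on_sum Ck_on_bilinear[OF bounded_bilinear_mult] Ck_on_const S Suc.IH hol_on_dz Suc.prems)
    qed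
  qed
qed

section \<open>Wirtinger calculus\<close>

lemma frechet_const: "frechet_derivative (\<lambda>_. c) (at z) = (\<lambda>_. 0)"
  using frechet_derivative_at[OF has_derivative_const[of c]] by metis

lemma dz_cong_open:
  assumes "open S" "z \<in> S" "\<And>y. y \<in> S \<Longrightarrow> f y = g y"
  shows "dz j f z = dz j g z" "dzbar j f z = dzbar j g z"
  using frechet_derivative_cong_open[OF assms] by (simp_all add: dz_def dzbar_def)

lemma dz_const: "dz j (\<lambda>_. c) z = 0" "dzbar j (\<lambda>_. c) z = 0"
  by (simp_all add: dz_def dzbar_def frechet_const)

lemma dz_linear_frechet:
  assumes "frechet_derivative f (at z) = (\<lambda>h. a * frechet_derivative g (at z) h + b * frechet_derivative k (at z) h)"
  shows "dz j f z = a * dz j g z + b * dz j k z" "dzbar j f z = a * dzbar j g z + b * dzbar j k z"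
  by (simp_all add: dz_def dzbar_def assms algebra_simps add_divide_distrib diff_divide_distrib)

lemma dz_add:
  assumes "f differentiable (at z)" "g differentiable (at z)"
  shows "dz j (\<lambda>z. f z + g z) z = dz j f z + dz j g z"
    "dzbar j (\<lambda>z. f z + g z) z = dzbar j f z + dzbar j g z"
proof -
  have "frechet_derivative (\<lambda>z. f z + g z) (at z) =
      (\<lambda>h. 1 * frechet_derivative f (at z) h + 1 * frechet_derivative g (at z) h)"
    using frechet_derivative_at[symmetric, OF has_derivative_add[OF assms[unfolded frechet_derivative_works]]]
    by simp
  from dz_linear_frechet[OF this]
  show "dz j (\<lambda>z. f z + g z) z = dz j f z + dz j g z"
    "dzbar j (\<lambda>z. f z + g z) z = dzbar j f z + dzbar j g z" by simp_all
qed

lemma dz_mult: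
  assumes "f differentiable (at z)" "g differentiable (at z)"
  shows "dz j (\<lambda>z. f z * g z) z = f z * dz j g z + g z * dz j f z"
    "dzbar j (\<lambda>z. f z * g z) z = f z * dzbar j g z + g z * dzbar j f z"
proof -
  have "frechet_derivative (\<lambda>z. f z * g z) (at z) =
      (\<lambda>h. f z * frechet_derivative g (at z) h + g z * frechet_derivative f (at z) h)"
    using frechet_derivative_at[symmetric, OF has_derivative_mult[OF assms[unfolded frechet_derivative_works]]]
    by (simp add: mult.commute)
  from dz_linear_frechet[OF this]
  show "dz j (\<lambda>z. f z * g z) z = f z * dz j g z + g z * dz j f z"
    "dzbar j (\<lambda>z. f z * g z) z = f z * dzbar j g z + g z * dzbar j f z" by simp_all
qed

lemma dz_cmult:
  assumes "f differentiable (at z)"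
  shows "dz j (\<lambda>z. c * f z) z = c * dz j f z" "dzbar j (\<lambda>z. c * f z) z = c * dzbar j f z"
  using dz_mult[of "\<lambda>_. c" z f j] assms by (simp_all add: dz_const)

lemma dz_sum:
  assumes "finite A" "\<And>i. i \<in> A \<Longrightarrow> f i differentiable (at z)"
  shows "dz j (\<lambda>z. \<Sum>i\<in>A. f i z) z = (\<Sum>i\<in>A. dz j (f i) z) \<and>
    dzbar j (\<lambda>z. \<Sum>i\<in>A. f i z) z = (\<Sum>i\<in>A. dzbar j (f i) z)"
  using assms
  by (induction A rule: finite_induct) (simp_all add: dz_const dz_add differentiable_sum)

lemma dz_cnj:
  assumes "f differentiable (at z)"
  shows "dz j (\<lambda>z. cnj (f z)) z = cnj (dzbar j f z)" "dzbar j (\<lambda>z. cnj (f z)) z = cnj (dz j f z)"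
  using frechet_derivative_linear_compose[OF bounded_linear_cnj assms]
  by (simp_all add: dz_def dzbar_def)

lemma differentiable_cnj: "f differentiable (at z) \<Longrightarrow> (\<lambda>z. cnj (f z)) differentiable (at z)"
  unfolding differentiable_def using bounded_linear.has_derivative[OF bounded_linear_cnj] by blast

lemma differentiable_of_real:
  "g differentiable (at z) \<Longrightarrow> (\<lambda>z. complex_of_real (g z)) differentiable (at z)"
  unfolding differentiable_def using bounded_linear.has_derivative[OF bounded_linear_of_real] by blast

lemma dz_real_chain:
  fixes g :: "complex^'m::finite \<Rightarrow> real"
  assumes g: "g differentiable (at z)" and E: "(E has_real_derivative e) (at (g z))"
  shows "dz j (\<lambda>z. complex_of_real (E (g z))) z = of_real e * dz j (\<lambda>z. complex_of_real (g z)) z"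
    "dzbar j (\<lambda>z. complex_of_real (E (g z))) z = of_real e * dzbar j (\<lambda>z. complex_of_real (g z)) z"
proof -
  have "((\<lambda>z. E (g z)) has_derivative (\<lambda>h. e * frechet_derivative g (at z) h)) (at z)"
    using has_derivative_compose[of g "frechet_derivative g (at z)" z UNIV E "(*) e"] g E
    by (simp add: frechet_derivative_works has_field_derivative_def)
  from frechet_derivative_at[symmetric, OF bounded_linear.has_derivative[OF bounded_linear_of_real this]]
  have "frechet_derivative (\<lambda>z. complex_of_real (E (g z))) (at z) =
      (\<lambda>h. complex_of_real (e * frechet_derivative g (at z) h))" by simp
  moreover have "frechet_derivative (\<lambda>z. complex_of_real (g z)) (at z) h =
      complex_of_real (frechet_derivative g (at z) h)" for h
    using frechet_derivative_linear_compose[OF bounded_linear_of_real g] .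
  ultimately show "dz j (\<lambda>z. complex_of_real (E (g z))) z = of_real e * dz j (\<lambda>z. complex_of_real (g z)) z"
    "dzbar j (\<lambda>z. complex_of_real (E (g z))) z = of_real e * dzbar j (\<lambda>z. complex_of_real (g z)) z"
    by (simp_all add: dz_def dzbar_def algebra_simps)
qed

lemma has_derivative_vec_components:
  fixes T :: "'a::real_normed_vector \<Rightarrow> complex^'m::finite"
  assumes "\<And>a. ((\<lambda>z. T z $ a) has_derivative (\<lambda>h. D h $ a)) (at z)"
  shows "(T has_derivative D) (at z)"
  unfolding has_derivative_componentwise_within[of T D z UNIV, simplified]
proof
  fix i :: "complex^'m" assume "i \<in> Basis"
  then obtain a u where i: "i = axis a u" by (auto simp: Basis_vec_def)
  show "((\<lambda>x. T x \<bullet> i) has_derivative (\<lambda>x. D x \<bullet> i)) (at z)"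
    using bounded_linear.has_derivative[OF bounded_linear_inner_left[of u] assms[of a]]
    by (simp add: i inner_axis)
qed

lemma hol_map_has_derivative:
  fixes T :: "complex^'n::finite \<Rightarrow> complex^'m::finite"
  assumes "\<And>a. hol_at (\<lambda>z. T z $ a) z"
  shows "(T has_derivative (\<lambda>v. \<chi> a. \<Sum>j\<in>UNIV. v $ j * dz j (\<lambda>z. T z $ a) z)) (at z)"
  by (rule has_derivative_vec_components) (use hol_at_has_derivative[OF assms] in simp)

lemma dz_compose:
  fixes T :: "complex^'n::finite \<Rightarrow> complex^'m::finite"
  assumes T: "\<And>a. hol_at (\<lambda>z. T z $ a) z" and u: "u differentiable (at (T z))"
  shows "dz j (\<lambda>z. u (T z)) z = (\<Sum>a\<in>UNIV. dz a u (T z) * dz j (\<lambda>z. T z $ a) z)"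
    "dzbar j (\<lambda>z. u (T z)) z = (\<Sum>a\<in>UNIV. dzbar a u (T z) * cnj (dz j (\<lambda>z. T z $ a) z))"
proof -
  have "((\<lambda>z. u (T z)) has_derivative (\<lambda>v.
      \<Sum>a\<in>UNIV. (\<Sum>j\<in>UNIV. v $ j * dz j (\<lambda>z. T z $ a) z) * dz a u (T z) +
        cnj (\<Sum>j\<in>UNIV. v $ j * dz j (\<lambda>z. T z $ a) z) * dzbar a u (T z))) (at z)"
    using has_derivative_compose[OF hol_map_has_derivative[OF T] has_derivative_wirtinger[OF u]] by simp
  also have "(\<lambda>v.
      \<Sum>a\<in>UNIV. (\<Sum>j\<in>UNIV. v $ j * dz j (\<lambda>z. T z $ a) z) * dz a u (T z) +
        cnj (\<Sum>j\<in>UNIV. v $ j * dz j (\<lambda>z. T z $ a) z) * dzbar a u (T z)) =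
      (\<lambda>v. \<Sum>j\<in>UNIV. v $ j * (\<Sum>a\<in>UNIV. dz a u (T z) * dz j (\<lambda>z. T z $ a) z) +
        cnj (v $ j) * (\<Sum>a\<in>UNIV. dzbar a u (T z) * cnj (dz j (\<lambda>z. T z $ a) z)))"
    (is "?l = ?r")
  proof
    fix v
    have "?l v = (\<Sum>a\<in>UNIV. \<Sum>j\<in>UNIV. v $ j * (dz a u (T z) * dz j (\<lambda>z. T z $ a) z) +
         cnj (v $ j) * (dzbar a u (T z) * cnj (dz j (\<lambda>z. T z $ a) z)))"
      by (simp add: sum_distrib_left sum_distrib_right sum.distrib mult_ac)
    also have "\<dots> = (\<Sum>j\<in>UNIV. \<Sum>a\<in>UNIV. v $ j * (dz a u (T z) * dz j (\<lambda>z. T z $ a) z) +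
         cnj (v $ j) * (dzbar a u (T z) * cnj (dz j (\<lambda>z. T z $ a) z)))"
      by (rule sum.swap)
    also have "\<dots> = ?r v"
      by (simp add: sum_distrib_left sum.distrib)
    finally show "?l v = ?r v" .
  qed
  finally show "dz j (\<lambda>z. u (T z)) z = (\<Sum>a\<in>UNIV. dz a u (T z) * dz j (\<lambda>z. T z $ a) z)"
    "dzbar j (\<lambda>z. u (T z)) z = (\<Sum>a\<in>UNIV. dzbar a u (T z) * cnj (dz j (\<lambda>z. T z $ a) z))"
    by (rule wirtinger_eqI)+
qed

lemma hol_at_const: "hol_at (\<lambda>_. c) z"
  by (simp add: hol_at_def dz_const)

lemma hol_at_add: "hol_at f z \<Longrightarrow> hol_at g z \<Longrightarrow> hol_at (\<lambda>z. f z + g z) z"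
  by (simp add: hol_at_def dz_add)

lemma hol_at_mult: "hol_at f z \<Longrightarrow> hol_at g z \<Longrightarrow> hol_at (\<lambda>z. f z * g z) z"
  by (simp add: hol_at_def dz_mult)

lemma hol_at_diff_const: "hol_at f z \<Longrightarrow> hol_at (\<lambda>z. f z - c) z"
  using hol_at_add[OF _ hol_at_const[of "- c"], of f z] by simp

lemma hol_at_sum: "(\<And>i. i \<in> A \<Longrightarrow> hol_at (f i) z) \<Longrightarrow> hol_at (\<lambda>z. \<Sum>i\<in>A. f i z) z"
  by (induction A rule: infinite_finite_induct) (simp_all add: hol_at_const hol_at_add)

lemma hol_at_prod: "(\<And>i. i \<in> A \<Longrightarrow> hol_at (f i) z) \<Longrightarrow> hol_at (\<lambda>z. \<Prod>i\<in>A. f i z) z"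
  by (induction A rule: infinite_finite_induct) (simp_all add: hol_at_const hol_at_mult)

lemma hol_at_inverse:
  assumes "hol_at f z" "f z \<noteq> 0"
  shows "hol_at (\<lambda>z. inverse (f z)) z"
  by (rule hol_atI[OF Deriv.has_derivative_inverse[OF assms(2) hol_at_has_derivative[OF assms(1)]]])
     (simp add: sum_distrib_left mult_ac)

lemma hol_at_component: "hol_at (\<lambda>z. z $ i) z"
  by (rule hol_atI[OF bounded_linear_imp_has_derivative[OF bounded_linear_vec_nth]]) simp

lemma hol_at_compose:
  fixes T :: "complex^'n::finite \<Rightarrow> complex^'m::finite"
  assumes T: "\<And>a. hol_at (\<lambda>z. T z $ a) z" and u: "hol_at u (T z)"
  shows "hol_at (\<lambda>z. u (T z)) z"
  by (rule hol_atI[OF has_derivative_compose[OF hol_map_has_derivative[OF T] hol_at_has_derivative[OF u]]])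
     (simp add: sum_distrib_left sum_distrib_right mult_ac)

lemma hol_at_det:
  fixes A :: "complex^'m::finite \<Rightarrow> complex^'n::finite^'n"
  assumes "\<And>i j. hol_at (\<lambda>z. A z $ i $ j) z"
  shows "hol_at (\<lambda>z. det (A z)) z"
  unfolding det_def by (intro hol_at_sum hol_at_mult hol_at_const hol_at_prod assms)

lemma smooth_on_det:
  fixes A :: "'a::real_normed_vector \<Rightarrow> complex^'n::finite^'n"
  assumes "open S" "\<And>i j. smooth_on S (\<lambda>z. A z $ i $ j)"
  shows "smooth_on S (\<lambda>z. det (A z))"
  unfolding det_def by (intro smooth_on_sum smooth_on_mult smooth_on_const smooth_on_prod assms)

lemma hol_at_cong_open:
  assumes "open S" "z \<in> S" "\<And>y. y \<in> S \<Longrightarrow> f y = g y" "hol_at f z"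
  shows "hol_at g z"
  using hol_at_has_derivative[OF assms(4)] assms(1-3)
  by (intro hol_atI[OF has_derivative_transform_within_open[of f _ z UNIV S g]])
     (auto simp: sum_distrib_left mult_ac)

lemma smooth_on_half_comb:
  fixes f g :: "'a::real_normed_vector \<Rightarrow> complex"
  assumes "open S" "smooth_on S f" "smooth_on S g"
  shows "smooth_on S (\<lambda>z. (f z + c * g z) / 2)"
proof -
  have "smooth_on S (\<lambda>z. f z + c * g z)"
    by (intro smooth_on_add smooth_on_mult smooth_on_const assms)
  then show ?thesis
    by (rule smooth_on_linear_compose[where L = "\<lambda>x. x / 2", OF bounded_linear_divide assms(1)])
qed

lemma dz_half_comb:
  "dz j f = (\<lambda>y. (frechet_derivative f (at y) (axis j 1) + (- \<i>) * frechet_derivative f (at y) (axis j \<i>)) / 2)"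
  "dzbar j f = (\<lambda>y. (frechet_derivative f (at y) (axis j 1) + \<i> * frechet_derivative f (at y) (axis j \<i>)) / 2)"
  by (simp_all add: dz_def dzbar_def fun_eq_iff)

lemma smooth_on_dz:
  assumes "open S" "smooth_on S f"
  shows "smooth_on S (dz j f)" "smooth_on S (dzbar j f)"
  unfolding dz_half_comb
  by (intro smooth_on_half_comb smooth_on_frechet_derivative assms)+

lemma frechet_half_comb:
  fixes f g :: "'a::real_normed_vector \<Rightarrow> complex"
  assumes "f differentiable (at z)" "g differentiable (at z)"
  shows "frechet_derivative (\<lambda>z. (f z + c * g z) / 2) (at z) w =
    (frechet_derivative f (at z) w + c * frechet_derivative g (at z) w) / 2"
proof -
  have "((\<lambda>z. (f z + c * g z) / 2) has_derivative (\<lambda>w.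
    (frechet_derivative f (at z) w + c * frechet_derivative g (at z) w) / 2)) (at z)"
    using assms unfolding frechet_derivative_works
    by (intro bounded_linear.has_derivative[where f = "\<lambda>x. x / 2", OF bounded_linear_divide]
        has_derivative_add has_derivative_mult_right)
  from frechet_derivative_at[symmetric, OF this] show ?thesis by simp
qed

lemma wirtinger_commute:
  fixes f :: "complex^'m::finite \<Rightarrow> complex"
  assumes S: "open S" and f: "smooth_on S f" and z: "z \<in> S"
  shows "dz l (dz j f) z = dz j (dz l f) z" "dz l (dzbar j f) z = dzbar j (dz l f) z"
    "dzbar l (dzbar j f) z = dzbar j (dzbar l f) z"
proof -
  note c = second_derivatives_commute[OF S f z]
  have F: "frechet_derivative (\<lambda>y. (frechet_derivative f (at y) a + c * frechet_derivative f (at y) b) / 2) (at z) w =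
    (frechet_derivative (\<lambda>y. frechet_derivative f (at y) a) (at z) w +
      c * frechet_derivative (\<lambda>y. frechet_derivative f (at y) b) (at z) w) / 2" for a b c w
    by (intro frechet_half_comb smooth_on_differentiable[OF smooth_on_frechet_derivative[OF f] z])
  show "dz l (dz j f) z = dz j (dz l f) z" "dz l (dzbar j f) z = dzbar j (dz l f) z"
    "dzbar l (dzbar j f) z = dzbar j (dzbar l f) z"
    unfolding dz_half_comb F
    by (simp_all add: c[of "axis j 1" "axis l 1"] c[of "axis j \<i>" "axis l 1"] c[of "axis j 1" "axis l \<i>"]
        c[of "axis j \<i>" "axis l \<i>"] algebra_simps add_divide_distrib diff_divide_distrib)
qed

text \<open>Since \<open>T\<close> is holomorphic, no second derivatives of \<open>T\<close> survive: the Levi matrix transforms as a (1,1)-form.\<close>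
lemma levi_compose:
  fixes T :: "complex^'n::finite \<Rightarrow> complex^'m::finite"
  assumes S: "open S" and V: "open V" and TV: "T ` S \<subseteq> V" and z: "z \<in> S"
    and T: "\<And>a. hol_on S (\<lambda>z. T z $ a)" and u: "smooth_on V u"
  shows "dz j (dzbar k (\<lambda>z. u (T z))) z =
    (\<Sum>a\<in>UNIV. \<Sum>b\<in>UNIV. dz a (dzbar b u) (T z) * dz j (\<lambda>z. T z $ a) z * cnj (dz k (\<lambda>z. T z $ b) z))"
proof -
  have Th: "hol_at (\<lambda>z. T z $ a) y" if "y \<in> S" for a y using T that by (simp add: hol_on_iff)
  have dT: "hol_at (dz k (\<lambda>z. T z $ b)) z" for b
    using hol_on_dz[OF S T] z by (simp add: hol_on_iff)
  have TzV: "T y \<in> V" if "y \<in> S" for y using TV that by blast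
  have du: "dzbar b u differentiable (at (T z))" for b
    using smooth_on_differentiable[OF smooth_on_dz(2)[OF V u] TzV[OF z]] .
  have "dz j (dzbar k (\<lambda>z. u (T z))) z =
      dz j (\<lambda>y. \<Sum>b\<in>UNIV. dzbar b u (T y) * cnj (dz k (\<lambda>z. T z $ b) y)) z"
  proof (rule dz_cong_open[OF S z])
    show "dzbar k (\<lambda>z. u (T z)) y = (\<Sum>b\<in>UNIV. dzbar b u (T y) * cnj (dz k (\<lambda>z. T z $ b) y))" if "y \<in> S" for y
      by (rule dz_compose[OF Th[OF that] smooth_on_differentiable[OF u TzV[OF that]]])
  qed
  also have "\<dots> = (\<Sum>b\<in>UNIV. dz j (\<lambda>y. dzbar b u (T y) * cnj (dz k (\<lambda>z. T z $ b) y)) z)"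
  proof (rule dz_sum[THEN conjunct1])
    fix b
    have "(\<lambda>y. dzbar b u (T y)) differentiable (at z)"
      using differentiable_chain_at[of T z "dzbar b u"] hol_map_has_derivative[OF Th[OF z]] du
      by (auto simp: o_def differentiable_def)
    then show "(\<lambda>y. dzbar b u (T y) * cnj (dz k (\<lambda>z. T z $ b) y)) differentiable (at z)"
      by (intro differentiable_mult differentiable_cnj hol_at_differentiable[OF dT])
  qed simp
  also have "\<dots> = (\<Sum>b\<in>UNIV. \<Sum>a\<in>UNIV. dz a (dzbar b u) (T z) * dz j (\<lambda>z. T z $ a) z * cnj (dz k (\<lambda>z. T z $ b) z))"
  proof (rule sum.cong[OF refl])
    fix b
    have 1: "(\<lambda>y. dzbar b u (T y)) differentiable (at z)"
      using differentiable_chain_at[of T z "dzbar b u"] hol_map_has_derivative[OF Th[OF z]] du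
      by (auto simp: o_def differentiable_def)
    have 2: "(\<lambda>y. cnj (dz k (\<lambda>z. T z $ b) y)) differentiable (at z)"
      by (intro differentiable_cnj hol_at_differentiable[OF dT])
    have 3: "dz j (\<lambda>y. cnj (dz k (\<lambda>z. T z $ b) y)) z = 0"
      using dz_cnj(1)[OF hol_at_differentiable[OF dT]] dT by (simp add: hol_at_def)
    show "dz j (\<lambda>y. dzbar b u (T y) * cnj (dz k (\<lambda>z. T z $ b) y)) z =
      (\<Sum>a\<in>UNIV. dz a (dzbar b u) (T z) * dz j (\<lambda>z. T z $ a) z * cnj (dz k (\<lambda>z. T z $ b) z))"
      using dz_mult(1)[OF 1 2, of j] dz_compose(1)[OF Th[OF z] du, of j]
      by (simp add: 3 sum_distrib_left mult_ac)
  qed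
  also have "\<dots> = (\<Sum>a\<in>UNIV. \<Sum>b\<in>UNIV. dz a (dzbar b u) (T z) * dz j (\<lambda>z. T z $ a) z * cnj (dz k (\<lambda>z. T z $ b) z))"
    by (rule sum.swap)
  finally show ?thesis .
qed

lemma smooth_on_of_real:
  "open S \<Longrightarrow> smooth_on S f \<Longrightarrow> smooth_on S (\<lambda>x. complex_of_real (f x))"
  by (rule smooth_on_linear_compose[OF bounded_linear_of_real])

lemma smooth_on_cmod2:
  fixes g :: "'a::real_normed_vector \<Rightarrow> complex"
  assumes "open S" "smooth_on S g"
  shows "smooth_on S (\<lambda>z. (cmod (g z))\<^sup>2)"
  unfolding cmod_power2
  unfolding power2_eq_square
  by (intro smooth_on_add smooth_on_mult smooth_on_linear_compose[OF bounded_linear_Re]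
       smooth_on_linear_compose[OF bounded_linear_Im] assms)

text \<open>\<open>dzbar k (ln (g * cnj g))\<close> is the conjugate of the holomorphic function \<open>dz k g / g\<close>, so it is annihilated by \<open>dz j\<close>.
  Hence a change of trivialization does not affect the curvature of a metric on a line bundle.\<close>
lemma ln_cmod2_pluriharmonic:
  assumes S: "open S" and z: "z \<in> S" and g: "hol_on S g" and nz: "\<And>z. z \<in> S \<Longrightarrow> g z \<noteq> 0"
  shows "dz j (dzbar k (\<lambda>z. complex_of_real (ln ((cmod (g z))\<^sup>2)))) z = 0"
proof -
  have gh: "hol_at g y" if "y \<in> S" for y using g that by (simp add: hol_on_iff)
  have gs: "smooth_on S (\<lambda>z. (cmod (g z))\<^sup>2)"
    by (intro smooth_on_cmod2 S hol_on_smooth g)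
  define q where "q y = dz k g y * inverse (g y)" for y
  have hq: "hol_at q z"
    unfolding q_def using hol_on_dz[OF S g] gh nz z
    by (intro hol_at_mult hol_at_inverse) (auto simp: hol_on_iff)
  have "dzbar k (\<lambda>z. complex_of_real (ln ((cmod (g z))\<^sup>2))) y = cnj (q y)" if y: "y \<in> S" for y
  proof -
    have sq: "(\<lambda>z. complex_of_real ((cmod (g z))\<^sup>2)) = (\<lambda>z. g z * cnj (g z))"
      by (simp add: complex_norm_square fun_eq_iff del: of_real_power)
    have "dzbar k (\<lambda>z. complex_of_real (ln ((cmod (g z))\<^sup>2))) y =
        of_real (1 / (cmod (g y))\<^sup>2) * dzbar k (\<lambda>z. complex_of_real ((cmod (g z))\<^sup>2)) y"
      using nz[OF y] by (intro dz_real_chain smooth_on_differentiable[OF gs y] DERIV_ln_divide) simp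
    also have "dzbar k (\<lambda>z. complex_of_real ((cmod (g z))\<^sup>2)) y = g y * cnj (dz k g y)"
      unfolding sq using dz_mult(2)[OF hol_at_differentiable[OF gh[OF y]] differentiable_cnj[OF hol_at_differentiable[OF gh[OF y]]], of k]
        dz_cnj(2)[OF hol_at_differentiable[OF gh[OF y]], of k] gh[OF y] by (simp add: hol_at_def)
    also have "complex_of_real (1 / (cmod (g y))\<^sup>2) = 1 / (g y * cnj (g y))"
      by (simp add: complex_norm_square flip: of_real_power)
    finally show ?thesis using nz[OF y] by (simp add: q_def field_simps)
  qed
  then have "dz j (dzbar k (\<lambda>z. complex_of_real (ln ((cmod (g z))\<^sup>2)))) z = dz j (\<lambda>y. cnj (q y)) z"
    by (rule dz_cong_open[OF S z])
  also have "\<dots> = 0"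
    using dz_cnj(1)[OF hol_at_differentiable[OF hq]] hq by (simp add: hol_at_def)
  finally show ?thesis .
qed

section \<open>Charts and transition maps\<close>

lemma cproj_nth [simp]: "cproj I z $ i = (if i \<in> I then z $ i else 0)"
  by (simp add: cproj_def)

lemma cproj_in_coords [simp]: "cproj I z \<in> coords I"
  by (simp add: coords_def)

lemma cproj_coords: "z \<in> coords I \<Longrightarrow> cproj I z = z"
  by (auto simp: vec_eq_iff coords_def)

lemma cproj_idem [simp]: "cproj I (cproj I z) = cproj I z"
  by (simp add: cproj_coords)

lemma cproj_cproj_subset: "J \<subseteq> I \<Longrightarrow> cproj I (cproj J z) = cproj J z"
  by (auto simp: vec_eq_iff)

lemma norm_cproj_le: "norm (cproj I z) \<le> norm z"
  unfolding norm_vec_def by (intro L2_set_mono) auto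

lemma bounded_linear_cproj: "bounded_linear (cproj I)"
  by (rule bounded_linear_intro[where K = 1]) (auto simp: vec_eq_iff norm_cproj_le)

lemma continuous_cproj: "continuous_on S (cproj I)"
  by (rule linear_continuous_on[OF bounded_linear_cproj])

lemma dz_component:
  fixes z :: "complex^'m::finite"
  shows "dz j (\<lambda>z. z $ a) z = (if a = j then 1 else 0)"
proof -
  have "frechet_derivative (\<lambda>z::complex^'m. z $ a) (at z) = (\<lambda>z::complex^'m. z $ a)"
    using frechet_derivative_at[OF bounded_linear_imp_has_derivative[OF bounded_linear_vec_nth[of a]]] by metis
  then show ?thesis by (simp add: dz_def axis_def)
qed

lemma hol_at_cproj: "hol_at (\<lambda>z. cproj I z $ a) z"
  by (cases "a \<in> I") (simp_all add: hol_at_component hol_at_const)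

lemma dz_cproj: "dz j (\<lambda>z. cproj I z $ a) z = (if a = j \<and> j \<in> I then 1 else 0)"
  by (cases "a \<in> I") (auto simp: dz_component dz_const)

lemma dz_compose_cproj:
  assumes "u differentiable (at (cproj I z))"
  shows "dz j (\<lambda>z. u (cproj I z)) z = (if j \<in> I then dz j u (cproj I z) else 0)"
    "dzbar j (\<lambda>z. u (cproj I z)) z = (if j \<in> I then dzbar j u (cproj I z) else 0)"
  unfolding dz_compose[OF hol_at_cproj assms] dz_cproj
  by (simp_all add: if_distrib[of cnj] if_distrib[of "(*) _"] sum.If_cases cong: if_cong)

definition chart_inv :: "('a, 'm::finite) cmanifold \<Rightarrow> ('a, 'm) chart \<Rightarrow> complex^'m \<Rightarrow> 'a" where
  "chart_inv M c z = inv_into (fst c) (snd c) (cproj (midx M) z)"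

text \<open>Padded by the identity in the coordinates that are not used, so that \<open>jacobian\<close> is the full matrix of its derivatives.\<close>
definition transition :: "('a, 'm::finite) cmanifold \<Rightarrow> ('a, 'm) chart \<Rightarrow> ('a, 'm) chart \<Rightarrow> complex^'m \<Rightarrow> complex^'m" where
  "transition M c d z = (\<chi> i. if i \<in> midx M then snd d (chart_inv M c z) $ i else z $ i)"

lemma coord_fun_par: "coord_fun M c f z = f (chart_inv M c z)"
  by (simp add: coord_fun_def chart_inv_def)

lemma par_cproj [simp]: "chart_inv M c (cproj (midx M) z) = chart_inv M c z"
  by (simp add: chart_inv_def)

lemma coord_dom_cproj: "cproj (midx M) z \<in> coord_dom M c V \<longleftrightarrow> z \<in> coord_dom M c V"
  by (simp add: coord_dom_def)

lemma par_dom: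
  assumes "z \<in> coord_dom M c V"
  shows "chart_inv M c z \<in> fst c" "snd c (chart_inv M c z) = cproj (midx M) z"
proof -
  have "cproj (midx M) z \<in> snd c ` fst c"
    using assms by (auto simp: coord_dom_def)
  then show "chart_inv M c z \<in> fst c" "snd c (chart_inv M c z) = cproj (midx M) z"
    unfolding chart_inv_def by (auto intro: inv_into_into f_inv_into_f)
qed

lemma is_chart_subset: "is_chart M c \<Longrightarrow> fst c \<subseteq> topspace (mtop M)"
  by (auto simp: is_chart_def dest: openin_subset)

lemma is_chart_inj: "is_chart M c \<Longrightarrow> inj_on (snd c) (fst c)"
  using is_chart_subset[of M c] homeomorphic_imp_injective_map[of "subtopology (mtop M) (fst c)" _ "snd c"]
  by (auto simp: is_chart_def Int_absorb1)

lemma is_chart_coords: "is_chart M c \<Longrightarrow> x \<in> fst c \<Longrightarrow> snd c x \<in> coords (midx M)"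
  unfolding is_chart_def by (metis image_eqI openin_imp_subset subsetD)

lemma par_chart: "inj_on (snd c) (fst c) \<Longrightarrow> snd c x \<in> coords (midx M) \<Longrightarrow> x \<in> fst c \<Longrightarrow> chart_inv M c (snd c x) = x"
  by (simp add: chart_inv_def cproj_coords)

lemma coord_dom_chart:
  assumes "inj_on (snd c) (fst c)" "snd c x \<in> coords (midx M)" "x \<in> fst c"
  shows "snd c x \<in> coord_dom M c V \<longleftrightarrow> x \<in> V"
  using assms by (auto simp: coord_dom_def cproj_coords inj_on_def)

lemma coord_dom_par:
  assumes "inj_on (snd c) (fst c)"
  shows "z \<in> coord_dom M c V \<longleftrightarrow> z \<in> coord_dom M c (fst c) \<and> chart_inv M c z \<in> V"
  using assms by (auto simp: coord_dom_def chart_inv_def)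

lemma coord_dom_subset: "coord_dom M c V \<subseteq> coord_dom M c (fst c)"
  by (auto simp: coord_dom_def)

lemma coord_dom_mono: "V \<subseteq> W \<Longrightarrow> coord_dom M c V \<subseteq> coord_dom M c W"
  by (auto simp: coord_dom_def)

lemma is_chart_open_vimage:
  assumes c: "is_chart M c" and W: "open W"
  shows "openin (mtop M) {x \<in> fst c. snd c x \<in> W}"
proof -
  have "continuous_map (subtopology (mtop M) (fst c)) (top_of_set (snd c ` fst c)) (snd c)"
    using c by (auto simp: is_chart_def homeomorphic_imp_continuous_map)
  then have "continuous_map (subtopology (mtop M) (fst c)) euclidean (snd c)"
    using continuous_map_in_subtopology by blast
  then have "openin (subtopology (mtop M) (fst c))
      {x \<in> topspace (subtopology (mtop M) (fst c)). snd c x \<in> W}"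
    using W openin_continuous_map_preimage open_openin by blast
  moreover have "topspace (subtopology (mtop M) (fst c)) = fst c"
    using is_chart_subset[OF c] by auto
  ultimately have "openin (subtopology (mtop M) (fst c)) {x \<in> fst c. snd c x \<in> W}"
    by (simp only:)
  then show ?thesis
    using c openin_trans_full unfolding is_chart_def by blast
qed

lemma open_coord_dom:
  assumes c: "is_chart M c" and V: "openin (mtop M) V"
  shows "open (coord_dom M c V)"
proof -
  have h: "homeomorphic_map (subtopology (mtop M) (fst c)) (top_of_set (snd c ` fst c)) (snd c)"
    and o: "openin (top_of_set (coords (midx M))) (snd c ` fst c)"
    using c by (auto simp: is_chart_def)
  have "openin (subtopology (mtop M) (fst c)) (fst c \<inter> V)"
    using V by (auto simp: openin_subtopology)
  then have "openin (top_of_set (snd c ` fst c)) (snd c ` (fst c \<inter> V))"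
    using h homeomorphic_imp_open_map open_map_def by blast
  then have "openin (top_of_set (coords (midx M))) (snd c ` (fst c \<inter> V))"
    using o openin_trans by blast
  then obtain T where T: "open T" "snd c ` (fst c \<inter> V) = coords (midx M) \<inter> T"
    by (auto simp: openin_open)
  have "coord_dom M c V = cproj (midx M) -` T"
    unfolding coord_dom_def T(2) by auto
  then show ?thesis
    using open_vimage[OF T(1) continuous_cproj] by simp
qed

locale cx_manifold =
  fixes M :: "('a, 'm::finite) cmanifold"
  assumes manifold: "complex_manifold M"
begin

lemma atlas_chart: "c \<in> atlas M \<Longrightarrow> is_chart M c"
  using manifold by (simp add: complex_manifold_def)

lemma atlas_maximal: "c \<in> atlas M \<Longrightarrow> c \<in> maximal_atlas M"
  using manifold by (auto simp: complex_manifold_def maximal_atlas_def)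

lemma max_chart: "c \<in> maximal_atlas M \<Longrightarrow> is_chart M c"
  by (simp add: maximal_atlas_def)

lemma max_inj: "c \<in> maximal_atlas M \<Longrightarrow> inj_on (snd c) (fst c)"
  by (rule is_chart_inj[OF max_chart])

lemma max_coords: "c \<in> maximal_atlas M \<Longrightarrow> x \<in> fst c \<Longrightarrow> snd c x \<in> coords (midx M)"
  by (rule is_chart_coords[OF max_chart])

lemma max_openin: "c \<in> maximal_atlas M \<Longrightarrow> openin (mtop M) (fst c)"
  using max_chart[of c] by (simp add: is_chart_def)

lemma max_par: "c \<in> maximal_atlas M \<Longrightarrow> x \<in> fst c \<Longrightarrow> chart_inv M c (snd c x) = x"
  by (simp add: par_chart max_inj max_coords)

lemma max_coord_dom: "c \<in> maximal_atlas M \<Longrightarrow> x \<in> fst c \<Longrightarrow> snd c x \<in> coord_dom M c V \<longleftrightarrow> x \<in> V"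
  by (simp add: coord_dom_chart max_inj max_coords)

lemma max_open_coord_dom: "c \<in> maximal_atlas M \<Longrightarrow> openin (mtop M) V \<Longrightarrow> open (coord_dom M c V)"
  by (simp add: open_coord_dom max_chart)

lemma max_coord_dom_par:
  "c \<in> maximal_atlas M \<Longrightarrow> z \<in> coord_dom M c V \<longleftrightarrow> z \<in> coord_dom M c (fst c) \<and> chart_inv M c z \<in> V"
  by (rule coord_dom_par[OF max_inj])

lemma max_parD:
  "c \<in> maximal_atlas M \<Longrightarrow> z \<in> coord_dom M c V \<Longrightarrow> chart_inv M c z \<in> V"
  using max_coord_dom_par[of c z V] by blast

lemma point_in_chart: "x \<in> topspace (mtop M) \<Longrightarrow> \<exists>c\<in>atlas M. x \<in> fst c"
  using manifold by (auto simp: complex_manifold_def)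

lemma trans_point:
  assumes "c \<in> maximal_atlas M" "d \<in> maximal_atlas M" "x \<in> fst c" "x \<in> fst d"
  shows "transition M c d (snd c x) = snd d x"
  using assms max_coords[of c x] max_coords[of d x]
  by (auto simp: transition_def vec_eq_iff max_par coords_def)

lemma trans_cproj:
  assumes d: "d \<in> maximal_atlas M" and z: "z \<in> coord_dom M c (fst d)" and c: "c \<in> maximal_atlas M"
  shows "cproj (midx M) (transition M c d z) = snd d (chart_inv M c z)"
proof -
  have "chart_inv M c z \<in> fst d" by (rule max_parD[OF c z])
  then have "snd d (chart_inv M c z) \<in> coords (midx M)" using d max_coords by blast
  then show ?thesis by (auto simp: transition_def vec_eq_iff coords_def)
qed

lemma trans_par:
  assumes "c \<in> maximal_atlas M" "d \<in> maximal_atlas M" and z: "z \<in> coord_dom M c (fst d)"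
  shows "chart_inv M d (transition M c d z) = chart_inv M c z"
proof -
  have "chart_inv M c z \<in> fst d" by (rule max_parD[OF assms(1) z])
  then have "chart_inv M d (cproj (midx M) (transition M c d z)) = chart_inv M c z"
    unfolding trans_cproj[OF assms(2) z assms(1)] by (rule max_par[OF assms(2)])
  then show ?thesis by simp
qed

lemma trans_coord_dom:
  assumes "c \<in> maximal_atlas M" "d \<in> maximal_atlas M" "V \<subseteq> fst d" and z: "z \<in> coord_dom M c V"
  shows "transition M c d z \<in> coord_dom M d V"
proof -
  have z': "z \<in> coord_dom M c (fst d)" using z assms(3) coord_dom_mono by blast
  have V: "chart_inv M c z \<in> V" by (rule max_parD[OF assms(1) z])
  then have "snd d (chart_inv M c z) \<in> coord_dom M d V" using max_coord_dom[OF assms(2)] assms(3) by blast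
  then have "cproj (midx M) (transition M c d z) \<in> coord_dom M d V"
    unfolding trans_cproj[OF assms(2) z' assms(1)] .
  then show ?thesis unfolding coord_dom_cproj .
qed

lemma trans_hol_atlas:
  assumes "hol_transition M c d" "z \<in> coord_dom M c (fst d)"
  shows "hol_at (\<lambda>z. transition M c d z $ i) z"
proof (cases "i \<in> midx M")
  case True
  then have "hol_at (coord_fun M c (\<lambda>x. snd d x $ i)) z"
    using assms by (simp add: hol_transition_def hol_on_iff)
  with True show ?thesis by (simp add: transition_def coord_fun_par[abs_def])
qed (simp add: transition_def hol_at_component)

text \<open>Two charts of the maximal atlas are compared through a chart of the atlas around the point in question.\<close>
lemma trans_hol:
  assumes c: "c \<in> maximal_atlas M" and d: "d \<in> maximal_atlas M" and z: "z \<in> coord_dom M c (fst d)"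
  shows "hol_at (\<lambda>z. transition M c d z $ i) z"
proof -
  define x where "x = chart_inv M c z"
  have x: "x \<in> fst c" "x \<in> fst d"
    using par_dom(1)[OF z] max_parD[OF c z] unfolding x_def by blast+
  obtain e where e: "e \<in> atlas M" "x \<in> fst e"
    using point_in_chart x(1) is_chart_subset[OF max_chart[OF c]] by blast
  have eM: "e \<in> maximal_atlas M" using e atlas_maximal by blast
  have tr: "hol_transition M c e" "hol_transition M e d"
    using c d e by (auto simp: maximal_atlas_def)
  let ?S = "coord_dom M c (fst d \<inter> fst e)"
  have S: "open ?S" using max_open_coord_dom[OF c] max_openin d eM by blast
  have zS: "z \<in> ?S" using z x e max_coord_dom_par[OF c, of z "fst d \<inter> fst e"] max_coord_dom_par[OF c, of z "fst d"] x_def by simp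
  have sub: "y \<in> coord_dom M c (fst e)" if "y \<in> ?S" for y
    using that coord_dom_mono[of "fst d \<inter> fst e" "fst e" M c] by blast
  have te: "transition M c e y \<in> coord_dom M e (fst d)" if "y \<in> ?S" for y
    using trans_coord_dom[OF c eM Int_lower2 that] coord_dom_mono[of "fst d \<inter> fst e" "fst d" M e] by blast
  have "hol_at (\<lambda>y. transition M e d (transition M c e y) $ i) z"
    by (rule hol_at_compose[where u = "\<lambda>w. transition M e d w $ i",
          OF trans_hol_atlas[OF tr(1) sub[OF zS]] trans_hol_atlas[OF tr(2) te[OF zS]]])
  moreover have "transition M e d (transition M c e y) $ i = transition M c d y $ i" if "y \<in> ?S" for y
    using trans_par[OF c eM sub[OF that]] by (simp add: transition_def)
  ultimately show ?thesis by (rule hol_at_cong_open[OF S zS, rotated])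
qed

lemma coord_fun_trans:
  assumes "c \<in> maximal_atlas M" "d \<in> maximal_atlas M" "z \<in> coord_dom M c (fst d)"
  shows "coord_fun M c f z = coord_fun M d f (transition M c d z)"
  using trans_par[OF assms] by (simp add: coord_fun_par)

lemma jacobian_trans:
  assumes c: "c \<in> maximal_atlas M" and d: "d \<in> maximal_atlas M" and x: "x \<in> fst c" "x \<in> fst d"
  shows "jacobian M c d x $ i $ j = dz j (\<lambda>z. transition M c d z $ i) (snd c x)"
proof (cases "i \<in> midx M")
  case False
  then show ?thesis by (simp add: jacobian_def transition_def dz_component)
next
  case i: True
  have xd: "snd c x \<in> coord_dom M c (fst d)" using max_coord_dom[OF c x(1)] x by simp
  let ?f = "\<lambda>z. snd d (chart_inv M c z) $ i"
  have f: "hol_at ?f (snd c x)"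
    using trans_hol[OF c d xd, of i] i by (simp add: transition_def)
  show ?thesis
  proof (cases "j \<in> midx M")
    case True
    then show ?thesis using i by (simp add: jacobian_def transition_def coord_fun_par[abs_def])
  next
    case False
    have p: "cproj (midx M) (snd c x) = snd c x"
      using cproj_coords max_coords[OF c x(1)] by blast
    have "dz j (\<lambda>z. ?f (cproj (midx M) z)) (snd c x) = 0"
      using dz_compose_cproj(1)[of ?f "midx M" "snd c x" j] False hol_at_differentiable[OF f] p by simp
    then have "dz j ?f (snd c x) = 0" by simp
    moreover have "i \<noteq> j" using i False by blast
    ultimately show ?thesis using i False by (simp add: jacobian_def transition_def)
  qed
qed

lemma jacobian_chain:
  assumes c: "c \<in> maximal_atlas M" and d: "d \<in> maximal_atlas M" and e: "e \<in> maximal_atlas M"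
    and x: "x \<in> fst c" "x \<in> fst d" "x \<in> fst e"
  shows "jacobian M c e x = jacobian M d e x ** jacobian M c d x"
proof -
  let ?S = "coord_dom M c (fst d \<inter> fst e)"
  have S: "open ?S" using max_open_coord_dom[OF c] max_openin d e by blast
  have zS: "snd c x \<in> ?S" using x max_coord_dom[OF c] by simp
  have sub: "y \<in> coord_dom M c (fst d)" if "y \<in> ?S" for y
    using that coord_dom_mono[of "fst d \<inter> fst e" "fst d" M c] by blast
  have xe: "snd d x \<in> coord_dom M d (fst e)" using x max_coord_dom[OF d] by simp
  have "jacobian M c e x $ i $ j = (\<Sum>k\<in>UNIV. jacobian M d e x $ i $ k * jacobian M c d x $ k $ j)" for i j
  proof -
    have "dz j (\<lambda>z. transition M c e z $ i) (snd c x) = dz j (\<lambda>z. transition M d e (transition M c d z) $ i) (snd c x)"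
      by (rule dz_cong_open[OF S zS])
         (use trans_par[OF c d sub] in \<open>simp add: transition_def\<close>)
    also have "\<dots> = (\<Sum>k\<in>UNIV. dz k (\<lambda>z. transition M d e z $ i) (transition M c d (snd c x)) * dz j (\<lambda>z. transition M c d z $ k) (snd c x))"
      using trans_hol[OF c d sub[OF zS]] hol_at_differentiable[OF trans_hol[OF d e xe]] trans_point[OF c d x(1,2)]
      by (intro dz_compose(1)[where u = "\<lambda>z. transition M d e z $ i"]) auto
    finally show ?thesis
      using jacobian_trans[OF c e x(1,3)] jacobian_trans[OF d e x(2,3)] jacobian_trans[OF c d x(1,2)] trans_point[OF c d x(1,2)]
      by simp
  qed
  then show ?thesis by (simp add: matrix_matrix_mult_def vec_eq_iff)
qed

lemma jacobian_self:
  assumes c: "c \<in> maximal_atlas M" and x: "x \<in> fst c"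
  shows "jacobian M c c x = mat 1"
proof -
  have xd: "snd c x \<in> coord_dom M c (fst c)" using max_coord_dom[OF c x] x by simp
  have "dz j (\<lambda>z. transition M c c z $ i) (snd c x) = dz j (\<lambda>z. z $ i) (snd c x)" for i j
    by (rule dz_cong_open[OF max_open_coord_dom[OF c max_openin[OF c]] xd])
       (simp add: transition_def par_dom)
  then show ?thesis
    using jacobian_trans[OF c c x x] by (simp add: vec_eq_iff mat_def dz_component)
qed

lemma det_jacobian_nonzero:
  assumes c: "c \<in> maximal_atlas M" and d: "d \<in> maximal_atlas M" and x: "x \<in> fst c" "x \<in> fst d"
  shows "det (jacobian M c d x) \<noteq> 0"
proof
  assume "det (jacobian M c d x) = 0"
  then have "det (jacobian M d c x ** jacobian M c d x) = 0" by (simp add: det_mul)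
  then show False
    using jacobian_chain[OF c d c x(1,2,1)] jacobian_self[OF c x(1)] by (metis det_I one_neq_zero)
qed

end

lemma smooth_on_vec:
  fixes T :: "'a::real_normed_vector \<Rightarrow> complex^'m::finite"
  assumes "open S" "\<And>a. smooth_on S (\<lambda>z. T z $ a)"
  shows "smooth_on S T"
proof -
  have "T = (\<lambda>z. \<Sum>a\<in>UNIV. (T z $ a) *s axis a 1)"
    by (simp add: fun_eq_iff basis_expansion)
  moreover have "smooth_on S (\<lambda>z. \<Sum>a\<in>UNIV. (T z $ a) *s axis a 1)"
    by (intro smooth_on_sum smooth_on_linear_compose[OF bounded_linear_cscale] assms)
  ultimately show ?thesis by simp
qed

context cx_manifold
begin

lemma trans_smooth:
  assumes c: "c \<in> maximal_atlas M" and d: "d \<in> maximal_atlas M"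
  shows "smooth_on (coord_dom M c (fst d)) (transition M c d)"
  by (intro smooth_on_vec hol_on_smooth max_open_coord_dom c max_openin d)
     (simp add: hol_on_iff trans_hol[OF c d])

lemma smooth_transfer:
  assumes c: "c \<in> maximal_atlas M" and d: "d \<in> maximal_atlas M"
    and W: "openin (mtop M) W" "W \<subseteq> fst d" and f: "smooth_on (coord_dom M d W) (coord_fun M d f)"
  shows "smooth_on (coord_dom M c W) (coord_fun M c f)"
proof -
  have S: "open (coord_dom M c W)" by (rule max_open_coord_dom[OF c W(1)])
  have sub: "coord_dom M c W \<subseteq> coord_dom M c (fst d)" using W(2) coord_dom_mono by blast
  have "smooth_on (coord_dom M c W) (\<lambda>z. coord_fun M d f (transition M c d z))"
    using trans_coord_dom[OF c d W(2)]
    by (intro smooth_on_compose[OF S max_open_coord_dom[OF d W(1)] _ smooth_on_subset[OF trans_smooth[OF c d] sub] f]) auto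
  then show ?thesis
    using smooth_on_cong[OF S, of "coord_fun M c f" "\<lambda>z. coord_fun M d f (transition M c d z)"]
      coord_fun_trans[OF c d] sub by blast
qed

text \<open>Smoothness may be tested in any charts of the maximal atlas; adapted charts of a family are in general not in the atlas.\<close>
lemma smooth_fun_on_local:
  assumes V: "openin (mtop M) V"
    and f: "\<And>x. x \<in> V \<Longrightarrow> \<exists>d W. d \<in> maximal_atlas M \<and> openin (mtop M) W \<and> x \<in> W \<and> W \<subseteq> fst d \<and>
       smooth_on (coord_dom M d W) (coord_fun M d f)"
    and c: "c \<in> maximal_atlas M"
  shows "smooth_on (coord_dom M c V) (coord_fun M c f)"
proof (rule smooth_on_local)
  fix z assume z: "z \<in> coord_dom M c V"
  then have "chart_inv M c z \<in> V" by (rule max_parD[OF c])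
  then obtain d W where d: "d \<in> maximal_atlas M" "openin (mtop M) W" "chart_inv M c z \<in> W" "W \<subseteq> fst d"
       "smooth_on (coord_dom M d W) (coord_fun M d f)" using f by blast
  have "z \<in> coord_dom M c W"
    using z d(3) max_coord_dom_par[OF c, of z V] max_coord_dom_par[OF c, of z W] by blast
  then show "\<exists>T. open T \<and> z \<in> T \<and> smooth_on T (coord_fun M c f)"
    using smooth_transfer[OF c d(1,2,4,5)] max_open_coord_dom[OF c d(2)] by blast
qed

lemma smooth_fun_onI:
  assumes V: "openin (mtop M) V"
    and f: "\<And>x. x \<in> V \<Longrightarrow> \<exists>d W. d \<in> maximal_atlas M \<and> openin (mtop M) W \<and> x \<in> W \<and> W \<subseteq> fst d \<and>
       smooth_on (coord_dom M d W) (coord_fun M d f)"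
  shows "smooth_fun_on M V f"
  unfolding smooth_fun_on_def using smooth_fun_on_local[OF V f] atlas_maximal by blast

lemma smooth_fun_on_max:
  assumes V: "openin (mtop M) V" and f: "smooth_fun_on M V f" and c: "c \<in> maximal_atlas M"
  shows "smooth_on (coord_dom M c V) (coord_fun M c f)"
proof (rule smooth_fun_on_local[OF V _ c])
  fix x assume x: "x \<in> V"
  obtain d where d: "d \<in> atlas M" "x \<in> fst d"
    using point_in_chart x V openin_subset by blast
  have "smooth_on (coord_dom M d (V \<inter> fst d)) (coord_fun M d f)"
    using f d coord_dom_mono[of "V \<inter> fst d" V M d] by (auto simp: smooth_fun_on_def intro: smooth_on_subset)
  then show "\<exists>d W. d \<in> maximal_atlas M \<and> openin (mtop M) W \<and> x \<in> W \<and> W \<subseteq> fst d \<and>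
       smooth_on (coord_dom M d W) (coord_fun M d f)"
    using d atlas_maximal V x openin_Int[OF V max_openin[OF atlas_maximal[OF d(1)]]] by (intro exI[of _ d] exI[of _ "V \<inter> fst d"]) auto
qed

lemma smooth_fun_on_openin_cover:
  assumes V: "openin (mtop M) V"
    and f: "\<And>x. x \<in> V \<Longrightarrow> \<exists>W. openin (mtop M) W \<and> x \<in> W \<and> smooth_fun_on M W f"
  shows "smooth_fun_on M V f"
proof (rule smooth_fun_onI[OF V])
  fix x assume x: "x \<in> V"
  obtain W where W: "openin (mtop M) W" "x \<in> W" "smooth_fun_on M W f" using f x by blast
  obtain d where d: "d \<in> atlas M" "x \<in> fst d"
    using point_in_chart x V openin_subset by blast
  have "smooth_on (coord_dom M d (W \<inter> fst d)) (coord_fun M d f)"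
    using W d coord_dom_mono[of "W \<inter> fst d" W M d] by (auto simp: smooth_fun_on_def intro: smooth_on_subset)
  then show "\<exists>d W. d \<in> maximal_atlas M \<and> openin (mtop M) W \<and> x \<in> W \<and> W \<subseteq> fst d \<and>
       smooth_on (coord_dom M d W) (coord_fun M d f)"
    using d atlas_maximal W x openin_Int[OF W(1) max_openin[OF atlas_maximal[OF d(1)]]] by (intro exI[of _ d] exI[of _ "W \<inter> fst d"]) auto
qed

lemma smooth_fun_on_subset: "smooth_fun_on M V f \<Longrightarrow> W \<subseteq> V \<Longrightarrow> smooth_fun_on M W f"
  unfolding smooth_fun_on_def using smooth_on_subset coord_dom_mono by blast

lemma smooth_fun_on_cong:
  assumes V: "openin (mtop M) V" and "\<And>x. x \<in> V \<Longrightarrow> f x = g x" "smooth_fun_on M V f"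
  shows "smooth_fun_on M V g"
  unfolding smooth_fun_on_def
proof
  fix c assume c: "c \<in> atlas M"
  have "coord_fun M c f z = coord_fun M c g z" if "z \<in> coord_dom M c V" for z
    using assms(2)[OF max_parD[OF atlas_maximal[OF c] that]] by (simp add: coord_fun_par)
  then show "smooth_on (coord_dom M c V) (coord_fun M c g)"
    using smooth_on_cong[OF max_open_coord_dom[OF atlas_maximal[OF c] V]] assms(3) c
    unfolding smooth_fun_on_def by blast
qed

lemma levi_transfer:
  assumes c: "c \<in> maximal_atlas M" and d: "d \<in> maximal_atlas M" and x: "x \<in> fst c" "x \<in> fst d"
    and V: "openin (mtop M) V" "x \<in> V" and f: "smooth_fun_on M V f"
  shows "i_ddbar M f c x $ j $ k =
    (\<Sum>a\<in>UNIV. \<Sum>b\<in>UNIV. i_ddbar M f d x $ a $ b * jacobian M c d x $ a $ j * cnj (jacobian M c d x $ b $ k))"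
proof -
  let ?W = "V \<inter> fst d" and ?u = "coord_fun M d (\<lambda>y. complex_of_real (f y))"
  have W: "openin (mtop M) ?W" using V max_openin[OF d] by blast
  have S: "open (coord_dom M c ?W)" by (rule max_open_coord_dom[OF c W])
  have xS: "snd c x \<in> coord_dom M c ?W" using x V max_coord_dom[OF c] by simp
  have oV: "open (coord_dom M d V)" by (rule max_open_coord_dom[OF d V(1)])
  have u: "smooth_on (coord_dom M d V) ?u"
    using smooth_on_of_real[OF oV smooth_fun_on_max[OF V(1) f d]] by (simp add: coord_fun_def)
  have sub: "coord_dom M c ?W \<subseteq> coord_dom M c (fst d)" by (rule coord_dom_mono) auto
  have im: "transition M c d ` coord_dom M c ?W \<subseteq> coord_dom M d V"
    using trans_coord_dom[OF c d, of ?W] coord_dom_mono[of ?W V M d] by blast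
  have T: "hol_on (coord_dom M c ?W) (\<lambda>z. transition M c d z $ a)" for a
    using trans_hol[OF c d] sub by (auto simp: hol_on_iff)
  have "dz j (dzbar k (coord_fun M c (\<lambda>y. complex_of_real (f y)))) (snd c x) =
      dz j (dzbar k (\<lambda>z. ?u (transition M c d z))) (snd c x)"
  proof (rule dz_cong_open[OF S xS])
    fix y assume y: "y \<in> coord_dom M c ?W"
    show "dzbar k (coord_fun M c (\<lambda>y. complex_of_real (f y))) y = dzbar k (\<lambda>z. ?u (transition M c d z)) y"
      by (rule dz_cong_open[OF S y]) (use coord_fun_trans[OF c d] sub in blast)
  qed
  also have "\<dots> = (\<Sum>a\<in>UNIV. \<Sum>b\<in>UNIV. dz a (dzbar b ?u) (transition M c d (snd c x)) *
      dz j (\<lambda>z. transition M c d z $ a) (snd c x) * cnj (dz k (\<lambda>z. transition M c d z $ b) (snd c x)))"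
    by (rule levi_compose[OF S oV im xS T u])
  finally show ?thesis
    by (simp add: i_ddbar_def trans_point[OF c d x] jacobian_trans[OF c d x])
qed

end

section \<open>Hermitian forms and the metric on the canonical bundle\<close>

text \<open>The determinant of this matrix is that of the block with indices in \<open>I\<close>.\<close>
definition padded :: "'m::finite set \<Rightarrow> complex^'m^'m \<Rightarrow> complex^'m^'m" where
  "padded I A = (\<chi> i j. if i \<in> I \<and> j \<in> I then A $ i $ j else if i = j then 1 else 0)"

lemma det_cnj: "det (\<chi> i j. cnj (A $ i $ j)) = cnj (det (A :: complex^'n::finite^'n))"
  unfolding det_def by (simp add: cnj_sum cnj_prod)

lemma jacobian_outside:
  "a \<notin> midx M \<Longrightarrow> jacobian M c d x $ a $ j = (if a = j then 1 else 0)"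
  "j \<notin> midx M \<Longrightarrow> jacobian M c d x $ a $ j = (if a = j then 1 else 0)"
  by (simp_all add: jacobian_def)

lemma levi_sum_midx:
  assumes "j \<in> midx M" "k \<in> midx M"
  shows "(\<Sum>a\<in>UNIV. \<Sum>b\<in>UNIV. B $ a $ b * jacobian M c d x $ a $ j * cnj (jacobian M c d x $ b $ k)) =
    (\<Sum>a\<in>midx M. \<Sum>b\<in>midx M. B $ a $ b * jacobian M c d x $ a $ j * cnj (jacobian M c d x $ b $ k))"
proof -
  have "(\<Sum>b\<in>UNIV. B $ a $ b * jacobian M c d x $ a $ j * cnj (jacobian M c d x $ b $ k)) =
    (\<Sum>b\<in>midx M. B $ a $ b * jacobian M c d x $ a $ j * cnj (jacobian M c d x $ b $ k))" for a
    by (rule sum.mono_neutral_right) (use assms in \<open>auto simp: jacobian_outside\<close>)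
  moreover have "(\<Sum>a\<in>UNIV. \<Sum>b\<in>midx M. B $ a $ b * jacobian M c d x $ a $ j * cnj (jacobian M c d x $ b $ k)) =
    (\<Sum>a\<in>midx M. \<Sum>b\<in>midx M. B $ a $ b * jacobian M c d x $ a $ j * cnj (jacobian M c d x $ b $ k))"
    by (rule sum.mono_neutral_right) (use assms in \<open>auto simp: jacobian_outside intro!: sum.neutral\<close>)
  ultimately show ?thesis by simp
qed

text \<open>The Jacobian is the identity in the coordinates that are not used, hence the padded matrices also transform by
  congruence, and their determinants change by the squared modulus of a Jacobian determinant, as volume densities do.\<close>
lemma pad_congruence:
  fixes A B :: "complex^'m::finite^'m" and M :: "('a, 'm) cmanifold"
  assumes A: "\<And>j k. j \<in> midx M \<Longrightarrow> k \<in> midx M \<Longrightarrow> A $ j $ k = (\<Sum>a\<in>midx M. \<Sum>b\<in>midx M.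
          B $ a $ b * jacobian M c d x $ a $ j * cnj (jacobian M c d x $ b $ k))"
  shows "padded (midx M) A = transpose (jacobian M c d x) ** padded (midx M) B ** (\<chi> i j. cnj (jacobian M c d x $ i $ j))"
proof -
  let ?I = "midx M" and ?J = "jacobian M c d x"
  have "(\<Sum>b\<in>UNIV. (\<Sum>a\<in>UNIV. ?J $ a $ j * padded ?I B $ a $ b) * cnj (?J $ b $ k)) = padded ?I A $ j $ k" for j k
  proof (cases "j \<in> ?I \<and> k \<in> ?I")
    case True
    have 1: "(\<Sum>a\<in>UNIV. ?J $ a $ j * padded ?I B $ a $ b) = (\<Sum>a\<in>?I. ?J $ a $ j * B $ a $ b)" if "b \<in> ?I" for b
      by (rule sum.mono_neutral_cong_right) (use True that in \<open>auto simp: jacobian_outside padded_def\<close>)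
    have "(\<Sum>b\<in>UNIV. (\<Sum>a\<in>UNIV. ?J $ a $ j * padded ?I B $ a $ b) * cnj (?J $ b $ k)) =
        (\<Sum>b\<in>?I. (\<Sum>a\<in>UNIV. ?J $ a $ j * padded ?I B $ a $ b) * cnj (?J $ b $ k))"
      by (rule sum.mono_neutral_right) (use True in \<open>auto simp: jacobian_outside\<close>)
    also have "\<dots> = (\<Sum>b\<in>?I. \<Sum>a\<in>?I. B $ a $ b * ?J $ a $ j * cnj (?J $ b $ k))"
    proof (rule sum.cong[OF refl])
      fix b assume "b \<in> ?I"
      show "(\<Sum>a\<in>UNIV. ?J $ a $ j * padded ?I B $ a $ b) * cnj (?J $ b $ k) =
          (\<Sum>a\<in>?I. B $ a $ b * ?J $ a $ j * cnj (?J $ b $ k))"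
        unfolding 1[OF \<open>b \<in> ?I\<close>] by (subst sum_distrib_right) (simp add: mult_ac)
    qed
    also have "\<dots> = (\<Sum>a\<in>?I. \<Sum>b\<in>?I. B $ a $ b * ?J $ a $ j * cnj (?J $ b $ k))"
      by (rule sum.swap)
    finally show ?thesis using A[of j k] True by (simp add: padded_def)
  next
    case False
    have 1: "(\<Sum>a\<in>UNIV. ?J $ a $ j * padded ?I B $ a $ b) * cnj (?J $ b $ k) =
        (if b = k \<and> k = j then 1 else 0)" for b
    proof (cases "j \<in> ?I")
      case j: True
      then have k: "k \<notin> ?I" using False by blast
      have "(\<Sum>a\<in>UNIV. ?J $ a $ j * padded ?I B $ a $ b) = 0" if "b = k"
        by (rule sum.neutral) (use that j k in \<open>auto simp: padded_def jacobian_outside\<close>)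
      then show ?thesis using j k by (auto simp: jacobian_outside)
    next
      case j: False
      have "(\<Sum>a\<in>UNIV. ?J $ a $ j * padded ?I B $ a $ b) = (\<Sum>a\<in>UNIV. if a = j then (if a = b then 1 else 0) else 0)"
        by (rule sum.cong) (use j in \<open>auto simp: padded_def jacobian_outside\<close>)
      then have "(\<Sum>a\<in>UNIV. ?J $ a $ j * padded ?I B $ a $ b) = (if j = b then 1 else 0)" by simp
      then show ?thesis using j by (auto simp: jacobian_outside)
    qed
    have "(\<Sum>b\<in>UNIV. (\<Sum>a\<in>UNIV. ?J $ a $ j * padded ?I B $ a $ b) * cnj (?J $ b $ k)) = (if k = j then 1 else 0)"
      unfolding 1 by (cases "k = j") simp_all
    then show ?thesis using False by (auto simp: padded_def)
  qed
  then show ?thesis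
    by (simp add: vec_eq_iff matrix_matrix_mult_def transpose_def)
qed

text \<open>A vector in the kernel would have zero length for the form.\<close>
lemma det_pad_nonzero:
  fixes A :: "complex^'m::finite^'m"
  assumes pos: "\<And>v. v \<in> coords I \<Longrightarrow> v \<noteq> 0 \<Longrightarrow> Re (herm I A v) > 0"
  shows "det (padded I A) \<noteq> 0"
proof
  assume "det (padded I A) = 0"
  then have "\<not> invertible (padded I A)" by (simp add: invertible_det_nz)
  then obtain w where w: "w \<noteq> 0" "padded I A *v w = 0"
    unfolding invertible_left_inverse matrix_left_invertible_ker by blast
  have row: "(\<Sum>k\<in>UNIV. padded I A $ j $ k * w $ k) = 0" for j
    using w(2) by (simp add: matrix_vector_mult_def vec_eq_iff)
  have wI: "w $ j = 0" if "j \<notin> I" for j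
  proof -
    have "(\<Sum>k\<in>UNIV. padded I A $ j $ k * w $ k) = (\<Sum>k\<in>UNIV. if k = j then w $ j else 0)"
      by (rule sum.cong) (use that in \<open>auto simp: padded_def\<close>)
    then show ?thesis using row[of j] by simp
  qed
  have rowI: "(\<Sum>k\<in>I. A $ j $ k * w $ k) = 0" if "j \<in> I" for j
  proof -
    have "(\<Sum>k\<in>UNIV. padded I A $ j $ k * w $ k) = (\<Sum>k\<in>I. A $ j $ k * w $ k)"
      by (rule sum.mono_neutral_cong_right) (use that in \<open>auto simp: padded_def wI\<close>)
    then show ?thesis using row[of j] by simp
  qed
  define v where "v = (\<chi> j. cnj (w $ j))"
  have "v \<in> coords I" using wI by (simp add: v_def coords_def)
  moreover have "v \<noteq> 0" using w(1) by (auto simp: v_def vec_eq_iff)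
  moreover have "herm I A v = (\<Sum>j\<in>I. cnj (w $ j) * (\<Sum>k\<in>I. A $ j $ k * w $ k))"
    by (simp add: herm_def v_def sum_distrib_left mult_ac)
  ultimately show False using pos[of v] rowI by simp
qed

definition push :: "'m::finite set \<Rightarrow> complex^'m^'m \<Rightarrow> complex^'m \<Rightarrow> complex^'m" where
  "push I J v = (\<chi> a. \<Sum>j\<in>I. J $ a $ j * v $ j)"

lemma herm_congruence:
  fixes A B J :: "complex^'m::finite^'m"
  assumes A: "\<And>j k. j \<in> I \<Longrightarrow> k \<in> I \<Longrightarrow> A $ j $ k = (\<Sum>a\<in>I. \<Sum>b\<in>I. B $ a $ b * J $ a $ j * cnj (J $ b $ k))"
  shows "herm I A v = herm I B (push I J v)"
proof -
  have "herm I B (push I J v) = (\<Sum>a\<in>I. \<Sum>b\<in>I. \<Sum>j\<in>I. \<Sum>k\<in>I. B $ a $ b * J $ a $ j * cnj (J $ b $ k) * v $ j * cnj (v $ k))"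
    unfolding herm_def push_def
    by (intro sum.cong refl) (simp add: cnj_sum sum_product sum_distrib_left mult_ac)
  also have "\<dots> = (\<Sum>a\<in>I. \<Sum>j\<in>I. \<Sum>b\<in>I. \<Sum>k\<in>I. B $ a $ b * J $ a $ j * cnj (J $ b $ k) * v $ j * cnj (v $ k))"
    by (rule sum.cong[OF refl], rule sum.swap)
  also have "\<dots> = (\<Sum>j\<in>I. \<Sum>a\<in>I. \<Sum>b\<in>I. \<Sum>k\<in>I. B $ a $ b * J $ a $ j * cnj (J $ b $ k) * v $ j * cnj (v $ k))"
    by (rule sum.swap)
  also have "\<dots> = (\<Sum>j\<in>I. \<Sum>a\<in>I. \<Sum>k\<in>I. \<Sum>b\<in>I. B $ a $ b * J $ a $ j * cnj (J $ b $ k) * v $ j * cnj (v $ k))"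
    by (rule sum.cong[OF refl], rule sum.cong[OF refl], rule sum.swap)
  also have "\<dots> = (\<Sum>j\<in>I. \<Sum>k\<in>I. \<Sum>a\<in>I. \<Sum>b\<in>I. B $ a $ b * J $ a $ j * cnj (J $ b $ k) * v $ j * cnj (v $ k))"
    by (rule sum.cong[OF refl], rule sum.swap)
  also have "\<dots> = herm I A v"
    unfolding herm_def using A by (intro sum.cong refl) (simp add: sum_distrib_right)
  finally show ?thesis by simp
qed

lemma push_coords: "push (midx M) (jacobian M c d x) v \<in> coords (midx M)"
  by (auto simp: push_def coords_def jacobian_outside intro!: sum.neutral)

lemma herm_add: "herm I (A + B) v = herm I A v + herm I B v"
  by (simp add: herm_def sum.distrib algebra_simps)

lemma herm_scaleR: "herm I (r *\<^sub>R A) v = r *\<^sub>R herm I A v"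
  by (simp add: herm_def scaleR_sum_right)

lemma herm_cong:
  fixes A B :: "complex^'m::finite^'m"
  shows "(\<And>j k. j \<in> I \<Longrightarrow> k \<in> I \<Longrightarrow> A $ j $ k = B $ j $ k) \<Longrightarrow> herm I A v = herm I B v"
  by (simp add: herm_def)

lemma herm_cproj: "herm I A (cproj I v) = herm I A v"
  by (simp add: herm_def)

lemma ddbar_add:
  assumes S: "open S" "z \<in> S" and u: "smooth_on S u" and w: "smooth_on S w"
  shows "dz j (dzbar k (\<lambda>z. u z + w z)) z = dz j (dzbar k u) z + dz j (dzbar k w) z"
proof -
  have "dz j (dzbar k (\<lambda>z. u z + w z)) z = dz j (\<lambda>z. dzbar k u z + dzbar k w z) z"
    by (rule dz_cong_open[OF S]) (intro dz_add smooth_on_differentiable[OF u] smooth_on_differentiable[OF w])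
  also have "\<dots> = dz j (dzbar k u) z + dz j (dzbar k w) z"
    by (intro dz_add smooth_on_differentiable[OF smooth_on_dz(2)[OF S(1) u] S(2)]
        smooth_on_differentiable[OF smooth_on_dz(2)[OF S(1) w] S(2)])
  finally show ?thesis .
qed

lemma ddbar_cmult:
  assumes S: "open S" "z \<in> S" and u: "smooth_on S u"
  shows "dz j (dzbar k (\<lambda>z. c * u z)) z = c * dz j (dzbar k u) z"
proof -
  have "dz j (dzbar k (\<lambda>z. c * u z)) z = dz j (\<lambda>z. c * dzbar k u z) z"
    by (rule dz_cong_open[OF S]) (intro dz_cmult smooth_on_differentiable[OF u])
  also have "\<dots> = c * dz j (dzbar k u) z"
    by (intro dz_cmult smooth_on_differentiable[OF smooth_on_dz(2)[OF S(1) u] S(2)])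
  finally show ?thesis .
qed

lemma ddbar_cnj:
  assumes S: "open S" "z \<in> S" and u: "smooth_on S u" and real: "\<And>z. cnj (u z) = u z"
  shows "cnj (dz j (dzbar k u) z) = dz k (dzbar j u) z"
proof -
  have "cnj (dz j (dzbar k u) z) = dzbar j (\<lambda>z. cnj (dzbar k u z)) z"
    using dz_cnj(2)[OF smooth_on_differentiable[OF smooth_on_dz(2)[OF S(1) u] S(2)]] by simp
  also have "\<dots> = dzbar j (dz k u) z"
  proof (rule dz_cong_open(2)[OF S])
    show "cnj (dzbar k u y) = dz k u y" if "y \<in> S" for y
      using dz_cnj(1)[OF smooth_on_differentiable[OF u that], of k] by (simp add: real)
  qed
  also have "\<dots> = dz k (dzbar j u) z"
    using wirtinger_commute(2)[OF S(1) u S(2)] by simp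
  finally show ?thesis .
qed

context cx_manifold
begin

lemma coord_fun_of_real_smooth:
  assumes "openin (mtop M) V" "smooth_fun_on M V f" "c \<in> maximal_atlas M"
  shows "smooth_on (coord_dom M c V) (coord_fun M c (\<lambda>y. complex_of_real (f y)))"
  using smooth_on_of_real[OF max_open_coord_dom[OF assms(3,1)] smooth_fun_on_max[OF assms]]
  by (simp add: coord_fun_def)

lemma i_ddbar_add:
  assumes V: "openin (mtop M) V" "x \<in> V" and f: "smooth_fun_on M V f" and g: "smooth_fun_on M V g"
    and c: "c \<in> maximal_atlas M" "x \<in> fst c"
  shows "i_ddbar M (\<lambda>y. f y + g y) c x = i_ddbar M f c x + i_ddbar M g c x"
proof -
  have x: "snd c x \<in> coord_dom M c V" using max_coord_dom[OF c] V(2) by simp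
  show ?thesis
    using ddbar_add[OF max_open_coord_dom[OF c(1) V(1)] x coord_fun_of_real_smooth[OF V(1) f c(1)]
        coord_fun_of_real_smooth[OF V(1) g c(1)]]
    by (simp add: i_ddbar_def vec_eq_iff coord_fun_def)
qed

lemma i_ddbar_cmult:
  assumes V: "openin (mtop M) V" "x \<in> V" and f: "smooth_fun_on M V f"
    and c: "c \<in> maximal_atlas M" "x \<in> fst c"
  shows "i_ddbar M (\<lambda>y. r * f y) c x = r *\<^sub>R i_ddbar M f c x"
proof -
  have x: "snd c x \<in> coord_dom M c V" using max_coord_dom[OF c] V(2) by simp
  show ?thesis
    using ddbar_cmult[OF max_open_coord_dom[OF c(1) V(1)] x coord_fun_of_real_smooth[OF V(1) f c(1)], of _ _ "of_real r"]
    by (simp add: i_ddbar_def vec_eq_iff coord_fun_def scaleR_conv_of_real[where 'a=complex])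
qed

lemma i_ddbar_cong:
  assumes V: "openin (mtop M) V" "x \<in> V" and fg: "\<And>y. y \<in> V \<Longrightarrow> f y = g y"
    and c: "c \<in> maximal_atlas M" "x \<in> fst c"
  shows "i_ddbar M f c x = i_ddbar M g c x"
proof -
  let ?S = "coord_dom M c V" and ?u = "\<lambda>f. coord_fun M c (\<lambda>y. complex_of_real (f y))"
  have x: "snd c x \<in> ?S" using max_coord_dom[OF c] V(2) by simp
  have S: "open ?S" by (rule max_open_coord_dom[OF c(1) V(1)])
  have "?u f z = ?u g z" if "z \<in> ?S" for z
    using fg[OF max_parD[OF c(1) that]] by (simp add: coord_fun_par)
  then have "dzbar k (?u f) z = dzbar k (?u g) z" if "z \<in> ?S" for z k
    using dz_cong_open(2)[OF S that] by blast
  then have "dz j (dzbar k (?u f)) (snd c x) = dz j (dzbar k (?u g)) (snd c x)" for j k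
    using dz_cong_open(1)[OF S x] by blast
  then show ?thesis by (simp add: i_ddbar_def vec_eq_iff)
qed

lemma i_ddbar_coord_smooth:
  assumes V: "openin (mtop M) V" and f: "smooth_fun_on M V f" and c: "c \<in> maximal_atlas M"
  shows "smooth_on (coord_dom M c V) (coord_fun M c (\<lambda>x. i_ddbar M f c x $ j $ k))"
proof -
  let ?S = "coord_dom M c V" and ?u = "coord_fun M c (\<lambda>y. complex_of_real (f y))"
  have S: "open ?S" by (rule max_open_coord_dom[OF c V])
  have "smooth_on ?S (\<lambda>z. dz j (dzbar k ?u) (cproj (midx M) z))"
    by (rule smooth_on_compose[OF S S _ smooth_on_linear[OF S bounded_linear_cproj]])
       (auto simp: coord_dom_cproj intro!: smooth_on_dz S coord_fun_of_real_smooth[OF V f c])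
  moreover have "coord_fun M c (\<lambda>x. i_ddbar M f c x $ j $ k) z = dz j (dzbar k ?u) (cproj (midx M) z)"
    if "z \<in> ?S" for z
    using par_dom(2)[OF that] unfolding coord_fun_par[of M c "\<lambda>x. i_ddbar M f c x $ j $ k"]
    by (simp add: i_ddbar_def)
  ultimately show ?thesis
    using smooth_on_cong[OF S, of "coord_fun M c (\<lambda>x. i_ddbar M f c x $ j $ k)"
        "\<lambda>z. dz j (dzbar k ?u) (cproj (midx M) z)"] by blast
qed

text \<open>The determinant of the Jacobian is a polynomial in derivatives of the holomorphic transition map.\<close>
lemma det_jacobian_coord:
  assumes c: "c \<in> maximal_atlas M" and d: "d \<in> maximal_atlas M"
  shows "hol_on (coord_dom M c (fst d)) (coord_fun M c (\<lambda>x. det (jacobian M c d x)))"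
proof -
  let ?S = "coord_dom M c (fst d)"
  have S: "open ?S" by (rule max_open_coord_dom[OF c max_openin[OF d]])
  have T: "hol_on ?S (\<lambda>z. transition M c d z $ i)" for i
    using trans_hol[OF c d] by (simp add: hol_on_iff)
  show ?thesis
    unfolding hol_on_iff
  proof
    fix z assume z: "z \<in> ?S"
    have zc: "cproj (midx M) z \<in> ?S" using z coord_dom_cproj by blast
    have "hol_at (\<lambda>w. det (\<chi> i j. dz j (\<lambda>z. transition M c d z $ i) w)) (cproj (midx M) z)"
      using hol_on_dz[OF S T] zc by (intro hol_at_det) (simp add: hol_on_iff)
    then have "hol_at (\<lambda>z. det (\<chi> i j. dz j (\<lambda>z. transition M c d z $ i) (cproj (midx M) z))) z"
      by (rule hol_at_compose[OF hol_at_cproj])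
    moreover have "det (\<chi> i j. dz j (\<lambda>z. transition M c d z $ i) (cproj (midx M) y)) =
        coord_fun M c (\<lambda>x. det (jacobian M c d x)) y" if y: "y \<in> ?S" for y
    proof -
      have "chart_inv M c y \<in> fst c" "chart_inv M c y \<in> fst d" "snd c (chart_inv M c y) = cproj (midx M) y"
        using par_dom[OF y] max_parD[OF c y] by auto
      moreover from this have "(\<chi> i j. dz j (\<lambda>z. transition M c d z $ i) (snd c (chart_inv M c y))) = jacobian M c d (chart_inv M c y)"
        using jacobian_trans[OF c d] by (simp add: vec_eq_iff)
      ultimately show ?thesis by (simp add: coord_fun_par)
    qed
    ultimately show "hol_at (coord_fun M c (\<lambda>x. det (jacobian M c d x))) z"
      by (rule hol_at_cong_open[OF S z, rotated])
  qed
qed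

lemma ln_det_jacobian_smooth:
  assumes c: "c \<in> maximal_atlas M" and d: "d \<in> maximal_atlas M"
  shows "smooth_fun_on M (fst c \<inter> fst d) (\<lambda>x. ln ((cmod (det (jacobian M c d x)))\<^sup>2))"
proof (rule smooth_fun_onI)
  have o: "openin (mtop M) (fst c \<inter> fst d)" using max_openin c d by blast
  then show "openin (mtop M) (fst c \<inter> fst d)" .
  have "smooth_on (coord_dom M c (fst c \<inter> fst d)) (\<lambda>z. ln ((cmod (coord_fun M c (\<lambda>x. det (jacobian M c d x)) z))\<^sup>2))"
  proof (intro smooth_on_ln smooth_on_cmod2 max_open_coord_dom[OF c o])
    show "smooth_on (coord_dom M c (fst c \<inter> fst d)) (coord_fun M c (\<lambda>x. det (jacobian M c d x)))"
      by (rule smooth_on_subset[OF hol_on_smooth[OF max_open_coord_dom[OF c max_openin[OF d]] det_jacobian_coord[OF c d]]])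
         (rule coord_dom_mono, blast)
    fix z assume "z \<in> coord_dom M c (fst c \<inter> fst d)"
    then show "0 < (cmod (coord_fun M c (\<lambda>x. det (jacobian M c d x)) z))\<^sup>2"
      using det_jacobian_nonzero[OF c d] max_parD[OF c] by (fastforce simp: coord_fun_par)
  qed
  then show "\<exists>e W. e \<in> maximal_atlas M \<and> openin (mtop M) W \<and> x \<in> W \<and> W \<subseteq> fst e \<and>
       smooth_on (coord_dom M e W) (coord_fun M e (\<lambda>x. ln ((cmod (det (jacobian M c d x)))\<^sup>2)))"
    if "x \<in> fst c \<inter> fst d" for x
    using that c o by (intro exI[of _ c] exI[of _ "fst c \<inter> fst d"]) (auto simp: coord_fun_def)
qed

lemma ln_det_jacobian_pluriharmonic:
  assumes c: "c \<in> maximal_atlas M" and d: "d \<in> maximal_atlas M" and x: "x \<in> fst c" "x \<in> fst d"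
  shows "i_ddbar M (\<lambda>x. ln ((cmod (det (jacobian M c d x)))\<^sup>2)) c x = 0"
proof -
  let ?S = "coord_dom M c (fst c \<inter> fst d)"
  have S: "open ?S" using max_openin c d by (intro max_open_coord_dom[OF c]) blast
  have x: "snd c x \<in> ?S" using max_coord_dom[OF c x(1)] x by simp
  have "hol_on ?S (coord_fun M c (\<lambda>x. det (jacobian M c d x)))"
    using det_jacobian_coord[OF c d] coord_dom_mono[of "fst c \<inter> fst d" "fst d" M c] by (auto simp: hol_on_iff)
  moreover have "coord_fun M c (\<lambda>x. det (jacobian M c d x)) z \<noteq> 0" if "z \<in> ?S" for z
    using det_jacobian_nonzero[OF c d] max_parD[OF c that] by (simp add: coord_fun_par)
  ultimately show ?thesis
    using ln_cmod2_pluriharmonic[OF S x] by (simp add: i_ddbar_def vec_eq_iff coord_fun_def)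
qed

text \<open>The logarithm of the weight \<open>1 / cmod (det \<omega>)\<close>, with the square inside the logarithm because the modulus itself is not a
  polynomial in the real and imaginary part.\<close>
definition canonical_potential :: "('a, 'm) form11 \<Rightarrow> ('a, 'm) chart \<Rightarrow> 'a \<Rightarrow> real" where
  "canonical_potential \<omega> c x = - (1 / 2) * ln ((cmod (det (padded (midx M) (\<omega> c x))))\<^sup>2)"

definition canonical_form :: "('a, 'm) form11 \<Rightarrow> ('a, 'm) form11" where
  "canonical_form \<omega> c x = (- (1 / (2 * pi))) *\<^sub>R i_ddbar M (canonical_potential \<omega> c) c x"

context
  fixes \<omega> :: "('a, 'm) form11"
  assumes \<omega>: "hermitian_metric M \<omega>"
begin

lemma metric_det_nonzero: "c \<in> atlas M \<Longrightarrow> x \<in> fst c \<Longrightarrow> det (padded (midx M) (\<omega> c x)) \<noteq> 0"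
  using \<omega> unfolding hermitian_metric_def by (intro det_pad_nonzero) blast

lemma metric_transform:
  assumes "c \<in> atlas M" "d \<in> atlas M" "x \<in> fst c" "x \<in> fst d" "j \<in> midx M" "k \<in> midx M"
  shows "\<omega> c x $ j $ k = (\<Sum>a\<in>midx M. \<Sum>b\<in>midx M.
          \<omega> d x $ a $ b * jacobian M c d x $ a $ j * cnj (jacobian M c d x $ b $ k))"
  using \<omega> assms unfolding hermitian_metric_def real_form11_def by blast

lemma metric_det_transform:
  assumes "c \<in> atlas M" "d \<in> atlas M" "x \<in> fst c" "x \<in> fst d"
  shows "cmod (det (padded (midx M) (\<omega> c x))) =
    (cmod (det (jacobian M c d x)))\<^sup>2 * cmod (det (padded (midx M) (\<omega> d x)))"
proof -
  have "padded (midx M) (\<omega> c x) = transpose (jacobian M c d x) ** padded (midx M) (\<omega> d x) ** (\<chi> i j. cnj (jacobian M c d x $ i $ j))"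
    by (rule pad_congruence) (rule metric_transform[OF assms])
  then show ?thesis
    by (simp add: det_mul det_cnj norm_mult power2_eq_square)
qed

lemma canonical_potential_smooth:
  assumes c: "c \<in> atlas M"
  shows "smooth_fun_on M (fst c) (canonical_potential \<omega> c)"
proof (rule smooth_fun_onI)
  have cM: "c \<in> maximal_atlas M" by (rule atlas_maximal[OF c])
  show o: "openin (mtop M) (fst c)" by (rule max_openin[OF cM])
  have S: "open (coord_dom M c (fst c))" by (rule max_open_coord_dom[OF cM o])
  have "smooth_on (coord_dom M c (fst c)) (\<lambda>z. - (1 / 2) * ln ((cmod (det (padded (midx M) (\<omega> c (chart_inv M c z)))))\<^sup>2))"
  proof (intro smooth_on_mult smooth_on_const smooth_on_ln smooth_on_cmod2 smooth_on_det S)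
    show "smooth_on (coord_dom M c (fst c)) (\<lambda>z. padded (midx M) (\<omega> c (chart_inv M c z)) $ i $ j)" for i j
      using \<omega> c S unfolding hermitian_metric_def real_form11_def
      by (cases "i \<in> midx M \<and> j \<in> midx M") (auto simp: padded_def smooth_on_const coord_fun_par[abs_def])
    show "0 < (cmod (det (padded (midx M) (\<omega> c (chart_inv M c z)))))\<^sup>2" if "z \<in> coord_dom M c (fst c)" for z
      using metric_det_nonzero[OF c par_dom(1)[OF that]] by simp
  qed
  then show "\<exists>e W. e \<in> maximal_atlas M \<and> openin (mtop M) W \<and> x \<in> W \<and> W \<subseteq> fst e \<and>
       smooth_on (coord_dom M e W) (coord_fun M e (canonical_potential \<omega> c))" if "x \<in> fst c" for x
    using that cM o
    by (intro exI[of _ c] exI[of _ "fst c"]) (simp add: coord_fun_par[abs_def] canonical_potential_def)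
qed

text \<open>These functions are the logarithms of the weights of a metric on the canonical bundle.\<close>
lemma canonical_potential_change:
  assumes c: "c \<in> atlas M" and d: "d \<in> atlas M" and x: "x \<in> fst c" "x \<in> fst d"
  shows "canonical_potential \<omega> d x = canonical_potential \<omega> c x + ln ((cmod (det (jacobian M c d x)))\<^sup>2)"
proof -
  have J: "cmod (det (jacobian M c d x)) > 0"
    using det_jacobian_nonzero[OF atlas_maximal[OF c] atlas_maximal[OF d] x] by simp
  have D: "cmod (det (padded (midx M) (\<omega> d x))) > 0" using metric_det_nonzero[OF d x(2)] by simp
  show ?thesis
    using J D unfolding canonical_potential_def metric_det_transform[OF c d x]
    by (simp add: ln_mult ln_realpow power_mult_distrib add_divide_distrib)
qed

lemma canonical_potential_i_ddbar:
  assumes c: "c \<in> atlas M" and d: "d \<in> atlas M" and x: "x \<in> fst c" "x \<in> fst d"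
  shows "i_ddbar M (canonical_potential \<omega> d) c x = i_ddbar M (canonical_potential \<omega> c) c x"
proof -
  note cM = atlas_maximal[OF c] and dM = atlas_maximal[OF d]
  let ?V = "fst c \<inter> fst d"
  have V: "openin (mtop M) ?V" "x \<in> ?V" using max_openin[OF cM] max_openin[OF dM] x by auto
  have "i_ddbar M (canonical_potential \<omega> d) c x =
      i_ddbar M (\<lambda>x. canonical_potential \<omega> c x + ln ((cmod (det (jacobian M c d x)))\<^sup>2)) c x"
    by (rule i_ddbar_cong[OF V _ cM x(1)]) (use canonical_potential_change[OF c d] in auto)
  also have "\<dots> = i_ddbar M (canonical_potential \<omega> c) c x +
      i_ddbar M (\<lambda>x. ln ((cmod (det (jacobian M c d x)))\<^sup>2)) c x"
    by (rule i_ddbar_add[OF V smooth_fun_on_subset[OF canonical_potential_smooth[OF c]]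
          ln_det_jacobian_smooth[OF cM dM] cM x(1)]) blast
  also have "i_ddbar M (\<lambda>x. ln ((cmod (det (jacobian M c d x)))\<^sup>2)) c x = 0"
    by (rule ln_det_jacobian_pluriharmonic[OF cM dM x])
  finally show ?thesis by simp
qed

text \<open>In each chart the form is the Levi form of the weight of that chart. The weights differ by pluriharmonic functions,
  so the transformation law is that of the Levi form of a single function.\<close>
lemma canonical_form_real: "real_form11 M (canonical_form \<omega>)"
  unfolding real_form11_def
proof (intro conjI ballI)
  fix c j k assume c: "c \<in> atlas M" and jk: "j \<in> midx M" "k \<in> midx M"
  note cM = atlas_maximal[OF c]
  have S: "open (coord_dom M c (fst c))" by (rule max_open_coord_dom[OF cM max_openin[OF cM]])
  have "smooth_on (coord_dom M c (fst c)) (\<lambda>z. complex_of_real (- (1 / (2 * pi))) *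
      coord_fun M c (\<lambda>x. i_ddbar M (canonical_potential \<omega> c) c x $ j $ k) z)"
    by (intro smooth_on_mult smooth_on_const S i_ddbar_coord_smooth max_openin cM canonical_potential_smooth c)
  then show "smooth_on (coord_dom M c (fst c)) (coord_fun M c (\<lambda>x. canonical_form \<omega> c x $ j $ k))"
    by (simp add: canonical_form_def coord_fun_def scaleR_conv_of_real[where 'a=complex])
  fix x assume x: "x \<in> fst c"
  have xS: "snd c x \<in> coord_dom M c (fst c)" using max_coord_dom[OF cM x] x by simp
  show "canonical_form \<omega> c x $ k $ j = cnj (canonical_form \<omega> c x $ j $ k)"
    using ddbar_cnj[OF S xS coord_fun_of_real_smooth[OF max_openin[OF cM] canonical_potential_smooth[OF c] cM], of j k]
    by (simp add: canonical_form_def i_ddbar_def coord_fun_def)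
next
  fix c d x j k assume c: "c \<in> atlas M" and d: "d \<in> atlas M" and x: "x \<in> fst c \<inter> fst d"
    and jk: "j \<in> midx M" "k \<in> midx M"
  note cM = atlas_maximal[OF c] and dM = atlas_maximal[OF d]
  have "i_ddbar M (canonical_potential \<omega> c) c x $ j $ k = i_ddbar M (canonical_potential \<omega> d) c x $ j $ k"
    using canonical_potential_i_ddbar[OF c d] x by simp
  also have "\<dots> = (\<Sum>a\<in>midx M. \<Sum>b\<in>midx M. i_ddbar M (canonical_potential \<omega> d) d x $ a $ b *
      jacobian M c d x $ a $ j * cnj (jacobian M c d x $ b $ k))"
    using levi_transfer[OF cM dM _ _ max_openin[OF dM] _ canonical_potential_smooth[OF d], of x j k] x
    by (simp add: levi_sum_midx[OF jk])
  finally show "canonical_form \<omega> c x $ j $ k = (\<Sum>a\<in>midx M. \<Sum>b\<in>midx M.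
          canonical_form \<omega> d x $ a $ b * jacobian M c d x $ a $ j * cnj (jacobian M c d x $ b $ k))"
    by (simp add: canonical_form_def scaleR_sum_right sum_negf)
qed

text \<open>The identities hold since third derivatives of the local weight commute.\<close>
lemma canonical_form_closed: "closed_form11 M (canonical_form \<omega>)"
  unfolding closed_form11_def
proof (intro ballI)
  fix c x j k l assume c: "c \<in> atlas M" and x: "x \<in> fst c" and jkl: "j \<in> midx M" "k \<in> midx M" "l \<in> midx M"
  note cM = atlas_maximal[OF c]
  let ?S = "coord_dom M c (fst c)" and ?u = "coord_fun M c (\<lambda>y. complex_of_real (canonical_potential \<omega> c y))"
  have S: "open ?S" by (rule max_open_coord_dom[OF cM max_openin[OF cM]])
  have u: "smooth_on ?S ?u"
    by (rule coord_fun_of_real_smooth[OF max_openin[OF cM] canonical_potential_smooth[OF c] cM])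
  have xS: "snd c x \<in> ?S" using max_coord_dom[OF cM x] x by simp
  have xp: "cproj (midx M) (snd c x) = snd c x" by (rule cproj_coords[OF max_coords[OF cM x]])
  define r where "r = complex_of_real (- (1 / (2 * pi)))"
  have D: "dz m (coord_fun M c (\<lambda>y. canonical_form \<omega> c y $ j $ k)) (snd c x) = r * dz m (dz j (dzbar k ?u)) (snd c x)"
    "dzbar m (coord_fun M c (\<lambda>y. canonical_form \<omega> c y $ j $ k)) (snd c x) = r * dzbar m (dz j (dzbar k ?u)) (snd c x)"
    if "m \<in> midx M" for m j k
  proof -
    have s: "smooth_on ?S (dz j (dzbar k ?u))" by (intro smooth_on_dz S u)
    have df: "dz j (dzbar k ?u) differentiable (at (snd c x))"
      by (rule smooth_on_differentiable[OF s xS])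
    have df': "(\<lambda>z. dz j (dzbar k ?u) (cproj (midx M) z)) differentiable (at (snd c x))"
    proof -
      obtain D where "(dz j (dzbar k ?u) has_derivative D) (at (cproj (midx M) (snd c x)))"
        using df unfolding xp differentiable_def by blast
      from has_derivative_compose[OF bounded_linear_imp_has_derivative[OF bounded_linear_cproj] this]
      show ?thesis unfolding differentiable_def by blast
    qed
    have eq: "coord_fun M c (\<lambda>y. canonical_form \<omega> c y $ j $ k) z = r * dz j (dzbar k ?u) (cproj (midx M) z)"
      if "z \<in> ?S" for z
      using par_dom(2)[OF that] unfolding coord_fun_par[of M c "\<lambda>x. canonical_form \<omega> c x $ j $ k"]
      by (simp add: canonical_form_def i_ddbar_def r_def scaleR_conv_of_real[where 'a=complex])
    show "dz m (coord_fun M c (\<lambda>y. canonical_form \<omega> c y $ j $ k)) (snd c x) = r * dz m (dz j (dzbar k ?u)) (snd c x)"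
      "dzbar m (coord_fun M c (\<lambda>y. canonical_form \<omega> c y $ j $ k)) (snd c x) = r * dzbar m (dz j (dzbar k ?u)) (snd c x)"
      using dz_cong_open[OF S xS eq] dz_cmult[OF df'] dz_compose_cproj[of "dz j (dzbar k ?u)" "midx M" "snd c x" m] df xp that
      by simp_all
  qed
  have u2: "smooth_on ?S (dzbar k ?u)" "smooth_on ?S (dz j ?u)" by (intro smooth_on_dz S u)+
  have "dz l (dz j (dzbar k ?u)) (snd c x) = dz j (dz l (dzbar k ?u)) (snd c x)"
    by (rule wirtinger_commute(1)[OF S u2(1) xS])
  moreover have "dzbar l (dz j (dzbar k ?u)) (snd c x) = dzbar k (dz j (dzbar l ?u)) (snd c x)"
  proof -
    have e: "dz j (dzbar m ?u) z = dzbar m (dz j ?u) z" if "z \<in> ?S" for m z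
      by (rule wirtinger_commute(2)[OF S u that])
    have "dzbar l (dz j (dzbar k ?u)) (snd c x) = dzbar l (dzbar k (dz j ?u)) (snd c x)"
      by (rule dz_cong_open(2)[OF S xS e])
    also have "\<dots> = dzbar k (dzbar l (dz j ?u)) (snd c x)"
      by (rule wirtinger_commute(3)[OF S u2(2) xS])
    also have "\<dots> = dzbar k (dz j (dzbar l ?u)) (snd c x)"
      by (rule dz_cong_open(2)[OF S xS e[symmetric]])
    finally show ?thesis .
  qed
  ultimately show "dz l (coord_fun M c (\<lambda>y. canonical_form \<omega> c y $ j $ k)) (snd c x) =
        dz j (coord_fun M c (\<lambda>y. canonical_form \<omega> c y $ l $ k)) (snd c x) \<and>
        dzbar l (coord_fun M c (\<lambda>y. canonical_form \<omega> c y $ j $ k)) (snd c x) =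
        dzbar k (coord_fun M c (\<lambda>y. canonical_form \<omega> c y $ j $ l)) (snd c x)"
    using jkl by (simp add: D)
qed

end

end

section \<open>Coercivity near a point, and holomorphic inverse functions\<close>

lemma herm_scale: "herm I A (r *\<^sub>R v) = of_real (r\<^sup>2) * herm I A v"
  unfolding herm_def
  by (simp add: sum_distrib_left power2_eq_square scaleR_conv_of_real[where 'a=complex] mult_ac)

text \<open>If the conclusion fails, there are points tending to \<open>z0\<close>, unit vectors \<open>v\<close> and constants tending to infinity that
  violate it; a limit of the \<open>v\<close> lies in the kernel of \<open>l z0\<close> and contradicts positivity there. With \<open>l = 0\<close> this is
  the local lower bound of a metric, and with \<open>l\<close> the differential of the projection it says that a form which is positive
  on vertical vectors becomes positive after adding a multiple of the pullback of a form on the base.\<close>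
lemma coercive_near:
  fixes A :: "complex^'m::finite \<Rightarrow> complex^'m^'m" and l :: "complex^'m \<Rightarrow> complex^'m"
  assumes contA: "\<And>j k. j \<in> I \<Longrightarrow> k \<in> I \<Longrightarrow> isCont (\<lambda>z. A z $ j $ k) z0"
    and contl: "\<And>j. j \<in> I \<Longrightarrow> isCont (\<lambda>z. l z $ j) z0"
    and pos: "\<And>v. v \<in> coords I \<Longrightarrow> v \<noteq> 0 \<Longrightarrow> (\<Sum>j\<in>I. l z0 $ j * v $ j) = 0 \<Longrightarrow> Re (herm I (A z0) v) > 0"
  shows "\<exists>C\<ge>0. \<exists>e>0. \<forall>z. dist z z0 < e \<longrightarrow> (\<forall>K\<ge>C. \<forall>v\<in>coords I.
      e * (norm v)\<^sup>2 \<le> Re (herm I (A z) v) + K * (cmod (\<Sum>j\<in>I. l z $ j * v $ j))\<^sup>2)"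
proof (rule ccontr)
  define q where "q z v = Re (herm I (A z) v)" for z v
  define s where "s z v = cmod (\<Sum>j\<in>I. l z $ j * v $ j)" for z v
  assume neg: "\<not> ?thesis"
  have "\<exists>z K v. dist z z0 < 1 / Suc n \<and> real n \<le> K \<and> v \<in> coords I \<and> norm v = 1 \<and>
      q z v + K * (s z v)\<^sup>2 < 1 / Suc n" for n
  proof -
    obtain z K v where *: "dist z z0 < 1 / Suc n" "real n \<le> K" "v \<in> coords I"
      "\<not> (1 / Suc n * (norm v)\<^sup>2 \<le> q z v + K * (s z v)\<^sup>2)"
      using neg[simplified, rule_format, of "real n" "1 / Suc n"] unfolding q_def s_def by auto
    have v0: "v \<noteq> 0"
      using *(4) by (auto simp: q_def s_def herm_def)
    define w where "w = (1 / norm v) *\<^sub>R v"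
    have vw: "v = norm v *\<^sub>R w" using v0 by (simp add: w_def)
    have "w \<in> coords I" "norm w = 1" using *(3) v0 by (auto simp: w_def coords_def)
    moreover have "q z v = (norm v)\<^sup>2 * q z w"
      by (subst vw) (simp add: q_def herm_scale del: scaleR_conv_of_real)
    moreover have "s z v = norm v * s z w"
    proof -
      have "(\<Sum>j\<in>I. l z $ j * v $ j) = of_real (norm v) * (\<Sum>j\<in>I. l z $ j * w $ j)"
        by (subst vw) (simp add: sum_distrib_left scaleR_conv_of_real[where 'a=complex] mult_ac)
      then show ?thesis by (simp add: s_def norm_mult)
    qed
    ultimately have "\<not> (1 / Suc n * (norm v)\<^sup>2 \<le> (norm v)\<^sup>2 * (q z w + K * (s z w)\<^sup>2))"
      using *(4) by (simp add: algebra_simps power_mult_distrib)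
    then have "q z w + K * (s z w)\<^sup>2 < 1 / Suc n"
      using v0 by (metis mult.commute mult_left_mono not_le zero_le_power2)
    then show ?thesis using *(1,2) \<open>w \<in> coords I\<close> \<open>norm w = 1\<close> by blast
  qed
  then obtain Z K V where Z: "\<And>n. dist (Z n) z0 < 1 / Suc n" and K: "\<And>n. real n \<le> K n"
    and V: "\<And>n. V n \<in> coords I" "\<And>n. norm (V n) = 1"
    and ineq: "\<And>n. q (Z n) (V n) + K n * (s (Z n) (V n))\<^sup>2 < 1 / Suc n"
    by metis
  have "coords I \<inter> sphere 0 1 = sphere 0 1 \<inter> {v. cproj I v = v}"
    by (auto simp: coords_def vec_eq_iff)
  moreover have "closed {v::complex^'m. cproj I v = v}"
    by (intro closed_Collect_eq continuous_cproj continuous_on_id)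
  ultimately have "compact (coords I \<inter> sphere 0 (1::real) :: (complex^'m) set)"
    by (simp add: compact_Int_closed)
  moreover have "\<forall>n. V n \<in> coords I \<inter> sphere 0 1" using V by simp
  ultimately obtain u r where u: "u \<in> coords I \<inter> sphere 0 1" and r: "strict_mono r" and lim: "(V \<circ> r) \<longlonglongrightarrow> u"
    unfolding compact_def by metis
  have rn: "real n \<le> real (r n)" for n using seq_suble[OF r] by simp
  have Zlim: "(\<lambda>n. Z (r n)) \<longlonglongrightarrow> z0"
  proof (rule metric_LIMSEQ_I)
    fix \<delta> :: real assume "\<delta> > 0"
    then obtain N where N: "1 / Suc N < \<delta>" using nat_approx_posE by metis
    have "dist (Z (r n)) z0 < \<delta>" if "n \<ge> N" for n
    proof -
      have "1 / Suc (r n) \<le> 1 / Suc N"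
        using rn[of n] that by (intro divide_left_mono) auto
      then show ?thesis using Z[of "r n"] N by linarith
    qed
    then show "\<exists>N. \<forall>n\<ge>N. dist (Z (r n)) z0 < \<delta>" by blast
  qed
  have Vlim: "(\<lambda>n. V (r n) $ j) \<longlonglongrightarrow> u $ j" for j
    using tendsto_vec_nth[OF lim] by (simp add: o_def)
  have qlim: "(\<lambda>n. q (Z (r n)) (V (r n))) \<longlonglongrightarrow> q z0 u"
    unfolding q_def herm_def
    by (intro tendsto_intros Vlim isCont_tendsto_compose[OF contA Zlim])
  have slim: "(\<lambda>n. s (Z (r n)) (V (r n))) \<longlonglongrightarrow> s z0 u"
    unfolding s_def by (intro tendsto_intros Vlim isCont_tendsto_compose[OF contl Zlim])
  have i0: "(\<lambda>n. 1 / real (Suc (r n))) \<longlonglongrightarrow> 0"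
    using LIMSEQ_subseq_LIMSEQ[OF LIMSEQ_Suc[OF lim_1_over_n] r] by (simp add: o_def)
  have "q z0 u \<le> 0"
  proof (rule LIMSEQ_le[OF qlim i0])
    have "q (Z (r n)) (V (r n)) \<le> 1 / real (Suc (r n))" for n
    proof -
      have "0 \<le> K (r n) * (s (Z (r n)) (V (r n)))\<^sup>2"
        using K[of "r n"] by (intro mult_nonneg_nonneg) auto
      then show ?thesis using ineq[of "r n"] by linarith
    qed
    then show "\<exists>N. \<forall>n\<ge>N. q (Z (r n)) (V (r n)) \<le> 1 / real (Suc (r n))" by blast
  qed
  moreover have "s z0 u = 0"
  proof (rule ccontr)
    assume "s z0 u \<noteq> 0"
    then have sp: "(s z0 u)\<^sup>2 > 0" by simp
    have s2: "(\<lambda>n. (s (Z (r n)) (V (r n)))\<^sup>2) \<longlonglongrightarrow> (s z0 u)\<^sup>2" by (intro tendsto_intros slim)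
    have ev1: "\<forall>\<^sub>F n in sequentially. (s z0 u)\<^sup>2 / 2 < (s (Z (r n)) (V (r n)))\<^sup>2"
      using order_tendstoD(1)[OF s2, of "(s z0 u)\<^sup>2 / 2"] sp by linarith
    have ev2: "\<forall>\<^sub>F n in sequentially. q z0 u - 1 < q (Z (r n)) (V (r n))"
      using order_tendstoD(1)[OF qlim, of "q z0 u - 1"] by simp
    have ev3: "\<forall>\<^sub>F n in sequentially. real n > (2 - q z0 u) * 2 / (s z0 u)\<^sup>2"
      using filterlim_real_sequentially unfolding filterlim_at_top_dense by blast
    have "\<forall>\<^sub>F n in sequentially. False"
      using ev1 ev2 ev3
    proof eventually_elim
      case (elim n)
      have "(2 - q z0 u) < real n * ((s z0 u)\<^sup>2 / 2)"
        using elim(3) sp by (simp add: pos_divide_less_eq)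
      also have "\<dots> \<le> K (r n) * (s (Z (r n)) (V (r n)))\<^sup>2"
        using elim(1) K[of "r n"] rn[of n] sp by (intro mult_mono) auto
      also have "\<dots> < 1 / Suc (r n) - q (Z (r n)) (V (r n))" using ineq[of "r n"] by linarith
      also have "\<dots> \<le> 1 - q (Z (r n)) (V (r n))" by simp
      finally show False using elim(2) by linarith
    qed
    then show False by simp
  qed
  moreover have "u \<noteq> 0" using u by auto
  ultimately show False
    using pos[of u] u by (simp add: q_def s_def)
qed

lemma isCont_smooth: "open S \<Longrightarrow> smooth_on S f \<Longrightarrow> z \<in> S \<Longrightarrow> isCont f z"
  using smooth_on_continuous continuous_on_eq_continuous_at by blast

text \<open>The inverse of a complex linear bijection is complex linear, so the real inverse function theorem yields a
  holomorphic inverse.\<close>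
lemma hol_inverse_function:
  fixes G :: "complex^'m::finite \<Rightarrow> complex^'m"
  assumes D: "open D" "z0 \<in> D" and G: "\<And>i. hol_on D (\<lambda>z. G z $ i)"
    and inj: "\<And>v. (\<And>i. (\<Sum>j\<in>UNIV. v $ j * dz j (\<lambda>z. G z $ i) z0) = 0) \<Longrightarrow> v = 0"
  shows "\<exists>U V g. open U \<and> U \<subseteq> D \<and> z0 \<in> U \<and> open V \<and> homeomorphism U V G g \<and> (\<forall>i. hol_on V (\<lambda>y. g y $ i))"
proof -
  define L where "L z v = (\<chi> i. \<Sum>j\<in>UNIV. v $ j * dz j (\<lambda>z. G z $ i) z)" for z v
  have Gh: "hol_at (\<lambda>z. G z $ i) z" if "z \<in> D" for i z using G that by (simp add: hol_on_iff)
  have derG: "(G has_derivative L z) (at z)" if "z \<in> D" for z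
    unfolding L_def by (rule hol_map_has_derivative[OF Gh[OF that]])
  have bl: "bounded_linear (L z)" if "z \<in> D" for z
    by (rule has_derivative_bounded_linear[OF derG[OF that]])
  have sG: "smooth_on D G" by (intro smooth_on_vec D hol_on_smooth G)
  have Lf: "L z = frechet_derivative G (at z)" if "z \<in> D" for z
    by (rule frechet_derivative_at[OF derG[OF that]])
  define F where "F z = Blinfun (L z)" for z
  have F: "blinfun_apply (F z) = L z" if "z \<in> D" for z
    using bl[OF that] by (simp add: F_def bounded_linear_Blinfun_apply)
  have contF: "continuous_on D F"
  proof (rule continuous_on_blinfun_componentwise)
    fix e :: "complex^'m"
    have "continuous_on D (\<lambda>z. frechet_derivative G (at z) e)"
      by (rule smooth_on_continuous[OF smooth_on_frechet_derivative[OF sG]])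
    then show "continuous_on D (\<lambda>z. blinfun_apply (F z) e)"
      by (rule continuous_on_eq) (simp only: F Lf)
  qed
  have linL: "linear (L z0)" by (rule bounded_linear.linear[OF bl[OF D(2)]])
  have "inj (L z0)"
  proof (rule linear_injective_0[OF linL, THEN iffD2], intro allI impI)
    fix v assume "L z0 v = 0"
    then have "(\<Sum>j\<in>UNIV. v $ j * dz j (\<lambda>z. G z $ i) z0) = 0" for i
      by (simp add: L_def vec_eq_iff)
    then show "v = 0" by (rule inj)
  qed
  then obtain h where h: "linear h" "h \<circ> L z0 = id"
    using linear_injective_left_inverse[OF linL] by blast
  have bh: "bounded_linear h" using h(1) unfolding linear_conv_bounded_linear .
  have inv: "Blinfun h o\<^sub>L F z0 = id_blinfun"
  proof (rule blinfun_eqI)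
    fix v
    have "h (L z0 v) = v" using fun_cong[OF h(2), of v] by simp
    then show "blinfun_apply (Blinfun h o\<^sub>L F z0) v = blinfun_apply id_blinfun v"
      by (simp add: F[OF D(2)] bounded_linear_Blinfun_apply[OF bh])
  qed
  have derF: "(G has_derivative blinfun_apply (F z)) (at z)" if "z \<in> D" for z
    using derG[OF that] F[OF that] by simp
  obtain U V g g' where U: "open U" "U \<subseteq> D" "z0 \<in> U" "open V" "G z0 \<in> V" and hom: "homeomorphism U V G g"
    and derg: "\<And>y. y \<in> V \<Longrightarrow> (g has_derivative (g' y)) (at y)"
    and g': "\<And>y. y \<in> V \<Longrightarrow> g' y = inv (blinfun_apply (F (g y)))"
    and bij: "\<And>y. y \<in> V \<Longrightarrow> bij (blinfun_apply (F (g y)))"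
  proof (rule inverse_function_theorem[OF D(1) derF contF D(2) inv])
    fix U V g g'
    assume "open U" "U \<subseteq> D" "z0 \<in> U" "open V" "G z0 \<in> V" "homeomorphism U V G g"
      and "\<And>y. y \<in> V \<Longrightarrow> (g has_derivative (g' y)) (at y)"
      and "\<And>y. y \<in> V \<Longrightarrow> g' y = inv (blinfun_apply (F (g y)))"
      and "\<And>y. y \<in> V \<Longrightarrow> bij (blinfun_apply (F (g y)))"
    then show thesis by (rule that)
  qed
  have "hol_at (\<lambda>y. g y $ i) y" if y: "y \<in> V" for i y
  proof (rule hol_atI)
    show "((\<lambda>y. g y $ i) has_derivative (\<lambda>v. g' y v $ i)) (at y)"
      by (rule bounded_linear.has_derivative[OF bounded_linear_vec_nth derg[OF y]])
    have gD: "g y \<in> D" using hom y U(2) unfolding homeomorphism_def by blast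
    have b: "bij (L (g y))" using bij[OF y] F[OF gD] by simp
    have Lc: "L (g y) (a *s w) = a *s L (g y) w" for a w
      by (simp add: L_def vec_eq_iff sum_distrib_left mult_ac)
    show "g' y (a *s v) $ i = a * g' y v $ i" for a v
    proof -
      have "L (g y) (a *s inv (L (g y)) v) = a *s v"
        using b by (simp add: Lc bij_is_surj surj_f_inv_f)
      then have "inv (L (g y)) (a *s v) = a *s inv (L (g y)) v"
        using b by (metis bij_is_inj inv_f_f)
      then show ?thesis using g'[OF y] F[OF gD] by simp
    qed
  qed
  then show ?thesis
    using U hom by (intro exI[of _ U] exI[of _ V] exI[of _ g]) (auto simp: hol_on_iff)
qed

text \<open>On a coordinate subspace, derivatives in directions of the subspace see only the restriction.\<close>
lemma ddbar_cproj:
  assumes S: "open S" and u: "smooth_on S u" and z: "z \<in> S" "cproj J z = z" and jk: "j \<in> J" "k \<in> J"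
  shows "dz j (dzbar k (\<lambda>y. u (cproj J y))) z = dz j (dzbar k u) z"
proof -
  let ?T = "cproj J -` S"
  have T: "open ?T" "z \<in> ?T"
    using open_vimage[OF S continuous_cproj] z by simp_all
  have "dz j (dzbar k (\<lambda>y. u (cproj J y))) z = dz j (\<lambda>y. dzbar k u (cproj J y)) z"
  proof (rule dz_cong_open(1)[OF T])
    show "dzbar k (\<lambda>y. u (cproj J y)) y = dzbar k u (cproj J y)" if "y \<in> ?T" for y
      using dz_compose_cproj(2)[OF smooth_on_differentiable[OF u], of J y k] that jk by simp
  qed
  also have "\<dots> = dz j (dzbar k u) z"
    using dz_compose_cproj(1)[OF smooth_on_differentiable[OF smooth_on_dz(2)[OF S u]], of J z j k] z jk by simp
  finally show ?thesis .
qed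

lemma push_eq_mult: "v \<in> coords I \<Longrightarrow> push I J v = J *v v"
  unfolding push_def matrix_vector_mult_def
  by (auto simp: vec_eq_iff coords_def intro!: sum.mono_neutral_left)

section \<open>Charts adapted to a family over the disk\<close>

text \<open>Only permutations that fix \<open>b\<close> contribute, and they never use the other entries of column \<open>b\<close>.\<close>
lemma det_unit_row:
  fixes A B :: "complex^'n::finite^'n"
  assumes row: "\<And>j. A $ b $ j = (if j = b then 1 else 0)"
    and B: "\<And>i j. B $ i $ j = (if i = b \<or> j = b then (if i = j then 1 else 0) else A $ i $ j)"
  shows "det A = det B"
  unfolding det_def
proof (rule sum.cong[OF refl])
  fix \<pi> :: "'n \<Rightarrow> 'n" assume "\<pi> \<in> {\<pi>. \<pi> permutes UNIV}"
  then have \<pi>: "inj \<pi>" using permutes_inj by auto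
  have "(\<Prod>i\<in>UNIV. A $ i $ \<pi> i) = (\<Prod>i\<in>UNIV. B $ i $ \<pi> i)"
  proof (cases "\<pi> b = b")
    case True
    have "A $ i $ \<pi> i = B $ i $ \<pi> i" for i
      using True row[of b] injD[OF \<pi>, of i b] by (auto simp: B)
    then show ?thesis by simp
  next
    case False
    then have "(\<Prod>i\<in>UNIV. A $ i $ \<pi> i) = 0" "(\<Prod>i\<in>UNIV. B $ i $ \<pi> i) = 0"
      using row[of "\<pi> b"] by (auto intro!: prod_zero bexI[of _ b] simp: B)
    then show ?thesis by (simp only:)
  qed
  then show "of_int (sign \<pi>) * (\<Prod>i\<in>UNIV. A $ i $ \<pi> i) = of_int (sign \<pi>) * (\<Prod>i\<in>UNIV. B $ i $ \<pi> i)"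
    by simp
qed

context cx_manifold
begin

lemma continuous_map_par:
  assumes c: "c \<in> maximal_atlas M"
  shows "continuous_map (top_of_set (coord_dom M c (fst c))) (mtop M) (chart_inv M c)"
  unfolding continuous_map_def
proof (intro conjI allI impI)
  show "chart_inv M c \<in> topspace (top_of_set (coord_dom M c (fst c))) \<rightarrow> topspace (mtop M)"
    using par_dom(1) is_chart_subset[OF max_chart[OF c]] by fastforce
  fix V assume V: "openin (mtop M) V"
  have "{z \<in> topspace (top_of_set (coord_dom M c (fst c))). chart_inv M c z \<in> V} = coord_dom M c V"
    using max_coord_dom_par[OF c, of _ V] by auto
  moreover have "openin (top_of_set (coord_dom M c (fst c))) (coord_dom M c V)"
    using max_open_coord_dom[OF c V] coord_dom_subset by (rule_tac open_subset)
  ultimately show "openin (top_of_set (coord_dom M c (fst c))) {z \<in> topspace (top_of_set (coord_dom M c (fst c))). chart_inv M c z \<in> V}"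
    by simp
qed

lemma continuous_map_chart:
  assumes c: "c \<in> maximal_atlas M"
  shows "continuous_map (subtopology (mtop M) (fst c)) euclidean (snd c)"
proof -
  have "continuous_map (subtopology (mtop M) (fst c)) (top_of_set (snd c ` fst c)) (snd c)"
    using max_chart[OF c] by (auto simp: is_chart_def homeomorphic_imp_continuous_map)
  then show ?thesis using continuous_map_in_subtopology by blast
qed

end

locale kaehler_disk_family =
  fixes X :: "('a, 'm::finite) cmanifold" and p :: "'a \<Rightarrow> complex" and b :: 'm
  assumes family: "kaehler_family X p" and b: "b \<in> midx X"

sublocale kaehler_disk_family \<subseteq> cx_manifold X
  using family by unfold_locales (simp add: kaehler_family_def)

context kaehler_disk_family
begin

lemma p_hol:
  assumes c: "c \<in> maximal_atlas X" and z: "z \<in> coord_dom X c (fst c)"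
  shows "hol_at (coord_fun X c p) z"
proof -
  have x: "chart_inv X c z \<in> fst c" by (rule par_dom(1)[OF z])
  then obtain d where d: "d \<in> atlas X" "chart_inv X c z \<in> fst d"
    using point_in_chart is_chart_subset[OF max_chart[OF c]] by blast
  note dM = atlas_maximal[OF d(1)]
  let ?S = "coord_dom X c (fst d)"
  have zS: "z \<in> ?S" using z d(2) max_coord_dom_par[OF c, of z "fst d"] by blast
  have "transition X c d z \<in> coord_dom X d (fst d)" by (rule trans_coord_dom[OF c dM _ zS]) blast
  then have "transition X c d z \<in> coord_dom X d (topspace (mtop X))"
    using coord_dom_mono[OF is_chart_subset[OF max_chart[OF dM]]] by blast
  then have "hol_at (coord_fun X d p) (transition X c d z)"
    using family d(1) by (auto simp: kaehler_family_def hol_fun_def hol_on_iff)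
  then have "hol_at (\<lambda>z. coord_fun X d p (transition X c d z)) z"
    by (rule hol_at_compose[OF trans_hol[OF c dM zS]])
  then show ?thesis
    by (rule hol_at_cong_open[OF max_open_coord_dom[OF c max_openin[OF dM]] zS, rotated])
       (rule coord_fun_trans[OF c dM, symmetric])
qed

lemma p_dz_outside:
  assumes c: "c \<in> maximal_atlas X" and x: "x \<in> fst c" and a: "a \<notin> midx X"
  shows "dz a (coord_fun X c p) (snd c x) = 0"
proof -
  have xc: "snd c x \<in> coord_dom X c (fst c)" using max_coord_dom[OF c x] x by simp
  have xp: "cproj (midx X) (snd c x) = snd c x" by (rule cproj_coords[OF max_coords[OF c x]])
  have "dz a (\<lambda>z. coord_fun X c p (cproj (midx X) z)) (snd c x) = 0"
    using dz_compose_cproj(1)[of "coord_fun X c p" "midx X" "snd c x" a] hol_at_differentiable[OF p_hol[OF c xc]] xp a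
    by simp
  then show ?thesis by (simp add: coord_fun_par[abs_def])
qed

definition dp :: "('a, 'm) chart \<Rightarrow> 'a \<Rightarrow> complex^'m \<Rightarrow> complex" where
  "dp c x v = (\<Sum>j\<in>midx X. dz j (coord_fun X c p) (snd c x) * v $ j)"

text \<open>The differential of the projection is a covector, so it is the same in all charts.\<close>
lemma dp_push:
  assumes c: "c \<in> maximal_atlas X" and d: "d \<in> maximal_atlas X" and x: "x \<in> fst c" "x \<in> fst d"
  shows "dp c x v = dp d x (push (midx X) (jacobian X c d x) v)"
proof -
  let ?I = "midx X" and ?J = "jacobian X c d x"
  have xS: "snd c x \<in> coord_dom X c (fst d)" using max_coord_dom[OF c x(1)] x by simp
  have xd: "snd d x \<in> coord_dom X d (fst d)" using max_coord_dom[OF d x(2)] x by simp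
  have "dz j (coord_fun X c p) (snd c x) = (\<Sum>a\<in>UNIV. dz a (coord_fun X d p) (snd d x) * ?J $ a $ j)" for j
  proof -
    have "dz j (coord_fun X c p) (snd c x) = dz j (\<lambda>z. coord_fun X d p (transition X c d z)) (snd c x)"
      by (rule dz_cong_open(1)[OF max_open_coord_dom[OF c max_openin[OF d]] xS coord_fun_trans[OF c d]])
    also have "\<dots> = (\<Sum>a\<in>UNIV. dz a (coord_fun X d p) (transition X c d (snd c x)) * dz j (\<lambda>z. transition X c d z $ a) (snd c x))"
      by (rule dz_compose(1)[OF trans_hol[OF c d xS]])
         (use hol_at_differentiable[OF p_hol[OF d xd]] trans_point[OF c d x] in simp)
    finally show ?thesis by (simp add: trans_point[OF c d x] jacobian_trans[OF c d x])
  qed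
  moreover have "(\<Sum>a\<in>UNIV. dz a (coord_fun X d p) (snd d x) * ?J $ a $ j) =
      (\<Sum>a\<in>?I. dz a (coord_fun X d p) (snd d x) * ?J $ a $ j)" for j
    by (rule sum.mono_neutral_right) (use p_dz_outside[OF d x(2)] in auto)
  ultimately have "dp c x v = (\<Sum>j\<in>?I. \<Sum>a\<in>?I. dz a (coord_fun X d p) (snd d x) * ?J $ a $ j * v $ j)"
    by (simp add: dp_def sum_distrib_right)
  also have "\<dots> = (\<Sum>a\<in>?I. \<Sum>j\<in>?I. dz a (coord_fun X d p) (snd d x) * ?J $ a $ j * v $ j)"
    by (rule sum.swap)
  also have "\<dots> = dp d x (push ?I ?J v)"
    by (simp add: dp_def push_def sum_distrib_left mult_ac)
  finally show ?thesis .
qed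

lemma push_nonzero:
  assumes c: "c \<in> maximal_atlas X" and d: "d \<in> maximal_atlas X" and x: "x \<in> fst c" "x \<in> fst d"
    and v: "v \<in> coords (midx X)" "v \<noteq> 0"
  shows "push (midx X) (jacobian X c d x) v \<noteq> 0"
proof
  assume "push (midx X) (jacobian X c d x) v = 0"
  then have "jacobian X d c x *v (jacobian X c d x *v v) = 0"
    by (simp add: push_eq_mult[OF v(1)])
  then have "(jacobian X d c x ** jacobian X c d x) *v v = 0"
    by (simp add: matrix_vector_mul_assoc)
  then show False
    using jacobian_chain[OF c d c x(1,2,1)] jacobian_self[OF c x(1)] v(2) by (metis matrix_vector_mul_lid)
qed

definition adapted :: "complex \<Rightarrow> ('a, 'm) chart \<Rightarrow> bool" where
  "adapted t d \<longleftrightarrow> d \<in> maximal_atlas X \<and> (\<forall>x\<in>fst d. snd d x $ b = p x - t)"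

text \<open>A surjective differential is nonzero, and it is complex linear.\<close>
lemma p_partial_nonzero:
  assumes c: "c \<in> atlas X" and x: "x \<in> fst c"
  shows "\<exists>a\<in>midx X. dz a (coord_fun X c p) (snd c x) \<noteq> 0"
proof (rule ccontr)
  note cM = atlas_maximal[OF c]
  assume "\<not> ?thesis"
  then have "dz a (coord_fun X c p) (snd c x) = 0" for a
    using p_dz_outside[OF cM x] by blast
  moreover have "snd c x \<in> coord_dom X c (fst c)" using max_coord_dom[OF cM x] x by simp
  ultimately have "frechet_derivative (coord_fun X c p) (at (snd c x)) v = 0" for v
    using hol_at_frechet[OF p_hol[OF cM]] by simp
  moreover have "surj (frechet_derivative (coord_fun X c p) (at (snd c x)))"
    using family c x by (simp add: kaehler_family_def submersion_def)
  ultimately show False by (metis surjD zero_neq_one)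
qed

text \<open>In a chart \<open>c\<close> some partial derivative \<open>dz a\<close> of \<open>p\<close> is nonzero. Replacing the coordinate \<open>a\<close> by \<open>p - t\<close> is locally
  biholomorphic by the inverse function theorem; as the fibre is modelled on the hyperplane where the coordinate \<open>b\<close>
  vanishes, the coordinates \<open>a\<close> and \<open>b\<close> are moreover exchanged.\<close>
lemma adapted_exists:
  assumes c: "c \<in> atlas X" and x0: "x0 \<in> fst c"
  shows "\<exists>d. adapted t d \<and> x0 \<in> fst d \<and> fst d \<subseteq> fst c"
proof -
  let ?I = "midx X"
  note cM = atlas_maximal[OF c]
  define P where "P = coord_fun X c p"
  define D where "D = coord_dom X c (fst c)"
  define z0 where "z0 = snd c x0"
  have D: "open D" unfolding D_def by (rule max_open_coord_dom[OF cM max_openin[OF cM]])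
  have z0: "z0 \<in> D" unfolding D_def z0_def using max_coord_dom[OF cM x0] x0 by simp
  obtain a where a: "a \<in> ?I" "dz a P z0 \<noteq> 0"
    using p_partial_nonzero[OF c x0] unfolding P_def z0_def by blast
  \<comment> \<open>For \<open>a = b\<close> the first case takes precedence, and the map only replaces one coordinate.\<close>
  define G where "G z = (\<chi> i. if i = b then P z - t else if i = a then z $ b else z $ i)" for z
  have hP: "hol_at P z" if "z \<in> D" for z using p_hol[OF cM] that unfolding P_def D_def by blast
  have Gi: "(\<lambda>z. G z $ i) = (if i = b then (\<lambda>z. P z - t) else if i = a then (\<lambda>z. z $ b) else (\<lambda>z. z $ i))" for i
    by (simp add: G_def fun_eq_iff)
  have hG: "hol_on D (\<lambda>z. G z $ i)" for i
    unfolding Gi hol_on_iff using hP by (auto intro: hol_at_diff_const hol_at_component)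
  have dP: "dz j (\<lambda>z. P z - t) z0 = dz j P z0" for j
    using dz_add(1)[OF hol_at_differentiable[OF hP[OF z0]] hol_at_differentiable[OF hol_at_const[of "- t"]], of j]
    by (simp add: dz_const)
  have inj: "v = 0" if v: "\<And>i. (\<Sum>j\<in>UNIV. v $ j * dz j (\<lambda>z. G z $ i) z0) = 0" for v
  proof -
    have comp: "(\<Sum>j\<in>UNIV. v $ j * dz j (\<lambda>z. z $ i) z0) = v $ i" for i
    proof -
      have "(\<Sum>j\<in>UNIV. v $ j * dz j (\<lambda>z. z $ i) z0) = (\<Sum>j\<in>UNIV. if j = i then v $ i else 0)"
        by (rule sum.cong) (auto simp: dz_component)
      then show ?thesis by simp
    qed
    have 1: "v $ i = 0" if "i \<noteq> a" for i
    proof (cases "i = b")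
      case True
      then show ?thesis using v[of a] comp[of b] that unfolding Gi by simp
    next
      case False
      then show ?thesis using v[of i] comp[of i] that unfolding Gi by simp
    qed
    have "(\<Sum>j\<in>UNIV. v $ j * dz j P z0) = 0" using v[of b] unfolding Gi by (simp add: dP)
    also have "(\<Sum>j\<in>UNIV. v $ j * dz j P z0) = (\<Sum>j\<in>UNIV. if j = a then v $ a * dz a P z0 else 0)"
      by (rule sum.cong) (use 1 in auto)
    finally have "v $ a = 0" using a(2) by simp
    with 1 have "v $ i = 0" for i by (cases "i = a") auto
    then show "v = 0" by (simp add: vec_eq_iff)
  qed
  obtain U' V g where U': "open U'" "U' \<subseteq> D" "z0 \<in> U'" and V: "open V" and hom: "homeomorphism U' V G g"
    and hg: "\<And>i. hol_on V (\<lambda>y. g y $ i)"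
    using hol_inverse_function[OF D z0 hG inj] by blast
  have Gg: "G (g y) = y" "g y \<in> U'" if "y \<in> V" for y using hom that unfolding homeomorphism_def by blast+
  have gG: "g (G z) = z" "G z \<in> V" if "z \<in> U'" for z using hom that unfolding homeomorphism_def by blast+
  have Gcoords: "G z \<in> coords ?I \<longleftrightarrow> z \<in> coords ?I" for z
    using a(1) b by (auto simp: coords_def G_def)
  define U where "U = {x \<in> fst c. snd c x \<in> U'}"
  define \<phi> where "\<phi> x = G (snd c x)" for x
  define \<psi> where "\<psi> y = chart_inv X c (g y)" for y
  have UM: "openin (mtop X) U" unfolding U_def by (rule is_chart_open_vimage[OF max_chart[OF cM] U'(1)])
  have xU: "x0 \<in> U" using x0 U'(3) by (simp add: U_def z0_def)
  have \<psi>\<phi>: "\<psi> (\<phi> x) = x" if "x \<in> U" for x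
    using that gG(1) max_par[OF cM] by (simp add: U_def \<phi>_def \<psi>_def)
  have gI: "g y \<in> coords ?I" if "y \<in> V" "y \<in> coords ?I" for y
    using Gcoords[of "g y"] Gg(1)[OF that(1)] that(2) by simp
  have gD: "g y \<in> D" if "y \<in> V" for y using Gg(2)[OF that] U'(2) by blast
  have par_g: "chart_inv X c (g y) \<in> fst c" "snd c (chart_inv X c (g y)) = g y" if "y \<in> V" "y \<in> coords ?I" for y
    using par_dom[of "g y" X c "fst c"] gD[OF that(1)] cproj_coords[OF gI[OF that]] unfolding D_def by auto
  have \<psi>U: "\<psi> y \<in> U" "\<phi> (\<psi> y) = y" if "y \<in> V" "y \<in> coords ?I" for y
    using par_g[OF that] Gg[OF that(1)] by (simp_all add: U_def \<phi>_def \<psi>_def)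
  have \<phi>U: "\<phi> ` U = coords ?I \<inter> V"
  proof
    show "\<phi> ` U \<subseteq> coords ?I \<inter> V"
      using gG(2) max_coords[OF cM] Gcoords by (auto simp: U_def \<phi>_def)
    show "coords ?I \<inter> V \<subseteq> \<phi> ` U" using \<psi>U by (metis IntE image_eqI subsetI)
  qed
  have contG: "continuous_on U' G" using hom by (simp add: homeomorphism_def)
  have "homeomorphic_maps (subtopology (mtop X) U) (top_of_set (\<phi> ` U)) \<phi> \<psi>"
    unfolding homeomorphic_maps_def
  proof (intro conjI ballI)
    have tU: "topspace (subtopology (mtop X) U) = U" using openin_subset[OF UM] by auto
    have "continuous_map (subtopology (mtop X) U) euclidean (snd c)"
      using continuous_map_from_subtopology_mono[OF continuous_map_chart[OF cM]] by (auto simp: U_def)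
    then have "continuous_map (subtopology (mtop X) U) (top_of_set U') (snd c)"
      using tU by (auto simp: continuous_map_in_subtopology U_def)
    moreover have "continuous_map (top_of_set U') euclidean G"
      using contG by simp
    ultimately have "continuous_map (subtopology (mtop X) U) euclidean (G \<circ> snd c)"
      by (rule continuous_map_compose)
    then show "continuous_map (subtopology (mtop X) U) (top_of_set (\<phi> ` U)) \<phi>"
      using tU by (auto simp: continuous_map_in_subtopology \<phi>_def[abs_def] o_def)
    have "continuous_map (top_of_set (\<phi> ` U)) euclidean g"
      using hom continuous_on_subset[of V g "\<phi> ` U"] \<phi>U by (auto simp: homeomorphism_def)
    then have "continuous_map (top_of_set (\<phi> ` U)) (top_of_set D) g"
      using gD \<phi>U by (auto simp: continuous_map_in_subtopology)
    then have "continuous_map (top_of_set (\<phi> ` U)) (mtop X) (chart_inv X c \<circ> g)"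
      using continuous_map_par[OF cM] unfolding D_def by (rule continuous_map_compose)
    then show "continuous_map (top_of_set (\<phi> ` U)) (subtopology (mtop X) U) \<psi>"
      using \<psi>U(1) \<phi>U by (auto simp: continuous_map_in_subtopology \<psi>_def[abs_def] o_def)
    show "\<psi> (\<phi> x) = x" if "x \<in> topspace (subtopology (mtop X) U)" for x using that tU \<psi>\<phi> by simp
    show "\<phi> (\<psi> y) = y" if "y \<in> topspace (top_of_set (\<phi> ` U))" for y using that \<phi>U \<psi>U(2) by simp
  qed
  then have "homeomorphic_map (subtopology (mtop X) U) (top_of_set (\<phi> ` U)) \<phi>"
    using homeomorphic_map_maps by blast
  moreover have "openin (top_of_set (coords ?I)) (\<phi> ` U)"
    unfolding \<phi>U using V by (rule openin_open_Int)
  ultimately have chart: "is_chart X (U, \<phi>)"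
    using UM by (simp add: is_chart_def)
  have parU: "chart_inv X (U, \<phi>) z = chart_inv X c (g (cproj ?I z))" "cproj ?I z \<in> V" if "z \<in> coord_dom X (U, \<phi>) W" for z W
  proof -
    have "cproj ?I z \<in> \<phi> ` U" using that by (auto simp: coord_dom_def)
    then have *: "cproj ?I z \<in> V" "cproj ?I z \<in> coords ?I" using \<phi>U by auto
    then show "cproj ?I z \<in> V" by simp
    have "\<phi> (\<psi> (cproj ?I z)) = cproj ?I z" "\<psi> (cproj ?I z) \<in> U" using \<psi>U[OF *] by auto
    then have "chart_inv X (U, \<phi>) (\<phi> (\<psi> (cproj ?I z))) = \<psi> (cproj ?I z)"
      by (intro par_chart[where c = "(U, \<phi>)", simplified]) (use is_chart_inj[OF chart] in auto)
    then show "chart_inv X (U, \<phi>) z = chart_inv X c (g (cproj ?I z))"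
      using \<open>\<phi> (\<psi> (cproj ?I z)) = cproj ?I z\<close> by (simp add: \<psi>_def)
  qed
  have "hol_transition X (U, \<phi>) d \<and> hol_transition X d (U, \<phi>)" if d: "d \<in> atlas X" for d
  proof
    note dM = atlas_maximal[OF d]
    show "hol_transition X (U, \<phi>) d"
      unfolding hol_transition_def hol_on_iff
    proof (intro ballI)
      fix i z assume i: "i \<in> ?I" and z: "z \<in> coord_dom X (U, \<phi>) (fst d)"
      have o: "open (coord_dom X (U, \<phi>) (fst d))" by (rule open_coord_dom[OF chart max_openin[OF dM]])
      have "chart_inv X (U, \<phi>) z \<in> fst d" using coord_dom_par[OF is_chart_inj[OF chart], of z X "fst d"] z by blast
      then have w: "g (cproj ?I z) \<in> coord_dom X c (fst d)"
        using parU[OF z] gD[OF parU(2)[OF z]] max_coord_dom_par[OF cM, of "g (cproj ?I z)" "fst d"] unfolding D_def by simp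
      have "hol_at (\<lambda>y. g (cproj ?I y) $ k) z" for k
        by (rule hol_at_compose[OF hol_at_cproj, where u = "\<lambda>y. g y $ k"])
           (use hg[of k] parU(2)[OF z] in \<open>simp add: hol_on_iff\<close>)
      then have "hol_at (\<lambda>y. transition X c d (g (cproj ?I y)) $ i) z"
        by (rule hol_at_compose[where u = "\<lambda>w. transition X c d w $ i"]) (rule trans_hol[OF cM dM w])
      then show "hol_at (coord_fun X (U, \<phi>) (\<lambda>x. snd d x $ i)) z"
        by (rule hol_at_cong_open[OF o z, rotated]) (use parU(1) i in \<open>simp add: coord_fun_par transition_def\<close>)
    qed
    show "hol_transition X d (U, \<phi>)"
      unfolding hol_transition_def hol_on_iff
    proof (intro ballI)
      fix i z assume i: "i \<in> ?I" and z: "z \<in> coord_dom X d (fst (U, \<phi>))"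
      have o: "open (coord_dom X d U)" by (rule max_open_coord_dom[OF dM UM])
      have Uc: "U \<subseteq> fst c" by (auto simp: U_def)
      have sub: "coord_dom X d U \<subseteq> coord_dom X d (fst c)" by (rule coord_dom_mono[OF Uc])
      have zc: "z \<in> coord_dom X d (fst c)" using z sub by auto
      have "transition X d c z \<in> D" unfolding D_def by (rule trans_coord_dom[OF dM cM _ zc]) blast
      then have "hol_at (\<lambda>y. G (transition X d c y) $ i) z"
        using hG[of i] by (intro hol_at_compose[OF trans_hol[OF dM cM zc], where u = "\<lambda>w. G w $ i"]) (simp add: hol_on_iff)
      moreover have "G (transition X d c y) $ i = coord_fun X d (\<lambda>x. snd (U, \<phi>) x $ i) y" if y: "y \<in> coord_dom X d U" for y
      proof -
        have e: "snd c (chart_inv X d y) = cproj ?I (transition X d c y)"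
          using trans_cproj[OF cM _ dM, of y] y sub by auto
        have "P (cproj ?I (transition X d c y)) = P (transition X d c y)" by (simp add: P_def coord_fun_par)
        then show ?thesis using i b by (simp add: coord_fun_par \<phi>_def e G_def)
      qed
      ultimately show "hol_at (coord_fun X d (\<lambda>x. snd (U, \<phi>) x $ i)) z"
        by (intro hol_at_cong_open[OF o _ _ \<open>hol_at (\<lambda>y. G (transition X d c y) $ i) z\<close>]) (use z in auto)
    qed
  qed
  then have "(U, \<phi>) \<in> maximal_atlas X"
    using chart by (simp add: maximal_atlas_def)
  moreover have "\<phi> x $ b = p x - t" if "x \<in> U" for x
    using max_par[OF cM, of x] that by (simp add: \<phi>_def G_def P_def coord_fun_par U_def)
  ultimately show ?thesis
    using xU by (intro exI[of _ "(U, \<phi>)"]) (auto simp: adapted_def U_def)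
qed

lemma adapted_dp:
  assumes d: "adapted t d" and x: "x \<in> fst d"
  shows "dp d x w = w $ b"
proof -
  have dM: "d \<in> maximal_atlas X" using d by (simp add: adapted_def)
  let ?S = "coord_dom X d (fst d)"
  have S: "open ?S" by (rule max_open_coord_dom[OF dM max_openin[OF dM]])
  have xS: "snd d x \<in> ?S" using max_coord_dom[OF dM x] x by simp
  have eq: "coord_fun X d p z = z $ b + t" if "z \<in> ?S" for z
  proof -
    have "snd d (chart_inv X d z) $ b = p (chart_inv X d z) - t"
      using d par_dom(1)[OF that] by (simp add: adapted_def)
    then show ?thesis using par_dom(2)[OF that] b by (simp add: coord_fun_par)
  qed
  have "dz j (coord_fun X d p) (snd d x) = (if j = b then 1 else 0)" for j
  proof -
    have "dz j (\<lambda>z. z $ b + t) (snd d x) = dz j (\<lambda>z. z $ b) (snd d x) + dz j (\<lambda>_. t) (snd d x)"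
      by (intro dz_add hol_at_differentiable hol_at_component hol_at_const)
    then show ?thesis
      using dz_cong_open(1)[OF S xS eq, where j = j] by (auto simp: dz_component dz_const)
  qed
  then have "dp d x w = (\<Sum>j\<in>midx X. if j = b then w $ b else 0)"
    unfolding dp_def by (intro sum.cong) auto
  then show ?thesis using b by simp
qed

lemma herm_slice:
  assumes "w $ b = 0"
  shows "herm (midx X) A w = herm (midx X - {b}) A w"
proof -
  have "herm (midx X - {b}) A w = (\<Sum>j\<in>midx X - {b}. \<Sum>k\<in>midx X. A $ j $ k * w $ j * cnj (w $ k))"
    unfolding herm_def by (intro sum.cong refl sum.mono_neutral_left) (use assms in auto)
  also have "\<dots> = herm (midx X) A w"
    unfolding herm_def by (intro sum.mono_neutral_left) (use assms in auto)
  finally show ?thesis by simp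
qed

lemma levi_push:
  assumes c: "c \<in> maximal_atlas X" and d: "d \<in> maximal_atlas X" and x: "x \<in> fst c" "x \<in> fst d"
    and V: "openin (mtop X) V" "x \<in> V" and f: "smooth_fun_on X V f"
  shows "herm (midx X) (i_ddbar X f c x) v = herm (midx X) (i_ddbar X f d x) (push (midx X) (jacobian X c d x) v)"
  by (rule herm_congruence) (simp add: levi_transfer[OF c d x V f] levi_sum_midx)

lemma adapted_slice_point:
  assumes d: "adapted t d" and x: "x \<in> fst d" "p x = t"
  shows "snd d x \<in> coords (midx X - {b})" "cproj (midx X - {b}) (snd d x) = snd d x"
proof -
  have "snd d x \<in> coords (midx X)" "snd d x $ b = 0"
    using d x max_coords by (auto simp: adapted_def)
  then show "snd d x \<in> coords (midx X - {b})" by (auto simp: coords_def)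
  then show "cproj (midx X - {b}) (snd d x) = snd d x" by (rule cproj_coords)
qed

lemma adapted_slice:
  assumes d: "adapted t d" and z: "cproj (midx X - {b}) z \<in> coord_dom X d V"
  shows "p (chart_inv X d (cproj (midx X - {b}) z)) = t"
proof -
  have z': "cproj (midx X - {b}) z \<in> coord_dom X d (fst d)" using z coord_dom_subset by blast
  have "snd d (chart_inv X d (cproj (midx X - {b}) z)) $ b = 0"
    unfolding par_dom(2)[OF z'] by simp
  then show ?thesis using d par_dom(1)[OF z'] by (simp add: adapted_def)
qed

lemma levi_slice:
  assumes d: "adapted (p x) d" and x: "x \<in> fst d"
    and V: "openin (mtop X) V" "x \<in> V" and f: "smooth_fun_on X V f" and w: "w $ b = 0"
  shows "herm (midx X) (i_ddbar X f d x) w = herm (midx X - {b})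
     (\<chi> j k. dz j (dzbar k (\<lambda>z. coord_fun X d (\<lambda>y. complex_of_real (f y)) (cproj (midx X - {b}) z))) (snd d x)) w"
proof -
  have dM: "d \<in> maximal_atlas X" using d by (simp add: adapted_def)
  have S: "open (coord_dom X d V)" by (rule max_open_coord_dom[OF dM V(1)])
  have xS: "snd d x \<in> coord_dom X d V" using max_coord_dom[OF dM x] V(2) by simp
  show ?thesis
    unfolding herm_slice[OF w] i_ddbar_def
    by (rule herm_cong)
       (simp add: ddbar_cproj[OF S coord_fun_of_real_smooth[OF V(1) f dM] xS adapted_slice_point(2)[OF d x refl]])
qed

text \<open>In an adapted chart the fibre is a coordinate subspace and vertical vectors are tangent to it, so their Levi form
  is that of the restriction to the fibre. This is why the extension of a function off a fibre may be arbitrary, and why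
  functions of the base behave like constants.\<close>
lemma vertical_levi_cong:
  assumes c: "c \<in> maximal_atlas X" and x: "x \<in> fst c" and V: "openin (mtop X) V" "x \<in> V"
    and f: "smooth_fun_on X V f" and g: "smooth_fun_on X V g"
    and fg: "\<And>y. y \<in> V \<Longrightarrow> p y = p x \<Longrightarrow> f y = g y" and v: "dp c x v = 0"
  shows "herm (midx X) (i_ddbar X f c x) v = herm (midx X) (i_ddbar X g c x) v"
proof -
  let ?J = "midx X - {b}"
  obtain c' where c': "c' \<in> atlas X" "x \<in> fst c'"
    using point_in_chart V openin_subset by blast
  obtain d where d: "adapted (p x) d" "x \<in> fst d" using adapted_exists[OF c', of "p x"] by blast
  have dM: "d \<in> maximal_atlas X" using d by (simp add: adapted_def)
  define w where "w = push (midx X) (jacobian X c d x) v"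
  have w: "w $ b = 0"
    using adapted_dp[OF d, of w] dp_push[OF c dM x d(2), of v] v by (simp add: w_def)
  let ?T = "cproj ?J -` coord_dom X d V"
  have T: "open ?T" by (rule open_vimage[OF max_open_coord_dom[OF dM V(1)] continuous_cproj])
  have xT: "snd d x \<in> ?T"
    using max_coord_dom[OF dM d(2)] V(2) adapted_slice_point(2)[OF d(1,2) refl] by simp
  have "coord_fun X d (\<lambda>y. complex_of_real (f y)) (cproj ?J z) = coord_fun X d (\<lambda>y. complex_of_real (g y)) (cproj ?J z)"
    if "z \<in> ?T" for z
    using fg[of "chart_inv X d (cproj ?J z)"] adapted_slice[OF d(1), of z V] that max_parD[OF dM, of "cproj ?J z" V]
    by (simp add: coord_fun_par)
  note e = dz_cong_open(2)[OF T _ this]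
  have "dz j (dzbar k (\<lambda>z. coord_fun X d (\<lambda>y. complex_of_real (f y)) (cproj ?J z))) (snd d x) =
     dz j (dzbar k (\<lambda>z. coord_fun X d (\<lambda>y. complex_of_real (g y)) (cproj ?J z))) (snd d x)" for j k
    by (rule dz_cong_open(1)[OF T xT]) (rule e)
  then show ?thesis
    unfolding levi_push[OF c dM x d(2) V f] levi_push[OF c dM x d(2) V g] w_def[symmetric]
      levi_slice[OF d V f w] levi_slice[OF d V g w] by simp
qed

end

section \<open>Bump functions, and fibres in adapted charts\<close>

context cx_manifold
begin

lemma coord_dom_topspace:
  assumes "c \<in> maximal_atlas M"
  shows "coord_dom M c (topspace (mtop M)) = coord_dom M c (fst c)"
  using is_chart_subset[OF max_chart[OF assms]] by (auto simp: coord_dom_def)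

lemma smooth_fun_on_add:
  assumes "openin (mtop M) V" "smooth_fun_on M V f" "smooth_fun_on M V g"
  shows "smooth_fun_on M V (\<lambda>x. f x + g x)"
  using assms max_open_coord_dom[OF atlas_maximal assms(1)] unfolding smooth_fun_on_def coord_fun_def
  by (auto intro: smooth_on_add)

lemma smooth_fun_on_mult:
  fixes f g :: "'a \<Rightarrow> real"
  assumes "openin (mtop M) V" "smooth_fun_on M V f" "smooth_fun_on M V g"
  shows "smooth_fun_on M V (\<lambda>x. f x * g x)"
  using assms max_open_coord_dom[OF atlas_maximal assms(1)] unfolding smooth_fun_on_def coord_fun_def
  by (auto intro: smooth_on_mult)

lemma smooth_fun_on_const:
  assumes "openin (mtop M) V"
  shows "smooth_fun_on M V (\<lambda>x. k)"
  using max_open_coord_dom[OF atlas_maximal assms(1)] unfolding smooth_fun_on_def coord_fun_def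
  by (auto intro: smooth_on_const)

lemma smooth_fun_on_inverse:
  fixes f :: "'a \<Rightarrow> real"
  assumes "openin (mtop M) V" "smooth_fun_on M V f" "\<And>x. x \<in> V \<Longrightarrow> f x \<noteq> 0"
  shows "smooth_fun_on M V (\<lambda>x. inverse (f x))"
  unfolding smooth_fun_on_def
proof
  fix c assume c: "c \<in> atlas M"
  have "smooth_on (coord_dom M c V) (\<lambda>z. inverse (coord_fun M c f z))"
  proof (rule smooth_on_inverse[OF max_open_coord_dom[OF atlas_maximal[OF c] assms(1)]])
    show "smooth_on (coord_dom M c V) (coord_fun M c f)" using assms(2) c by (simp add: smooth_fun_on_def)
    show "coord_fun M c f z \<noteq> 0" if "z \<in> coord_dom M c V" for z
      using assms(3)[OF max_parD[OF atlas_maximal[OF c] that]] by (simp add: coord_fun_par)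
  qed
  then show "smooth_on (coord_dom M c V) (coord_fun M c (\<lambda>x. inverse (f x)))"
    by (simp add: coord_fun_def)
qed

lemma smooth_fun_on_sum:
  fixes f :: "'i \<Rightarrow> 'a \<Rightarrow> real"
  assumes "openin (mtop M) V" "\<And>i. i \<in> A \<Longrightarrow> smooth_fun_on M V (f i)"
  shows "smooth_fun_on M V (\<lambda>x. \<Sum>i\<in>A. f i x)"
  using assms(2)
  by (induction A rule: infinite_finite_induct)
     (simp_all add: smooth_fun_on_const smooth_fun_on_add assms(1))

lemma smooth_fun_on_continuous:
  assumes V: "openin (mtop M) V" and f: "smooth_fun_on M V f" and B: "open B"
  shows "openin (mtop M) {x \<in> V. f x \<in> B}"
proof (subst openin_subopen, intro ballI)
  fix x assume x: "x \<in> {x \<in> V. f x \<in> B}"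
  then obtain c where c: "c \<in> atlas M" "x \<in> fst c"
    using point_in_chart openin_subset[OF V] by blast
  note cM = atlas_maximal[OF c(1)]
  have S: "open (coord_dom M c V)" by (rule max_open_coord_dom[OF cM V])
  have "continuous_on (coord_dom M c V) (coord_fun M c f)"
    using f c by (auto simp: smooth_fun_on_def intro: smooth_on_continuous)
  then have o: "open (coord_dom M c V \<inter> coord_fun M c f -` B)"
    using continuous_open_preimage[OF _ S B] by blast
  let ?W = "{y \<in> fst c. snd c y \<in> coord_dom M c V \<inter> coord_fun M c f -` B}"
  have "openin (mtop M) ?W" by (rule is_chart_open_vimage[OF max_chart[OF cM] o])
  moreover have "x \<in> ?W"
    using x c max_coord_dom[OF cM c(2)] max_par[OF cM c(2)] by (simp add: coord_fun_par)
  moreover have "?W \<subseteq> {x \<in> V. f x \<in> B}"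
    using max_coord_dom[OF cM] max_par[OF cM] by (auto simp: coord_fun_par)
  ultimately show "\<exists>T. openin (mtop M) T \<and> x \<in> T \<and> T \<subseteq> {x \<in> V. f x \<in> B}" by blast
qed

text \<open>The closed set \<open>Z\<close> inside \<open>V\<close> keeps the support of \<open>w\<close> away from the boundary of \<open>V\<close>, where \<open>f\<close> may
  behave badly.\<close>
lemma smooth_glue_zero:
  fixes w f :: "'a \<Rightarrow> real"
  assumes V: "openin (mtop M) V" and Z: "closedin (mtop M) Z" "Z \<subseteq> V"
    and w: "smooth_fun_on M V w" "\<And>x. x \<in> topspace (mtop M) \<Longrightarrow> x \<notin> Z \<Longrightarrow> w x = 0"
    and f: "smooth_fun_on M V f"
  shows "smooth_fun_on M (topspace (mtop M)) (\<lambda>x. w x * f x)"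
proof (rule smooth_fun_on_openin_cover[OF openin_topspace])
  fix x assume x: "x \<in> topspace (mtop M)"
  show "\<exists>W. openin (mtop M) W \<and> x \<in> W \<and> smooth_fun_on M W (\<lambda>x. w x * f x)"
  proof (cases "x \<in> V")
    case True
    then show ?thesis using smooth_fun_on_mult[OF V w(1) f] V by blast
  next
    case False
    have o: "openin (mtop M) (topspace (mtop M) - Z)" using Z(1) by blast
    have "smooth_fun_on M (topspace (mtop M) - Z) (\<lambda>x. w x * f x)"
      by (rule smooth_fun_on_cong[OF o _ smooth_fun_on_const[OF o, of 0]]) (use w(2) in auto)
    then show ?thesis using o x False Z(2) by blast
  qed
qed

text \<open>A closed coordinate ball is compact, hence closed in the manifold because the latter is Hausdorff; so the bump function
  of the coordinate ball can be extended by 0.\<close>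
lemma bump_exists:
  assumes d: "d \<in> maximal_atlas M" and x0: "x0 \<in> fst d" and r: "r > 0"
    and B: "ball (snd d x0) r \<subseteq> coord_dom M d (fst d)"
  shows "\<exists>\<kappa> Z W. smooth_fun_on M (topspace (mtop M)) \<kappa> \<and> (\<forall>x. \<kappa> x \<ge> (0::real)) \<and>
     closedin (mtop M) Z \<and> Z \<subseteq> {x \<in> fst d. snd d x \<in> ball (snd d x0) r} \<and>
     (\<forall>x. x \<notin> Z \<longrightarrow> \<kappa> x = 0) \<and>
     openin (mtop M) W \<and> x0 \<in> W \<and> W \<subseteq> fst d \<and> (\<forall>x\<in>W. \<kappa> x > 0)"
proof -
  define \<zeta> where "\<zeta> = snd d x0"
  define g where "g z = flat_exp_power 0 ((r / 2)\<^sup>2 - (z - \<zeta>) \<bullet> (z - \<zeta>))" for z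
  have g: "smooth_on UNIV g"
    unfolding g_def
  proof (rule smooth_on_compose[OF open_UNIV open_UNIV _ _ smooth_on_flat_exp_power])
    show "smooth_on UNIV (\<lambda>z. (r / 2)\<^sup>2 - (z - \<zeta>) \<bullet> (z - \<zeta>))"
    proof (rule smooth_on_diff[OF open_UNIV smooth_on_const[OF open_UNIV]])
      have "smooth_on UNIV (\<lambda>z::complex^'m. z - \<zeta>)"
        by (intro smooth_on_diff smooth_on_linear[OF open_UNIV bounded_linear_ident] smooth_on_const open_UNIV)
      then show "smooth_on UNIV (\<lambda>z. (z - \<zeta>) \<bullet> (z - \<zeta>))"
        unfolding smooth_on_def using Ck_on_bilinear[OF bounded_bilinear_inner open_UNIV] by blast
    qed
  qed auto
  have gpos: "g z > 0 \<longleftrightarrow> z \<in> ball \<zeta> (r / 2)" for z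
  proof -
    have "g z > 0 \<longleftrightarrow> (norm (z - \<zeta>))\<^sup>2 < (r / 2)\<^sup>2"
      by (simp add: g_def flat_exp_power_pos_iff power2_norm_eq_inner)
    also have "\<dots> \<longleftrightarrow> norm (z - \<zeta>) < r / 2"
      using r by (metis norm_ge_zero half_gt_zero less_imp_le power2_less_imp_less power_strict_mono zero_less_numeral)
    finally show ?thesis by (simp add: dist_norm norm_minus_commute)
  qed
  have g0: "g z = 0" if "z \<notin> ball \<zeta> (r / 2)" for z
    using gpos[of z] that flat_exp_power_nonneg unfolding g_def by (metis less_eq_real_def)
  define \<kappa> where "\<kappa> x = (if x \<in> fst d then g (snd d x) else 0)" for x
  define Z where "Z = {x \<in> fst d. snd d x \<in> cball \<zeta> (r / 2)}"
  have oV: "openin (mtop M) (fst d)" by (rule max_openin[OF d])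
  have B2: "cball \<zeta> (r / 2) \<subseteq> ball \<zeta> r" using r by auto
  have Zc: "closedin (mtop M) Z"
  proof -
    have Zim: "Z = chart_inv M d ` (cball \<zeta> (r / 2) \<inter> coords (midx M))"
    proof
      show "Z \<subseteq> chart_inv M d ` (cball \<zeta> (r / 2) \<inter> coords (midx M))"
        using max_par[OF d] max_coords[OF d] by (force simp: Z_def)
      show "chart_inv M d ` (cball \<zeta> (r / 2) \<inter> coords (midx M)) \<subseteq> Z"
      proof
        fix x assume "x \<in> chart_inv M d ` (cball \<zeta> (r / 2) \<inter> coords (midx M))"
        then obtain z where z: "z \<in> cball \<zeta> (r / 2)" "z \<in> coords (midx M)" "x = chart_inv M d z" by blast
        then have "z \<in> coord_dom M d (fst d)" using B B2 unfolding \<zeta>_def by blast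
        then show "x \<in> Z" using par_dom[of z M d] z cproj_coords[OF z(2)] by (simp add: Z_def)
      qed
    qed
    have "coords (midx M) = {v. cproj (midx M) v = v}" by (auto simp: coords_def vec_eq_iff)
    moreover have "closed {v::complex^'m. cproj (midx M) v = v}"
      by (intro closed_Collect_eq continuous_cproj continuous_on_id)
    ultimately have "compact (cball \<zeta> (r / 2) \<inter> coords (midx M))"
      by (simp add: compact_Int_closed)
    then have "compactin (top_of_set (coord_dom M d (fst d))) (cball \<zeta> (r / 2) \<inter> coords (midx M))"
      using B B2 by (auto simp: compactin_subtopology \<zeta>_def)
    then have "compactin (mtop M) Z"
      unfolding Zim
      by (rule image_compactin[OF _ continuous_map_par[OF d]])
    moreover have "Hausdorff_space (mtop M)" using manifold by (simp add: complex_manifold_def)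
    ultimately show ?thesis by (rule_tac compactin_imp_closedin)
  qed
  have \<kappa>d: "smooth_fun_on M (fst d) \<kappa>"
  proof (rule smooth_fun_onI[OF oV])
    fix x assume x: "x \<in> fst d"
    have S: "open (coord_dom M d (fst d))" by (rule max_open_coord_dom[OF d oV])
    have "smooth_on (coord_dom M d (fst d)) (\<lambda>z. g (cproj (midx M) z))"
      by (rule smooth_on_compose[OF S open_UNIV _ smooth_on_linear[OF S bounded_linear_cproj] g]) auto
    moreover have "coord_fun M d \<kappa> z = g (cproj (midx M) z)" if "z \<in> coord_dom M d (fst d)" for z
      using par_dom[OF that] by (simp add: coord_fun_par \<kappa>_def)
    ultimately have "smooth_on (coord_dom M d (fst d)) (coord_fun M d \<kappa>)"
      using smooth_on_cong[OF S, of "coord_fun M d \<kappa>" "\<lambda>z. g (cproj (midx M) z)"] by blast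
    then show "\<exists>e W. e \<in> maximal_atlas M \<and> openin (mtop M) W \<and> x \<in> W \<and> W \<subseteq> fst e \<and>
       smooth_on (coord_dom M e W) (coord_fun M e \<kappa>)"
      using d x oV by blast
  qed
  have \<kappa>0: "\<kappa> x = 0" if "x \<notin> Z" for x
    using that g0[of "snd d x"] by (auto simp: \<kappa>_def Z_def)
  have ZV: "Z \<subseteq> fst d" by (auto simp: Z_def)
  have "smooth_fun_on M (topspace (mtop M)) (\<lambda>x. \<kappa> x * 1)"
    by (rule smooth_glue_zero[OF oV Zc ZV \<kappa>d \<kappa>0 smooth_fun_on_const[OF oV]])
  then have "smooth_fun_on M (topspace (mtop M)) \<kappa>" by simp
  moreover have "\<kappa> x \<ge> 0" for x by (simp add: \<kappa>_def g_def flat_exp_power_nonneg)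
  moreover have "Z \<subseteq> {x \<in> fst d. snd d x \<in> ball (snd d x0) r}"
    using B2 by (auto simp: Z_def \<zeta>_def)
  moreover have "openin (mtop M) {x \<in> fst d. snd d x \<in> ball \<zeta> (r / 2)}"
    by (rule is_chart_open_vimage[OF max_chart[OF d] open_ball])
  ultimately show ?thesis
    using Zc \<kappa>0 x0 r gpos
    by (intro exI[of _ \<kappa>] exI[of _ Z] exI[of _ "{x \<in> fst d. snd d x \<in> ball \<zeta> (r / 2)}"])
       (auto simp: \<kappa>_def \<zeta>_def)
qed

lemma locally_bounded_chart:
  fixes B :: "complex^'m \<Rightarrow> real"
  assumes d: "d \<in> maximal_atlas M" and x0: "x0 \<in> fst d" and B: "isCont B (snd d x0)"
  shows "\<exists>W. openin (mtop M) W \<and> x0 \<in> W \<and> W \<subseteq> fst d \<and> (\<forall>x\<in>W. B (snd d x) \<le> B (snd d x0) + 1)"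
proof -
  obtain e where e: "e > 0" "\<And>z. dist z (snd d x0) < e \<Longrightarrow> dist (B z) (B (snd d x0)) < 1"
    using B unfolding continuous_at_eps_delta by (meson zero_less_one)
  have "openin (mtop M) {x \<in> fst d. snd d x \<in> ball (snd d x0) e}"
    by (rule is_chart_open_vimage[OF max_chart[OF d] open_ball])
  moreover have "B (snd d x) \<le> B (snd d x0) + 1" if "snd d x \<in> ball (snd d x0) e" for x
    using e(2)[of "snd d x"] that by (auto simp: dist_commute dist_real_def)
  ultimately show ?thesis
    using e(1) x0 by (intro exI[of _ "{x \<in> fst d. snd d x \<in> ball (snd d x0) e}"]) auto
qed

end

lemma herm_bound: "cmod (herm J B w) \<le> (\<Sum>j\<in>J. \<Sum>k\<in>J. cmod (B $ j $ k)) * (norm w)\<^sup>2"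
proof -
  have "cmod (herm J B w) \<le> (\<Sum>j\<in>J. \<Sum>k\<in>J. cmod (B $ j $ k) * (norm w)\<^sup>2)"
    unfolding herm_def
  proof (intro sum_norm_le)
    fix j k
    have "cmod (w $ j) * cmod (w $ k) \<le> norm w * norm w"
      by (intro mult_mono Finite_Cartesian_Product.norm_nth_le) auto
    then show "cmod (B $ j $ k * w $ j * cnj (w $ k)) \<le> cmod (B $ j $ k) * (norm w)\<^sup>2"
      by (simp add: norm_mult power2_eq_square mult_left_mono mult.assoc)
  qed
  then show ?thesis by (simp add: sum_distrib_right)
qed

lemma push_bound: "norm (push I A v) \<le> (\<Sum>a\<in>UNIV. \<Sum>j\<in>I. cmod (A $ a $ j)) * norm v"
proof -
  have "norm (push I A v) \<le> (\<Sum>a\<in>UNIV. cmod (push I A v $ a))"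
    unfolding norm_vec_def by (rule L2_set_le_sum) auto
  also have "\<dots> \<le> (\<Sum>a\<in>UNIV. \<Sum>j\<in>I. cmod (A $ a $ j) * norm v)"
  proof (rule sum_mono)
    fix a
    show "cmod (push I A v $ a) \<le> (\<Sum>j\<in>I. cmod (A $ a $ j) * norm v)"
      unfolding push_def
      by (simp, intro sum_norm_le) (simp add: norm_mult Finite_Cartesian_Product.norm_nth_le mult_left_mono)
  qed
  finally show ?thesis by (simp add: sum_distrib_right)
qed

context kaehler_disk_family
begin

definition fibre_set :: "complex \<Rightarrow> 'a set" where
  "fibre_set t = {x \<in> topspace (mtop X). p x = t}"

definition slice :: "complex \<Rightarrow> ('a, 'm) chart \<Rightarrow> ('a, 'm) chart" where
  "slice t d = (fst d \<inter> fibre_set t, snd d)"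

lemma fibre_simps [simp]:
  "mtop (fibre X p b t) = subtopology (mtop X) (fibre_set t)"
  "midx (fibre X p b t) = midx X - {b}"
  by (simp_all add: fibre_def submanifold_def fibre_set_def)

lemma adaptedD: "adapted t d \<Longrightarrow> d \<in> maximal_atlas X" by (simp add: adapted_def)

lemma slice_atlas:
  assumes d: "adapted t d"
  shows "slice t d \<in> atlas (fibre X p b t)"
proof -
  have "snd d x \<in> coords (midx X - {b}) \<longleftrightarrow> x \<in> fibre_set t" if x: "x \<in> fst d" for x
  proof -
    have "snd d x \<in> coords (midx X)" "snd d x $ b = p x - t" "x \<in> topspace (mtop X)"
      using d x max_coords[OF adaptedD[OF d]] is_chart_subset[OF max_chart[OF adaptedD[OF d]]]
      by (auto simp: adapted_def)
    then show ?thesis by (auto simp: coords_def fibre_set_def)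
  qed
  then have "snd d ` (fst d \<inter> fibre_set t) = snd d ` fst d \<inter> coords (midx X - {b})" by auto
  then show ?thesis
    using adaptedD[OF d] unfolding fibre_def submanifold_def slice_def fibre_set_def
    by (simp, intro exI[of _ "fst d"]) simp
qed

text \<open>In an adapted chart a point with vanishing coordinate \<open>b\<close> lies on the fibre, so no condition on the fibre remains.\<close>
lemma slice_coord_dom:
  assumes d: "adapted t d"
  shows "coord_dom (fibre X p b t) (slice t d) V = cproj (midx X - {b}) -` coord_dom X d V"
proof -
  have "cproj (midx X - {b}) z \<in> snd d ` (fst d \<inter> fibre_set t \<inter> V) \<longleftrightarrow> cproj (midx X - {b}) z \<in> snd d ` (fst d \<inter> V)" for z
  proof
    assume "cproj (midx X - {b}) z \<in> snd d ` (fst d \<inter> V)"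
    then obtain y where y: "y \<in> fst d" "y \<in> V" "snd d y = cproj (midx X - {b}) z" by force
    then have "snd d y $ b = 0" by simp
    then have "p y = t" using d y(1) by (simp add: adapted_def)
    then have "y \<in> fibre_set t"
      using y(1) is_chart_subset[OF max_chart[OF adaptedD[OF d]]] by (auto simp: fibre_set_def)
    then show "cproj (midx X - {b}) z \<in> snd d ` (fst d \<inter> fibre_set t \<inter> V)"
      using y by (metis IntI image_eqI)
  qed auto
  then show ?thesis
    by (auto simp: coord_dom_def slice_def cproj_cproj_subset)
qed

lemma slice_coord_dom_full:
  assumes d: "adapted t d" and V: "fst d \<inter> fibre_set t \<subseteq> V"
  shows "coord_dom (fibre X p b t) (slice t d) V = cproj (midx X - {b}) -` coord_dom X d (fst d)"
proof -
  have "coord_dom (fibre X p b t) (slice t d) V = coord_dom (fibre X p b t) (slice t d) (fst d)"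
    using V by (auto simp: coord_dom_def slice_def)
  then show ?thesis using slice_coord_dom[OF d] by simp
qed

lemma slice_coord_fun:
  assumes d: "adapted t d" and z: "cproj (midx X - {b}) z \<in> coord_dom X d (fst d)"
  shows "coord_fun (fibre X p b t) (slice t d) f z = coord_fun X d f (cproj (midx X - {b}) z)"
proof -
  let ?z = "cproj (midx X - {b}) z" and ?x = "chart_inv X d (cproj (midx X - {b}) z)"
  have x: "?x \<in> fst d" "snd d ?x = ?z"
    using par_dom[OF z] by (simp_all add: cproj_cproj_subset)
  have "?x \<in> fibre_set t"
    using adapted_slice[OF d z] x(1) is_chart_subset[OF max_chart[OF adaptedD[OF d]]] by (auto simp: fibre_set_def)
  then have "inv_into (fst d \<inter> fibre_set t) (snd d) (snd d ?x) = ?x"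
    using x(1) inj_on_subset[OF max_inj[OF adaptedD[OF d]]] by (intro inv_into_f_f) auto
  then show ?thesis
    unfolding x(2) by (simp add: coord_fun_par[of X] coord_fun_def[of "fibre X p b t"] slice_def)
qed

text \<open>The adjunction formula: both adapted charts have \<open>p - t\<close> as coordinate \<open>b\<close>, so row \<open>b\<close> of the Jacobian is a unit
  vector, and deleting row and column \<open>b\<close> leaves the Jacobian of the fibre. Hence the canonical bundles of the fibre
  and of the total space have the same transition functions along the fibre.\<close>
lemma slice_det:
  assumes d: "adapted t d" and e: "adapted t e" and x: "x \<in> fst d" "x \<in> fst e" "p x = t"
  shows "det (jacobian (fibre X p b t) (slice t d) (slice t e) x) = det (jacobian X d e x)"
proof (rule det_unit_row[symmetric])
  note dM = adaptedD[OF d] and eM = adaptedD[OF e]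
  let ?J = "midx X - {b}"
  have xS: "snd d x \<in> coord_dom X d (fst e)" using max_coord_dom[OF dM x(1)] x(2) by simp
  have S: "open (coord_dom X d (fst e))" by (rule max_open_coord_dom[OF dM max_openin[OF eM]])
  show "jacobian X d e x $ b $ j = (if j = b then 1 else 0)" for j
  proof -
    have "transition X d e z $ b = z $ b" if z: "z \<in> coord_dom X d (fst e)" for z
    proof -
      have zd: "z \<in> coord_dom X d (fst d)" using z coord_dom_subset by blast
      have "snd e (chart_inv X d z) $ b = p (chart_inv X d z) - t" "snd d (chart_inv X d z) $ b = p (chart_inv X d z) - t"
        using d e par_dom(1)[OF zd] max_parD[OF dM z] by (simp_all add: adapted_def)
      then show ?thesis using par_dom(2)[OF zd] b by (simp add: transition_def)
    qed
    then have "dz j (\<lambda>z. transition X d e z $ b) (snd d x) = dz j (\<lambda>z. z $ b) (snd d x)"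
      by (rule dz_cong_open(1)[OF S xS])
    then show ?thesis by (auto simp: jacobian_trans[OF dM eM x(1,2)] dz_component)
  qed
  have main: "jacobian (fibre X p b t) (slice t d) (slice t e) x $ i $ j = jacobian X d e x $ i $ j"
    if i: "i \<in> ?J" and j: "j \<in> ?J" for i j
  proof -
    let ?T = "cproj ?J -` coord_dom X d (fst e)" and ?h = "coord_fun X d (\<lambda>y. snd e y $ i)"
    have T: "open ?T" by (rule open_vimage[OF S continuous_cproj])
    have cx: "cproj ?J (snd d x) = snd d x" by (rule adapted_slice_point(2)[OF d x(1,3)])
    have xT: "snd d x \<in> ?T" using xS cx by simp
    have h: "hol_at ?h (snd d x)"
      using trans_hol[OF dM eM xS, of i] i by (simp add: transition_def coord_fun_par[abs_def])
    have "dz j (coord_fun (fibre X p b t) (slice t d) (\<lambda>y. snd (slice t e) y $ i)) (snd d x) =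
        dz j (\<lambda>z. ?h (cproj ?J z)) (snd d x)"
    proof (rule dz_cong_open(1)[OF T xT])
      fix z assume "z \<in> ?T"
      then have "cproj ?J z \<in> coord_dom X d (fst d)" using coord_dom_subset by blast
      then show "coord_fun (fibre X p b t) (slice t d) (\<lambda>y. snd (slice t e) y $ i) z = ?h (cproj ?J z)"
        using slice_coord_fun[OF d] by (simp add: slice_def)
    qed
    also have "\<dots> = dz j ?h (snd d x)"
      using dz_compose_cproj(1)[of ?h ?J "snd d x" j] hol_at_differentiable[OF h] cx j by simp
    finally show ?thesis using i j by (simp add: jacobian_def slice_def)
  qed
  show "jacobian (fibre X p b t) (slice t d) (slice t e) x $ i $ j =
      (if i = b \<or> j = b then (if i = j then 1 else 0) else jacobian X d e x $ i $ j)" for i j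
  proof (cases "i \<in> ?J \<and> j \<in> ?J")
    case True
    then show ?thesis using main by auto
  next
    case False
    then have "jacobian (fibre X p b t) (slice t d) (slice t e) x $ i $ j = (if i = j then 1 else 0)"
      by (cases "i \<in> ?J") (auto simp: jacobian_outside)
    then show ?thesis using False by (auto simp: jacobian_outside)
  qed
qed

end

section \<open>Positivity on vertical vectors\<close>

lemma real_form11_smooth:
  assumes "real_form11 M A" "c \<in> atlas M" "j \<in> midx M" "k \<in> midx M"
  shows "smooth_on (coord_dom M c (fst c)) (coord_fun M c (\<lambda>x. A c x $ j $ k))"
  using assms unfolding real_form11_def by blast

lemma real_form11_transform:
  assumes "real_form11 M A" "c \<in> atlas M" "d \<in> atlas M" "x \<in> fst c" "x \<in> fst d" "j \<in> midx M" "k \<in> midx M"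
  shows "A c x $ j $ k = (\<Sum>a\<in>midx M. \<Sum>b\<in>midx M.
          A d x $ a $ b * jacobian M c d x $ a $ j * cnj (jacobian M c d x $ b $ k))"
  using assms unfolding real_form11_def by blast

context kaehler_disk_family
begin

definition twisted_form :: "('a, 'm) form11 \<Rightarrow> real \<Rightarrow> ('a \<Rightarrow> real) \<Rightarrow> ('a, 'm) form11" where
  "twisted_form \<omega> \<epsilon> F c x = canonical_form \<omega> c x + i_ddbar X F c x + \<epsilon> *\<^sub>R \<omega> c x"

text \<open>Vertical vectors are those in the kernel of \<open>dp\<close>, i.e. tangent to the fibres.\<close>
definition vertically_positive :: "('a, 'm) form11 \<Rightarrow> real \<Rightarrow> ('a \<Rightarrow> real) \<Rightarrow> 'a \<Rightarrow> bool" where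
  "vertically_positive \<omega> \<epsilon> F x \<longleftrightarrow> (\<forall>c\<in>atlas X. x \<in> fst c \<longrightarrow>
     (\<forall>v\<in>coords (midx X). v \<noteq> 0 \<longrightarrow> dp c x v = 0 \<longrightarrow> 0 < Re (herm (midx X) (twisted_form \<omega> \<epsilon> F c x) v)))"

lemma tot_push:
  assumes \<omega>: "hermitian_metric X \<omega>" and c: "c \<in> atlas X" and d: "d \<in> atlas X" and x: "x \<in> fst c" "x \<in> fst d"
    and V: "openin (mtop X) V" "x \<in> V" and F: "smooth_fun_on X V F"
  shows "herm (midx X) (twisted_form \<omega> \<epsilon> F c x) v = herm (midx X) (twisted_form \<omega> \<epsilon> F d x) (push (midx X) (jacobian X c d x) v)"
proof -
  have "herm (midx X) (canonical_form \<omega> c x) v = herm (midx X) (canonical_form \<omega> d x) (push (midx X) (jacobian X c d x) v)"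
    by (rule herm_congruence) (rule real_form11_transform[OF canonical_form_real[OF \<omega>] c d x])
  moreover have "herm (midx X) (\<omega> c x) v = herm (midx X) (\<omega> d x) (push (midx X) (jacobian X c d x) v)"
    by (rule herm_congruence) (rule metric_transform[OF \<omega> c d x])
  ultimately show ?thesis
    using levi_push[OF atlas_maximal[OF c] atlas_maximal[OF d] x V F]
    by (simp add: twisted_form_def herm_add herm_scaleR)
qed

lemma vposI:
  assumes \<omega>: "hermitian_metric X \<omega>" and d: "d \<in> atlas X" "x \<in> fst d"
    and V: "openin (mtop X) V" "x \<in> V" and F: "smooth_fun_on X V F"
    and pos: "\<And>v. v \<in> coords (midx X) \<Longrightarrow> v \<noteq> 0 \<Longrightarrow> dp d x v = 0 \<Longrightarrow> 0 < Re (herm (midx X) (twisted_form \<omega> \<epsilon> F d x) v)"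
  shows "vertically_positive \<omega> \<epsilon> F x"
  unfolding vertically_positive_def
proof (intro ballI impI)
  fix c v assume c: "c \<in> atlas X" "x \<in> fst c" and v: "v \<in> coords (midx X)" "v \<noteq> 0" "dp c x v = 0"
  note cM = atlas_maximal[OF c(1)] and dM = atlas_maximal[OF d(1)]
  show "0 < Re (herm (midx X) (twisted_form \<omega> \<epsilon> F c x) v)"
    unfolding tot_push[OF \<omega> c(1) d(1) c(2) d(2) V F]
    by (intro pos push_coords push_nonzero[OF cM dM c(2) d(2) v(1,2)])
       (use dp_push[OF cM dM c(2) d(2), of v] v(3) in simp)
qed

lemma tot_coord_smooth:
  assumes \<omega>: "hermitian_metric X \<omega>" and c: "c \<in> atlas X" and V: "openin (mtop X) V" and F: "smooth_fun_on X V F"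
    and jk: "j \<in> midx X" "k \<in> midx X"
  shows "smooth_on (coord_dom X c (V \<inter> fst c)) (\<lambda>z. twisted_form \<omega> \<epsilon> F c (chart_inv X c z) $ j $ k)"
proof -
  note cM = atlas_maximal[OF c]
  let ?S = "coord_dom X c (V \<inter> fst c)"
  have o: "openin (mtop X) (V \<inter> fst c)" using V max_openin[OF cM] by blast
  have S: "open ?S" by (rule max_open_coord_dom[OF cM o])
  have "smooth_on ?S (coord_fun X c (\<lambda>x. canonical_form \<omega> c x $ j $ k))"
    by (rule smooth_on_subset[OF real_form11_smooth[OF canonical_form_real[OF \<omega>] c jk] coord_dom_subset])
  moreover have "smooth_on ?S (coord_fun X c (\<lambda>x. \<omega> c x $ j $ k))"
    using \<omega> by (intro smooth_on_subset[OF real_form11_smooth[OF _ c jk] coord_dom_subset]) (simp add: hermitian_metric_def)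
  moreover have "smooth_on ?S (coord_fun X c (\<lambda>x. i_ddbar X F c x $ j $ k))"
    by (rule i_ddbar_coord_smooth[OF o smooth_fun_on_subset[OF F] cM]) blast
  ultimately have "smooth_on ?S (\<lambda>z. coord_fun X c (\<lambda>x. canonical_form \<omega> c x $ j $ k) z +
      coord_fun X c (\<lambda>x. i_ddbar X F c x $ j $ k) z + of_real \<epsilon> * coord_fun X c (\<lambda>x. \<omega> c x $ j $ k) z)"
    by (intro smooth_on_add smooth_on_mult smooth_on_const S)
  then show ?thesis
    by (simp add: coord_fun_par[of X c "\<lambda>x. canonical_form \<omega> c x $ j $ k"]
        coord_fun_par[of X c "\<lambda>x. i_ddbar X F c x $ j $ k"] coord_fun_par[of X c "\<lambda>x. \<omega> c x $ j $ k"]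
        twisted_form_def scaleR_conv_of_real[where 'a=complex])
qed

text \<open>Vertical positivity at one point makes the form coercive nearby, once a multiple of the square of \<open>dp\<close> is added.\<close>
lemma vpos_coercive:
  assumes \<omega>: "hermitian_metric X \<omega>" and c: "c \<in> atlas X" "x0 \<in> fst c"
    and V: "openin (mtop X) V" "x0 \<in> V" and F: "smooth_fun_on X V F" and pos: "vertically_positive \<omega> \<epsilon> F x0"
  shows "\<exists>W C e. openin (mtop X) W \<and> x0 \<in> W \<and> W \<subseteq> V \<inter> fst c \<and> C \<ge> 0 \<and> e > (0::real) \<and>
    (\<forall>x\<in>W. \<forall>K\<ge>C. \<forall>v\<in>coords (midx X).
       e * (norm v)\<^sup>2 \<le> Re (herm (midx X) (twisted_form \<omega> \<epsilon> F c x) v) + K * (cmod (dp c x v))\<^sup>2)"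
proof -
  note cM = atlas_maximal[OF c(1)]
  let ?z0 = "snd c x0"
  define A where "A z = twisted_form \<omega> \<epsilon> F c (chart_inv X c z)" for z
  define l where "l z = (\<chi> j. dz j (coord_fun X c p) (cproj (midx X) z))" for z
  have o: "openin (mtop X) (V \<inter> fst c)" using V max_openin[OF cM] by blast
  have z0: "?z0 \<in> coord_dom X c (V \<inter> fst c)" using max_coord_dom[OF cM c(2)] V c by simp
  have S: "open (coord_dom X c (fst c))" by (rule max_open_coord_dom[OF cM max_openin[OF cM]])
  have z0': "?z0 \<in> coord_dom X c (fst c)" using z0 coord_dom_subset by blast
  have "\<exists>C\<ge>0. \<exists>e>0. \<forall>z. dist z ?z0 < e \<longrightarrow> (\<forall>K\<ge>C. \<forall>v\<in>coords (midx X).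
      e * (norm v)\<^sup>2 \<le> Re (herm (midx X) (A z) v) + K * (cmod (\<Sum>j\<in>midx X. l z $ j * v $ j))\<^sup>2)"
  proof (rule coercive_near)
    show "isCont (\<lambda>z. A z $ j $ k) ?z0" if "j \<in> midx X" "k \<in> midx X" for j k
      unfolding A_def
      by (rule isCont_smooth[OF max_open_coord_dom[OF cM o] tot_coord_smooth[OF \<omega> c(1) V(1) F that] z0])
    show "isCont (\<lambda>z. l z $ j) ?z0" for j
    proof -
      have "hol_on (coord_dom X c (fst c)) (coord_fun X c p)"
        using p_hol[OF cM] by (simp add: hol_on_iff)
      then have "smooth_on (coord_dom X c (fst c)) (dz j (coord_fun X c p))"
        by (intro hol_on_smooth S hol_on_dz)
      then have "smooth_on (coord_dom X c (fst c)) (\<lambda>z. dz j (coord_fun X c p) (cproj (midx X) z))"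
        by (intro smooth_on_compose[OF S S _ smooth_on_linear[OF S bounded_linear_cproj]]) (auto simp: coord_dom_cproj)
      then show ?thesis
        using isCont_smooth[OF S _ z0'] by (simp add: l_def)
    qed
    show "0 < Re (herm (midx X) (A ?z0) v)"
      if v: "v \<in> coords (midx X)" "v \<noteq> 0" "(\<Sum>j\<in>midx X. l ?z0 $ j * v $ j) = 0" for v
    proof -
      have "dp c x0 v = 0"
        using v(3) cproj_coords[OF max_coords[OF cM c(2)]] by (simp add: dp_def l_def)
      then show ?thesis
        using pos c v(1,2) by (simp add: vertically_positive_def A_def max_par[OF cM c(2)])
    qed
  qed
  then obtain C e where C: "C \<ge> 0" "e > 0" and *: "\<And>z K v. dist z ?z0 < e \<Longrightarrow> K \<ge> C \<Longrightarrow> v \<in> coords (midx X) \<Longrightarrow>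
      e * (norm v)\<^sup>2 \<le> Re (herm (midx X) (A z) v) + K * (cmod (\<Sum>j\<in>midx X. l z $ j * v $ j))\<^sup>2"
    by blast
  let ?W = "V \<inter> {x \<in> fst c. snd c x \<in> ball ?z0 e}"
  have "openin (mtop X) ?W"
    by (intro openin_Int V(1) is_chart_open_vimage[OF max_chart[OF cM] open_ball])
  moreover have "e * (norm v)\<^sup>2 \<le> Re (herm (midx X) (twisted_form \<omega> \<epsilon> F c x) v) + K * (cmod (dp c x v))\<^sup>2"
    if x: "x \<in> ?W" and K: "K \<ge> C" and v: "v \<in> coords (midx X)" for x K v
  proof -
    have xc: "x \<in> fst c" using x by simp
    have "dist (snd c x) ?z0 < e" using x by (simp add: dist_commute)
    from *[OF this K v] show ?thesis
      using cproj_coords[OF max_coords[OF cM xc]] by (simp add: A_def l_def max_par[OF cM xc] dp_def)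
  qed
  ultimately show ?thesis
    using C V(2) c(2) by (intro exI[of _ ?W] exI[of _ C] exI[of _ e]) auto
qed

text \<open>On vertical vectors the correction term of \<open>vpos_coercive\<close> vanishes.\<close>
lemma vpos_open:
  assumes \<omega>: "hermitian_metric X \<omega>" and V: "openin (mtop X) V" "x0 \<in> V" and F: "smooth_fun_on X V F" and pos: "vertically_positive \<omega> \<epsilon> F x0"
  shows "\<exists>W. openin (mtop X) W \<and> x0 \<in> W \<and> W \<subseteq> V \<and> (\<forall>x\<in>W. vertically_positive \<omega> \<epsilon> F x)"
proof -
  obtain c where c: "c \<in> atlas X" "x0 \<in> fst c" using point_in_chart V openin_subset by blast
  obtain W C e where W: "openin (mtop X) W" "x0 \<in> W" "W \<subseteq> V \<inter> fst c" "C \<ge> 0" "e > (0::real)"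
    "\<And>x K v. x \<in> W \<Longrightarrow> K \<ge> C \<Longrightarrow> v \<in> coords (midx X) \<Longrightarrow>
       e * (norm v)\<^sup>2 \<le> Re (herm (midx X) (twisted_form \<omega> \<epsilon> F c x) v) + K * (cmod (dp c x v))\<^sup>2"
    using vpos_coercive[OF \<omega> c V F pos] by blast
  have "vertically_positive \<omega> \<epsilon> F x" if x: "x \<in> W" for x
  proof (rule vposI[OF \<omega> c(1) _ V(1) _ F])
    fix v assume v: "v \<in> coords (midx X)" "v \<noteq> 0" "dp c x v = 0"
    have "0 < e * (norm v)\<^sup>2" using W(5) v(2) by simp
    also have "\<dots> \<le> Re (herm (midx X) (twisted_form \<omega> \<epsilon> F c x) v)"
      using W(6)[OF x order_refl v(1)] v(3) by simp
    finally show "0 < Re (herm (midx X) (twisted_form \<omega> \<epsilon> F c x) v)" .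
  qed (use x W(3) in auto)
  then show ?thesis using W by blast
qed

lemma metric_lower_bound:
  assumes \<omega>: "hermitian_metric X \<omega>" and c: "c \<in> atlas X" "x0 \<in> fst c"
  shows "\<exists>W e. openin (mtop X) W \<and> x0 \<in> W \<and> W \<subseteq> fst c \<and> e > (0::real) \<and>
    (\<forall>x\<in>W. \<forall>v\<in>coords (midx X). e * (norm v)\<^sup>2 \<le> Re (herm (midx X) (\<omega> c x) v))"
proof -
  note cM = atlas_maximal[OF c(1)]
  let ?z0 = "snd c x0"
  define A where "A z = \<omega> c (chart_inv X c z)" for z
  have S: "open (coord_dom X c (fst c))" by (rule max_open_coord_dom[OF cM max_openin[OF cM]])
  have z0: "?z0 \<in> coord_dom X c (fst c)" using max_coord_dom[OF cM c(2)] c by simp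
  have "\<exists>C\<ge>0. \<exists>e>0. \<forall>z. dist z ?z0 < e \<longrightarrow> (\<forall>K\<ge>C. \<forall>v\<in>coords (midx X).
      e * (norm v)\<^sup>2 \<le> Re (herm (midx X) (A z) v) + K * (cmod (\<Sum>j\<in>midx X. (\<lambda>_. 0) z $ j * v $ j))\<^sup>2)"
  proof (rule coercive_near)
    show "isCont (\<lambda>z. A z $ j $ k) ?z0" if "j \<in> midx X" "k \<in> midx X" for j k
    proof (rule isCont_smooth[OF S _ z0])
      show "smooth_on (coord_dom X c (fst c)) (\<lambda>z. A z $ j $ k)"
        using \<omega> real_form11_smooth[of X \<omega> c j k] c(1) that
        by (simp add: hermitian_metric_def A_def coord_fun_par[abs_def])
    qed
    show "0 < Re (herm (midx X) (A ?z0) v)" if "v \<in> coords (midx X)" "v \<noteq> 0" for v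
      using \<omega> c that by (simp add: hermitian_metric_def A_def max_par[OF cM c(2)])
  qed simp
  then obtain C e where e: "e > 0" and **: "\<And>z K v. dist z ?z0 < e \<Longrightarrow> K \<ge> C \<Longrightarrow> v \<in> coords (midx X) \<Longrightarrow>
      e * (norm v)\<^sup>2 \<le> Re (herm (midx X) (A z) v) + K * (cmod (\<Sum>j\<in>midx X. (\<lambda>_. 0) z $ j * v $ j))\<^sup>2"
    by blast
  have *: "e * (norm v)\<^sup>2 \<le> Re (herm (midx X) (A z) v)" if "dist z ?z0 < e" "v \<in> coords (midx X)" for z v
    using **[OF that(1) order_refl that(2)] by simp
  have "openin (mtop X) {x \<in> fst c. snd c x \<in> ball ?z0 e}"
    by (rule is_chart_open_vimage[OF max_chart[OF cM] open_ball])
  moreover have "e * (norm v)\<^sup>2 \<le> Re (herm (midx X) (\<omega> c x) v)"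
    if "x \<in> fst c" "snd c x \<in> ball ?z0 e" "v \<in> coords (midx X)" for x v
    using *[of "snd c x" v] that by (simp add: A_def max_par[OF cM] dist_commute)
  ultimately show ?thesis
    using e c(2) by (intro exI[of _ "{x \<in> fst c. snd c x \<in> ball ?z0 e}"] exI[of _ e]) auto
qed

text \<open>The metric on the fibre is unrelated to the metric of the total space; on the compact fibre they are
  comparable, and this is the local estimate for it.\<close>
lemma fibre_metric_bound:
  assumes \<omega>: "hermitian_metric X \<omega>" and \<eta>: "real_form11 (fibre X p b t) \<eta>"
    and d: "adapted t d" and c: "c \<in> atlas X" and x0: "x0 \<in> fst c" "x0 \<in> fst d" "p x0 = t"
  shows "\<exists>W K. openin (mtop X) W \<and> x0 \<in> W \<and> W \<subseteq> fst c \<inter> fst d \<and> K > (0::real) \<and>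
    (\<forall>x\<in>W. p x = t \<longrightarrow> (\<forall>v\<in>coords (midx X).
       Re (herm (midx X - {b}) (\<eta> (slice t d) x) (push (midx X) (jacobian X c d x) v)) \<le> K * Re (herm (midx X) (\<omega> c x) v)))"
proof -
  let ?I = "midx X" and ?J = "midx X - {b}" and ?Y = "fibre X p b t"
  note cM = atlas_maximal[OF c] and dM = adaptedD[OF d]
  obtain W1 e where W1: "openin (mtop X) W1" "x0 \<in> W1" "W1 \<subseteq> fst c" and e: "e > 0"
    "\<And>x v. x \<in> W1 \<Longrightarrow> v \<in> coords ?I \<Longrightarrow> e * (norm v)\<^sup>2 \<le> Re (herm ?I (\<omega> c x) v)"
    using metric_lower_bound[OF \<omega> c x0(1)] by blast
  \<comment> \<open>\<open>B1\<close> and \<open>B2\<close> are continuous majorants for the norms of the Jacobian and of the form on the fibre,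
    so both are bounded near \<open>x0\<close>.\<close>
  define B1 where "B1 z = (\<Sum>a\<in>UNIV. \<Sum>j\<in>?I. cmod (dz j (\<lambda>z. transition X c d z $ a) z))" for z
  have zS: "snd c x0 \<in> coord_dom X c (fst d)" using max_coord_dom[OF cM x0(1)] x0 by simp
  have S: "open (coord_dom X c (fst d))" by (rule max_open_coord_dom[OF cM max_openin[OF dM]])
  have "smooth_on (coord_dom X c (fst d)) (dz j (\<lambda>z. transition X c d z $ a))" for j a
    by (intro hol_on_smooth S hol_on_dz) (simp add: hol_on_iff trans_hol[OF cM dM])
  then have cj: "isCont (dz j (\<lambda>z. transition X c d z $ a)) (snd c x0)" for j a
    by (rule isCont_smooth[OF S _ zS])
  have "isCont B1 (snd c x0)" unfolding B1_def by (intro continuous_sum continuous_norm cj)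
  then obtain W2 where W2: "openin (mtop X) W2" "x0 \<in> W2" "W2 \<subseteq> fst c"
    "\<And>x. x \<in> W2 \<Longrightarrow> B1 (snd c x) \<le> B1 (snd c x0) + 1"
    using locally_bounded_chart[OF cM x0(1), of B1] by blast
  define B2 where "B2 z = (\<Sum>j\<in>?J. \<Sum>k\<in>?J. cmod (coord_fun ?Y (slice t d) (\<lambda>x. \<eta> (slice t d) x $ j $ k) z))" for z
  let ?T = "cproj ?J -` coord_dom X d (fst d)"
  have T: "open ?T" by (rule open_vimage[OF max_open_coord_dom[OF dM max_openin[OF dM]] continuous_cproj])
  have in_T: "snd d x \<in> ?T" if "x \<in> fst d" "p x = t" for x
    using max_coord_dom[OF dM that(1)] adapted_slice_point(2)[OF d that] that(1) by simp
  have dom: "coord_dom ?Y (slice t d) (fst (slice t d)) = ?T"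
    by (rule slice_coord_dom_full[OF d]) (simp add: slice_def)
  have ce: "isCont (coord_fun ?Y (slice t d) (\<lambda>x. \<eta> (slice t d) x $ j $ k)) (snd d x0)" if "j \<in> ?J" "k \<in> ?J" for j k
  proof (rule isCont_smooth[OF T _ in_T[OF x0(2,3)]])
    show "smooth_on ?T (coord_fun ?Y (slice t d) (\<lambda>x. \<eta> (slice t d) x $ j $ k))"
      unfolding dom[symmetric] by (rule real_form11_smooth[OF \<eta> slice_atlas[OF d]]) (use that in simp_all)
  qed
  have "isCont B2 (snd d x0)" unfolding B2_def by (intro continuous_sum continuous_norm ce)
  then obtain W3 where W3: "openin (mtop X) W3" "x0 \<in> W3" "W3 \<subseteq> fst d"
    "\<And>x. x \<in> W3 \<Longrightarrow> B2 (snd d x) \<le> B2 (snd d x0) + 1"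
    using locally_bounded_chart[OF dM x0(2), of B2] by blast
  have B0: "B1 z \<ge> 0" "B2 z \<ge> 0" for z by (auto simp: B1_def B2_def intro!: sum_nonneg)
  define M1 where "M1 = B1 (snd c x0) + 1"
  define M2 where "M2 = B2 (snd d x0) + 1"
  have M: "M1 > 0" "M2 > 0" using B0 by (auto simp: M1_def M2_def add_nonneg_pos)
  define K where "K = M2 * M1\<^sup>2 / e"
  have "Re (herm ?J (\<eta> (slice t d) x) (push ?I (jacobian X c d x) v)) \<le> K * Re (herm ?I (\<omega> c x) v)"
    if x: "x \<in> W1" "x \<in> W2" "x \<in> W3" "p x = t" and v: "v \<in> coords ?I" for x v
  proof -
    have xc: "x \<in> fst c" "x \<in> fst d" using x W1(3) W3(3) by auto
    let ?w = "push ?I (jacobian X c d x) v"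
    have "(\<Sum>a\<in>UNIV. \<Sum>j\<in>?I. cmod (jacobian X c d x $ a $ j)) = B1 (snd c x)"
      by (simp add: B1_def jacobian_trans[OF cM dM xc])
    then have "norm ?w \<le> B1 (snd c x) * norm v" using push_bound[of ?I "jacobian X c d x" v] by simp
    also have "\<dots> \<le> M1 * norm v" using W2(4)[OF x(2)] by (intro mult_right_mono) (auto simp: M1_def)
    finally have w: "(norm ?w)\<^sup>2 \<le> (M1 * norm v)\<^sup>2" by (intro power_mono) auto
    have "coord_fun ?Y (slice t d) (\<lambda>x. \<eta> (slice t d) x $ j $ k) (snd d x) = \<eta> (slice t d) x $ j $ k" for j k
    proof -
      have cx: "cproj ?J (snd d x) = snd d x" by (rule adapted_slice_point(2)[OF d xc(2) x(4)])
      show ?thesis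
        using slice_coord_fun[OF d, of "snd d x" "\<lambda>x. \<eta> (slice t d) x $ j $ k"] in_T[OF xc(2) x(4)]
        by (simp add: cx coord_fun_par[of X] max_par[OF dM xc(2)] del: cproj_nth)
    qed
    then have "(\<Sum>j\<in>?J. \<Sum>k\<in>?J. cmod (\<eta> (slice t d) x $ j $ k)) = B2 (snd d x)"
      by (simp add: B2_def)
    then have "cmod (herm ?J (\<eta> (slice t d) x) ?w) \<le> B2 (snd d x) * (norm ?w)\<^sup>2"
      using herm_bound[of ?J "\<eta> (slice t d) x" ?w] by simp
    also have "\<dots> \<le> M2 * (M1 * norm v)\<^sup>2"
      using W3(4)[OF x(3)] w M by (intro mult_mono) (auto simp: M2_def)
    also have "\<dots> = K * (e * (norm v)\<^sup>2)" using e(1) by (simp add: K_def power_mult_distrib)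
    also have "\<dots> \<le> K * Re (herm ?I (\<omega> c x) v)"
      using e(2)[OF x(1) v] e(1) M by (intro mult_left_mono) (auto simp: K_def)
    finally show ?thesis by (rule order_trans[OF complex_Re_le_cmod])
  qed
  moreover have "openin (mtop X) (W1 \<inter> W2 \<inter> W3)" by (intro openin_Int W1(1) W2(1) W3(1))
  moreover have "x0 \<in> W1 \<inter> W2 \<inter> W3" using W1(2) W2(2) W3(2) by blast
  moreover have "W1 \<inter> W2 \<inter> W3 \<subseteq> fst c \<inter> fst d" using W1(3) W3(3) by blast
  moreover have "K > 0" using M e(1) by (simp add: K_def)
  ultimately show ?thesis by (intro exI[of _ "W1 \<inter> W2 \<inter> W3"] exI[of _ K]) blast
qed

lemma fibre_compact:
  assumes "t \<in> ball 0 1"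
  shows "compactin (mtop X) (fibre_set t)"
proof -
  have "compactin (top_of_set (ball 0 1)) {t}" using assms by (simp add: compactin_subtopology)
  moreover have "proper_map (mtop X) (top_of_set (ball 0 1)) p" using family by (simp add: kaehler_family_def)
  ultimately show ?thesis
    using compactin_proper_map_preimage[of "mtop X" _ p "{t}"] unfolding fibre_set_def by fastforce
qed

end

section \<open>Potentials on a fibre and their extensions\<close>

context kaehler_disk_family
begin

lemma ln_det_jacobian_chain:
  assumes c: "c \<in> maximal_atlas X" and d: "d \<in> maximal_atlas X" and e: "e \<in> maximal_atlas X"
    and x: "x \<in> fst c" "x \<in> fst d" "x \<in> fst e"
  shows "ln ((cmod (det (jacobian X c e x)))\<^sup>2) =
    ln ((cmod (det (jacobian X c d x)))\<^sup>2) + ln ((cmod (det (jacobian X d e x)))\<^sup>2)"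
proof -
  have "cmod (det (jacobian X c d x)) > 0" "cmod (det (jacobian X d e x)) > 0"
    using det_jacobian_nonzero[OF c d x(1,2)] det_jacobian_nonzero[OF d e x(2,3)] by auto
  then show ?thesis
    by (simp add: jacobian_chain[OF c d e x] det_mul norm_mult power_mult_distrib ln_mult add.commute)
qed

text \<open>The logarithm of the weight that \<open>\<omega>\<close> induces in the chart \<open>d\<close> of the maximal atlas, where \<open>\<omega>\<close> itself has no coefficients.\<close>
definition chart_potential :: "('a, 'm) form11 \<Rightarrow> ('a, 'm) chart \<Rightarrow> ('a, 'm) chart \<Rightarrow> 'a \<Rightarrow> real" where
  "chart_potential \<omega> c d x = canonical_potential \<omega> c x + ln ((cmod (det (jacobian X c d x)))\<^sup>2)"

lemma chart_potential_change:
  assumes \<omega>: "hermitian_metric X \<omega>" and c: "c \<in> atlas X" "c' \<in> atlas X"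
    and d: "d \<in> maximal_atlas X" "d' \<in> maximal_atlas X"
    and x: "x \<in> fst c" "x \<in> fst c'" "x \<in> fst d" "x \<in> fst d'"
  shows "chart_potential \<omega> c' d' x = chart_potential \<omega> c d x + ln ((cmod (det (jacobian X d d' x)))\<^sup>2)"
  unfolding chart_potential_def canonical_potential_change[OF \<omega> c x(1,2)]
  using ln_det_jacobian_chain[OF atlas_maximal[OF c(1)] atlas_maximal[OF c(2)] d(2) x(1,2,4)]
    ln_det_jacobian_chain[OF atlas_maximal[OF c(1)] d x(1,3,4)] by linarith

text \<open>The points whose projection to the hyperplane of the fibre, along the coordinate \<open>b\<close>, stays in the chart.\<close>
definition slice_dom :: "('a, 'm) chart \<Rightarrow> 'a set" where
  "slice_dom d = {x \<in> fst d. snd d x \<in> cproj (midx X - {b}) -` coord_dom X d (fst d)}"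

text \<open>A local extension of the potential on the fibre: the part given by data of the fibre is extended to be constant along the
  coordinate \<open>b\<close>, and the weight of \<open>\<omega>\<close> lives on the total space anyway.\<close>
definition fibre_ext :: "('a, 'm) form11 \<Rightarrow> complex \<Rightarrow> ('a \<Rightarrow> real) \<Rightarrow> (('a, 'm) chart \<Rightarrow> 'a \<Rightarrow> real) \<Rightarrow>
    ('a, 'm) chart \<Rightarrow> ('a, 'm) chart \<Rightarrow> 'a \<Rightarrow> real" where
  "fibre_ext \<omega> t f h c d x =
     coord_fun (fibre X p b t) (slice t d) (\<lambda>y. f y + (- (1 / (2 * pi))) * ln (h (slice t d) y)) (snd d x) +
     1 / (2 * pi) * chart_potential \<omega> c d x"

lemma slice_dom_open: "adapted t d \<Longrightarrow> openin (mtop X) (slice_dom d)"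
  unfolding slice_dom_def
  by (intro is_chart_open_vimage max_chart open_vimage[OF max_open_coord_dom continuous_cproj] max_openin)
     (simp_all add: adaptedD)

lemma slice_dom_subset: "slice_dom d \<subseteq> fst d"
  by (auto simp: slice_dom_def)

lemma slice_fun_at:
  assumes d: "adapted t d" and x: "x \<in> fst d" "p x = t"
  shows "coord_fun (fibre X p b t) (slice t d) g (snd d x) = g x"
proof -
  have cx: "cproj (midx X - {b}) (snd d x) = snd d x" by (rule adapted_slice_point(2)[OF d x])
  have "snd d x \<in> coord_dom X d (fst d)" using max_coord_dom[OF adaptedD[OF d] x(1)] x(1) by simp
  then show ?thesis
    using slice_coord_fun[OF d, of "snd d x" g] max_par[OF adaptedD[OF d] x(1)]
    unfolding cx coord_fun_par[of X] by simp
qed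

lemma fibre_ext_fibre:
  assumes d: "adapted t d" and x: "x \<in> fst d" "p x = t"
  shows "fibre_ext \<omega> t f h c d x = f x - 1 / (2 * pi) * ln (h (slice t d) x) + 1 / (2 * pi) * chart_potential \<omega> c d x"
  unfolding fibre_ext_def slice_fun_at[OF d x] by simp

context
  fixes \<omega> :: "('a, 'm) form11" and t :: complex and f :: "'a \<Rightarrow> real" and h :: "('a, 'm) chart \<Rightarrow> 'a \<Rightarrow> real"
  assumes \<omega>: "hermitian_metric X \<omega>"
    and h: "bundle_metric (fibre X p b t) (canonical_bundle (fibre X p b t)) h"
    and f: "smooth_fun_on (fibre X p b t) (topspace (mtop (fibre X p b t))) f"
begin

lemma canonical_weight:
  assumes "i \<in> atlas (fibre X p b t)" "j \<in> atlas (fibre X p b t)"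
  shows "smooth_fun_on (fibre X p b t) (fst i) (h i)"
    and "x \<in> fst i \<Longrightarrow> h i x > 0"
    and "x \<in> fst i \<Longrightarrow> x \<in> fst j \<Longrightarrow> h j x = (cmod (det (jacobian (fibre X p b t) i j x)))\<^sup>2 * h i x"
  using h[unfolded bundle_metric_def canonical_bundle_def line_bundle.select_convs] assms by blast+

text \<open>On the fibre the chart dependent terms cancel: by adjunction, passing from \<open>d\<close> to \<open>d'\<close> changes the logarithms of
  the weights \<open>h\<close> and of the weights given by \<open>\<omega>\<close> by the same amount.\<close>
lemma fibre_ext_independent:
  assumes c: "c \<in> atlas X" "c' \<in> atlas X" and d: "adapted t d" "adapted t d'"
    and x: "x \<in> fst c" "x \<in> fst c'" "x \<in> fst d" "x \<in> fst d'" "p x = t"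
  shows "fibre_ext \<omega> t f h c d x = fibre_ext \<omega> t f h c' d' x"
proof -
  have xf: "x \<in> fibre_set t"
    using x(3,5) is_chart_subset[OF max_chart[OF adaptedD[OF d(1)]]] by (auto simp: fibre_set_def)
  have h1: "h (slice t d') x = (cmod (det (jacobian X d d' x)))\<^sup>2 * h (slice t d) x" and h2: "h (slice t d) x > 0"
    using canonical_weight(2,3)[OF slice_atlas[OF d(1)] slice_atlas[OF d(2)], of x] xf x
    unfolding slice_det[OF d x(3,4,5)] by (simp_all add: slice_def)
  have "cmod (det (jacobian X d d' x)) > 0"
    using det_jacobian_nonzero[OF adaptedD[OF d(1)] adaptedD[OF d(2)] x(3,4)] by simp
  then have "ln (h (slice t d') x) = ln ((cmod (det (jacobian X d d' x)))\<^sup>2) + ln (h (slice t d) x)"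
    using h2 unfolding h1 by (intro ln_mult_pos) auto
  then show ?thesis
    unfolding fibre_ext_fibre[OF d(1) x(3,5)] fibre_ext_fibre[OF d(2) x(4,5)]
      chart_potential_change[OF \<omega> c adaptedD[OF d(1)] adaptedD[OF d(2)] x(1,2,3,4)]
    by (simp add: algebra_simps)
qed

lemma slice_data_smooth:
  assumes d: "adapted t d"
  defines "T \<equiv> cproj (midx X - {b}) -` coord_dom X d (fst d)"
  shows "open T"
    "smooth_on T (coord_fun (fibre X p b t) (slice t d) f)"
    "smooth_on T (coord_fun (fibre X p b t) (slice t d) (\<lambda>y. ln (h (slice t d) y)))"
proof -
  let ?Y = "fibre X p b t" and ?s = "slice t d"
  note dM = adaptedD[OF d]
  show T: "open T"
    unfolding T_def by (rule open_vimage[OF max_open_coord_dom[OF dM max_openin[OF dM]] continuous_cproj])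
  have T1: "coord_dom ?Y ?s (fst ?s) = T"
    unfolding T_def by (rule slice_coord_dom_full[OF d]) (simp add: slice_def)
  have T2: "coord_dom ?Y ?s (topspace (mtop ?Y)) = T"
    unfolding T_def by (rule slice_coord_dom_full[OF d]) (auto simp: fibre_set_def)
  show "smooth_on T (coord_fun ?Y ?s f)"
    using f slice_atlas[OF d] unfolding smooth_fun_on_def T2[symmetric] by blast
  have hs: "smooth_on T (coord_fun ?Y ?s (h ?s))" and hp: "\<And>x. x \<in> fst ?s \<Longrightarrow> h ?s x > 0"
    using canonical_weight(1,2)[OF slice_atlas[OF d] slice_atlas[OF d]] slice_atlas[OF d]
    unfolding smooth_fun_on_def T1[symmetric] by blast+
  have "smooth_on T (\<lambda>z. ln (coord_fun ?Y ?s (h ?s) z))"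
  proof (rule smooth_on_ln[OF T hs])
    fix z assume "z \<in> T"
    then have "chart_inv ?Y ?s z \<in> fst ?s" using par_dom(1) T1 by blast
    then show "0 < coord_fun ?Y ?s (h ?s) z" using hp by (simp add: coord_fun_par)
  qed
  then show "smooth_on T (coord_fun ?Y ?s (\<lambda>y. ln (h ?s y)))" by (simp add: coord_fun_def)
qed

lemma slice_part_smooth:
  assumes d: "adapted t d"
  shows "smooth_fun_on X (slice_dom d) (\<lambda>x. coord_fun (fibre X p b t) (slice t d)
     (\<lambda>y. f y + (- (1 / (2 * pi))) * ln (h (slice t d) y)) (snd d x))"
    (is "smooth_fun_on X _ (\<lambda>x. ?G (snd d x))")
proof (rule smooth_fun_onI[OF slice_dom_open[OF d]])
  fix x assume x: "x \<in> slice_dom d"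
  note dM = adaptedD[OF d]
  let ?T = "cproj (midx X - {b}) -` coord_dom X d (fst d)" and ?S = "coord_dom X d (slice_dom d)"
  have S: "open ?S" by (rule max_open_coord_dom[OF dM slice_dom_open[OF d]])
  note T = slice_data_smooth[OF d]
  have "smooth_on ?T (\<lambda>z. coord_fun (fibre X p b t) (slice t d) f z +
      (- (1 / (2 * pi))) * coord_fun (fibre X p b t) (slice t d) (\<lambda>y. ln (h (slice t d) y)) z)"
    by (intro smooth_on_add smooth_on_mult smooth_on_const T)
  then have G: "smooth_on ?T ?G" by (simp add: coord_fun_def)
  have im: "cproj (midx X) z \<in> ?T" if "z \<in> ?S" for z
  proof -
    have "chart_inv X d z \<in> slice_dom d" by (rule max_parD[OF dM that])
    then show ?thesis using par_dom(2)[OF that] by (simp add: slice_dom_def)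
  qed
  have "smooth_on ?S (\<lambda>z. ?G (cproj (midx X) z))"
    using im by (intro smooth_on_compose[OF S T(1) _ smooth_on_linear[OF S bounded_linear_cproj] G]) blast
  moreover have "coord_fun X d (\<lambda>x. ?G (snd d x)) z = ?G (cproj (midx X) z)" if "z \<in> ?S" for z
    unfolding coord_fun_par[of X d] par_dom(2)[OF that] ..
  ultimately have "smooth_on ?S (coord_fun X d (\<lambda>x. ?G (snd d x)))"
    using smooth_on_cong[OF S, of "coord_fun X d (\<lambda>x. ?G (snd d x))" "\<lambda>z. ?G (cproj (midx X) z)"] by blast
  then show "\<exists>d' W. d' \<in> maximal_atlas X \<and> openin (mtop X) W \<and> x \<in> W \<and> W \<subseteq> fst d' \<and>
       smooth_on (coord_dom X d' W) (coord_fun X d' (\<lambda>x. ?G (snd d x)))"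
    using x dM slice_dom_open[OF d] slice_dom_subset by blast
qed

lemma chart_potential_smooth:
  assumes c: "c \<in> atlas X" and d: "adapted t d" and sub: "fst d \<subseteq> fst c"
  shows "smooth_fun_on X (fst d) (chart_potential \<omega> c d)"
proof -
  note cM = atlas_maximal[OF c] and dM = adaptedD[OF d]
  have "fst c \<inter> fst d = fst d" using sub by blast
  then show ?thesis
    unfolding chart_potential_def[abs_def]
    using smooth_fun_on_add[OF max_openin[OF dM] smooth_fun_on_subset[OF canonical_potential_smooth[OF \<omega> c] sub]]
      ln_det_jacobian_smooth[OF cM dM] by simp
qed

lemma fibre_ext_smooth:
  assumes c: "c \<in> atlas X" and d: "adapted t d" and sub: "fst d \<subseteq> fst c"
  shows "smooth_fun_on X (slice_dom d) (fibre_ext \<omega> t f h c d)"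
  unfolding fibre_ext_def[abs_def]
  by (intro smooth_fun_on_add slice_dom_open[OF d] slice_part_smooth[OF d] smooth_fun_on_mult smooth_fun_on_const
      smooth_fun_on_subset[OF chart_potential_smooth[OF c d sub] slice_dom_subset])

text \<open>The curvature of \<open>\<omega>\<close> cancels the Levi form of \<open>chart_potential\<close>, which differs from the weight in \<open>c\<close> by a
  pluriharmonic function. What remains is the Levi form of \<open>f - ln h / (2 pi)\<close> along the fibre, that is, the
  curvature form of \<open>h\<close> changed by the potential \<open>f\<close>.\<close>
lemma fibre_ext_levi:
  assumes c: "c \<in> atlas X" and d: "adapted t d" and sub: "fst d \<subseteq> fst c"
    and x: "x \<in> slice_dom d" "p x = t" and v: "dp c x v = 0"
    and \<rho>: "is_chern_form (fibre X p b t) (canonical_bundle (fibre X p b t)) h \<rho>"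
  shows "herm (midx X) (canonical_form \<omega> c x) v + herm (midx X) (i_ddbar X (fibre_ext \<omega> t f h c d) c x) v =
    herm (midx X - {b}) (\<rho> (slice t d) x + i_ddbar (fibre X p b t) f (slice t d) x)
      (push (midx X) (jacobian X c d x) v)"
proof -
  let ?I = "midx X" and ?J = "midx X - {b}" and ?Y = "fibre X p b t" and ?s = "slice t d"
  note cM = atlas_maximal[OF c] and dM = adaptedD[OF d]
  let ?r = "1 / (2 * pi)"
  let ?g = "\<lambda>y. f y + (- ?r) * ln (h ?s y)"
  let ?G = "\<lambda>x. coord_fun ?Y ?s ?g (snd d x)"
  let ?w = "push ?I (jacobian X c d x) v"
  have xd: "x \<in> fst d" using x(1) slice_dom_subset by blast
  have xc: "x \<in> fst c" using xd sub by blast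
  note U = slice_dom_open[OF d] x(1)
  have Usub: "slice_dom d \<subseteq> fst c" "slice_dom d \<subseteq> fst c \<inter> fst d" using sub slice_dom_subset[of d] by blast+
  note sG = slice_part_smooth[OF d]
  note sP = smooth_fun_on_subset[OF canonical_potential_smooth[OF \<omega> c] Usub(1)]
  note sJ = smooth_fun_on_subset[OF ln_det_jacobian_smooth[OF cM dM] Usub(2)]
  note sC = smooth_fun_on_subset[OF chart_potential_smooth[OF c d sub] slice_dom_subset]
  have "i_ddbar X (chart_potential \<omega> c d) c x = i_ddbar X (canonical_potential \<omega> c) c x"
    unfolding chart_potential_def[abs_def] i_ddbar_add[OF U sP sJ cM xc]
      ln_det_jacobian_pluriharmonic[OF cM dM xc xd] by simp
  then have "canonical_form \<omega> c x + i_ddbar X (fibre_ext \<omega> t f h c d) c x = i_ddbar X ?G c x"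
    unfolding fibre_ext_def[abs_def]
      i_ddbar_add[OF U sG smooth_fun_on_mult[OF U(1) smooth_fun_on_const[OF U(1)] sC] cM xc]
      i_ddbar_cmult[OF U sC cM xc] canonical_form_def
    by simp
  then have "herm ?I (canonical_form \<omega> c x) v + herm ?I (i_ddbar X (fibre_ext \<omega> t f h c d) c x) v =
      herm ?I (i_ddbar X ?G c x) v"
    by (simp flip: herm_add)
  also have "\<dots> = herm ?I (i_ddbar X ?G d x) ?w"
    by (rule levi_push[OF cM dM xc xd U sG])
  also have "\<dots> = herm ?J (\<chi> j k. dz j (dzbar k (\<lambda>z. coord_fun X d (\<lambda>y. complex_of_real (?G y)) (cproj ?J z))) (snd d x)) ?w"
  proof (rule levi_slice[OF _ xd U sG])
    show "adapted (p x) d" using d x(2) by simp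
    show "?w $ b = 0" using adapted_dp[OF d xd, of ?w] dp_push[OF cM dM xc xd, of v] v by simp
  qed
  also have "\<dots> = herm ?J (\<rho> ?s x + i_ddbar ?Y f ?s x) ?w"
  proof (rule herm_cong)
    fix j k assume jk: "j \<in> ?J" "k \<in> ?J"
    let ?T = "cproj ?J -` coord_dom X d (fst d)"
    note T = slice_data_smooth[OF d]
    let ?uf = "coord_fun ?Y ?s (\<lambda>y. complex_of_real (f y))"
    let ?uh = "coord_fun ?Y ?s (\<lambda>y. complex_of_real (ln (h ?s y)))"
    have uf: "smooth_on ?T ?uf" and uh: "smooth_on ?T ?uh"
      using smooth_on_of_real[OF T(1,2)] smooth_on_of_real[OF T(1,3)] by (simp_all add: coord_fun_def)
    have xT: "snd d x \<in> ?T" using x(1) by (simp add: slice_dom_def)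
    have eq: "coord_fun X d (\<lambda>y. complex_of_real (?G y)) (cproj ?J z) = ?uf z + of_real (- ?r) * ?uh z" if "z \<in> ?T" for z
    proof -
      have "snd d (chart_inv X d (cproj ?J z)) = cproj ?J z"
        using par_dom(2)[of "cproj ?J z" X d "fst d"] that by (simp add: cproj_cproj_subset)
      then have "coord_fun X d (\<lambda>y. complex_of_real (?G y)) (cproj ?J z) = complex_of_real (coord_fun ?Y ?s ?g (cproj ?J z))"
        unfolding coord_fun_par[of X d] by simp
      also have "coord_fun ?Y ?s ?g (cproj ?J z) = coord_fun ?Y ?s ?g z"
        using par_cproj[of ?Y ?s z] by (simp add: coord_fun_par)
      also have "complex_of_real (coord_fun ?Y ?s ?g z) = ?uf z + of_real (- ?r) * ?uh z"
        by (simp add: coord_fun_def)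
      finally show ?thesis .
    qed
    have "dz j (dzbar k (\<lambda>z. coord_fun X d (\<lambda>y. complex_of_real (?G y)) (cproj ?J z))) (snd d x) =
        dz j (dzbar k (\<lambda>z. ?uf z + of_real (- ?r) * ?uh z)) (snd d x)"
      by (rule dz_cong_open(1)[OF T(1) xT dz_cong_open(2)[OF T(1) _ eq]])
    also have "\<dots> = dz j (dzbar k ?uf) (snd d x) + of_real (- ?r) * dz j (dzbar k ?uh) (snd d x)"
      unfolding ddbar_add[OF T(1) xT uf smooth_on_mult[OF T(1) smooth_on_const[OF T(1)] uh]]
        ddbar_cmult[OF T(1) xT uh] ..
    also have "\<dots> = i_ddbar ?Y f ?s x $ j $ k + of_real (- ?r) * i_ddbar ?Y (\<lambda>y. ln (h ?s y)) ?s x $ j $ k"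
      by (simp add: i_ddbar_def slice_def)
    also have "of_real (- ?r) * i_ddbar ?Y (\<lambda>y. ln (h ?s y)) ?s x $ j $ k = \<rho> ?s x $ j $ k"
    proof -
      have "x \<in> fst ?s"
        using xd x(2) is_chart_subset[OF max_chart[OF dM]] by (auto simp: slice_def fibre_set_def)
      then show ?thesis
        using \<rho> slice_atlas[OF d] jk unfolding is_chern_form_def canonical_bundle_def by simp
    qed
    finally show "(\<chi> j k. dz j (dzbar k (\<lambda>z. coord_fun X d (\<lambda>y. complex_of_real (?G y)) (cproj ?J z))) (snd d x)) $ j $ k =
        (\<rho> ?s x + i_ddbar ?Y f ?s x) $ j $ k"
      by simp
  qed
  finally show ?thesis .
qed

end

end

section \<open>Vertical positivity near a fibre\<close>

context kaehler_disk_family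
begin

text \<open>Nefness of the fibre gives a potential with curvature at least \<open>- \<delta> * \<eta>\<close>, where \<open>\<delta>\<close> is chosen such that
  \<open>\<delta> * \<eta>\<close> is smaller than \<open>\<epsilon> * \<omega>\<close> on the whole compact fibre. The local extensions are averaged with bump functions;
  as they agree on the fibre, so does the average, and vertical Levi forms do not see the rest.\<close>
lemma fibre_potential:
  assumes \<omega>: "hermitian_metric X \<omega>" and t: "t \<in> ball 0 1" and \<eta>: "hermitian_metric (fibre X p b t) \<eta>"
    and nef: "nef_line_bundle (fibre X p b t) \<eta> (canonical_bundle (fibre X p b t))" and \<epsilon>: "\<epsilon> > 0"
  shows "\<exists>V F. openin (mtop X) V \<and> fibre_set t \<subseteq> V \<and> smooth_fun_on X V F \<and> (\<forall>x\<in>fibre_set t. vertically_positive \<omega> \<epsilon> F x)"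
proof -
  let ?I = "midx X" and ?J = "midx X - {b}" and ?Y = "fibre X p b t"
  obtain h \<rho> where h: "bundle_metric ?Y (canonical_bundle ?Y) h"
    and \<rho>: "is_chern_form ?Y (canonical_bundle ?Y) h \<rho>" and nc: "nef_class ?Y \<eta> \<rho>"
    using nef unfolding nef_line_bundle_def by blast
  have \<eta>r: "real_form11 ?Y \<eta>" using \<eta> by (simp add: hermitian_metric_def)
  define P where "P x0 c d K \<kappa> Z U \<longleftrightarrow> c \<in> atlas X \<and> adapted t d \<and> fst d \<subseteq> fst c \<and> K > (0::real) \<and>
     smooth_fun_on X (topspace (mtop X)) \<kappa> \<and> (\<forall>x. \<kappa> x \<ge> (0::real)) \<and> closedin (mtop X) Z \<and> Z \<subseteq> slice_dom d \<and>
     (\<forall>x. x \<notin> Z \<longrightarrow> \<kappa> x = 0) \<and> openin (mtop X) U \<and> x0 \<in> U \<and> U \<subseteq> fst d \<and> (\<forall>x\<in>U. \<kappa> x > 0) \<and>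
     (\<forall>x\<in>U. p x = t \<longrightarrow> (\<forall>v\<in>coords ?I. Re (herm ?J (\<eta> (slice t d) x) (push ?I (jacobian X c d x) v)) \<le>
        K * Re (herm ?I (\<omega> c x) v)))" for x0 c d K \<kappa> Z U
  have ex: "\<exists>c d K \<kappa> Z U. P x0 c d K \<kappa> Z U" if "x0 \<in> fibre_set t" for x0
  proof -
    have x0: "x0 \<in> topspace (mtop X)" "p x0 = t" using that by (auto simp: fibre_set_def)
    obtain c where c: "c \<in> atlas X" "x0 \<in> fst c" using point_in_chart x0 by blast
    obtain d where d: "adapted t d" "x0 \<in> fst d" "fst d \<subseteq> fst c" using adapted_exists[OF c] by blast
    note dM = adaptedD[OF d(1)]
    obtain W K where W: "openin (mtop X) W" "x0 \<in> W" "W \<subseteq> fst c \<inter> fst d" "K > 0"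
      "\<forall>x\<in>W. p x = t \<longrightarrow> (\<forall>v\<in>coords ?I. Re (herm ?J (\<eta> (slice t d) x) (push ?I (jacobian X c d x) v)) \<le>
        K * Re (herm ?I (\<omega> c x) v))"
      using fibre_metric_bound[OF \<omega> \<eta>r d(1) c(1) c(2) d(2) x0(2)] by blast
    have S: "open (coord_dom X d (fst d))" by (rule max_open_coord_dom[OF dM max_openin[OF dM]])
    have "snd d x0 \<in> coord_dom X d (fst d)" using max_coord_dom[OF dM d(2)] d(2) by simp
    then obtain r where r: "r > 0" "ball (snd d x0) r \<subseteq> coord_dom X d (fst d)"
      using S open_contains_ball by blast
    obtain \<kappa> Z U where B: "smooth_fun_on X (topspace (mtop X)) \<kappa>" "\<forall>x. \<kappa> x \<ge> (0::real)" "closedin (mtop X) Z"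
      "Z \<subseteq> {x \<in> fst d. snd d x \<in> ball (snd d x0) r}" "\<forall>x. x \<notin> Z \<longrightarrow> \<kappa> x = 0"
      "openin (mtop X) U" "x0 \<in> U" "U \<subseteq> fst d" "\<forall>x\<in>U. \<kappa> x > 0"
      using bump_exists[OF dM d(2) r] by blast
    have "cproj ?J z \<in> ball (snd d x0) r" if "z \<in> ball (snd d x0) r" for z
    proof -
      have "snd d x0 - cproj ?J z = cproj ?J (snd d x0 - z)"
        using adapted_slice_point(2)[OF d(1,2) x0(2)] linear_diff[OF bounded_linear.linear[OF bounded_linear_cproj], of ?J "snd d x0" z] by simp
      then show ?thesis using that norm_cproj_le[of ?J "snd d x0 - z"] by (simp add: dist_norm)
    qed
    then have "Z \<subseteq> slice_dom d" using B(4) r(2) by (auto simp: slice_dom_def simp del: mem_ball)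
    moreover have "openin (mtop X) (U \<inter> W)" using B(6) W(1) by blast
    ultimately have "P x0 c d K \<kappa> Z (U \<inter> W)"
      unfolding P_def using c(1) d(1,3) W(2,4,5) B(1,2,3,5,7,8,9) by blast
    then show ?thesis by blast
  qed
  have "\<forall>x\<in>fibre_set t. \<exists>c d K \<kappa> Z U. P x c d K \<kappa> Z U" using ex by blast
  then obtain c d K \<kappa> Z U where PP: "\<And>x. x \<in> fibre_set t \<Longrightarrow> P x (c x) (d x) (K x) (\<kappa> x) (Z x) (U x)"
    by metis
  have Uop: "openin (mtop X) (U x)" "x \<in> U x" if "x \<in> fibre_set t" for x
    using PP[OF that] unfolding P_def by blast+
  obtain A where A: "finite A" "A \<subseteq> fibre_set t" "fibre_set t \<subseteq> \<Union> (U ` A)"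
  proof -
    have "\<exists>\<F>. finite \<F> \<and> \<F> \<subseteq> U ` fibre_set t \<and> fibre_set t \<subseteq> \<Union> \<F>"
      using fibre_compact[OF t] Uop unfolding compactin_def by (elim conjE allE[of _ "U ` fibre_set t"]) blast
    then show ?thesis using that by (metis finite_subset_image)
  qed
  note PA = PP[OF subsetD[OF A(2)], unfolded P_def]
  \<comment> \<open>The constants \<open>K a\<close> compare the metrics on the finitely many sets of the cover, before the potential \<open>f\<close> is chosen.\<close>
  define \<delta> where "\<delta> = \<epsilon> / (2 * (1 + (\<Sum>a\<in>A. K a)))"
  have Kpos: "K a > 0" if "a \<in> A" for a using PA[OF that] by blast
  have K0: "(\<Sum>a\<in>A. K a) \<ge> 0" using Kpos by (intro sum_nonneg) (simp add: less_imp_le)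
  have \<delta>: "\<delta> > 0" using \<epsilon> K0 by (simp add: \<delta>_def)
  have \<delta>K: "\<delta> * K a < \<epsilon>" if "a \<in> A" for a
  proof -
    have "K a \<le> (\<Sum>a\<in>A. K a)" using A(1) that Kpos by (intro member_le_sum) (auto intro: less_imp_le)
    then have "\<delta> * K a \<le> \<delta> * (1 + (\<Sum>a\<in>A. K a))" using \<delta> by (intro mult_left_mono) auto
    also have "\<dots> = \<epsilon> / 2" using K0 by (simp add: \<delta>_def divide_simps)
    finally show ?thesis using \<epsilon> by simp
  qed
  obtain f where f: "smooth_fun_on ?Y (topspace (mtop ?Y)) f"
    and fge: "form_ge ?Y (\<lambda>c x. \<rho> c x + i_ddbar ?Y f c x) (\<lambda>c x. - \<delta> *\<^sub>R \<eta> c x)"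
    using nc \<delta> unfolding nef_class_def by blast
  define E where "E a = fibre_ext \<omega> t f h (c a) (d a)" for a
  define N where "N x = (\<Sum>a\<in>A. \<kappa> a x * E a x)" for x
  define D where "D x = (\<Sum>a\<in>A. \<kappa> a x)" for x
  have T: "openin (mtop X) (topspace (mtop X))" by simp
  have Esm: "smooth_fun_on X (slice_dom (d a)) (E a)" if "a \<in> A" for a
    unfolding E_def by (rule fibre_ext_smooth[OF \<omega> h f]) (use PA[OF that] in blast)+
  have sd: "openin (mtop X) (slice_dom (d a))" if "a \<in> A" for a
    using slice_dom_open PA[OF that] by blast
  have Nsm: "smooth_fun_on X (topspace (mtop X)) N"
    unfolding N_def[abs_def]
  proof (rule smooth_fun_on_sum[OF T])
    fix a assume a: "a \<in> A"
    show "smooth_fun_on X (topspace (mtop X)) (\<lambda>x. \<kappa> a x * E a x)"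
      by (rule smooth_glue_zero[OF sd[OF a] _ _ _ _ Esm[OF a], of "Z a"])
         (use PA[OF a] openin_subset[OF sd[OF a]] in \<open>auto intro: smooth_fun_on_subset\<close>)
  qed
  have Dsm: "smooth_fun_on X (topspace (mtop X)) D"
    unfolding D_def[abs_def] by (rule smooth_fun_on_sum[OF T]) (use PA in blast)
  define V where "V = {x \<in> topspace (mtop X). D x \<in> {0<..}}"
  have Vo: "openin (mtop X) V"
    unfolding V_def by (rule smooth_fun_on_continuous[OF T Dsm]) simp
  have VT: "V \<subseteq> topspace (mtop X)" by (auto simp: V_def)
  define F where "F x = N x * inverse (D x)" for x
  have Fsm: "smooth_fun_on X V F"
    unfolding F_def[abs_def]
    by (intro smooth_fun_on_mult[OF Vo] smooth_fun_on_inverse[OF Vo] smooth_fun_on_subset[OF Nsm VT]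
        smooth_fun_on_subset[OF Dsm VT]) (simp add: V_def)
  have fibV: "fibre_set t \<subseteq> V"
  proof
    fix x assume x: "x \<in> fibre_set t"
    then obtain a where a: "a \<in> A" "x \<in> U a" using A(3) by blast
    have "0 < \<kappa> a x" using PA[OF a(1)] a(2) by blast
    also have "\<dots> \<le> D x" unfolding D_def
      by (rule member_le_sum[OF a(1) _ A(1)]) (use PA in blast)
    finally show "x \<in> V" using x by (simp add: V_def fibre_set_def)
  qed
  have "vertically_positive \<omega> \<epsilon> F x" if x: "x \<in> fibre_set t" for x
  proof -
    obtain a where a: "a \<in> A" "x \<in> U a" using A(3) x by blast
    note Pa = PA[OF a(1)]
    have ca: "c a \<in> atlas X" and da: "adapted t (d a)" and sub: "fst (d a) \<subseteq> fst (c a)" using Pa by blast+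
    have xd: "x \<in> fst (d a)" using Pa a(2) by blast
    have xc: "x \<in> fst (c a)" using xd sub by blast
    have px: "p x = t" using x by (simp add: fibre_set_def)
    have xs: "x \<in> slice_dom (d a)"
    proof -
      have "\<kappa> a x > 0" using Pa a(2) by blast
      then have "x \<in> Z a" using Pa by (metis less_irrefl)
      then show ?thesis using Pa by blast
    qed
    have Fval: "F y = E a y" if y: "y \<in> V \<inter> slice_dom (d a)" "p y = p x" for y
    proof -
      have yd: "y \<in> fst (d a)" using y slice_dom_subset by blast
      have "\<kappa> a' y * E a' y = \<kappa> a' y * E a y" if a': "a' \<in> A" for a'
      proof (cases "y \<in> Z a'")
        case True
        then have yd': "y \<in> fst (d a')" using PA[OF a'] slice_dom_subset by blast
        have "E a' y = E a y"
          unfolding E_def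
          by (rule fibre_ext_independent[OF \<omega> h f]) (use PA[OF a'] Pa yd yd' y(2) px in auto)
        then show ?thesis by simp
      next
        case False
        then have "\<kappa> a' y = 0" using PA[OF a'] by blast
        then show ?thesis by simp
      qed
      then have "N y = D y * E a y"
        unfolding N_def D_def sum_distrib_right by (rule sum.cong[OF refl])
      moreover have "D y \<noteq> 0" using y by (simp add: V_def)
      ultimately show ?thesis by (simp add: F_def)
    qed
    show ?thesis
    proof (rule vposI[OF \<omega> ca xc Vo _ Fsm])
      show "x \<in> V" using x fibV by blast
      fix v assume v: "v \<in> coords ?I" "v \<noteq> 0" "dp (c a) x v = 0"
      let ?V = "V \<inter> slice_dom (d a)" and ?w = "push ?I (jacobian X (c a) (d a) x) v" and ?s = "slice t (d a)"
      have o: "openin (mtop X) ?V" using Vo sd[OF a(1)] by blast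
      have xV: "x \<in> ?V" using x fibV xs by blast
      have "herm ?I (i_ddbar X F (c a) x) v = herm ?I (i_ddbar X (E a) (c a) x) v"
        by (rule vertical_levi_cong[OF atlas_maximal[OF ca] xc o xV smooth_fun_on_subset[OF Fsm]
              smooth_fun_on_subset[OF Esm[OF a(1)]] Fval v(3)]) auto
      then have "herm ?I (twisted_form \<omega> \<epsilon> F (c a) x) v =
          herm ?J (\<rho> ?s x + i_ddbar ?Y f ?s x) ?w + \<epsilon> *\<^sub>R herm ?I (\<omega> (c a) x) v"
        using fibre_ext_levi[OF \<omega> h f ca da sub xs px v(3) \<rho>]
        by (simp add: twisted_form_def herm_add herm_scaleR E_def)
      moreover have "Re (herm ?J (\<rho> ?s x + i_ddbar ?Y f ?s x) ?w) \<ge> Re (herm ?J (- \<delta> *\<^sub>R \<eta> ?s x) ?w)"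
      proof -
        have "x \<in> fst ?s" using xd x by (simp add: slice_def)
        then show ?thesis using fge slice_atlas[OF da] unfolding form_ge_def fibre_simps by blast
      qed
      moreover have "Re (herm ?J (- \<delta> *\<^sub>R \<eta> ?s x) ?w) = - \<delta> * Re (herm ?J (\<eta> ?s x) ?w)"
        by (simp only: herm_scaleR) simp
      moreover have "Re (herm ?J (\<eta> ?s x) ?w) \<le> K a * Re (herm ?I (\<omega> (c a) x) v)"
        using Pa a(2) px v(1) by blast
      then have "\<delta> * Re (herm ?J (\<eta> ?s x) ?w) \<le> \<delta> * (K a * Re (herm ?I (\<omega> (c a) x) v))"
        using \<delta> by (intro mult_left_mono) auto
      moreover have "Re (herm ?I (\<omega> (c a) x) v) > 0"
        using \<omega> ca xc v(1,2) unfolding hermitian_metric_def by blast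
      then have "(\<delta> * K a) * Re (herm ?I (\<omega> (c a) x) v) < \<epsilon> * Re (herm ?I (\<omega> (c a) x) v)"
        using \<delta>K[OF a(1)] by (intro mult_strict_right_mono)
      ultimately show "0 < Re (herm ?I (twisted_form \<omega> \<epsilon> F (c a) x) v)" by simp
    qed
  qed
  then show ?thesis using Vo fibV Fsm by blast
qed

lemma p_smooth: "smooth_fun_on X (topspace (mtop X)) p"
  unfolding smooth_fun_on_def
proof
  fix c assume c: "c \<in> atlas X"
  note cM = atlas_maximal[OF c]
  show "smooth_on (coord_dom X c (topspace (mtop X))) (coord_fun X c p)"
    unfolding coord_dom_topspace[OF cM]
    by (rule hol_on_smooth[OF max_open_coord_dom[OF cM max_openin[OF cM]]]) (simp add: hol_on_iff p_hol[OF cM])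
qed

lemma p_open_vimage: "open B \<Longrightarrow> openin (mtop X) {x \<in> topspace (mtop X). p x \<in> B}"
  by (rule smooth_fun_on_continuous[OF openin_topspace p_smooth])

lemma p_in_disk: "x \<in> topspace (mtop X) \<Longrightarrow> p x \<in> ball 0 1"
  using family unfolding kaehler_family_def by blast

lemma smooth_compose_p:
  fixes w :: "complex \<Rightarrow> real"
  assumes w: "smooth_on UNIV w"
  shows "smooth_fun_on X (topspace (mtop X)) (\<lambda>x. w (p x))"
  unfolding smooth_fun_on_def
proof
  fix c assume c: "c \<in> atlas X"
  have "smooth_on (coord_dom X c (topspace (mtop X))) (\<lambda>z. w (coord_fun X c p z))"
    using p_smooth c unfolding smooth_fun_on_def
    by (intro smooth_on_compose[OF max_open_coord_dom[OF atlas_maximal[OF c] openin_topspace] open_UNIV _ _ w]) auto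
  then show "smooth_on (coord_dom X c (topspace (mtop X))) (coord_fun X c (\<lambda>x. w (p x)))"
    by (simp add: coord_fun_def)
qed

text \<open>A proper map is closed, so the image of the complement of \<open>V\<close> is a closed set that does not contain \<open>t\<close>.\<close>
lemma fibre_tube:
  assumes t: "t \<in> ball 0 1" and V: "openin (mtop X) V" "fibre_set t \<subseteq> V"
  shows "\<exists>\<delta>>0. \<forall>x\<in>topspace (mtop X). p x \<in> ball t \<delta> \<longrightarrow> x \<in> V"
proof -
  have "closed_map (mtop X) (top_of_set (ball 0 1)) p"
    using family by (simp add: kaehler_family_def proper_map_def)
  moreover have "closedin (mtop X) (topspace (mtop X) - V)" using V(1) by blast
  ultimately have "closedin (top_of_set (ball 0 1)) (p ` (topspace (mtop X) - V))"
    unfolding closed_map_def by blast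
  then have "openin (top_of_set (ball 0 1)) (ball 0 1 - p ` (topspace (mtop X) - V))"
    using openin_diff[OF openin_topspace] by fastforce
  then have "open (ball 0 1 - p ` (topspace (mtop X) - V))"
    using openin_open_trans by blast
  moreover have "t \<in> ball 0 1 - p ` (topspace (mtop X) - V)"
    using t V(2) by (auto simp: fibre_set_def)
  ultimately obtain \<delta> where "\<delta> > 0" "ball t \<delta> \<subseteq> ball 0 1 - p ` (topspace (mtop X) - V)"
    using open_contains_ball by blast
  then show ?thesis by blast
qed

text \<open>This is where nefness of each single fibre is turned into information on all nearby fibres: the loss of \<open>\<epsilon> * \<omega>\<close> that
  nefness permits makes the inequality strict, hence open.\<close>
lemma tube_potential:
  assumes \<omega>: "hermitian_metric X \<omega>" and t: "t \<in> ball 0 1" and \<eta>: "hermitian_metric (fibre X p b t) \<eta>"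
    and nef: "nef_line_bundle (fibre X p b t) \<eta> (canonical_bundle (fibre X p b t))" and \<epsilon>: "\<epsilon> > 0"
  shows "\<exists>\<delta>>0. \<exists>F. smooth_fun_on X {x \<in> topspace (mtop X). p x \<in> ball t \<delta>} F \<and>
     (\<forall>x\<in>topspace (mtop X). p x \<in> ball t \<delta> \<longrightarrow> vertically_positive \<omega> \<epsilon> F x)"
proof -
  obtain V F where V: "openin (mtop X) V" "fibre_set t \<subseteq> V" and F: "smooth_fun_on X V F"
    and pos: "\<And>x. x \<in> fibre_set t \<Longrightarrow> vertically_positive \<omega> \<epsilon> F x"
    using fibre_potential[OF assms] by blast
  have "\<exists>W. openin (mtop X) W \<and> x \<in> W \<and> W \<subseteq> V \<and> (\<forall>x\<in>W. vertically_positive \<omega> \<epsilon> F x)" if "x \<in> fibre_set t" for x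
    using vpos_open[OF \<omega> V(1) _ F pos[OF that]] that V(2) by blast
  then obtain W where W: "\<And>x. x \<in> fibre_set t \<Longrightarrow> openin (mtop X) (W x) \<and> x \<in> W x \<and> W x \<subseteq> V \<and> (\<forall>y\<in>W x. vertically_positive \<omega> \<epsilon> F y)"
    by metis
  have "openin (mtop X) (\<Union> (W ` fibre_set t))" using W by blast
  moreover have "fibre_set t \<subseteq> \<Union> (W ` fibre_set t)" using W by blast
  ultimately obtain \<delta> where \<delta>: "\<delta> > 0" "\<forall>x\<in>topspace (mtop X). p x \<in> ball t \<delta> \<longrightarrow> x \<in> \<Union> (W ` fibre_set t)"
    using fibre_tube[OF t] by blast
  have "{x \<in> topspace (mtop X). p x \<in> ball t \<delta>} \<subseteq> V" using \<delta>(2) W by blast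
  then have "smooth_fun_on X {x \<in> topspace (mtop X). p x \<in> ball t \<delta>} F" by (rule smooth_fun_on_subset[OF F])
  moreover have "\<forall>x\<in>topspace (mtop X). p x \<in> ball t \<delta> \<longrightarrow> vertically_positive \<omega> \<epsilon> F x" using \<delta>(2) W by blast
  ultimately show ?thesis using \<delta>(1) by blast
qed

end

section \<open>Gluing over the disk\<close>

lemma smooth_on_norm_diff: "smooth_on UNIV (\<lambda>z::complex. (r::real) - (z - a) \<bullet> (z - a))"
proof (rule smooth_on_diff[OF open_UNIV smooth_on_const[OF open_UNIV]])
  have "smooth_on UNIV (\<lambda>z::complex. z - a)"
    by (intro smooth_on_diff smooth_on_linear[OF open_UNIV bounded_linear_ident] smooth_on_const open_UNIV)
  then show "smooth_on UNIV (\<lambda>z. (z - a) \<bullet> (z - a))"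
    unfolding smooth_on_def using Ck_on_bilinear[OF bounded_bilinear_inner open_UNIV] by blast
qed

lemma smooth_on_flat_compose:
  fixes g :: "'a::real_normed_vector \<Rightarrow> real"
  shows "smooth_on UNIV g \<Longrightarrow> smooth_on UNIV (\<lambda>z. flat_exp_power k (g z))"
  by (rule smooth_on_compose[OF open_UNIV open_UNIV _ _ smooth_on_flat_exp_power]) auto

text \<open>The bump functions \<open>\<theta> k\<close> of the balls are multiplied by factors that vanish as soon as some earlier \<open>\<theta> j\<close> exceeds
  \<open>1 / (k + 1)\<close>. Near a point where \<open>\<theta> j\<close> is positive this kills all late weights, while the first weight that is
  positive there is not affected.\<close>
lemma locally_finite_weights:
  fixes a :: "nat \<Rightarrow> complex" and r :: "nat \<Rightarrow> real"
  assumes r: "\<And>k. r k > 0" and cover: "D \<subseteq> (\<Union>k. ball (a k) (r k))"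
  shows "\<exists>w :: nat \<Rightarrow> complex \<Rightarrow> real. (\<forall>k. smooth_on UNIV (w k)) \<and> (\<forall>k z. w k z \<ge> 0) \<and>
     (\<forall>k z. z \<notin> ball (a k) (r k) \<longrightarrow> w k z = 0) \<and> (\<forall>z\<in>D. \<exists>k. w k z > 0) \<and>
     (\<forall>z\<in>D. \<exists>N. \<exists>B. open B \<and> z \<in> B \<and> (\<forall>y\<in>B. \<forall>k\<ge>N. w k y = 0))"
proof -
  define \<theta> where "\<theta> k z = flat_exp_power 0 ((r k)\<^sup>2 - (z - a k) \<bullet> (z - a k))" for k z
  define w where "w k z = \<theta> k z * (\<Prod>j<k. flat_exp_power 0 (1 / Suc k - \<theta> j z))" for k z
  have \<theta>s: "smooth_on UNIV (\<theta> k)" for k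
    unfolding \<theta>_def[abs_def] by (rule smooth_on_flat_compose[OF smooth_on_norm_diff])
  have \<theta>0: "\<theta> k z \<ge> 0" for k z by (simp add: \<theta>_def flat_exp_power_nonneg)
  have \<theta>p: "\<theta> k z > 0 \<longleftrightarrow> z \<in> ball (a k) (r k)" for k z
  proof -
    have "\<theta> k z > 0 \<longleftrightarrow> (norm (z - a k))\<^sup>2 < (r k)\<^sup>2"
      by (simp add: \<theta>_def flat_exp_power_pos_iff power2_norm_eq_inner)
    also have "\<dots> \<longleftrightarrow> norm (z - a k) < r k"
      using r[of k] power2_less_imp_less[of "norm (z - a k)" "r k"] power_strict_mono[of "norm (z - a k)" "r k" 2] by auto
    finally show ?thesis by (simp add: dist_norm norm_minus_commute)
  qed
  have ws: "smooth_on UNIV (w k)" for k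
    unfolding w_def[abs_def]
    by (intro smooth_on_mult smooth_on_prod smooth_on_flat_compose smooth_on_diff smooth_on_const \<theta>s open_UNIV)
  have w0: "w k z \<ge> 0" for k z
    unfolding w_def by (intro mult_nonneg_nonneg prod_nonneg \<theta>0) (simp add: flat_exp_power_nonneg)
  have wz: "w k z = 0" if "z \<notin> ball (a k) (r k)" for k z
    using \<theta>p[of k z] \<theta>0[of k z] that by (simp add: w_def)
  have ex: "\<exists>k. z \<in> ball (a k) (r k)" if "z \<in> D" for z using cover that by blast
  have wp: "\<exists>k. w k z > 0" if z: "z \<in> D" for z
  proof -
    define k where "k = (LEAST k. z \<in> ball (a k) (r k))"
    have k: "z \<in> ball (a k) (r k)" unfolding k_def by (rule LeastI_ex[OF ex[OF z]])
    have "\<theta> j z = 0" if "j < k" for j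
      using not_less_Least[of j "\<lambda>k. z \<in> ball (a k) (r k)"] that \<theta>p[of j z] \<theta>0[of j z] by (simp add: k_def)
    then have "w k z > 0"
      using k \<theta>p[of k z] unfolding w_def by (intro mult_pos_pos prod_pos) (auto simp: flat_exp_power_pos_iff)
    then show ?thesis by blast
  qed
  have "\<exists>N. \<exists>B. open B \<and> z \<in> B \<and> (\<forall>y\<in>B. \<forall>k\<ge>N. w k y = 0)" if z: "z \<in> D" for z
  proof -
    obtain j where j: "z \<in> ball (a j) (r j)" using ex[OF z] by blast
    then have m: "\<theta> j z > 0" using \<theta>p by blast
    obtain M where M: "1 / Suc M < \<theta> j z / 2" using nat_approx_posE[of "\<theta> j z / 2"] m by auto
    define B where "B = \<theta> j -` {\<theta> j z / 2<..}"
    have "open B" unfolding B_def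
      by (rule open_vimage[OF open_greaterThan smooth_on_continuous[OF \<theta>s]])
    moreover have "z \<in> B" using m by (simp add: B_def)
    moreover have "w k y = 0" if y: "y \<in> B" and k: "k \<ge> max (Suc j) M" for y k
    proof -
      have "1 / Suc k \<le> 1 / Suc M" using k by (intro divide_left_mono) auto
      then have "1 / Suc k - \<theta> j y \<le> 0" using y M unfolding B_def by simp
      then have "flat_exp_power 0 (1 / Suc k - \<theta> j y) = 0"
        by (simp add: flat_exp_power_def)
      then have "(\<Prod>j<k. flat_exp_power 0 (1 / Suc k - \<theta> j y)) = 0"
        using k by (intro prod_zero bexI[of _ j]) auto
      then show ?thesis unfolding w_def by simp
    qed
    ultimately show ?thesis by blast
  qed
  then show ?thesis using ws w0 wz wp by (intro exI[of _ w]) blast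
qed

context kaehler_disk_family
begin

lemma i_ddbar_sum:
  assumes V: "openin (mtop X) V" "x \<in> V" and f: "\<And>i. i \<in> A \<Longrightarrow> smooth_fun_on X V (f i)"
    and c: "c \<in> maximal_atlas X" "x \<in> fst c" and A: "finite A"
  shows "i_ddbar X (\<lambda>y. \<Sum>i\<in>A. f i y) c x = (\<Sum>i\<in>A. i_ddbar X (f i) c x)"
  using A f
proof (induction A rule: finite_induct)
  case empty
  have "i_ddbar X (\<lambda>y. 0 * 0) c x = 0"
    using i_ddbar_cmult[OF V smooth_fun_on_const[OF V(1)] c, of 0 0] by simp
  then show ?case by simp
next
  case (insert a A)
  have "i_ddbar X (\<lambda>y. f a y + (\<Sum>i\<in>A. f i y)) c x = i_ddbar X (f a) c x + i_ddbar X (\<lambda>y. \<Sum>i\<in>A. f i y) c x"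
    using insert.prems by (intro i_ddbar_add[OF V _ _ c] smooth_fun_on_sum[OF V(1)]) auto
  then show ?case using insert by simp
qed

lemma herm_sum: "herm I (\<Sum>i\<in>A. B i) v = (\<Sum>i\<in>A. herm I (B i) v)"
proof (induction A rule: infinite_finite_induct)
  case (insert a A)
  then show ?case by (simp add: herm_add)
qed (simp_all add: herm_def)

text \<open>The weights are functions of the base, so on each fibre the glued function is a convex combination of the local
  potentials with constant coefficients, and vertical positivity is preserved by convex combinations.\<close>
lemma global_vertical_potential:
  assumes \<omega>: "hermitian_metric X \<omega>" and \<epsilon>: "\<epsilon> > 0"
    and nef: "\<forall>t\<in>ball 0 1. \<exists>\<eta>. hermitian_metric (fibre X p b t) \<eta> \<and>
           nef_line_bundle (fibre X p b t) \<eta> (canonical_bundle (fibre X p b t))"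
  shows "\<exists>G. smooth_fun_on X (topspace (mtop X)) G \<and> (\<forall>x\<in>topspace (mtop X). vertically_positive \<omega> \<epsilon> G x)"
proof -
  let ?D = "ball (0::complex) 1"
  let ?T = "topspace (mtop X)"
  define tube where "tube t \<delta> = {x \<in> ?T. p x \<in> ball t \<delta>}" for t \<delta>
  have "\<forall>t\<in>?D. \<exists>\<delta> F. \<delta> > 0 \<and> smooth_fun_on X (tube t \<delta>) F \<and> (\<forall>x\<in>tube t \<delta>. vertically_positive \<omega> \<epsilon> F x)"
  proof
    fix t assume t: "t \<in> ?D"
    obtain \<eta> where "hermitian_metric (fibre X p b t) \<eta>"
      "nef_line_bundle (fibre X p b t) \<eta> (canonical_bundle (fibre X p b t))"
      using nef t by blast
    from tube_potential[OF \<omega> t this \<epsilon>]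
    show "\<exists>\<delta> F. \<delta> > 0 \<and> smooth_fun_on X (tube t \<delta>) F \<and> (\<forall>x\<in>tube t \<delta>. vertically_positive \<omega> \<epsilon> F x)"
      unfolding tube_def by blast
  qed
  then obtain \<delta> F where \<delta>: "\<And>t. t \<in> ?D \<Longrightarrow> \<delta> t > 0" and F: "\<And>t. t \<in> ?D \<Longrightarrow> smooth_fun_on X (tube t (\<delta> t)) (F t)"
    and Fpos: "\<And>t x. t \<in> ?D \<Longrightarrow> x \<in> tube t (\<delta> t) \<Longrightarrow> vertically_positive \<omega> \<epsilon> (F t) x"
    by metis
  let ?b = "\<lambda>t. ball t (\<delta> t / 2)"
  have bo: "open S" if "S \<in> ?b ` ?D" for S using that by auto
  obtain \<C> where \<C>: "\<C> \<subseteq> ?b ` ?D" "countable \<C>" "\<Union>\<C> = \<Union> (?b ` ?D)"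
    by (rule Lindelof[OF bo])
  obtain T where T: "countable T" "T \<subseteq> ?D" "\<C> = ?b ` T"
    using \<C>(1,2) countable_subset_image[of \<C> ?b ?D] by blast
  have covT: "?D \<subseteq> (\<Union>t\<in>T. ball t (\<delta> t / 2))"
  proof
    fix z assume z: "z \<in> ?D"
    then have "z \<in> ball z (\<delta> z / 2)" using \<delta>[OF z] by simp
    then have "z \<in> \<Union>\<C>" using \<C>(3) z by blast
    then show "z \<in> (\<Union>t\<in>T. ball t (\<delta> t / 2))" using T(3) by blast
  qed
  have "T \<noteq> {}" using covT by force
  define a where "a = from_nat_into T"
  have aT: "range a = T" unfolding a_def by (rule range_from_nat_into[OF \<open>T \<noteq> {}\<close> T(1)])
  have aD: "a k \<in> ?D" for k using aT T(2) by blast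
  have rpos: "\<delta> (a k) / 2 > 0" for k using \<delta>[OF aD] by simp
  have cov: "?D \<subseteq> (\<Union>k. ball (a k) (\<delta> (a k) / 2))" using covT aT by blast
  obtain w :: "nat \<Rightarrow> complex \<Rightarrow> real" where ws: "\<And>k. smooth_on UNIV (w k)" and w0: "\<And>k z. w k z \<ge> 0"
    and wz: "\<And>k z. z \<notin> ball (a k) (\<delta> (a k) / 2) \<Longrightarrow> w k z = 0" and wp: "\<And>z. z \<in> ?D \<Longrightarrow> \<exists>k. w k z > 0"
    and wf: "\<And>z. z \<in> ?D \<Longrightarrow> \<exists>N. \<exists>B. open B \<and> z \<in> B \<and> (\<forall>y\<in>B. \<forall>k\<ge>N. w k y = 0)"
    using locally_finite_weights[of "\<lambda>k. \<delta> (a k) / 2" ?D a, OF rpos cov] by blast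
  define V where "V k = tube (a k) (\<delta> (a k))" for k
  define f where "f k = F (a k)" for k
  have Vo: "openin (mtop X) (V k)" for k unfolding V_def tube_def by (rule p_open_vimage[OF open_ball])
  have fs: "smooth_fun_on X (V k) (f k)" for k unfolding V_def f_def by (rule F[OF aD])
  have fp: "vertically_positive \<omega> \<epsilon> (f k) x" if "x \<in> V k" for k x using Fpos[OF aD] that unfolding V_def f_def by blast
  have wV: "x \<in> V k" if "x \<in> ?T" "w k (p x) \<noteq> 0" for x k
  proof -
    have "p x \<in> ball (a k) (\<delta> (a k) / 2)" using wz[of "p x" k] that by blast
    then show ?thesis using that(1) \<delta>[OF aD[of k]] by (auto simp: V_def tube_def)
  qed
  have trm: "smooth_fun_on X ?T (\<lambda>x. w k (p x) * f k x)" for k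
  proof (rule smooth_glue_zero[OF Vo _ _ smooth_fun_on_subset[OF smooth_compose_p[OF ws]] _ fs])
    let ?Z = "?T - {x \<in> ?T. p x \<in> - cball (a k) (\<delta> (a k) / 2)}"
    show "closedin (mtop X) ?Z" by (intro closedin_diff closedin_topspace p_open_vimage) auto
    show "?Z \<subseteq> V k" using \<delta>[OF aD[of k]] by (auto simp: V_def tube_def)
    show "w k (p x) = 0" if "x \<in> ?T" "x \<notin> ?Z" for x
      using that by (intro wz) auto
    show "V k \<subseteq> ?T" by (auto simp: V_def tube_def)
  qed
  define num where "num N x = (\<Sum>k<N. w k (p x) * f k x)" for N x
  define den where "den N z = (\<Sum>k<N. w k z)" for N z
  \<comment> \<open>Any bound beyond which the weights vanish at the point gives the same sum, so the choice is immaterial (\<open>G_eq\<close>).\<close>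
  define \<N> where "\<N> z = (SOME N. \<forall>k\<ge>N. w k z = 0)" for z
  define G where "G x = num (\<N> (p x)) x * inverse (den (\<N> (p x)) (p x))" for x
  have G_eq: "G x = num N x * inverse (den N (p x))" if N: "\<forall>k\<ge>N. w k (p x) = 0" for x N
  proof -
    have *: "\<forall>k\<ge>\<N> (p x). w k (p x) = 0" unfolding \<N>_def by (rule someI[of _ N]) (rule N)
    have trunc: "(\<Sum>k<M. w k (p x) * g k) = (\<Sum>k<max N (\<N> (p x)). w k (p x) * g k)"
      if "\<forall>k\<ge>M. w k (p x) = 0" "M \<le> max N (\<N> (p x))" for M and g :: "nat \<Rightarrow> real"
      using that by (intro sum.mono_neutral_left) (auto simp: not_less)
    have "num (\<N> (p x)) x = num N x"
      unfolding num_def using trunc[OF *, of "\<lambda>k. f k x"] trunc[OF N, of "\<lambda>k. f k x"] by simp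
    moreover have "den (\<N> (p x)) (p x) = den N (p x)"
      unfolding den_def using trunc[OF *, of "\<lambda>k. 1"] trunc[OF N, of "\<lambda>k. 1"] by simp
    ultimately show ?thesis by (simp add: G_def)
  qed
  have loc: "\<exists>N W. openin (mtop X) W \<and> x \<in> W \<and> W \<subseteq> ?T \<and> (\<forall>y\<in>W. \<forall>k\<ge>N. w k (p y) = 0)" if x: "x \<in> ?T" for x
  proof -
    obtain N B where "open B" "p x \<in> B" "\<forall>y\<in>B. \<forall>k\<ge>N. w k y = 0" using wf[OF p_in_disk[OF x]] by blast
    then show ?thesis
      using x p_open_vimage by (intro exI[of _ N] exI[of _ "{x \<in> ?T. p x \<in> B}"]) auto
  qed
  have den_pos: "den N (p y) > 0" if y: "y \<in> ?T" and N: "\<forall>k\<ge>N. w k (p y) = 0" for y N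
  proof -
    obtain k where k: "w k (p y) > 0" using wp[OF p_in_disk[OF y]] by blast
    then have "k < N" using N by (metis less_irrefl not_less)
    then have "w k (p y) \<le> den N (p y)" unfolding den_def
      using w0 by (intro member_le_sum) auto
    with k show ?thesis by linarith
  qed
  have num_sm: "smooth_fun_on X ?T (num N)" for N
    unfolding num_def[abs_def] by (rule smooth_fun_on_sum[OF openin_topspace]) (rule trm)
  have den_sm: "smooth_fun_on X ?T (\<lambda>x. den N (p x))" for N
    unfolding den_def by (rule smooth_fun_on_sum[OF openin_topspace]) (rule smooth_compose_p[OF ws])
  have "smooth_fun_on X ?T G"
  proof (rule smooth_fun_on_openin_cover[OF openin_topspace])
    fix x assume x: "x \<in> ?T"
    obtain N W where W: "openin (mtop X) W" "x \<in> W" "W \<subseteq> ?T" "\<forall>y\<in>W. \<forall>k\<ge>N. w k (p y) = 0"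
      using loc[OF x] by (elim exE conjE)
    have dp0: "den N (p y) \<noteq> 0" if "y \<in> W" for y
    proof -
      have "den N (p y) > 0" by (rule den_pos[OF subsetD[OF W(3) that]]) (use W(4) that in blast)
      then show ?thesis by simp
    qed
    have "smooth_fun_on X W (\<lambda>y. num N y * inverse (den N (p y)))"
      by (rule smooth_fun_on_mult[OF W(1) smooth_fun_on_subset[OF num_sm W(3)]
            smooth_fun_on_inverse[OF W(1) smooth_fun_on_subset[OF den_sm W(3)] dp0]])
    moreover have "num N y * inverse (den N (p y)) = G y" if "y \<in> W" for y
      by (rule G_eq[symmetric]) (use W(4) that in blast)
    ultimately have "smooth_fun_on X W G"
      by (rule_tac smooth_fun_on_cong[OF W(1)])
    then show "\<exists>W. openin (mtop X) W \<and> x \<in> W \<and> smooth_fun_on X W G" using W by blast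
  qed
  moreover have "vertically_positive \<omega> \<epsilon> G x" if x: "x \<in> ?T" for x
  proof -
    obtain N W where W: "openin (mtop X) W" "x \<in> W" "W \<subseteq> ?T" "\<forall>y\<in>W. \<forall>k\<ge>N. w k (p y) = 0"
      using loc[OF x] by (elim exE conjE)
    define A where "A = {k. k < N \<and> w k (p x) \<noteq> 0}"
    have Af: "finite A" by (simp add: A_def)
    define s where "s = den N (p x)"
    have s: "s > 0" unfolding s_def using den_pos x W(2,4) by blast
    define m where "m k = w k (p x) / s" for k
    have mpos: "m k > 0" if "k \<in> A" for k
      using that w0[of k "p x"] s by (simp add: A_def m_def less_le)
    have msum: "(\<Sum>k\<in>A. m k) = 1"
    proof -
      have "s = (\<Sum>k\<in>A. w k (p x))"
        unfolding s_def den_def by (rule sum.mono_neutral_right) (auto simp: A_def)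
      then show ?thesis using s by (simp add: m_def flip: sum_divide_distrib)
    qed
    obtain c where c: "c \<in> atlas X" "x \<in> fst c" using point_in_chart x by blast
    note cM = atlas_maximal[OF c(1)]
    have xA: "x \<in> V k" if "k \<in> A" for k using wV[OF x] that by (simp add: A_def)
    have "openin (mtop X) (W \<inter> \<Inter> (V ` A) \<inter> W)"
    proof (cases "A = {}")
      case False
      then have "openin (mtop X) (\<Inter> (V ` A))" using Af Vo by (intro openin_Inter) auto
      then show ?thesis using W(1) by blast
    qed (use W(1) in auto)
    then have o: "openin (mtop X) (W \<inter> \<Inter> (V ` A))" (is "openin _ ?W") by (simp add: Int_ac)
    have xW: "x \<in> ?W" using W(2) xA by blast
    have fA: "smooth_fun_on X ?W (f k)" if "k \<in> A" for k
      by (rule smooth_fun_on_subset[OF fs]) (use that in blast)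
    have fmA: "smooth_fun_on X ?W (\<lambda>y. m k * f k y)" if "k \<in> A" for k
      by (rule smooth_fun_on_mult[OF o smooth_fun_on_const[OF o] fA[OF that]])
    have Gsm: "smooth_fun_on X ?W G" by (rule smooth_fun_on_subset[OF \<open>smooth_fun_on X ?T G\<close>]) (use W(3) in blast)
    have Gval: "G y = (\<Sum>k\<in>A. m k * f k y)" if y: "y \<in> ?W" "p y = p x" for y
    proof -
      have "G y = num N y * inverse (den N (p y))" by (rule G_eq) (use y W(4) in blast)
      also have "num N y = (\<Sum>k\<in>A. w k (p x) * f k y)"
        unfolding num_def y(2) by (rule sum.mono_neutral_right) (auto simp: A_def)
      finally show ?thesis by (simp add: y(2) s_def m_def sum_distrib_left divide_inverse mult_ac)
    qed
    show ?thesis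
    proof (rule vposI[OF \<omega> c openin_topspace x \<open>smooth_fun_on X ?T G\<close>])
      fix v assume v: "v \<in> coords (midx X)" "v \<noteq> 0" "dp c x v = 0"
      let ?h = "\<lambda>B. herm (midx X) B v"
      have "?h (i_ddbar X G c x) = ?h (i_ddbar X (\<lambda>y. \<Sum>k\<in>A. m k * f k y) c x)"
        by (rule vertical_levi_cong[OF cM c(2) o xW Gsm smooth_fun_on_sum[OF o fmA] Gval v(3)])
      also have "i_ddbar X (\<lambda>y. \<Sum>k\<in>A. m k * f k y) c x = (\<Sum>k\<in>A. m k *\<^sub>R i_ddbar X (f k) c x)"
        using i_ddbar_sum[OF o xW fmA cM c(2) Af] i_ddbar_cmult[OF o xW fA cM c(2)] by simp
      finally have e: "Re (?h (i_ddbar X G c x)) = (\<Sum>k\<in>A. m k * Re (?h (i_ddbar X (f k) c x)))"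
        by (simp add: herm_sum herm_scaleR)
      define q where "q = Re (?h (canonical_form \<omega> c x)) + \<epsilon> * Re (?h (\<omega> c x))"
      have tq: "Re (?h (twisted_form \<omega> \<epsilon> g c x)) = q + Re (?h (i_ddbar X g c x))" for g
        by (simp add: twisted_form_def herm_add herm_scaleR q_def)
      have "Re (?h (twisted_form \<omega> \<epsilon> G c x)) = (\<Sum>k\<in>A. m k * (q + Re (?h (i_ddbar X (f k) c x))))"
        by (simp add: tq e distrib_left sum.distrib msum flip: sum_distrib_right)
      also have "\<dots> = (\<Sum>k\<in>A. m k * Re (?h (twisted_form \<omega> \<epsilon> (f k) c x)))" by (simp add: tq)
      also have "\<dots> > 0"
      proof (rule sum_pos[OF Af])
        show "A \<noteq> {}" using msum by auto
        show "0 < m k * Re (?h (twisted_form \<omega> \<epsilon> (f k) c x))" if "k \<in> A" for k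
          using mpos[OF that] fp[OF xA[OF that]] c v unfolding vertically_positive_def by simp
      qed
      finally show "0 < Re (?h (twisted_form \<omega> \<epsilon> G c x))" .
    qed
  qed
  ultimately show ?thesis by blast
qed

end

section \<open>Horizontal positivity, and nefness\<close>

lemma flat_exp_DERIV:
  "(flat_exp_power 0 has_real_derivative flat_exp_power 2 x) (at x)"
  "(flat_exp_power 2 has_real_derivative flat_exp_power 4 x - 2 * flat_exp_power 3 x) (at x)"
  using flat_exp_power_DERIV[of 0 x] flat_exp_power_DERIV[of 2 x] by (simp_all add: numeral_2_eq_2 eval_nat_numeral)

lemma flat_exp_power_2_mono:
  assumes "x \<le> y" "y \<le> 1 / 2"
  shows "flat_exp_power 2 x \<le> flat_exp_power 2 y"
  by (rule DERIV_nonneg_imp_nondecreasing[OF assms(1)])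
     (use flat_exp_DERIV(2) flat_exp_second_derivative_nonneg assms(2) order_trans in blast)

text \<open>The chain rule for the square of the absolute value of \<open>P\<close>, whose Levi form is \<open>dz j P * cnj (dz k P)\<close>. The
  division by 4 keeps the argument at most 1/2, where the flat function is convex, if \<open>P\<close> takes values in the disk and
  \<open>s\<close> is at least -1.\<close>
lemma ddbar_radial:
  assumes S: "open S" and z: "z \<in> S" and P: "hol_on S P"
  shows "dz j (dzbar k (\<lambda>y. complex_of_real (K * flat_exp_power 0 (((cmod (P y))\<^sup>2 - s) / 4)))) z =
     of_real (K / 4 * (flat_exp_power 2 (((cmod (P z))\<^sup>2 - s) / 4) +
        (flat_exp_power 4 (((cmod (P z))\<^sup>2 - s) / 4) - 2 * flat_exp_power 3 (((cmod (P z))\<^sup>2 - s) / 4)) *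
          ((cmod (P z))\<^sup>2 / 4))) * (dz j P z * cnj (dz k P z))"
proof -
  define q where "q y = ((cmod (P y))\<^sup>2 - s) / 4" for y
  have Ph: "hol_at P y" if "y \<in> S" for y using P that by (simp add: hol_on_iff)
  have dP: "P differentiable (at y)" "(\<lambda>y. cnj (P y)) differentiable (at y)" if "y \<in> S" for y
    using hol_at_differentiable[OF Ph[OF that]] differentiable_cnj by blast+
  have hk: "hol_at (dz k P) z" using hol_on_dz[OF S P] z by (simp add: hol_on_iff)
  have q_eq: "q = (\<lambda>y. 1 / 4 * ((cmod (P y))\<^sup>2 + (- s)))" by (simp add: q_def fun_eq_iff)
  have qs: "smooth_on S q"
    unfolding q_eq by (intro smooth_on_mult smooth_on_add smooth_on_const smooth_on_cmod2 S hol_on_smooth P)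
  have qd: "q differentiable (at y)" if "y \<in> S" for y by (rule smooth_on_differentiable[OF qs that])
  have qc: "(\<lambda>y. complex_of_real (q y)) = (\<lambda>y. 1 / 4 * (P y * cnj (P y)) + of_real (- s / 4))"
    by (simp add: q_eq fun_eq_iff complex_norm_square algebra_simps add_divide_distrib diff_divide_distrib flip: of_real_power)
  have dq: "dz j (\<lambda>y. complex_of_real (q y)) y = 1 / 4 * (cnj (P y) * dz j P y)"
    "dzbar k (\<lambda>y. complex_of_real (q y)) y = 1 / 4 * (P y * cnj (dz k P y))" if y: "y \<in> S" for y j k
  proof -
    have m: "(\<lambda>y. P y * cnj (P y)) differentiable (at y)" using dP[OF y] by (intro differentiable_mult)
    have m4: "(\<lambda>y. 1 / 4 * (P y * cnj (P y))) differentiable (at y)" by (intro differentiable_mult m differentiable_const)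
    have c: "(\<lambda>y. complex_of_real (- s / 4)) differentiable (at y)" by (rule differentiable_const)
    show "dz j (\<lambda>y. complex_of_real (q y)) y = 1 / 4 * (cnj (P y) * dz j P y)"
      "dzbar k (\<lambda>y. complex_of_real (q y)) y = 1 / 4 * (P y * cnj (dz k P y))"
      unfolding qc dz_add[OF m4 c] dz_cmult[OF m] dz_mult[OF dP[OF y]] dz_cnj[OF dP(1)[OF y]] dz_const
      using Ph[OF y] by (simp_all add: hol_at_def)
  qed
  let ?A = "\<lambda>y. complex_of_real (K * flat_exp_power 2 (q y))" and ?B = "\<lambda>y. 1 / 4 * (P y * cnj (dz k P y))"
  have E0: "((\<lambda>x. K * flat_exp_power 0 x) has_real_derivative K * flat_exp_power 2 x) (at x)" for x
    by (rule DERIV_cmult[OF flat_exp_DERIV(1)])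
  have E2: "((\<lambda>x. K * flat_exp_power 2 x) has_real_derivative K * (flat_exp_power 4 x - 2 * flat_exp_power 3 x)) (at x)" for x
    by (rule DERIV_cmult[OF flat_exp_DERIV(2)])
  have 1: "dzbar k (\<lambda>y. complex_of_real (K * flat_exp_power 0 (q y))) y = ?A y * ?B y" if "y \<in> S" for y
    unfolding dz_real_chain(2)[OF qd[OF that] E0] dq(2)[OF that] ..
  have Ad: "?A differentiable (at z)"
  proof (rule differentiable_of_real)
    have "(\<lambda>y. K * flat_exp_power 2 (q y)) differentiable (at z)"
      using smooth_on_compose[OF S open_UNIV _ qs smooth_on_flat_exp_power[of 2]]
      by (intro differentiable_mult differentiable_const smooth_on_differentiable[OF _ z]) auto
    then show "(\<lambda>y. K * flat_exp_power 2 (q y)) differentiable (at z)" .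
  qed
  have Bm: "(\<lambda>y. P y * cnj (dz k P y)) differentiable (at z)"
    by (intro differentiable_mult dP(1)[OF z] differentiable_cnj hol_at_differentiable[OF hk])
  have Bd: "?B differentiable (at z)" by (intro differentiable_mult differentiable_const Bm)
  have "dz j (dzbar k (\<lambda>y. complex_of_real (K * flat_exp_power 0 (q y)))) z = dz j (\<lambda>y. ?A y * ?B y) z"
    by (rule dz_cong_open(1)[OF S z 1])
  also have "\<dots> = ?A z * dz j ?B z + ?B z * dz j ?A z" by (rule dz_mult(1)[OF Ad Bd])
  also have "dz j ?B z = 1 / 4 * (cnj (dz k P z) * dz j P z)"
    unfolding dz_cmult(1)[OF Bm] dz_mult(1)[OF dP(1)[OF z] differentiable_cnj[OF hol_at_differentiable[OF hk]]]
      dz_cnj(1)[OF hol_at_differentiable[OF hk]]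
    using hk by (simp add: hol_at_def)
  also have "dz j ?A z = of_real (K * (flat_exp_power 4 (q z) - 2 * flat_exp_power 3 (q z))) * (1 / 4 * (cnj (P z) * dz j P z))"
    unfolding dz_real_chain(1)[OF qd[OF z] E2] dq(1)[OF z] ..
  also have "?A z * (1 / 4 * (cnj (dz k P z) * dz j P z)) +
      ?B z * (of_real (K * (flat_exp_power 4 (q z) - 2 * flat_exp_power 3 (q z))) * (1 / 4 * (cnj (P z) * dz j P z))) =
    (of_real (K / 4 * flat_exp_power 2 (q z)) +
      of_real (K / 4 * (flat_exp_power 4 (q z) - 2 * flat_exp_power 3 (q z)) / 4) * (P z * cnj (P z))) * (dz j P z * cnj (dz k P z))"
  proof -
    have alg: "A * (1 / 4 * (d2 * d1)) + 1 / 4 * (u * d2) * (F * (1 / 4 * (u' * d1))) =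
        (A / 4 + F / 16 * (u * u')) * (d1 * d2)" for A F u u' d1 d2 :: complex
      by (simp add: algebra_simps)
    show ?thesis unfolding alg by simp
  qed
  also have "P z * cnj (P z) = of_real ((cmod (P z))\<^sup>2)"
    by (simp only: complex_norm_square[symmetric] of_real_power)
  also have "of_real (K / 4 * flat_exp_power 2 (q z)) +
      of_real (K / 4 * (flat_exp_power 4 (q z) - 2 * flat_exp_power 3 (q z)) / 4) * of_real ((cmod (P z))\<^sup>2) =
    complex_of_real (K / 4 * (flat_exp_power 2 (q z) +
      (flat_exp_power 4 (q z) - 2 * flat_exp_power 3 (q z)) * ((cmod (P z))\<^sup>2 / 4)))"
  proof -
    have "K / 4 * x + K / 4 * y / 4 * u = K / 4 * (x + y * (u / 4))" for x y u :: real
      by (simp add: algebra_simps)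
    then show ?thesis by (simp only: of_real_mult[symmetric] of_real_add[symmetric])
  qed
  finally show ?thesis by (simp only: q_def)
qed

context kaehler_disk_family
begin

definition radial :: "real \<Rightarrow> real \<Rightarrow> 'a \<Rightarrow> real" where
  "radial K s y = K * flat_exp_power 0 (((cmod (p y))\<^sup>2 - s) / 4)"

lemma radial_smooth: "smooth_fun_on X (topspace (mtop X)) (radial K s)"
proof -
  have "smooth_on UNIV (\<lambda>z. K * flat_exp_power 0 (1 / 4 * ((cmod z)\<^sup>2 + (- s))))"
    by (intro smooth_on_mult smooth_on_const smooth_on_flat_compose smooth_on_add smooth_on_cmod2
        smooth_on_linear[OF open_UNIV bounded_linear_ident] open_UNIV)
  from smooth_compose_p[OF this] show ?thesis by (simp add: radial_def[abs_def])
qed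

lemma radial_levi:
  fixes K s :: real
  assumes c: "c \<in> maximal_atlas X" and x: "x \<in> fst c"
  defines "q \<equiv> ((cmod (p x))\<^sup>2 - s) / 4"
  shows "Re (herm (midx X) (i_ddbar X (radial K s) c x) v) =
    K / 4 * (flat_exp_power 2 q + (flat_exp_power 4 q - 2 * flat_exp_power 3 q) * ((cmod (p x))\<^sup>2 / 4)) * (cmod (dp c x v))\<^sup>2"
proof -
  let ?P = "coord_fun X c p" and ?S = "coord_dom X c (fst c)"
  define k where "k = K / 4 * (flat_exp_power 2 q + (flat_exp_power 4 q - 2 * flat_exp_power 3 q) * ((cmod (p x))\<^sup>2 / 4))"
  have S: "open ?S" by (rule max_open_coord_dom[OF c max_openin[OF c]])
  have xS: "snd c x \<in> ?S" using max_coord_dom[OF c x] x by simp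
  have P: "hol_on ?S ?P" using p_hol[OF c] by (simp add: hol_on_iff)
  have Px: "?P (snd c x) = p x" by (simp add: coord_fun_par max_par[OF c x])
  have "i_ddbar X (radial K s) c x $ i $ j = of_real k * (dz i ?P (snd c x) * cnj (dz j ?P (snd c x)))" for i j
    using ddbar_radial[OF S xS P, of i j K s] unfolding Px k_def q_def
    by (simp add: i_ddbar_def radial_def coord_fun_def)
  then have "herm (midx X) (i_ddbar X (radial K s) c x) v =
      (\<Sum>i\<in>midx X. \<Sum>j\<in>midx X. of_real k * ((dz i ?P (snd c x) * v $ i) * cnj (dz j ?P (snd c x) * v $ j)))"
    by (simp add: herm_def mult_ac)
  also have "\<dots> = of_real k * (dp c x v * cnj (dp c x v))"
  proof -
    have "dp c x v * cnj (dp c x v) =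
        (\<Sum>i\<in>midx X. \<Sum>j\<in>midx X. (dz i ?P (snd c x) * v $ i) * cnj (dz j ?P (snd c x) * v $ j))"
      unfolding dp_def cnj_sum sum_product ..
    then show ?thesis by (simp only: sum_distrib_left)
  qed
  also have "\<dots> = of_real (k * (cmod (dp c x v))\<^sup>2)"
    by (simp only: of_real_mult complex_norm_square[symmetric] of_real_power)
  finally have "Re (herm (midx X) (i_ddbar X (radial K s) c x) v) = k * (cmod (dp c x v))\<^sup>2"
    by (simp only: Re_complex_of_real)
  then show ?thesis unfolding k_def .
qed

text \<open>The constants of \<open>vpos_coercive\<close> are bounded over the preimage of a closed disk, which is compact as the projection
  is proper.\<close>
lemma compact_horizontal_bound:
  assumes \<omega>: "hermitian_metric X \<omega>" and G: "smooth_fun_on X (topspace (mtop X)) G"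
    and pos: "\<And>x. x \<in> topspace (mtop X) \<Longrightarrow> vertically_positive \<omega> \<epsilon> G x" and r: "r < 1"
  shows "\<exists>C\<ge>0. \<forall>x\<in>topspace (mtop X). cmod (p x) \<le> r \<longrightarrow> (\<forall>c\<in>atlas X. x \<in> fst c \<longrightarrow>
     (\<forall>v\<in>coords (midx X). 0 \<le> Re (herm (midx X) (twisted_form \<omega> \<epsilon> G c x) v) + C * (cmod (dp c x v))\<^sup>2))"
proof -
  let ?I = "midx X" and ?T = "topspace (mtop X)"
  define S where "S = {x \<in> ?T. p x \<in> cball 0 r}"
  have "compactin (top_of_set (ball 0 1)) (cball (0::complex) r)"
    using r by (auto simp: compactin_subtopology)
  moreover have "proper_map (mtop X) (top_of_set (ball 0 1)) p" using family by (simp add: kaehler_family_def)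
  ultimately have Sc: "compactin (mtop X) S"
    using compactin_proper_map_preimage[of "mtop X" _ p "cball 0 r"] unfolding S_def by fastforce
  define Q where "Q x0 W C \<longleftrightarrow> openin (mtop X) W \<and> x0 \<in> W \<and> C \<ge> (0::real) \<and>
     (\<forall>x\<in>W. \<forall>K\<ge>C. \<forall>c\<in>atlas X. x \<in> fst c \<longrightarrow> (\<forall>v\<in>coords ?I.
        0 \<le> Re (herm ?I (twisted_form \<omega> \<epsilon> G c x) v) + K * (cmod (dp c x v))\<^sup>2))" for x0 W C
  have "\<exists>W C. Q x0 W C" if x0: "x0 \<in> ?T" for x0
  proof -
    obtain d where d: "d \<in> atlas X" "x0 \<in> fst d" using point_in_chart x0 by blast
    obtain W C e where W: "openin (mtop X) W" "x0 \<in> W" "W \<subseteq> ?T \<inter> fst d" "C \<ge> 0" "e > (0::real)"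
      "\<And>x K v. x \<in> W \<Longrightarrow> K \<ge> C \<Longrightarrow> v \<in> coords ?I \<Longrightarrow>
         e * (norm v)\<^sup>2 \<le> Re (herm ?I (twisted_form \<omega> \<epsilon> G d x) v) + K * (cmod (dp d x v))\<^sup>2"
      using vpos_coercive[OF \<omega> d openin_topspace x0 G pos[OF x0]] by blast
    have "0 \<le> Re (herm ?I (twisted_form \<omega> \<epsilon> G c x) v) + K * (cmod (dp c x v))\<^sup>2"
      if x: "x \<in> W" and K: "K \<ge> C" and c: "c \<in> atlas X" "x \<in> fst c" and v: "v \<in> coords ?I" for x K c v
    proof -
      have xd: "x \<in> fst d" "x \<in> ?T" using x W(3) by auto
      have "0 \<le> e * (norm (push ?I (jacobian X c d x) v))\<^sup>2" using W(5) by simp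
      also have "\<dots> \<le> Re (herm ?I (twisted_form \<omega> \<epsilon> G d x) (push ?I (jacobian X c d x) v)) +
          K * (cmod (dp d x (push ?I (jacobian X c d x) v)))\<^sup>2"
        by (rule W(6)[OF x K push_coords])
      finally show ?thesis
        unfolding tot_push[OF \<omega> c(1) d(1) c(2) xd(1) openin_topspace xd(2) G]
          dp_push[OF atlas_maximal[OF c(1)] atlas_maximal[OF d(1)] c(2) xd(1), of v] .
    qed
    then have "Q x0 W C" unfolding Q_def using W(1,2,4) by blast
    then show ?thesis by blast
  qed
  then have "\<forall>x\<in>?T. \<exists>W C. Q x W C" by blast
  then obtain W C where QQ: "\<And>x. x \<in> ?T \<Longrightarrow> Q x (W x) (C x)" by metis
  have ST: "S \<subseteq> ?T" by (auto simp: S_def)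
  have Wo: "openin (mtop X) (W x)" "x \<in> W x" if "x \<in> S" for x
    using QQ[of x] that ST unfolding Q_def by blast+
  obtain A where A: "finite A" "A \<subseteq> S" "S \<subseteq> \<Union> (W ` A)"
  proof -
    have "\<exists>\<F>. finite \<F> \<and> \<F> \<subseteq> W ` S \<and> S \<subseteq> \<Union> \<F>"
      using Sc Wo unfolding compactin_def by (elim conjE allE[of _ "W ` S"]) blast
    then show ?thesis using that by (metis finite_subset_image)
  qed
  have C0: "C a \<ge> 0" if "a \<in> A" for a using QQ[of a] that A(2) ST unfolding Q_def by blast
  let ?C = "\<Sum>a\<in>A. C a"
  have "?C \<ge> 0" using C0 by (rule sum_nonneg)
  moreover have "0 \<le> Re (herm ?I (twisted_form \<omega> \<epsilon> G c x) v) + ?C * (cmod (dp c x v))\<^sup>2"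
    if x: "x \<in> ?T" "cmod (p x) \<le> r" and c: "c \<in> atlas X" "x \<in> fst c" and v: "v \<in> coords ?I" for x c v
  proof -
    have "x \<in> S" using x by (simp add: S_def)
    then obtain a where a: "a \<in> A" "x \<in> W a" using A(3) by blast
    have "C a \<le> ?C" by (rule member_le_sum[OF a(1) _ A(1)]) (use C0 in blast)
    moreover have "Q a (W a) (C a)" using QQ[of a] a(1) A(2) ST by blast
    ultimately show ?thesis unfolding Q_def using a(2) c v by blast
  qed
  ultimately show ?thesis by blast
qed

text \<open>The constants needed to compensate negativity in horizontal directions may blow up towards the boundary of the disk.
  They are dominated by the Levi form of a function of the base: a locally finite sum of convex increasing functions of
  \<open>cmod (p x)^2\<close>, the summand \<open>m\<close> of which vanishes up to \<open>s m\<close> and has Levi form at least \<open>C m * cmod dp^2\<close> from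
  \<open>s (m + 1)\<close> on.\<close>
lemma global_potential:
  assumes \<omega>: "hermitian_metric X \<omega>" and \<epsilon>: "\<epsilon> > 0"
    and nef: "\<forall>t\<in>ball 0 1. \<exists>\<eta>. hermitian_metric (fibre X p b t) \<eta> \<and>
           nef_line_bundle (fibre X p b t) \<eta> (canonical_bundle (fibre X p b t))"
  shows "\<exists>f. smooth_fun_on X (topspace (mtop X)) f \<and>
     (\<forall>c\<in>atlas X. \<forall>x\<in>fst c. \<forall>v. 0 \<le> Re (herm (midx X) (twisted_form \<omega> \<epsilon> f c x) v))"
proof -
  let ?I = "midx X" and ?T = "topspace (mtop X)"
  obtain G where G: "smooth_fun_on X ?T G" and Gpos: "\<And>x. x \<in> ?T \<Longrightarrow> vertically_positive \<omega> \<epsilon> G x"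
    using global_vertical_potential[OF assms] by blast
  \<comment> \<open>The sequence increases from -1 to 1, and its second term is 0, so each squared modulus in the disk lies between
    \<open>s (m + 1)\<close> and \<open>s (m + 2)\<close> for some \<open>m\<close>.\<close>
  define s where "s n = 1 - 2 / (real n + 1)" for n :: nat
  have s1: "s n < 1" and sm1: "s n \<ge> -1" for n by (simp_all add: s_def divide_simps)
  have s_mono: "s m \<le> s n" if "m \<le> n" for m n
    using that unfolding s_def by (intro diff_left_mono divide_left_mono) auto
  have s_Suc: "s n < s (Suc n)" for n unfolding s_def by (intro diff_strict_left_mono divide_strict_left_mono) auto
  have "\<exists>C\<ge>0. \<forall>x\<in>?T. cmod (p x) \<le> sqrt (s (m + 2)) \<longrightarrow> (\<forall>c\<in>atlas X. x \<in> fst c \<longrightarrow>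
     (\<forall>v\<in>coords ?I. 0 \<le> Re (herm ?I (twisted_form \<omega> \<epsilon> G c x) v) + C * (cmod (dp c x v))\<^sup>2))" for m
    using s1[of "m + 2"] by (intro compact_horizontal_bound[OF \<omega> G Gpos]) simp_all
  then obtain C where C0: "\<And>m. C m \<ge> 0" and C: "\<And>m x c v. x \<in> ?T \<Longrightarrow> cmod (p x) \<le> sqrt (s (m + 2)) \<Longrightarrow>
     c \<in> atlas X \<Longrightarrow> x \<in> fst c \<Longrightarrow> v \<in> coords ?I \<Longrightarrow>
     0 \<le> Re (herm ?I (twisted_form \<omega> \<epsilon> G c x) v) + C m * (cmod (dp c x v))\<^sup>2"
    by metis
  \<comment> \<open>A lower bound for the derivative of the summand \<open>m\<close> where the squared modulus is at least \<open>s (m + 1)\<close>.\<close>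
  define e where "e m = flat_exp_power 2 ((s (Suc m) - s m) / 4)" for m
  have e: "e m > 0" for m unfolding e_def flat_exp_power_pos_iff using s_Suc[of m] by simp
  define g where "g m = radial (4 * C m / e m) (s m)" for m
  have gs: "smooth_fun_on X ?T (g m)" for m unfolding g_def by (rule radial_smooth)
  have g0: "g n y = 0" if "(cmod (p y))\<^sup>2 \<le> s n" for n y
    using that by (simp add: g_def radial_def flat_exp_power_def)
  define \<psi> where "\<psi> x = (\<Sum>n | s n < (cmod (p x))\<^sup>2. g n x)" for x
  have \<psi>_eq: "\<psi> y = (\<Sum>n<N. g n y)" if "(cmod (p y))\<^sup>2 < s N" for y N
    unfolding \<psi>_def
  proof (rule sum.mono_neutral_left)
    show "{n. s n < (cmod (p y))\<^sup>2} \<subseteq> {..<N}"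
    proof
      fix n assume "n \<in> {n. s n < (cmod (p y))\<^sup>2}"
      then have "s n < s N" using that by simp
      then show "n \<in> {..<N}" using s_mono[of N n] by (cases "n < N") auto
    qed
  qed (use g0 in \<open>auto simp: not_less\<close>)
  have sN: "\<exists>N. (cmod (p x))\<^sup>2 < s N" if x: "x \<in> ?T" for x
  proof -
    have "cmod (p x) < 1" using p_in_disk[OF x] by simp
    then have "(cmod (p x))\<^sup>2 < 1" by (simp add: power_less_one_iff abs_square_less_1)
    then obtain N where "1 / Suc N < (1 - (cmod (p x))\<^sup>2) / 2"
      using nat_approx_posE[of "(1 - (cmod (p x))\<^sup>2) / 2"] by auto
    then have "(cmod (p x))\<^sup>2 < s N" by (simp add: s_def add.commute)
    then show ?thesis by blast
  qed
  have loc: "openin (mtop X) {y \<in> ?T. (cmod (p y))\<^sup>2 < s N}" for N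
  proof -
    have "open {z::complex. (cmod z)\<^sup>2 < s N}" by (intro open_Collect_less continuous_intros)
    from p_open_vimage[OF this] show ?thesis by simp
  qed
  have gsum: "smooth_fun_on X {y \<in> ?T. (cmod (p y))\<^sup>2 < s N} (\<lambda>y. \<Sum>n<N. g n y)" for N
    by (rule smooth_fun_on_sum[OF loc]) (rule smooth_fun_on_subset[OF gs], blast)
  have \<psi>s: "smooth_fun_on X ?T \<psi>"
  proof (rule smooth_fun_on_openin_cover[OF openin_topspace])
    fix x assume x: "x \<in> ?T"
    then obtain N where N: "(cmod (p x))\<^sup>2 < s N" using sN by blast
    have "smooth_fun_on X {y \<in> ?T. (cmod (p y))\<^sup>2 < s N} \<psi>"
      by (rule smooth_fun_on_cong[OF loc _ gsum]) (rule \<psi>_eq[symmetric], simp)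
    then show "\<exists>W. openin (mtop X) W \<and> x \<in> W \<and> smooth_fun_on X W \<psi>" using loc x N by blast
  qed
  have "0 \<le> Re (herm ?I (twisted_form \<omega> \<epsilon> (\<lambda>x. G x + \<psi> x) c x) v)"
    if c: "c \<in> atlas X" "x \<in> fst c" and v: "v \<in> coords ?I" for c x v
  proof -
    note cM = atlas_maximal[OF c(1)]
    have x: "x \<in> ?T" using c(2) is_chart_subset[OF max_chart[OF cM]] by blast
    obtain N where N: "(cmod (p x))\<^sup>2 < s N" using sN[OF x] by blast
    let ?W = "{y \<in> ?T. (cmod (p y))\<^sup>2 < s N}"
    have xW: "x \<in> ?W" using x N by simp
    have gW: "smooth_fun_on X ?W (g n)" for n by (rule smooth_fun_on_subset[OF gs]) blast
    have "i_ddbar X \<psi> c x = i_ddbar X (\<lambda>y. \<Sum>n<N. g n y) c x"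
      by (rule i_ddbar_cong[OF loc xW _ cM c(2)]) (rule \<psi>_eq, simp)
    also have "\<dots> = (\<Sum>n<N. i_ddbar X (g n) c x)"
      by (rule i_ddbar_sum[OF loc xW gW cM c(2)]) simp
    finally have "i_ddbar X (\<lambda>x. G x + \<psi> x) c x = i_ddbar X G c x + (\<Sum>n<N. i_ddbar X (g n) c x)"
      using i_ddbar_add[OF openin_topspace x G \<psi>s cM c(2)] by simp
    then have twisted_form: "Re (herm ?I (twisted_form \<omega> \<epsilon> (\<lambda>x. G x + \<psi> x) c x) v) =
        Re (herm ?I (twisted_form \<omega> \<epsilon> G c x) v) + (\<Sum>n<N. Re (herm ?I (i_ddbar X (g n) c x) v))"
      by (simp add: twisted_form_def herm_add herm_sum)
    define a where "a n = ((cmod (p x))\<^sup>2 - s n) / 4" for n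
    have p1: "(cmod (p x))\<^sup>2 < 1" using N s1[of N] by linarith
    have a: "a n \<le> 1 / 2" for n using p1 sm1[of n] by (simp add: a_def)
    have lg: "Re (herm ?I (i_ddbar X (g n) c x) v) \<ge> C n / e n * flat_exp_power 2 (a n) * (cmod (dp c x v))\<^sup>2" for n
    proof -
      have "0 \<le> (flat_exp_power 4 (a n) - 2 * flat_exp_power 3 (a n)) * ((cmod (p x))\<^sup>2 / 4)"
        using flat_exp_second_derivative_nonneg[OF a] by (intro mult_nonneg_nonneg) auto
      then have "C n / e n * flat_exp_power 2 (a n) \<le> C n / e n * (flat_exp_power 2 (a n) +
          (flat_exp_power 4 (a n) - 2 * flat_exp_power 3 (a n)) * ((cmod (p x))\<^sup>2 / 4))"
        using C0[of n] e[of n] by (intro mult_left_mono) auto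
      then have "C n / e n * flat_exp_power 2 (a n) * (cmod (dp c x v))\<^sup>2 \<le>
          C n / e n * (flat_exp_power 2 (a n) +
          (flat_exp_power 4 (a n) - 2 * flat_exp_power 3 (a n)) * ((cmod (p x))\<^sup>2 / 4)) * (cmod (dp c x v))\<^sup>2"
        by (intro mult_right_mono) auto
      also have "\<dots> = Re (herm ?I (i_ddbar X (g n) c x) v)"
        unfolding g_def a_def radial_levi[OF cM c(2)] by simp
      finally show ?thesis .
    qed
    have nn: "Re (herm ?I (i_ddbar X (g n) c x) v) \<ge> 0" for n
      by (rule order_trans[OF _ lg]) (use C0[of n] e[of n] flat_exp_power_nonneg in \<open>simp add: less_imp_le\<close>)
    define m where "m = (LEAST n. (cmod (p x))\<^sup>2 < s (n + 2))"
    have "(cmod (p x))\<^sup>2 < s (N + 2)" using N s_mono[of N "N + 2"] by simp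
    then have m: "(cmod (p x))\<^sup>2 < s (m + 2)" unfolding m_def by (rule LeastI)
    have m1: "s (Suc m) \<le> (cmod (p x))\<^sup>2"
    proof (cases m)
      case 0
      then show ?thesis by (simp add: s_def)
    next
      case (Suc k)
      then have "\<not> (cmod (p x))\<^sup>2 < s (k + 2)"
        using not_less_Least[of k "\<lambda>n. (cmod (p x))\<^sup>2 < s (n + 2)"] by (simp add: m_def)
      then show ?thesis using Suc by simp
    qed
    have mN: "m < N" using m1 N s_mono[of N "Suc m"] by (cases "m < N") auto
    have "e m \<le> flat_exp_power 2 (a m)"
      unfolding e_def by (rule flat_exp_power_2_mono[OF _ a]) (use m1 in \<open>simp add: a_def\<close>)
    then have "C m \<le> C m / e m * flat_exp_power 2 (a m)"
      using C0[of m] e[of m] mult_left_mono[of "e m" "flat_exp_power 2 (a m)" "C m / e m"] by simp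
    then have "C m * (cmod (dp c x v))\<^sup>2 \<le> C m / e m * flat_exp_power 2 (a m) * (cmod (dp c x v))\<^sup>2"
      by (intro mult_right_mono) auto
    also have "\<dots> \<le> Re (herm ?I (i_ddbar X (g m) c x) v)" by (rule lg)
    also have "\<dots> \<le> (\<Sum>n<N. Re (herm ?I (i_ddbar X (g n) c x) v))"
      by (rule member_le_sum) (use mN nn in auto)
    finally have "C m * (cmod (dp c x v))\<^sup>2 \<le> (\<Sum>n<N. Re (herm ?I (i_ddbar X (g n) c x) v))" .
    moreover have "0 \<le> Re (herm ?I (twisted_form \<omega> \<epsilon> G c x) v) + C m * (cmod (dp c x v))\<^sup>2"
    proof (rule C[OF x _ c v])
      show "cmod (p x) \<le> sqrt (s (m + 2))" using m by (intro real_le_rsqrt) simp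
    qed
    ultimately show ?thesis unfolding twisted_form by linarith
  qed
  then have "0 \<le> Re (herm ?I (twisted_form \<omega> \<epsilon> (\<lambda>x. G x + \<psi> x) c x) v)" if "c \<in> atlas X" "x \<in> fst c" for c x v
    using herm_cproj[of ?I "twisted_form \<omega> \<epsilon> (\<lambda>x. G x + \<psi> x) c x" v] that by (metis cproj_in_coords)
  moreover have "smooth_fun_on X ?T (\<lambda>x. G x + \<psi> x)" by (rule smooth_fun_on_add[OF openin_topspace G \<psi>s])
  ultimately show ?thesis by blast
qed

end

text \<open>The canonical bundle of the disk is trivialized by the coordinate, so the relative canonical bundle has the transition
  functions of the canonical bundle of the total space.\<close>
lemma disk_jacobian:
  assumes "t \<in> ball 0 1"
  shows "det (jacobian disk (ball 0 1, \<lambda>t. vec t) (ball 0 1, \<lambda>t. vec t) t) = 1"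
proof -
  let ?c = "(ball 0 1, \<lambda>t. vec t) :: (complex, 1) chart"
  let ?S = "{z::complex^1. z $ 1 \<in> ball 0 1}"
  have S: "open ?S"
  proof -
    have "open ((\<lambda>z::complex^1. z $ 1) -` ball 0 1)"
      by (rule open_vimage[OF open_ball linear_continuous_on[OF bounded_linear_vec_nth]])
    then show ?thesis by (simp add: vimage_def)
  qed
  have tS: "vec t \<in> ?S" using assms by simp
  have inj: "inj_on (vec :: complex \<Rightarrow> complex^1) (ball 0 1)" by (auto simp: inj_on_def vec_eq_iff)
  have "coord_fun disk ?c (\<lambda>y. snd ?c y $ 1) z = z $ 1" if "z \<in> ?S" for z
  proof -
    have e: "cproj UNIV z = vec (z $ 1)" by (simp add: vec_eq_iff)
    have "inv_into (ball 0 1) vec (vec (z $ 1) :: complex^1) = z $ 1" using that by (intro inv_into_f_f[OF inj]) simp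
    then show ?thesis
      unfolding coord_fun_def disk_def cmanifold.select_convs fst_conv snd_conv e by simp
  qed
  then have "dz 1 (coord_fun disk ?c (\<lambda>y. snd ?c y $ 1)) (vec t) = dz 1 (\<lambda>z. z $ 1) (vec t :: complex^1)"
    by (rule dz_cong_open(1)[OF S tS])
  then show ?thesis
    unfolding det_1 by (simp add: jacobian_def disk_def dz_component)
qed

theorem corollary1p3:
  fixes X :: "('a, 'm::finite) cmanifold" and p :: "'a \<Rightarrow> complex" and b :: 'm
    and \<omega> :: "('a, 'm) form11"
  assumes "kaehler_family X p"
    and "b \<in> midx X"
    and "\<forall>t\<in>ball 0 1. \<exists>\<omega>\<^sub>t. hermitian_metric (fibre X p b t) \<omega>\<^sub>t \<and>
           nef_line_bundle (fibre X p b t) \<omega>\<^sub>t (canonical_bundle (fibre X p b t))"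
    and "kaehler_metric X \<omega>"
  shows "nef_line_bundle X \<omega> (relative_canonical_bundle X p)"
proof -
  interpret kaehler_disk_family X p b using assms(1,2) by unfold_locales
  have \<omega>: "hermitian_metric X \<omega>" using assms(4) by (simp add: kaehler_metric_def)
  let ?L = "relative_canonical_bundle X p"
  let ?e = "(ball 0 1, \<lambda>t. vec t) :: (complex, 1) chart"
  define h where "h i x = exp (canonical_potential \<omega> (fst i) x)" for i :: "('a, 'm) chart \<times> (complex, 1) chart" and x
  have idx: "lidx ?L = atlas X \<times> {?e}"
    by (simp add: relative_canonical_bundle_def bundle_diff_def canonical_bundle_def pullback_bundle_def disk_def)
  have ii: "fst i \<in> atlas X" "snd i = ?e" if "i \<in> lidx ?L" for i
    using that unfolding idx mem_Times_iff by simp_all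
  have dom: "ldom ?L i = fst (fst i)" if "i \<in> lidx ?L" for i
  proof -
    note i = ii[OF that]
    have "fst (fst i) \<subseteq> {x \<in> topspace (mtop X). p x \<in> ball 0 1}"
      using is_chart_subset[OF atlas_chart[OF i(1)]] p_in_disk by blast
    moreover have "ldom ?L i = fst (fst i) \<inter> {x \<in> topspace (mtop X). p x \<in> fst (snd i)}"
      by (simp add: relative_canonical_bundle_def bundle_diff_def canonical_bundle_def pullback_bundle_def case_prod_beta)
    ultimately show ?thesis unfolding i(2) fst_conv by blast
  qed
  have coc: "cocycle ?L i j x = det (jacobian X (fst i) (fst j) x)"
    if "i \<in> lidx ?L" "j \<in> lidx ?L" "x \<in> fst (fst i)" for i j x
  proof -
    have i: "fst i \<in> atlas X" "snd i = ?e" "snd j = ?e" using ii[OF that(1)] ii[OF that(2)] by blast+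
    have "p x \<in> ball 0 1" using is_chart_subset[OF atlas_chart[OF i(1)]] p_in_disk that(3) by blast
    moreover have "cocycle ?L i j x = det (jacobian X (fst i) (fst j) x) / det (jacobian disk (snd i) (snd j) (p x))"
      by (simp add: relative_canonical_bundle_def bundle_diff_def canonical_bundle_def pullback_bundle_def case_prod_beta)
    ultimately show ?thesis unfolding i(2,3) by (simp add: disk_jacobian)
  qed
  have "bundle_metric X ?L h"
    unfolding bundle_metric_def
  proof (intro conjI ballI)
    fix i assume i: "i \<in> lidx ?L"
    then have c: "fst i \<in> atlas X" by (rule ii(1))
    show "smooth_fun_on X (ldom ?L i) (h i)"
      unfolding dom[OF i] smooth_fun_on_def
    proof
      fix d assume d: "d \<in> atlas X"
      have "smooth_on (coord_dom X d (fst (fst i))) (\<lambda>z. exp (coord_fun X d (canonical_potential \<omega> (fst i)) z))"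
        using canonical_potential_smooth[OF \<omega> c] d unfolding smooth_fun_on_def
        by (intro smooth_on_exp max_open_coord_dom atlas_maximal max_openin c) auto
      then show "smooth_on (coord_dom X d (fst (fst i))) (coord_fun X d (h i))"
        by (simp add: coord_fun_def h_def)
    qed
    show "h i x > 0" for x by (simp add: h_def)
  next
    fix i j x assume i: "i \<in> lidx ?L" and j: "j \<in> lidx ?L" and x: "x \<in> ldom ?L i \<inter> ldom ?L j"
    note c = ii(1)[OF i] ii(1)[OF j]
    have x': "x \<in> fst (fst i)" "x \<in> fst (fst j)" using x unfolding dom[OF i] dom[OF j] by blast+
    have "cmod (det (jacobian X (fst i) (fst j) x)) > 0"
      using det_jacobian_nonzero[OF atlas_maximal[OF c(1)] atlas_maximal[OF c(2)] x'] by simp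
    then show "h j x = (cmod (cocycle ?L i j x))\<^sup>2 * h i x"
      unfolding h_def coc[OF i j x'(1)] canonical_potential_change[OF \<omega> c x'] by (simp add: exp_add mult.commute)
  qed
  moreover have "is_chern_form X ?L h (canonical_form \<omega>)"
    unfolding is_chern_form_def
  proof (intro ballI)
    fix c i x j k assume c: "c \<in> atlas X" and i: "i \<in> lidx ?L" and x: "x \<in> fst c \<inter> ldom ?L i"
    note d = ii(1)[OF i]
    have x': "x \<in> fst c" "x \<in> fst (fst i)" using x unfolding dom[OF i] by blast+
    show "canonical_form \<omega> c x $ j $ k = - (1 / (2 * pi)) * i_ddbar X (\<lambda>y. ln (h i y)) c x $ j $ k"
      using canonical_potential_i_ddbar[OF \<omega> c d x']
      by (simp add: h_def canonical_form_def scaleR_conv_of_real[where 'a=complex])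
  qed
  moreover have "nef_class X \<omega> (canonical_form \<omega>)"
    unfolding nef_class_def
  proof (intro conjI allI impI canonical_form_real[OF \<omega>] canonical_form_closed[OF \<omega>])
    fix \<epsilon> :: real assume "\<epsilon> > 0"
    then obtain f where f: "smooth_fun_on X (topspace (mtop X)) f"
      and pos: "\<And>c x v. c \<in> atlas X \<Longrightarrow> x \<in> fst c \<Longrightarrow> 0 \<le> Re (herm (midx X) (twisted_form \<omega> \<epsilon> f c x) v)"
      using global_potential[OF \<omega> _ assms(3)] by blast
    have "form_ge X (\<lambda>c x. canonical_form \<omega> c x + i_ddbar X f c x) (\<lambda>c x. - \<epsilon> *\<^sub>R \<omega> c x)"
      unfolding form_ge_def
    proof (intro ballI allI)
      fix c x v assume "c \<in> atlas X" "x \<in> fst c"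
      from pos[OF this, of v]
      show "Re (herm (midx X) (canonical_form \<omega> c x + i_ddbar X f c x) v) \<ge> Re (herm (midx X) (- \<epsilon> *\<^sub>R \<omega> c x) v)"
        unfolding twisted_form_def herm_add herm_scaleR by simp
    qed
    then show "\<exists>f. smooth_fun_on X (topspace (mtop X)) f \<and>
        form_ge X (\<lambda>c x. canonical_form \<omega> c x + i_ddbar X f c x) (\<lambda>c x. - \<epsilon> *\<^sub>R \<omega> c x)"
      using f by blast
  qed
  ultimately show ?thesis unfolding nef_line_bundle_def by blast
qed

end
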